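(* Let $1<p<\infty$, $\frac1p+\frac1{p'}=1$, $T>0$, and let $b\in L_1(0,T;W^1_{p'(loc)}(\mathbb{R}^n))$ be a vector field such that $$\operatorname{div} b\in L_1(0,T;BMO(\mathbb{R}^n)),\qquad \frac{b}{1+|x|}\in L_1(0,T;L_1(\mathbb{R}^n)),$$ and, for a fixed $R>0$, $\operatorname{supp}\operatorname{div} b(\cdot,t)\subset B(0,R)$. Let $u^1,u^2\in L_\infty(0,T;L_p(\mathbb{R}^n))$ be two weak solutions to $$u_t+b\cdot\nabla u=0\ \text{ in }\ \mathbb{R}^n\times(0,T),\qquad u|_{t=0}=u_0\ \text{ on }\ \mathbb{R}^n$$ with the same initial datum $u_0$. Then $u^1\equiv u^2$.
   Context: Here $b:\mathbb{R}^n\times(0,T)\to\mathbb{R}^n$ is a given vector field, $u$ is a scalar function, $\operatorname{div}$ and $\nabla$ are taken in the space variable $x\in\mathbb{R}^n$, $B(x,r)$ is the ball of radius $r$ centered at $x$, and the subscript $(loc)$ refers to locality in the space variable. Equality $u^1\equiv u^2$ is equality almost everywhere. Weak solution: a function $u\in L_\infty(0,T;L_p(\mathbb{R}^n))$ is a weak solution of $u_t+b\cdot\nabla u=0$, $u|_{t=0}=u_0$ (with $u_0$ locally integrable, so that the right-hand side below makes sense) iff $$\int_0^T\int_{\mathbb{R}^n}u\,\phi_t\,dx\,dt+\int_0^T\int_{\mathbb{R}^n}(\operatorname{div} b)\,u\,\phi\,dx\,dt+\int_0^T\int_{\mathbb{R}^n}(b\cdot\nabla\phi)\,u\,dx\,dt=-\int_{\mathbb{R}^n}u_0\,\phi(\cdot,0)\,dx$$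 for each $\phi\in C^\infty([0,T];C_0^\infty(\mathbb{R}^n))$ such that $\phi|_{t=T}\equiv0$. $BMO(\mathbb{R}^n)$: the set of locally integrable $f$ with finite semi-norm $$\|f\|_{BMO(\mathbb{R}^n)}=\sup_{x\in\mathbb{R}^n,\,r>0}\frac{1}{|B(x,r)|}\int_{B(x,r)}|f(y)-\{f\}_{B(x,r)}|\,dy,\qquad \{f\}_{B(x,r)}=\frac{1}{|B(x,r)|}\int_{B(x,r)}f(y)\,dy.$$ *)

theory Defs
  imports "HOL-Analysis.Analysis"
begin

text \<open>
  The Euclidean space of dimension n is a type of class \<open>euclidean_space\<close>; a time-dependent function
  is curried as \<open>f t x\<close>.  Integrals and null sets refer to the (completed) Lebesgue measure.
\<close>

section \<open>Smooth functions\<close>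

text \<open>
  All iterated partial derivatives exist and are continuous on \<open>S\<close>; \<open>D [i\<^sub>k, \<dots>, i\<^sub>1]\<close> is the derivative
  taken first in direction \<open>i\<^sub>1\<close>, last in direction \<open>i\<^sub>k\<close>.  Difference quotients only use points of \<open>S\<close>,
  so for \<open>S = {0..T} \<times> UNIV\<close> the time derivatives at 0 and T are one-sided.
\<close>
definition smooth_on :: "'e::euclidean_space set \<Rightarrow> ('e \<Rightarrow> real) \<Rightarrow> bool" where
  "smooth_on S f \<longleftrightarrow>
    (\<exists>D :: 'e list \<Rightarrow> 'e \<Rightarrow> real.
       (\<forall>z\<in>S. D [] z = f z) \<and>
       (\<forall>l\<in>lists Basis.
          continuous_on S (D l) \<and>
          (\<forall>i\<in>Basis. \<forall>z\<in>S.
             ((\<lambda>s. D l (z + s *\<^sub>R i)) has_real_derivative D (i # l) z)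
               (at 0 within {s. z + s *\<^sub>R i \<in> S}))))"

definition test_function :: "('a::euclidean_space \<Rightarrow> real) \<Rightarrow> bool" where
  "test_function \<phi> \<longleftrightarrow> smooth_on UNIV \<phi> \<and> compact (closure {x. \<phi> x \<noteq> 0})"

text \<open>
  Smooth maps from \<open>{0..T}\<close> into the space of test functions: by compactness of \<open>{0..T}\<close>, the values
  of such a map have their supports in one compact set.
\<close>
definition spacetime_test_function :: "real \<Rightarrow> (real \<Rightarrow> 'a::euclidean_space \<Rightarrow> real) \<Rightarrow> bool" where
  "spacetime_test_function T \<phi> \<longleftrightarrow>
     smooth_on ({0..T} \<times> UNIV) (\<lambda>(t, x). \<phi> t x) \<and>
     (\<exists>K. compact K \<and> (\<forall>t\<in>{0..T}. \<forall>x. x \<notin> K \<longrightarrow> \<phi> t x = 0))"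

definition grad :: "('a::euclidean_space \<Rightarrow> real) \<Rightarrow> 'a \<Rightarrow> 'a" where
  "grad f x = (THE D. GDERIV f x :> D)"

section \<open>Weak derivatives\<close>

definition locally_integrable :: "('a::euclidean_space \<Rightarrow> 'b::euclidean_space) \<Rightarrow> bool" where
  "locally_integrable f \<longleftrightarrow> (\<forall>K. compact K \<longrightarrow> f absolutely_integrable_on K)"

definition has_weak_partial ::
    "'a::euclidean_space \<Rightarrow> ('a \<Rightarrow> 'b::euclidean_space) \<Rightarrow> ('a \<Rightarrow> 'b) \<Rightarrow> bool" where
  "has_weak_partial i f g \<longleftrightarrow>
     locally_integrable f \<and> locally_integrable g \<and>
     (\<forall>\<phi>. test_function \<phi> \<longrightarrow>
        (LINT x|lebesgue. (grad \<phi> x \<bullet> i) *\<^sub>R f x) = - (LINT x|lebesgue. \<phi> x *\<^sub>R g x))"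

definition has_weak_div :: "('a::euclidean_space \<Rightarrow> 'a) \<Rightarrow> ('a \<Rightarrow> real) \<Rightarrow> bool" where
  "has_weak_div v d \<longleftrightarrow>
     locally_integrable v \<and> locally_integrable d \<and>
     (\<forall>\<phi>. test_function \<phi> \<longrightarrow>
        (LINT x|lebesgue. v x \<bullet> grad \<phi> x) = - (LINT x|lebesgue. d x * \<phi> x))"

definition jointly_measurable ::
    "real \<Rightarrow> (real \<Rightarrow> 'a::euclidean_space \<Rightarrow> 'b::euclidean_space) \<Rightarrow> bool" where
  "jointly_measurable T f \<longleftrightarrow>
     (\<lambda>(t, x). f t x) \<in> borel_measurable (lebesgue_on ({0<..<T} \<times> UNIV))"

text \<open>
  A jointly measurable representative of the spatial divergence; it is unique up to null sets of
  \<open>{0<..<T} \<times> UNIV\<close>.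
\<close>
definition space_div ::
    "real \<Rightarrow> (real \<Rightarrow> 'a::euclidean_space \<Rightarrow> 'a) \<Rightarrow> real \<Rightarrow> 'a \<Rightarrow> real" where
  "space_div T b =
     (SOME d. jointly_measurable T d \<and> (AE t in lebesgue_on {0<..<T}. has_weak_div (b t) (d t)))"

text \<open>Support of an almost-everywhere class: complement of the largest open set where it vanishes.\<close>
definition ess_support :: "('a::euclidean_space \<Rightarrow> real) \<Rightarrow> 'a set" where
  "ess_support f = - \<Union>{U. open U \<and> (AE x in lebesgue. x \<in> U \<longrightarrow> f x = 0)}"

section \<open>Function spaces\<close>

definition Lp :: "real \<Rightarrow> 'a::euclidean_space set \<Rightarrow> ('a \<Rightarrow> 'b::euclidean_space) set" where
  "Lp q S = {f. f \<in> borel_measurable (lebesgue_on S) \<and>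
                (\<lambda>x. norm (f x) powr q) absolutely_integrable_on S}"

definition Lp_norm :: "real \<Rightarrow> 'a::euclidean_space set \<Rightarrow> ('a \<Rightarrow> 'b::euclidean_space) \<Rightarrow> real" where
  "Lp_norm q S f = (LINT x:S|lebesgue. norm (f x) powr q) powr (1 / q)"

definition ball_mean :: "('a::euclidean_space \<Rightarrow> real) \<Rightarrow> 'a \<Rightarrow> real \<Rightarrow> real" where
  "ball_mean f x r = (LINT y:ball x r|lebesgue. f y) / measure lebesgue (ball x r)"

definition mean_oscillation :: "('a::euclidean_space \<Rightarrow> real) \<Rightarrow> 'a \<Rightarrow> real \<Rightarrow> real" where
  "mean_oscillation f x r = ball_mean (\<lambda>y. \<bar>f y - ball_mean f x r\<bar>) x r"

definition BMO :: "('a::euclidean_space \<Rightarrow> real) set" where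
  "BMO = {f. locally_integrable f \<and>
             bdd_above ((\<lambda>(x, r). mean_oscillation f x r) ` (UNIV \<times> {0<..}))}"

definition BMO_seminorm :: "('a::euclidean_space \<Rightarrow> real) \<Rightarrow> real" where
  "BMO_seminorm f = (SUP (x, r) \<in> UNIV \<times> {0<..}. mean_oscillation f x r)"

text \<open>
  The space of functions on \<open>{0<..<T}\<close> with values in a function space \<open>X\<close> with (semi)norm \<open>N\<close>,
  integrable, resp. essentially bounded, in time.  Measurability in time is that of the function of
  \<open>(t, x)\<close> and of the norm; for separable \<open>X\<close> this amounts to Bochner measurability, and for \<open>BMO\<close>
  it is implied by it.
\<close>
definition L1_time ::
    "real \<Rightarrow> ('a::euclidean_space \<Rightarrow> 'b::euclidean_space) set \<Rightarrow> (('a \<Rightarrow> 'b) \<Rightarrow> real)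
       \<Rightarrow> (real \<Rightarrow> 'a \<Rightarrow> 'b) set" where
  "L1_time T X N = {f. jointly_measurable T f \<and>
                       (AE t in lebesgue_on {0<..<T}. f t \<in> X) \<and>
                       (\<lambda>t. N (f t)) absolutely_integrable_on {0<..<T}}"

definition Linf_time ::
    "real \<Rightarrow> ('a::euclidean_space \<Rightarrow> 'b::euclidean_space) set \<Rightarrow> (('a \<Rightarrow> 'b) \<Rightarrow> real)
       \<Rightarrow> (real \<Rightarrow> 'a \<Rightarrow> 'b) set" where
  "Linf_time T X N = {f. jointly_measurable T f \<and>
                         (\<exists>C. AE t in lebesgue_on {0<..<T}. f t \<in> X \<and> N (f t) \<le> C)}"

text \<open>Integrable in time with values in \<open>L\<^sub>q\<close> of every ball.\<close>
definition L1_Lp_loc :: "real \<Rightarrow> real \<Rightarrow> (real \<Rightarrow> 'a::euclidean_space \<Rightarrow> 'b::euclidean_space) set" where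
  "L1_Lp_loc T q = {f. \<forall>r>0. f \<in> L1_time T (Lp q (ball 0 r)) (Lp_norm q (ball 0 r))}"

text \<open>
  Integrable in time with values in the first order Sobolev space of exponent \<open>q\<close>, locally in space:
  the Sobolev norm on a ball is the sum of the \<open>L\<^sub>q\<close> norms of the function and its weak partials.
\<close>
definition L1_W1_loc :: "real \<Rightarrow> real \<Rightarrow> (real \<Rightarrow> 'a::euclidean_space \<Rightarrow> 'b::euclidean_space) set" where
  "L1_W1_loc T q = {f. f \<in> L1_Lp_loc T q \<and>
     (\<forall>i\<in>Basis. \<exists>g\<in>L1_Lp_loc T q. AE t in lebesgue_on {0<..<T}. has_weak_partial i (f t) (g t))}"

section \<open>Weak solutions of the transport equation\<close>

definition weak_solution ::
    "real \<Rightarrow> (real \<Rightarrow> 'a::euclidean_space \<Rightarrow> 'a) \<Rightarrow> ('a \<Rightarrow> real) \<Rightarrow> (real \<Rightarrow> 'a \<Rightarrow> real) \<Rightarrow> bool" where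
  "weak_solution T b u\<^sub>0 u \<longleftrightarrow>
     (\<forall>\<phi>. spacetime_test_function T \<phi> \<and> (\<forall>x. \<phi> T x = 0) \<longrightarrow>
        (LINT t:{0<..<T}|lebesgue. LINT x|lebesgue. u t x * deriv (\<lambda>s. \<phi> s x) t) +
        (LINT t:{0<..<T}|lebesgue. LINT x|lebesgue. space_div T b t x * u t x * \<phi> t x) +
        (LINT t:{0<..<T}|lebesgue. LINT x|lebesgue. (b t x \<bullet> grad (\<phi> t) x) * u t x)
        = - (LINT x|lebesgue. u\<^sub>0 x * \<phi> 0 x))"

end

theory Submission
  imports Defs
begin

text \<open>
  Let \<open>u\<close> be the difference of the two solutions.  Mollification and multiplication by a cutoff \<open>\<psi>\<close> turn
  the equation into an evolution of \<open>X t = \<integral> \<psi> * \<beta> (u\<^sub>\<epsilon>)\<close> with \<open>\<beta> s = s\<^sup>2 / (1 + s\<^sup>2)\<close>, and the DiPerna--Lions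
  commutator tends to 0 with \<open>\<epsilon>\<close>.  The divergence contributes at most \<open>\<integral> \<bar>div b\<bar> * G\<close> for a continuous
  weight \<open>0 \<le> G \<le> 1\<close> whose integral is \<open>X t\<close>.  As \<open>div b\<close> has bounded mean oscillation and
  support in a fixed ball, this is at most \<open>w t * (m * X t + C * exp (- m))\<close> for every \<open>m \<ge> 0\<close>, with \<open>w\<close> integrable.
  If \<open>u = 0\<close> before \<open>t0\<close> and the integral of \<open>w\<close> over \<open>{t0..t1}\<close> is at most 1/2, Gronwall's inequality
  gives \<open>X t \<le> (o(1) + C * exp (- m)) * exp (m / 2)\<close> on \<open>{t0..t1}\<close>.  First the regularisation and the cutoff
  are removed, then \<open>m\<close> tends to infinity: \<open>u = 0\<close> up to \<open>t1\<close>.  Finitely many such steps cover \<open>{0..T}\<close>.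
\<close>

section \<open>Smooth bumps and the mollifier\<close>

text \<open>The classical renormalisation argument bounds the divergence term by the supremum of
  \<open>div b\<close> times the energy. Here \<open>div b\<close> may be unbounded, so no such rate
  is at hand; what bounded mean oscillation offers is local exponential integrability, used in a
  dual form: a linear rate \<open>m\<close> is bought at the price \<open>C * exp (- m)\<close>. The
  duality needs a weight with values between 0 and 1, which is why \<beta> is bounded; it vanishes
  only at 0, so that zero energy means \<open>u = 0\<close>. The bound 1/2 on the integral of
  \<open>w\<close> leaves the Gronwall factor \<open>exp (m / 2)\<close> behind the gain
  \<open>exp (- m)\<close>; any bound below 1 would serve. The admissible length of a time step
  depends on \<open>w\<close> alone and not on \<open>m\<close>. Zero initial data come from
  linearity: the common datum cancels on subtraction, and test functions that do not vanish at time
  0 then detect the initial value. The hypotheses speak of almost every time and of Lebesgue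
  measurable functions; these are replaced by Borel functions that vanish at the exceptional times,
  so that each estimate holds at every time and Fubini's theorem applies.\<close>

definition smooth1 :: "(nat \<Rightarrow> real \<Rightarrow> real) \<Rightarrow> bool" where
  "smooth1 D \<longleftrightarrow> (\<forall>n x. (D n has_real_derivative D (Suc n) x) (at x))"

lemma smooth1D: "smooth1 D \<Longrightarrow> (D n has_real_derivative D (Suc n) x) (at x)"
  by (simp add: smooth1_def)

lemma smooth1_continuous: "smooth1 D \<Longrightarrow> continuous_on S (D n)"
  by (meson DERIV_continuous_on smooth1D has_field_derivative_at_within)

lemma smooth1_affine:
  assumes "smooth1 D" shows "smooth1 (\<lambda>n s. c ^ n * D n (c * s + a))"
  unfolding smooth1_def
proof (intro allI)
  fix n x
  show "((\<lambda>s. c ^ n * D n (c * s + a)) has_real_derivative c ^ Suc n * D (Suc n) (c * x + a)) (at x)"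
    by (rule derivative_eq_intros DERIV_chain2[OF smooth1D[OF assms]] refl | simp)+
qed

lemma smooth1_cmult:
  assumes "smooth1 D" shows "smooth1 (\<lambda>n s. c * D n s)"
  using assms unfolding smooth1_def by (auto intro!: derivative_eq_intros)

text \<open>The \<open>n\<close>-th derivative of \<open>F i * G j\<close> when \<open>F\<close> and
  \<open>G\<close> list the successive derivatives of two functions. The binary recursion turns the
  product rule into an induction on \<open>n\<close> without binomial coefficients.\<close>

fun leibniz :: "(nat \<Rightarrow> real \<Rightarrow> real) \<Rightarrow> (nat \<Rightarrow> real \<Rightarrow> real) \<Rightarrow> nat \<Rightarrow> nat \<Rightarrow> nat \<Rightarrow> real \<Rightarrow> real" where
  "leibniz F G 0 i j x = F i x * G j x"
| "leibniz F G (Suc n) i j x = leibniz F G n (Suc i) j x + leibniz F G n i (Suc j) x"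

lemma smooth1_leibniz:
  assumes "smooth1 F" "smooth1 G"
  shows "smooth1 (\<lambda>n. leibniz F G n 0 0)"
proof -
  have "(leibniz F G n i j has_real_derivative leibniz F G (Suc n) i j x) (at x)" for n i j x
  proof (induction n arbitrary: i j)
    case 0
    have "leibniz F G 0 i j = (\<lambda>x. F i x * G j x)" by auto
    then show ?case by (auto intro!: derivative_eq_intros smooth1D assms)
  next
    case (Suc n)
    have "leibniz F G (Suc n) i j = (\<lambda>x. leibniz F G n (Suc i) j x + leibniz F G n i (Suc j) x)" by auto
    then show ?case
      using DERIV_add[OF Suc[of "Suc i" j] Suc[of i "Suc j"]] by simp
  qed
  then show ?thesis by (simp add: smooth1_def)
qed

text \<open>A class that contains \<open>exp (-1/s)\<close>, extended by 0, and is closed under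
  differentiation: the derivative of \<open>poly P (1/s) * exp (-1/s)\<close> has the same form with
  the polynomial \<open>x^2 * (P - P')\<close>. Smoothness becomes a recursion on
  polynomials.\<close>

definition flat :: "real poly \<Rightarrow> real \<Rightarrow> real" where
  "flat P s = (if s > 0 then poly P (1/s) * exp (-1/s) else 0)"

lemma poly_div_exp_tendsto: "((\<lambda>x::real. poly P x * exp (-x)) \<longlongrightarrow> 0) at_top"
proof -
  have "((\<lambda>x. \<Sum>i\<le>degree P. coeff P i * (x ^ i / exp x)) \<longlongrightarrow> (\<Sum>i\<le>degree P. coeff P i * 0)) at_top"
    by (intro tendsto_intros tendsto_power_div_exp_0)
  then show ?thesis
    by (simp add: poly_altdef exp_minus sum_distrib_right sum_divide_distrib divide_inverse mult.assoc)
qed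

lemma flat_deriv: "(flat P has_real_derivative flat (monom 1 2 * (P - pderiv P)) s) (at s)"
proof -
  consider "s > 0" | "s < 0" | "s = 0" by linarith
  then show ?thesis
  proof cases
    case 1
    have "((\<lambda>s. poly P (1/s) * exp (-1/s)) has_real_derivative flat (monom 1 2 * (P - pderiv P)) s) (at s)"
      using 1 by (auto intro!: derivative_eq_intros simp: flat_def poly_monom field_simps power2_eq_square)
    then show ?thesis
      by (rule has_field_derivative_transform_within[where d=s]) (use 1 in \<open>auto simp: flat_def dist_real_def\<close>)
  next
    case 2
    have "((\<lambda>s. 0) has_real_derivative flat (monom 1 2 * (P - pderiv P)) s) (at s)"
      using 2 by (auto simp: flat_def)
    then show ?thesis
      by (rule has_field_derivative_transform_within[where d="-s"]) (use 2 in \<open>auto simp: flat_def dist_real_def\<close>)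
  next
    case 3
    have "((\<lambda>h. flat P h / h) \<longlongrightarrow> 0) (at_left 0)"
      by (rule tendsto_eventually) (auto simp: flat_def eventually_at intro!: exI[of _ 1])
    moreover have "((\<lambda>h. flat P h / h) \<longlongrightarrow> 0) (at_right 0)"
    proof -
      \<comment> \<open>The quotient by \<open>h\<close> is a multiplication by
        \<open>x = 1/h\<close>, and \<open>pCons 0 P\<close> is the polynomial \<open>x * P\<close>;
        so the limit from the right is one of polynomial against exponential at infinity.\<close>
      have "((\<lambda>h::real. poly (pCons 0 P) (inverse h) * exp (- (inverse h))) \<longlongrightarrow> 0) (at_right 0)"
        by (rule filterlim_compose[OF poly_div_exp_tendsto filterlim_inverse_at_top_right])
      then show ?thesis
        by (rule tendsto_cong[THEN iffD1, rotated])
          (auto simp: flat_def eventually_at field_simps intro!: exI[of _ 1])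
    qed
    ultimately have "((\<lambda>h. flat P h / h) \<longlongrightarrow> 0) (at 0)"
      by (rule filterlim_split_at)
    then show ?thesis using 3 by (simp add: DERIV_def) (simp add: flat_def)
  qed
qed

text \<open>The iteration starts from the constant polynomial 1, so order 0 is
  \<open>exp (-1/s)\<close> for positive \<open>s\<close>.\<close>

definition hseq :: "nat \<Rightarrow> real \<Rightarrow> real" where
  "hseq n = flat (((\<lambda>P. monom 1 2 * (P - pderiv P)) ^^ n) 1)"

lemma smooth1_hseq: "smooth1 hseq"
  unfolding smooth1_def hseq_def using flat_deriv by simp

text \<open>Order 0 is the product of \<open>exp (-1/(1+s))\<close> and
  \<open>exp (-1/(1-s))\<close> inside the interval from -1 to 1, and 0 outside. The factors
  \<open>1 ^ n\<close> and \<open>1 * s\<close> keep the shape of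
  \<open>smooth1_affine\<close>.\<close>

definition bump :: "nat \<Rightarrow> real \<Rightarrow> real" where
  "bump n = leibniz (\<lambda>n s. 1 ^ n * hseq n (1 * s + 1)) (\<lambda>n s. (-1) ^ n * hseq n ((-1) * s + 1)) n 0 0"

lemma smooth1_bump: "smooth1 bump"
  unfolding bump_def by (intro smooth1_leibniz smooth1_affine smooth1_hseq)

lemma bump_0: "bump 0 s = hseq 0 (s + 1) * hseq 0 (1 - s)"
  by (simp add: bump_def)

lemma bump_nonneg: "0 \<le> bump 0 s" by (simp add: bump_0 hseq_def flat_def)

lemma bump_pos: "0 < bump 0 0" by (simp add: bump_0 hseq_def flat_def)

lemma bump_1: "bump (Suc 0) s = hseq 1 (s + 1) * hseq 0 (1 - s) - hseq 0 (s + 1) * hseq 1 (1 - s)"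
  by (simp add: bump_def)

lemma bump_support: "\<bar>s\<bar> \<ge> 1 \<Longrightarrow> bump 0 s = 0" "\<bar>s\<bar> \<ge> 1 \<Longrightarrow> bump (Suc 0) s = 0"
  by (auto simp: bump_0 bump_1 hseq_def flat_def abs_real_def split: if_splits)

text \<open>For a product of functions of one coordinate each, a mixed partial derivative depends
  only on how often each direction occurs, so \<open>count_list\<close> turns a list of directions
  into the orders of the factors. This is why smoothness is carried by sequences of one-variable
  derivatives and why the mollifier is a product rather than radial.\<close>

lemma smooth_on_prod:
  fixes F :: "'e::euclidean_space \<Rightarrow> nat \<Rightarrow> real \<Rightarrow> real"
  assumes F: "\<And>i. i \<in> Basis \<Longrightarrow> smooth1 (F i)"
    and f: "\<And>z. z \<in> S \<Longrightarrow> f z = (\<Prod>i\<in>Basis. F i 0 (z \<bullet> i))"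
  shows "smooth_on S f"
  unfolding smooth_on_def
proof (intro exI conjI ballI)
  let ?D = "\<lambda>l z. \<Prod>i\<in>Basis. F i (count_list l i) (z \<bullet> i)"
  show "?D [] z = f z" if "z \<in> S" for z using f that by simp
  fix l :: "'e list"
  show "continuous_on S (?D l)"
    by (intro continuous_on_prod continuous_on_compose2[OF smooth1_continuous[OF F, of _ UNIV]]
        continuous_intros) auto
  fix i z :: 'e assume i: "i \<in> Basis" and z: "z \<in> S"
  \<comment> \<open>Along direction \<open>i\<close> the factor for \<open>i\<close> varies and all
    others are frozen at \<open>z\<close>.\<close>
  have eq: "?D l' (z + s *\<^sub>R i) = F i (count_list l' i) (z \<bullet> i + s) *
      (\<Prod>j\<in>Basis-{i}. F j (count_list l' j) (z \<bullet> j))" for l' s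
  proof -
    have "?D l' (z + s *\<^sub>R i) = F i (count_list l' i) ((z + s *\<^sub>R i) \<bullet> i) *
      (\<Prod>j\<in>Basis-{i}. F j (count_list l' j) ((z + s *\<^sub>R i) \<bullet> j))"
      using i by (rule prod.remove[OF finite_Basis])
    also have "(\<Prod>j\<in>Basis-{i}. F j (count_list l' j) ((z + s *\<^sub>R i) \<bullet> j)) =
      (\<Prod>j\<in>Basis-{i}. F j (count_list l' j) (z \<bullet> j))"
      using i by (intro prod.cong) (auto simp: inner_simps inner_Basis)
    finally show ?thesis using i by (simp add: inner_simps)
  qed
  have "((\<lambda>s. F i (count_list l i) (z \<bullet> i + s)) has_real_derivative
      F i (Suc (count_list l i)) (z \<bullet> i + 0)) (at 0)"
    using smooth1D[OF F[OF i], of "count_list l i" "z \<bullet> i + 0"]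
      DERIV_shift[of "F i (count_list l i)" "F i (Suc (count_list l i)) (z \<bullet> i + 0)" 0 "z \<bullet> i"]
    by (simp add: add.commute)
  then have "((\<lambda>s. ?D l (z + s *\<^sub>R i)) has_real_derivative
      F i (Suc (count_list l i)) (z \<bullet> i + 0) * (\<Prod>j\<in>Basis-{i}. F j (count_list l j) (z \<bullet> j)))
      (at 0)"
    unfolding eq by (rule DERIV_cmult_right)
  moreover have "?D (i # l) z = F i (Suc (count_list l i)) (z \<bullet> i + 0) * (\<Prod>j\<in>Basis-{i}. F j (count_list l j) (z \<bullet> j))"
  proof -
    have c: "(\<Prod>j\<in>Basis-{i}. F j (count_list (i # l) j) (z \<bullet> j)) = (\<Prod>j\<in>Basis-{i}. F j (count_list l j) (z \<bullet> j))"
      by (rule prod.cong) auto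
    have "?D (i # l) z = ?D (i # l) (z + 0 *\<^sub>R i)" by (simp only: scaleR_zero_left add_0_right)
    also have "\<dots> = F i (count_list (i # l) i) (z \<bullet> i + 0) * (\<Prod>j\<in>Basis-{i}. F j (count_list (i # l) j) (z \<bullet> j))"
      by (rule eq)
    also have "\<dots> = F i (count_list (i # l) i) (z \<bullet> i + 0) * (\<Prod>j\<in>Basis-{i}. F j (count_list l j) (z \<bullet> j))"
      by (simp only: c)
    also have "count_list (i # l) i = Suc (count_list l i)" by simp
    finally show ?thesis .
  qed
  ultimately have "((\<lambda>s. ?D l (z + s *\<^sub>R i)) has_real_derivative ?D (i # l) z) (at 0)" by (simp only:)
  then show "((\<lambda>s. ?D l (z + s *\<^sub>R i)) has_real_derivative ?D (i # l) z) (at 0 within {s. z + s *\<^sub>R i \<in> S})"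
    by (rule has_field_derivative_at_within)
qed

section \<open>The product kernel, its gradient and its scaling\<close>

definition kern0 :: "'a::euclidean_space \<Rightarrow> real" where
  "kern0 x = (\<Prod>i\<in>Basis. bump 0 (x \<bullet> i))"

definition gkern0 :: "'a::euclidean_space \<Rightarrow> 'a" where
  "gkern0 x = (\<Sum>i\<in>Basis. (bump (Suc 0) (x \<bullet> i) * (\<Prod>j\<in>Basis - {i}. bump 0 (x \<bullet> j))) *\<^sub>R i)"

lemma kern0_nonneg: "0 \<le> kern0 x" by (simp add: kern0_def bump_nonneg prod_nonneg)

text \<open>By comparison with the sum of the absolute coordinates. It places the cube that supports
  the kernel inside the ball of radius \<open>DIM('a)\<close>, the radius that recurs in all later
  estimates.\<close>

lemma large_coordinate:
  fixes x :: "'a::euclidean_space"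
  assumes "norm x > DIM('a)" shows "\<exists>i\<in>Basis. \<bar>x \<bullet> i\<bar> \<ge> 1"
proof (rule ccontr)
  assume "\<not> ?thesis"
  then have "(\<Sum>i\<in>Basis. \<bar>x \<bullet> i\<bar>) \<le> (\<Sum>i\<in>(Basis::'a set). 1)" by (intro sum_mono) force
  then show False using norm_le_l1[of x] assms by simp
qed

lemma kern0_support: "norm (x::'a::euclidean_space) > DIM('a) \<Longrightarrow> kern0 x = 0"
  using large_coordinate[of x] bump_support(1) unfolding kern0_def by (metis finite_Basis prod_zero)

lemma gkern0_support:
  fixes x :: "'a::euclidean_space"
  assumes "norm x > DIM('a)" shows "gkern0 x = 0"
proof -
  obtain i where i: "i \<in> Basis" "\<bar>x \<bullet> i\<bar> \<ge> 1" using large_coordinate[OF assms] by auto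
  have "bump (Suc 0) (x \<bullet> k) * (\<Prod>j\<in>Basis - {k}. bump 0 (x \<bullet> j)) = 0" if "k \<in> Basis" for k
    using i bump_support by (cases "k = i") (auto intro!: prod_zero bexI[of _ i])
  then show ?thesis unfolding gkern0_def by (simp add: sum.neutral)
qed

lemma continuous_kern0: "continuous_on S kern0"
  unfolding kern0_def
  by (intro continuous_intros continuous_on_compose2[OF smooth1_continuous[OF smooth1_bump, of UNIV]]) auto

lemma continuous_gkern0: "continuous_on S gkern0"
  unfolding gkern0_def
  by (intro continuous_intros continuous_on_compose2[OF smooth1_continuous[OF smooth1_bump, of UNIV]]) auto

lemma kern0_gderiv: "GDERIV kern0 x :> gkern0 x"
proof -
  have "((\<lambda>x. bump 0 (x \<bullet> i)) has_derivative (\<lambda>h. bump (Suc 0) (x \<bullet> i) * (h \<bullet> i))) (at x)" for i x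
    by (rule has_derivative_compose[OF _ smooth1D[OF smooth1_bump, unfolded has_field_derivative_def], of "\<lambda>x. x \<bullet> i"])
      (auto intro!: derivative_eq_intros)
  then have "(kern0 has_derivative (\<lambda>h. \<Sum>i\<in>Basis. (bump (Suc 0) (x \<bullet> i) * (h \<bullet> i)) * (\<Prod>j\<in>Basis - {i}. bump 0 (x \<bullet> j)))) (at x)"
    unfolding kern0_def by (rule has_derivative_prod)
  then show ?thesis
    unfolding gderiv_def gkern0_def by (simp add: inner_sum_right algebra_simps)
qed

lemma bounded_of_continuous_support:
  fixes f :: "'a::euclidean_space \<Rightarrow> 'b::real_normed_vector"
  assumes "continuous_on UNIV f" "\<And>x. norm x > r \<Longrightarrow> f x = 0"
  obtains M where "M > 0" "\<And>x. norm (f x) \<le> M"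
proof -
  have "bounded (f ` cball 0 r)"
    by (intro compact_imp_bounded compact_continuous_image continuous_on_subset[OF assms(1)]) auto
  then obtain M where M: "M > 0" "\<And>x. norm x \<le> r \<Longrightarrow> norm (f x) \<le> M"
    unfolding bounded_pos by auto
  show thesis
    by (rule that[OF M(1)]) (metis M less_le_not_le linorder_not_le norm_zero assms(2))
qed

lemma integrable_continuous_support:
  fixes f :: "'a::euclidean_space \<Rightarrow> 'b::euclidean_space"
  assumes "continuous_on UNIV f" "\<And>x. norm x > r \<Longrightarrow> f x = 0"
  shows "integrable lborel f"
proof -
  have "integrable lborel (\<lambda>x. indicator (cball 0 r) x *\<^sub>R f x)"
    by (rule borel_integrable_compact) (auto intro: continuous_on_subset[OF assms(1)])
  then show ?thesis
    by (rule Bochner_Integration.integrable_cong[THEN iffD1, rotated -1])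
      (auto simp: indicator_def assms(2))
qed

definition kmass :: "'a::euclidean_space itself \<Rightarrow> real" where
  "kmass _ = (LINT x|lborel. kern0 (x::'a))"

lemma kern0_integrable: "integrable lborel kern0"
  by (rule integrable_continuous_support[OF continuous_kern0]) (rule kern0_support)

text \<open>A nonnegative continuous kernel with integral 0 would vanish on a closed set of full
  measure, hence everywhere, but it is positive at the origin.\<close>

lemma kmass_pos: "kmass TYPE('a::euclidean_space) > 0"
proof (rule ccontr)
  assume "\<not> ?thesis"
  moreover have "kmass TYPE('a) \<ge> 0" unfolding kmass_def by (simp add: kern0_nonneg)
  ultimately have "(LINT x|lborel. kern0 (x::'a)) = 0" unfolding kmass_def by simp
  then have "AE x in lborel. kern0 (x::'a) = 0"
    by (subst integral_nonneg_eq_0_iff_AE[symmetric]) (auto simp: kern0_integrable kern0_nonneg)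
  then have "AE x in lborel. x \<in> {x::'a. kern0 x = 0}" by simp
  moreover have "closed {x::'a. kern0 x = 0}"
    by (rule closed_Collect_eq) (auto simp: continuous_kern0)
  ultimately have "kern0 (0::'a) = 0"
    using mem_closed_if_AE_lebesgue[of "{x::'a. kern0 x = 0}" 0] by (auto simp: AE_completion)
  then show False using bump_pos by (simp add: kern0_def)
qed

definition kern :: "real \<Rightarrow> 'a::euclidean_space \<Rightarrow> real" where
  "kern \<epsilon> x = kern0 (x /\<^sub>R \<epsilon>) / (kmass TYPE('a) * \<epsilon> ^ DIM('a))"

definition gkern :: "real \<Rightarrow> 'a::euclidean_space \<Rightarrow> 'a" where
  "gkern \<epsilon> x = gkern0 (x /\<^sub>R \<epsilon>) /\<^sub>R (kmass TYPE('a) * \<epsilon> ^ Suc DIM('a))"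

lemma kern_nonneg: "\<epsilon> > 0 \<Longrightarrow> 0 \<le> kern \<epsilon> (x::'a::euclidean_space)"
  using kmass_pos[where 'a='a] by (simp add: kern_def kern0_nonneg)

lemma kern_support: "\<epsilon> > 0 \<Longrightarrow> norm (x::'a::euclidean_space) > \<epsilon> * real DIM('a) \<Longrightarrow> kern \<epsilon> x = 0"
  using kern0_support[of "x /\<^sub>R \<epsilon>"] by (simp add: kern_def field_simps)

lemma gkern_support: "\<epsilon> > 0 \<Longrightarrow> norm (x::'a::euclidean_space) > \<epsilon> * real DIM('a) \<Longrightarrow> gkern \<epsilon> x = 0"
  using gkern0_support[of "x /\<^sub>R \<epsilon>"] by (simp add: gkern_def field_simps)

lemma continuous_kern: "continuous_on S (kern \<epsilon>)"
  unfolding kern_def divide_inverse by (intro continuous_intros continuous_on_compose2[OF continuous_kern0[of UNIV]]) auto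

lemma continuous_gkern: "continuous_on S (gkern \<epsilon>)"
  unfolding gkern_def by (intro continuous_intros continuous_on_compose2[OF continuous_gkern0[of UNIV]]) auto

lemma kern_measurable [measurable]: "kern \<epsilon> \<in> borel_measurable borel"
  "gkern \<epsilon> \<in> borel_measurable borel"
  by (auto intro!: borel_measurable_continuous_onI continuous_kern continuous_gkern)

lemma kern_integrable: "\<epsilon> > 0 \<Longrightarrow> integrable lborel (kern \<epsilon>)"
  by (rule integrable_continuous_support[OF continuous_kern]) (rule kern_support)

lemma kern_gderiv: "\<epsilon> > 0 \<Longrightarrow> GDERIV (kern \<epsilon>) x :> gkern \<epsilon> x"
proof -
  assume "\<epsilon> > 0"
  have "((\<lambda>x. kern0 (x /\<^sub>R \<epsilon>)) has_derivative (\<lambda>h. (h /\<^sub>R \<epsilon>) \<bullet> gkern0 (x /\<^sub>R \<epsilon>))) (at x)"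
    by (rule has_derivative_compose[OF _ kern0_gderiv[unfolded gderiv_def], of "\<lambda>x. x /\<^sub>R \<epsilon>"])
      (auto intro!: derivative_eq_intros)
  then have "((\<lambda>x. kern0 (x /\<^sub>R \<epsilon>) * inverse (kmass TYPE('a) * \<epsilon> ^ DIM('a))) has_derivative
    (\<lambda>h. ((h /\<^sub>R \<epsilon>) \<bullet> gkern0 (x /\<^sub>R \<epsilon>)) * inverse (kmass TYPE('a) * \<epsilon> ^ DIM('a)))) (at x)"
    by (rule has_derivative_mult_left)
  then show ?thesis
    unfolding gderiv_def kern_def gkern_def divide_inverse
    by (simp add: algebra_simps)
qed

lemma lborel_affine_has_integral:
  fixes f :: "'a::euclidean_space \<Rightarrow> 'b::{banach,second_countable_topology}"
  assumes [measurable]: "f \<in> borel_measurable borel" and "c \<noteq> 0"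
  shows "(LINT x|lborel. f x) = \<bar>c\<bar> ^ DIM('a) *\<^sub>R (LINT x|lborel. f (t + c *\<^sub>R x))"
  using assms(2)
  by (subst lborel_affine[OF assms(2), of t])
    (simp add: integral_density integral_distr)

lemma kern_integral:
  assumes "\<epsilon> > 0" shows "(LINT x|lborel. kern \<epsilon> (x::'a::euclidean_space)) = 1"
proof -
  have "(LINT x|lborel. kern \<epsilon> (x::'a)) = \<epsilon> ^ DIM('a) * (LINT x|lborel. kern \<epsilon> (0 + \<epsilon> *\<^sub>R (x::'a)))"
    using lborel_affine_has_integral[of "kern \<epsilon> :: 'a \<Rightarrow> real" \<epsilon> 0] assms by simp
  also have "\<dots> = 1"
    using assms kmass_pos[where 'a='a] by (simp add: kern_def kmass_def)
  finally show ?thesis .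
qed

text \<open>After the substitution with scale \<open>\<epsilon>\<close>, whose Jacobian is
  \<open>\<epsilon> ^ DIM('a)\<close>, the kernel leaves a bounded factor, whereas its gradient
  leaves an additional \<open>1 / \<epsilon>\<close>. That factor is absorbed later by a difference
  of \<open>b\<close>.\<close>

lemma kern_bounds:
  obtains M where "M > 0" "\<And>\<epsilon> z. \<epsilon> > 0 \<Longrightarrow> kern \<epsilon> (\<epsilon> *\<^sub>R (z::'a::euclidean_space)) * \<epsilon> ^ DIM('a) \<le> M"
    "\<And>\<epsilon> z. \<epsilon> > 0 \<Longrightarrow> norm (gkern \<epsilon> (\<epsilon> *\<^sub>R (z::'a))) * \<epsilon> ^ Suc DIM('a) \<le> M"
proof -
  obtain M1 where M1: "M1 > 0" "\<And>x::'a. norm (kern0 x) \<le> M1"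
    using bounded_of_continuous_support[OF continuous_kern0 kern0_support] by metis
  obtain M2 where M2: "M2 > 0" "\<And>x::'a. norm (gkern0 x) \<le> M2"
    using bounded_of_continuous_support[OF continuous_gkern0 gkern0_support] by metis
  note kmass_pos[where 'a='a, simp]
  show thesis
  proof (rule that[of "(M1 + M2) / kmass TYPE('a)"])
    show "(M1 + M2) / kmass TYPE('a) > 0" using M1 M2 by simp
    fix \<epsilon> :: real and z :: 'a assume e: "\<epsilon> > 0"
    have "kern \<epsilon> (\<epsilon> *\<^sub>R z) * \<epsilon> ^ DIM('a) = kern0 z / kmass TYPE('a)" using e by (simp add: kern_def)
    also have "\<dots> \<le> (M1 + M2) / kmass TYPE('a)"
      using M1(2)[of z] M2(1) by (intro divide_right_mono) (auto simp: less_imp_le)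
    finally show "kern \<epsilon> (\<epsilon> *\<^sub>R z) * \<epsilon> ^ DIM('a) \<le> (M1 + M2) / kmass TYPE('a)" .
    have "norm (gkern \<epsilon> (\<epsilon> *\<^sub>R z)) * \<epsilon> ^ Suc DIM('a) = norm (gkern0 z) / kmass TYPE('a)"
      using e abs_of_pos[OF kmass_pos[where 'a='a]] by (simp add: gkern_def abs_mult divide_simps)
    also have "\<dots> \<le> (M1 + M2) / kmass TYPE('a)"
      using M2(2)[of z] M1(1) by (intro divide_right_mono) (auto simp: less_imp_le)
    finally show "norm (gkern \<epsilon> (\<epsilon> *\<^sub>R z)) * \<epsilon> ^ Suc DIM('a) \<le> (M1 + M2) / kmass TYPE('a)" .
  qed
qed

lemma gderiv_unique: "GDERIV f x :> D \<Longrightarrow> GDERIV f x :> D' \<Longrightarrow> D = D'"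
  unfolding gderiv_def by (metis has_derivative_unique vector_eq_ldot)

lemma grad_eq: "GDERIV f x :> D \<Longrightarrow> grad f x = D"
  unfolding grad_def by (rule the_equality) (auto dest: gderiv_unique)

lemma kern_reflected_gderiv:
  assumes "\<epsilon> > 0" shows "GDERIV (\<lambda>x. c * kern \<epsilon> (y - x)) x :> - (c *\<^sub>R gkern \<epsilon> (y - x))"
proof -
  have "((\<lambda>x. kern \<epsilon> (y - x)) has_derivative (\<lambda>h. (- h) \<bullet> gkern \<epsilon> (y - x))) (at x)"
    by (rule has_derivative_compose[OF _ kern_gderiv[OF assms, unfolded gderiv_def], of "\<lambda>x. y - x"])
      (auto intro!: derivative_eq_intros)
  then show ?thesis unfolding gderiv_def by (auto dest: has_derivative_mult_right[of _ _ _ c] simp: algebra_simps)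
qed

definition shifted_bump :: "real \<Rightarrow> real \<Rightarrow> nat \<Rightarrow> real \<Rightarrow> real" where
  "shifted_bump \<epsilon> a n s = (- inverse \<epsilon>) ^ n * bump n ((- inverse \<epsilon>) * s + inverse \<epsilon> * a)"

lemma smooth1_shifted_bump: "smooth1 (shifted_bump \<epsilon> a)"
  unfolding shifted_bump_def by (rule smooth1_affine[OF smooth1_bump])

lemma kern_eq_prod:
  "kern \<epsilon> (y - x) = (\<Prod>i\<in>Basis. shifted_bump \<epsilon> (y \<bullet> i) 0 (x \<bullet> i)) / (kmass TYPE('a) * \<epsilon> ^ DIM('a))"
  for y :: "'a::euclidean_space"
  by (simp add: kern_def kern0_def shifted_bump_def algebra_simps)

lemma test_function_kern:
  fixes y :: "'a::euclidean_space"
  assumes "\<epsilon> > 0" shows "test_function (\<lambda>x. kern \<epsilon> (y - x))"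
  unfolding test_function_def
proof
  obtain k :: 'a where k: "k \<in> Basis" using nonempty_Basis by blast
  \<comment> \<open>The criterion for products has no constant in front, so the normalisation is
    given to the factor of one chosen direction.\<close>
  let ?c = "inverse (kmass TYPE('a) * \<epsilon> ^ DIM('a))"
  show "smooth_on UNIV (\<lambda>x. kern \<epsilon> (y - x))"
  proof (rule smooth_on_prod[where F="\<lambda>i n s. (if i = k then ?c else 1) * shifted_bump \<epsilon> (y \<bullet> i) n s"])
    show "smooth1 (\<lambda>n s. (if i = k then ?c else 1) * shifted_bump \<epsilon> (y \<bullet> i) n s)" for i
      by (rule smooth1_cmult[OF smooth1_shifted_bump])
    show "kern \<epsilon> (y - z) = (\<Prod>i\<in>Basis. (if i = k then ?c else 1) * shifted_bump \<epsilon> (y \<bullet> i) 0 (z \<bullet> i))" for z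
      using k by (simp add: kern_eq_prod prod.distrib divide_inverse)
  qed
  have "{x. kern \<epsilon> (y - x) \<noteq> 0} \<subseteq> cball y (\<epsilon> * real DIM('a))"
  proof
    fix x assume "x \<in> {x. kern \<epsilon> (y - x) \<noteq> 0}"
    then have "\<not> norm (y - x) > \<epsilon> * real DIM('a)" using kern_support[OF assms, of "y - x"] by auto
    then show "x \<in> cball y (\<epsilon> * real DIM('a))" by (simp add: dist_norm)
  qed
  then have "bounded {x. kern \<epsilon> (y - x) \<noteq> 0}" using bounded_cball bounded_subset by blast
  then show "compact (closure {x. kern \<epsilon> (y - x) \<noteq> 0})" by (simp add: compact_closure)
qed

text \<open>Testing the equation with these functions amounts to mollifying it in space at the point
  \<open>y\<close>; the weak formulation is used with no others.\<close>

lemma spacetime_test_function_kern: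
  fixes y :: "'a::euclidean_space"
  assumes "\<epsilon> > 0" "smooth1 \<eta>"
  shows "spacetime_test_function T (\<lambda>t x. \<eta> 0 t * kern \<epsilon> (y - x))"
  unfolding spacetime_test_function_def
proof
  let ?c = "inverse (kmass TYPE('a) * \<epsilon> ^ DIM('a))"
  \<comment> \<open>The vector \<open>(1, 0)\<close> is the time direction of the product space; its
    factor carries both \<open>\<eta>\<close> and the normalisation.\<close>
  let ?F = "\<lambda>(i::real \<times> 'a) n s. if i = (1, 0) then ?c * \<eta> n s else shifted_bump \<epsilon> (y \<bullet> snd i) n s"
  show "smooth_on ({0..T} \<times> UNIV) (\<lambda>(t, x). \<eta> 0 t * kern \<epsilon> (y - x))"
  proof (rule smooth_on_prod[where F="?F"])
    show "smooth1 (?F i)" for i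
      using smooth1_cmult[OF assms(2)] smooth1_shifted_bump by (cases "i = (1,0)") auto
    fix z :: "real \<times> 'a"
    have "(\<Prod>i\<in>Basis. ?F i 0 (z \<bullet> i)) =
       (\<Prod>i\<in>(\<lambda>u. (u, 0)) ` Basis. ?F i 0 (z \<bullet> i)) * (\<Prod>i\<in>(\<lambda>u. (0, u)) ` Basis. ?F i 0 (z \<bullet> i))"
      unfolding Basis_prod_def by (subst prod.union_disjoint) (auto simp: nonzero_Basis)
    also have "(\<Prod>i\<in>(\<lambda>u. (u, 0)) ` Basis. ?F i 0 (z \<bullet> i)) = ?c * \<eta> 0 (fst z)"
      by (cases z) simp
    also have "(\<Prod>i\<in>(\<lambda>u. (0, u)) ` (Basis::'a set). ?F i 0 (z \<bullet> i)) = (\<Prod>i\<in>Basis. shifted_bump \<epsilon> (y \<bullet> i) 0 (snd z \<bullet> i))"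
      by (subst prod.reindex) (auto simp: inj_on_def inner_prod_def intro!: prod.cong)
    finally show "(case z of (t, x) \<Rightarrow> \<eta> 0 t * kern \<epsilon> (y - x)) = (\<Prod>i\<in>Basis. ?F i 0 (z \<bullet> i))"
      by (cases z) (simp add: kern_eq_prod divide_inverse)
  qed
  have "\<eta> 0 t * kern \<epsilon> (y - x) = 0" if "x \<notin> cball y (\<epsilon> * real DIM('a))" for t x
  proof -
    have "norm (y - x) > \<epsilon> * real DIM('a)" using that by (simp add: dist_norm)
    then show ?thesis using kern_support[OF assms(1), of "y - x"] by simp
  qed
  then show "\<exists>K. compact K \<and> (\<forall>t\<in>{0..T}. \<forall>x. x \<notin> K \<longrightarrow> \<eta> 0 t * kern \<epsilon> (y - x) = 0)"
    by (intro exI[of _ "cball y (\<epsilon> * real DIM('a))"]) auto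
qed

section \<open>Translation and mollification\<close>

definition Cc :: "('a::euclidean_space \<Rightarrow> real) \<Rightarrow> bool" where
  "Cc g \<longleftrightarrow> continuous_on UNIV g \<and> (\<exists>r. \<forall>x. norm x > r \<longrightarrow> g x = 0)"

lemma Cc_integrable: "Cc g \<Longrightarrow> integrable lborel g"
  unfolding Cc_def by (meson integrable_continuous_support)

lemma Cc_add: "Cc f \<Longrightarrow> Cc g \<Longrightarrow> Cc (\<lambda>x. f x + g x)"
  unfolding Cc_def
proof safe
  fix r r' assume "\<forall>x. norm x > r \<longrightarrow> f x = 0" "\<forall>x. norm x > r' \<longrightarrow> g x = 0"
  then show "\<exists>r. \<forall>x. norm x > r \<longrightarrow> f x + g x = 0" by (intro exI[of _ "max r r'"]) auto
qed (auto intro: continuous_intros)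

lemma Cc_cmult: "Cc f \<Longrightarrow> Cc (\<lambda>x. c * f x)"
  unfolding Cc_def by (auto intro!: continuous_intros)

text \<open>Regularity of Lebesgue measure gives a closed set inside and an open set outside;
  intersecting both with large balls leaves a compact set within a bounded open one, and a Urysohn
  function between them is the approximation.\<close>

lemma Cc_approx_indicator:
  fixes A :: "'a::euclidean_space set"
  assumes A: "A \<in> sets borel" "emeasure lborel A < \<infinity>" and e: "e > 0"
  shows "\<exists>g. Cc g \<and> (LINT x|lborel. \<bar>indicator A x - g x\<bar>) < e"
proof -
  have "A \<in> sets lebesgue" using A by simp
  obtain T where T: "closed T" "T \<subseteq> A" "A - T \<in> lmeasurable" "emeasure lebesgue (A - T) < ennreal (e/4)"
    using sets_lebesgue_inner_closed[of A "e/4"] A e by auto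
  obtain U where U: "open U" "A \<subseteq> U" "U - A \<in> lmeasurable" "emeasure lebesgue (U - A) < ennreal (e/4)"
    using sets_lebesgue_outer_open[of A "e/4"] A e by auto
  have TB: "T \<in> sets borel" "U \<in> sets borel" using T U by auto
  have fT: "emeasure lborel T < \<infinity>" using emeasure_mono[of T A lborel] T(2) A by (auto simp: sets_lborel intro: le_less_trans)
  have "((\<lambda>n. emeasure lborel (T - cball 0 (real n))) \<longlonglongrightarrow> emeasure lborel (\<Inter>n. T - cball 0 (real n)))"
  proof (rule Lim_emeasure_decseq)
    show "emeasure lborel (T - cball 0 (real n)) \<noteq> \<infinity>" for n
      using emeasure_mono[of "T - cball 0 (real n)" T lborel] TB fT by (auto simp: top_unique)
  qed (use TB in \<open>auto simp: decseq_def dest: order_trans\<close>)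
  also have "(\<Inter>n. T - cball 0 (real n)) = {}"
    using real_arch_simple by (auto simp: dist_norm)
  finally have "((\<lambda>n. emeasure lborel (T - cball 0 (real n))) \<longlonglongrightarrow> 0)" by (simp only: emeasure_empty)
  from order_tendstoD(2)[OF this, of "ennreal (e/4)"] e
  obtain n where n: "emeasure lborel (T - cball 0 (real n)) < ennreal (e/4)"
    by (auto simp: eventually_sequentially)
  define K where "K = T \<inter> cball 0 (real n)"
  define V where "V = U \<inter> ball 0 (real n + 1)"
  have KV: "closed K" "closed (- V)" "K \<inter> (- V) = {}" "K \<subseteq> A"
    using T U by (auto simp: K_def V_def)
  obtain g :: "'a \<Rightarrow> real" where g: "continuous_on UNIV g" "\<And>x. g x \<in> closed_segment 1 0"
     "\<And>x. x \<in> K \<Longrightarrow> g x = 1" "\<And>x. x \<in> - V \<Longrightarrow> g x = 0"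
    using Urysohn[OF KV(1,2,3)] by metis
  have g01: "0 \<le> g x" "g x \<le> 1" for x using g(2)[of x] by (auto simp: closed_segment_eq_real_ivl)
  have Cc: "Cc g" unfolding Cc_def using g(1,4)
    by (auto simp: V_def intro!: exI[of _ "real n + 1"])
  \<comment> \<open>Off this set the Urysohn function equals the indicator; each of the three pieces
    has measure below \<open>e/4\<close>.\<close>
  let ?S = "(A - T) \<union> ((T - cball 0 (real n)) \<union> (U - A))"
  have S: "?S \<in> sets borel" using A TB by auto
  have le: "emeasure lborel ?S \<le> ennreal (e/4) + (ennreal (e/4) + ennreal (e/4))"
  proof -
    have "emeasure lborel ?S \<le> emeasure lborel (A - T) + (emeasure lborel (T - cball 0 (real n)) + emeasure lborel (U - A))"
      using A TB by (intro order_trans[OF emeasure_subadditive] add_left_mono emeasure_subadditive) auto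
    also have "\<dots> \<le> ennreal (e/4) + (ennreal (e/4) + ennreal (e/4))"
      using T(4) U(4) n A TB by (intro add_mono) (auto simp: less_imp_le)
    finally show ?thesis .
  qed
  also have "\<dots> = ennreal (3 * e / 4)" using e by (simp flip: ennreal_plus)
  finally have le: "emeasure lborel ?S \<le> ennreal (3 * e / 4)" .
  have fS: "emeasure lborel ?S < \<infinity>" using le by (simp add: le_less_trans less_top)
  have "(LINT x|lborel. \<bar>indicator A x - g x\<bar>) \<le> (LINT x|lborel. indicator ?S x)"
  proof (rule Bochner_Integration.integral_mono)
    show "integrable lborel (\<lambda>x. \<bar>indicator A x - g x\<bar>)"
      using Cc_integrable[OF Cc] A by (intro integrable_abs Bochner_Integration.integrable_diff) auto
    show "integrable lborel (indicator ?S :: 'a \<Rightarrow> real)"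
      using S fS by (intro integrable_real_indicator) auto
    fix x
    have "x \<in> K \<or> x \<notin> V \<and> x \<notin> A \<or> x \<in> ?S" using U T by (auto simp: K_def V_def)
    then show "\<bar>indicator A x - g x\<bar> \<le> indicator ?S x"
    proof (elim disjE)
      assume "x \<in> K" then show ?thesis using g(3)[of x] KV(4) by (auto simp: indicator_def)
    next
      assume "x \<notin> V \<and> x \<notin> A" then show ?thesis using g(4)[of x] by (auto simp: indicator_def)
    next
      assume "x \<in> ?S" then show ?thesis using g01[of x] by (auto simp: indicator_def)
    qed
  qed
  also have "\<dots> = measure lborel ?S" using S by simp
  also have "\<dots> \<le> 3 * e / 4" unfolding measure_def by (rule enn2real_leI[OF _ le]) (use e in auto)
  also have "\<dots> < e" using e by simp
  finally show ?thesis using Cc by auto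
qed

lemma Cc_dense_L1:
  fixes f :: "'a::euclidean_space \<Rightarrow> real"
  assumes "integrable lborel f" "e > 0"
  shows "\<exists>g. Cc g \<and> (LINT x|lborel. \<bar>f x - g x\<bar>) < e"
  using assms
proof (induction arbitrary: e rule: integrable_induct)
  case (base A c)
  show ?case
  proof (cases "c = 0")
    case True
    have "Cc (\<lambda>x::'a. 0)" by (simp add: Cc_def)
    then show ?thesis using True base by (intro exI[of _ "\<lambda>_. 0"]) auto
  next
    case False
    obtain g where g: "Cc g" "(LINT x|lborel. \<bar>indicator A x - g x\<bar>) < e / \<bar>c\<bar>"
      using Cc_approx_indicator[of A "e / \<bar>c\<bar>"] base False by auto
    have "(LINT x|lborel. \<bar>indicat_real A x *\<^sub>R c - c * g x\<bar>) = (LINT x|lborel. \<bar>c\<bar> * \<bar>indicator A x - g x\<bar>)"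
      by (intro Bochner_Integration.integral_cong) (auto simp: abs_mult[symmetric] algebra_simps)
    also have "\<dots> = \<bar>c\<bar> * (LINT x|lborel. \<bar>indicator A x - g x\<bar>)" by simp
    also have "\<dots> < e" using g(2) False by (simp add: field_simps)
    finally show ?thesis using Cc_cmult[OF g(1)] by blast
  qed
next
  case (add f g)
  obtain f' where f': "Cc f'" "(LINT x|lborel. \<bar>f x - f' x\<bar>) < e/2" using add(3)[of "e/2"] add(5) by auto
  obtain g' where g': "Cc g'" "(LINT x|lborel. \<bar>g x - g' x\<bar>) < e/2" using add(4)[of "e/2"] add(5) by auto
  have "(LINT x|lborel. \<bar>f x + g x - (f' x + g' x)\<bar>) \<le> (LINT x|lborel. \<bar>f x - f' x\<bar> + \<bar>g x - g' x\<bar>)"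
    using add(1,2) Cc_integrable[OF f'(1)] Cc_integrable[OF g'(1)]
    by (intro Bochner_Integration.integral_mono) auto
  also have "\<dots> = (LINT x|lborel. \<bar>f x - f' x\<bar>) + (LINT x|lborel. \<bar>g x - g' x\<bar>)"
    using add(1,2) Cc_integrable[OF f'(1)] Cc_integrable[OF g'(1)]
    by (intro Bochner_Integration.integral_add) auto
  also have "\<dots> < e" using f' g' by simp
  finally show ?case using Cc_add[OF f'(1) g'(1)] by blast
next
  case (lim f s)
  have "(\<lambda>i. LINT x|lborel. \<bar>s i x - f x\<bar>) \<longlonglongrightarrow> (LINT x|(lborel :: 'a measure). (0::real))"
  proof (rule Bochner_Integration.integral_dominated_convergence[where w="\<lambda>x. 3 * norm (f x)"])
    show "AE x in lborel. (\<lambda>i. \<bar>s i x - f x\<bar>) \<longlonglongrightarrow> 0"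
      using lim(2) by (auto intro!: tendsto_rabs_zero LIM_zero)
    show "AE x in lborel. norm \<bar>s i x - f x\<bar> \<le> 3 * norm (f x)" for i
      using lim(3)[of _ i] by (intro AE_I2) (smt (verit) real_norm_def space_lborel UNIV_I)
  qed (use lim in \<open>auto intro: borel_measurable_integrable\<close>)
  then have "(\<lambda>i. LINT x|lborel. \<bar>s i x - f x\<bar>) \<longlonglongrightarrow> 0" by simp
  from order_tendstoD(2)[OF this, of "e/2"] lim(6)
  obtain i where i: "(LINT x|lborel. \<bar>s i x - f x\<bar>) < e/2" by (auto simp: eventually_sequentially)
  obtain g where g: "Cc g" "(LINT x|lborel. \<bar>s i x - g x\<bar>) < e/2" using lim(5)[of "e/2" i] lim(6) by auto
  have "(LINT x|lborel. \<bar>f x - g x\<bar>) \<le> (LINT x|lborel. \<bar>s i x - f x\<bar> + \<bar>s i x - g x\<bar>)"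
    using lim(1,4) Cc_integrable[OF g(1)] by (intro Bochner_Integration.integral_mono) auto
  also have "\<dots> = (LINT x|lborel. \<bar>s i x - f x\<bar>) + (LINT x|lborel. \<bar>s i x - g x\<bar>)"
    using lim(1,4) Cc_integrable[OF g(1)] by (intro Bochner_Integration.integral_add) auto
  also have "\<dots> < e" using i g by simp
  finally show ?case using g(1) by blast
qed

lemma lborel_translate_integral:
  fixes f :: "'a::euclidean_space \<Rightarrow> 'b::{banach,second_countable_topology}"
  assumes [measurable]: "f \<in> borel_measurable borel"
  shows "(LINT x|lborel. f (x + h)) = (LINT x|lborel. f x)"
  using lborel_affine_has_integral[OF assms, of 1 h] by (simp add: add.commute)

lemma lborel_reflect_integral:
  fixes f :: "'a::euclidean_space \<Rightarrow> 'b::{banach,second_countable_topology}"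
  assumes [measurable]: "f \<in> borel_measurable borel"
  shows "(LINT x|lborel. f (h - x)) = (LINT x|lborel. f x)"
  using lborel_affine_has_integral[OF assms, of "-1" h] by simp

lemma lborel_affine_nn_integral:
  fixes f :: "'a::euclidean_space \<Rightarrow> ennreal"
  assumes [measurable]: "f \<in> borel_measurable borel" and "c \<noteq> 0"
  shows "(\<integral>\<^sup>+x. f x \<partial>lborel) = ennreal (\<bar>c\<bar> ^ DIM('a)) * (\<integral>\<^sup>+x. f (t + c *\<^sub>R x) \<partial>lborel)"
  by (subst lborel_affine[OF assms(2), of t]) (simp add: nn_integral_density nn_integral_distr nn_integral_cmult)

lemma lborel_translate_nn_integral:
  fixes f :: "'a::euclidean_space \<Rightarrow> ennreal"
  assumes [measurable]: "f \<in> borel_measurable borel"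
  shows "(\<integral>\<^sup>+x. f (x + h) \<partial>lborel) = (\<integral>\<^sup>+x. f x \<partial>lborel)" "(\<integral>\<^sup>+x. f (x - h) \<partial>lborel) = (\<integral>\<^sup>+x. f x \<partial>lborel)"
  using lborel_affine_nn_integral[OF assms, of 1 h] lborel_affine_nn_integral[OF assms, of 1 "-h"]
  by (simp_all add: add.commute)

lemma lborel_translate_integrable:
  fixes f :: "'a::euclidean_space \<Rightarrow> 'b::{banach,second_countable_topology}"
  assumes "integrable lborel f"
  shows "integrable lborel (\<lambda>x. f (x - h))"
proof -
  have [measurable]: "f \<in> borel_measurable borel" using assms by auto
  show ?thesis
    using assms lborel_translate_nn_integral(2)[of "\<lambda>x. ennreal (norm (f x))" h]
    by (subst integrable_iff_bounded) (auto simp: integrable_iff_bounded)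
qed

lemma uniformly_continuous_support:
  fixes g :: "'a::euclidean_space \<Rightarrow> 'b::euclidean_space"
  assumes c: "continuous_on UNIV g" and r: "\<And>x. norm x > r \<Longrightarrow> g x = 0" and e: "e > 0"
  obtains d where "d > 0" "\<And>x y. norm (x - y) < d \<Longrightarrow> norm (g x - g y) < e"
proof -
  have "uniformly_continuous_on (cball 0 (r + 1)) g"
    by (intro compact_uniformly_continuous continuous_on_subset[OF c]) auto
  then obtain d where d: "d > 0" "\<And>x y. x \<in> cball 0 (r+1) \<Longrightarrow> y \<in> cball 0 (r+1) \<Longrightarrow> dist y x < d \<Longrightarrow> dist (g y) (g x) < e"
    unfolding uniformly_continuous_on_def using e by meson
  show thesis
  proof (rule that[of "min d 1"])
    show "min d 1 > 0" using d by simp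
    fix x y :: 'a assume xy: "norm (x - y) < min d 1"
    show "norm (g x - g y) < e"
    proof (cases "norm x \<le> r + 1 \<and> norm y \<le> r + 1")
      case True then show ?thesis using d(2)[of y x] xy by (auto simp: dist_norm)
    next
      case False
      have "norm x > r" "norm y > r" using False xy norm_triangle_ineq2[of x y] norm_triangle_ineq2[of y x]
        by (auto simp: norm_minus_commute)
      then show ?thesis using r e by simp
    qed
  qed
qed

lemma Cc_uniform:
  fixes g :: "'a::euclidean_space \<Rightarrow> real"
  assumes "Cc g" "e > 0"
  obtains d where "d > 0" "\<And>x y. norm (x - y) < d \<Longrightarrow> \<bar>g x - g y\<bar> < e"
proof -
  obtain r where r: "\<And>x. norm x > r \<Longrightarrow> g x = 0" and c: "continuous_on UNIV g" using assms(1) by (auto simp: Cc_def)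
  obtain d where "d > 0" "\<And>x y. norm (x - y) < d \<Longrightarrow> norm (g x - g y) < e"
    by (rule uniformly_continuous_support[OF c r assms(2)]) blast+
  then show thesis by (intro that[of d]) simp_all
qed

text \<open>A continuous function with compact support differs from its translates by a uniformly
  small amount on one fixed ball. Density transfers this to \<open>f\<close>; the approximation
  error of the translate equals that of \<open>f\<close> by translation invariance.\<close>

lemma L1_translation_continuous:
  fixes f :: "'a::euclidean_space \<Rightarrow> real"
  assumes f: "integrable lborel f" and e: "e > 0"
  obtains d where "d > 0" "\<And>h. norm h < d \<Longrightarrow> (LINT x|lborel. \<bar>f (x - h) - f x\<bar>) < e"
proof -
  obtain g where g: "Cc g" "(LINT x|lborel. \<bar>f x - g x\<bar>) < e/3" using Cc_dense_L1[OF f, of "e/3"] e by auto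
  note gi = Cc_integrable[OF g(1)]
  have [measurable]: "f \<in> borel_measurable borel" "g \<in> borel_measurable borel" using f gi by auto
  obtain r0 where r0: "\<And>x. norm x > r0 \<Longrightarrow> g x = 0" using g(1) unfolding Cc_def by auto
  define r where "r = max r0 1"
  have r: "r > 0" "\<And>x. norm x > r \<Longrightarrow> g x = 0" using r0 by (auto simp: r_def)
  define m where "m = measure lborel (cball (0::'a) (r + 1))"
  have m: "m \<ge> 0" by (simp add: m_def)
  obtain d where d: "d > 0" "\<And>x y. norm (x - y) < d \<Longrightarrow> \<bar>g x - g y\<bar> < e / (3 * (m + 1))"
    using Cc_uniform[OF g(1), of "e / (3 * (m + 1))"] e m by auto
  show thesis
  proof (rule that[of "min d 1"])
    show "min d 1 > 0" using d by simp
    fix h :: 'a assume h: "norm h < min d 1"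
    have "(LINT x|lborel. \<bar>g (x - h) - g x\<bar>) \<le> (LINT x|lborel. e / (3 * (m + 1)) * indicator (cball (0::'a) (r + 1)) x)"
    proof (rule Bochner_Integration.integral_mono)
      show "integrable lborel (\<lambda>x. \<bar>g (x - h) - g x\<bar>)"
        using gi lborel_translate_integrable[OF gi] by auto
      show "integrable lborel (\<lambda>x. e / (3 * (m + 1)) * indicator (cball (0::'a) (r + 1)) x)"
        using emeasure_bounded_finite[OF bounded_cball, of "0::'a" "r + 1"]
        by (intro integrable_mult_right integrable_real_indicator) auto
      fix x :: 'a
      show "\<bar>g (x - h) - g x\<bar> \<le> e / (3 * (m + 1)) * indicator (cball 0 (r + 1)) x"
      proof (cases "norm x \<le> r + 1")
        case True then show ?thesis using d(2)[of "x - h" x] h by (simp add: less_imp_le)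
      next
        case False
        then have "norm x > r" "norm (x - h) > r" using h norm_triangle_ineq2[of x h] by auto
        then show ?thesis using r(2) e m by (auto simp: indicator_def)
      qed
    qed
    also have "\<dots> = e / (3 * (m + 1)) * m" by (simp add: m_def)
    also have "\<dots> < e / 3" using e m by (simp add: field_simps)
    finally have 1: "(LINT x|lborel. \<bar>g (x - h) - g x\<bar>) < e/3" .
    have tf: "integrable lborel (\<lambda>x. f (x - h))" "integrable lborel (\<lambda>x. g (x - h))"
      using lborel_translate_integrable f gi by auto
    have 2: "(LINT x|lborel. \<bar>f (x - h) - g (x - h)\<bar>) = (LINT x|lborel. \<bar>f x - g x\<bar>)"
      using lborel_translate_integral[of "\<lambda>x. \<bar>f x - g x\<bar>" "-h"] by simp
    have "(LINT x|lborel. \<bar>f (x - h) - f x\<bar>) \<le> (LINT x|lborel. \<bar>f (x - h) - g (x - h)\<bar> + (\<bar>g (x - h) - g x\<bar> + \<bar>f x - g x\<bar>))"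
      using f gi tf by (intro Bochner_Integration.integral_mono) auto
    also have "\<dots> = (LINT x|lborel. \<bar>f (x - h) - g (x - h)\<bar>) + ((LINT x|lborel. \<bar>g (x - h) - g x\<bar>) + (LINT x|lborel. \<bar>f x - g x\<bar>))"
      using f gi tf by simp
    also have "\<dots> < e" using 1 2 g(2) by simp
    finally show "(LINT x|lborel. \<bar>f (x - h) - f x\<bar>) < e" .
  qed
qed

section \<open>Local integrability and convergence of mollifications\<close>

lemma integrable_mult_bounded:
  fixes f k :: "'a::euclidean_space \<Rightarrow> real"
  assumes "integrable lborel f" and [measurable]: "k \<in> borel_measurable borel" and "\<And>x. \<bar>k x\<bar> \<le> M"
  shows "integrable lborel (\<lambda>x. k x * f x)"
proof (rule Bochner_Integration.integrable_bound)
  show "integrable lborel (\<lambda>x. M * f x)" using assms(1) by simp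
  have [measurable]: "f \<in> borel_measurable borel" using assms(1) by auto
  show "(\<lambda>x. k x * f x) \<in> borel_measurable lborel" by simp
  show "AE x in lborel. norm (k x * f x) \<le> norm (M * f x)"
    using assms(3) by (auto simp: abs_mult intro!: mult_right_mono order_trans[OF assms(3) abs_ge_self])
qed

text \<open>The counterpart of \<open>locally_integrable\<close> for Borel functions and Lebesgue
  measure on Borel sets: Fubini's theorem and the measurability of parametric integrals are applied
  to Borel products, whereas the hypotheses refer to the completed measure.\<close>

definition loc_int :: "('a::euclidean_space \<Rightarrow> 'b::euclidean_space) \<Rightarrow> bool" where
  "loc_int f \<longleftrightarrow> f \<in> borel_measurable borel \<and> (\<forall>r. integrable lborel (\<lambda>x. indicator (cball 0 r) x *\<^sub>R f x))"

lemma loc_int_mult_continuous: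
  fixes f :: "'a::euclidean_space \<Rightarrow> 'b::euclidean_space"
  assumes f: "loc_int f" and k: "continuous_on UNIV k" "\<And>x. norm x > r \<Longrightarrow> k x = 0"
  shows "integrable lborel (\<lambda>x. k x *\<^sub>R f x)"
proof -
  obtain M where M: "\<And>x. norm (k x) \<le> M" using bounded_of_continuous_support[OF k] by metis
  have [measurable]: "k \<in> borel_measurable borel" by (rule borel_measurable_continuous_onI[OF k(1)])
  have [measurable]: "f \<in> borel_measurable borel" using f by (simp add: loc_int_def)
  show ?thesis
  proof (rule Bochner_Integration.integrable_bound)
    show "integrable lborel (\<lambda>x. M *\<^sub>R (indicator (cball 0 r) x *\<^sub>R f x))" using f unfolding loc_int_def by (intro integrable_scaleR_right) blast
    show "AE x in lborel. norm (k x *\<^sub>R f x) \<le> norm (M *\<^sub>R (indicator (cball 0 r) x *\<^sub>R f x))"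
    proof (rule AE_I2)
      fix x
      show "norm (k x *\<^sub>R f x) \<le> norm (M *\<^sub>R (indicator (cball 0 r) x *\<^sub>R f x))"
        using k(2)[of x] mult_right_mono[OF M[of x], of "norm (f x)"] order_trans[OF norm_ge_zero M[of x]]
        by (cases "norm x \<le> r") auto
    qed
  qed measurable
qed

lemma integrable_compact_mult:
  fixes f :: "'a::euclidean_space \<Rightarrow> real"
  assumes "loc_int f" "continuous_on UNIV k" "\<And>x. norm x > r \<Longrightarrow> k x = 0"
  shows "integrable lborel (\<lambda>x. k x * f x)"
  using loc_int_mult_continuous[OF assms] by simp

lemma kern_mult_integrable:
  fixes f :: "'a::euclidean_space \<Rightarrow> real"
  assumes f: "loc_int f" and "\<epsilon> > 0"
  shows "integrable lborel (\<lambda>x. kern \<epsilon> (y - x) * f x)"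
proof (rule integrable_compact_mult[OF f])
  show "continuous_on UNIV (\<lambda>x. kern \<epsilon> (y - x))"
    by (intro continuous_on_compose2[OF continuous_kern[of UNIV]] continuous_intros) auto
  fix x :: 'a assume "norm x > norm y + \<epsilon> * real DIM('a)"
  then have "norm (y - x) > \<epsilon> * real DIM('a)" using norm_triangle_ineq2[of x y] by (simp add: norm_minus_commute)
  then show "kern \<epsilon> (y - x) = 0" by (rule kern_support[OF assms(2)])
qed

lemma loc_int_integrable: "integrable lborel f \<Longrightarrow> loc_int f"
  unfolding loc_int_def by (auto intro!: integrable_mult_indicator)

definition moll :: "real \<Rightarrow> ('a::euclidean_space \<Rightarrow> real) \<Rightarrow> 'a \<Rightarrow> real" where
  "moll \<epsilon> f y = (LINT x|lborel. kern \<epsilon> (y - x) * f x)"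

lemma moll_eq:
  assumes [measurable]: "f \<in> borel_measurable borel"
  shows "moll \<epsilon> f y = (LINT z|lborel. kern \<epsilon> z * f (y - z))"
  using lborel_reflect_integral[of "\<lambda>x. kern \<epsilon> (y - x) * f x" y] by (simp add: moll_def)

lemma moll_measurable [measurable]:
  assumes [measurable]: "f \<in> borel_measurable borel"
  shows "moll \<epsilon> f \<in> borel_measurable borel"
  unfolding moll_def[abs_def] by measurable

lemma kern_nn_integral: "\<epsilon> > 0 \<Longrightarrow> (\<integral>\<^sup>+z. ennreal (kern \<epsilon> (z::'a::euclidean_space)) \<partial>lborel) = 1"
  using kern_integral[where 'a='a] kern_integrable[where 'a='a] kern_nonneg
  by (subst nn_integral_eq_integral) (auto intro!: AE_I2)

text \<open>The kernel has mass 1, so \<open>f y\<close> is itself a weighted mean of the constant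
  \<open>f y\<close>. The bound is a nonnegative integral, ready for Tonelli's theorem.\<close>

lemma moll_diff_le:
  fixes f :: "'a::euclidean_space \<Rightarrow> real"
  assumes f: "loc_int f" and e: "\<epsilon> > 0"
  shows "ennreal \<bar>moll \<epsilon> f y - f y\<bar> \<le> (\<integral>\<^sup>+z. ennreal (kern \<epsilon> z * \<bar>f (y - z) - f y\<bar>) \<partial>lborel)"
proof -
  have [measurable]: "f \<in> borel_measurable borel" using f by (simp add: loc_int_def)
  have i1: "integrable lborel (\<lambda>z. kern \<epsilon> z * f (y - z))"
  proof -
    have "integrable lborel (\<lambda>x. kern \<epsilon> (y - x) * f x)" by (rule kern_mult_integrable[OF f e])
    then have "integrable (distr lborel lborel (\<lambda>z. y - z)) (\<lambda>x. kern \<epsilon> (y - x) * f x)"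
      using lborel_affine[of "-1" y] by (simp add: density_1 cong: distr_cong)
    then show ?thesis by (subst (asm) integrable_distr_eq) auto
  qed
  have i2: "integrable lborel (\<lambda>z::'a. kern \<epsilon> z * f y)" using kern_integrable[OF e, where 'a='a] by simp
  have "moll \<epsilon> f y - f y = (LINT z|lborel. kern \<epsilon> z * f (y - z)) - (LINT z|lborel. kern \<epsilon> (z::'a) * f y)"
    using kern_integral[OF e, where 'a='a] by (simp add: moll_eq)
  also have "\<dots> = (LINT z|lborel. kern \<epsilon> z * (f (y - z) - f y))"
    using i1 i2 by (simp add: algebra_simps)
  finally have "ennreal \<bar>moll \<epsilon> f y - f y\<bar> = ennreal (norm (LINT z|lborel. kern \<epsilon> z * (f (y - z) - f y)))" by simp
  also have "\<dots> \<le> (\<integral>\<^sup>+z. ennreal (norm (kern \<epsilon> z * (f (y - z) - f y))) \<partial>lborel)"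
    by (rule integral_norm_bound_ennreal) (use i1 i2 in \<open>auto simp: algebra_simps\<close>)
  also have "\<dots> = (\<integral>\<^sup>+z. ennreal (kern \<epsilon> z * \<bar>f (y - z) - f y\<bar>) \<partial>lborel)"
    by (simp add: kern_nonneg[OF e] abs_mult)
  finally show ?thesis .
qed

text \<open>After an exchange of integrals the error is a mean, weighted by the kernel, of the L1
  distances between \<open>f\<close> and its translates.\<close>

lemma moll_L1:
  fixes f :: "'a::euclidean_space \<Rightarrow> real"
  assumes f: "integrable lborel f" and e: "e > 0"
  obtains d where "d > 0" "\<And>\<epsilon>. 0 < \<epsilon> \<Longrightarrow> \<epsilon> < d \<Longrightarrow> (\<integral>\<^sup>+y. ennreal \<bar>moll \<epsilon> f y - f y\<bar> \<partial>lborel) \<le> ennreal e"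
proof -
  have [measurable]: "f \<in> borel_measurable borel" using f by auto
  obtain d where d: "d > 0" "\<And>h. norm h < d \<Longrightarrow> (LINT x|lborel. \<bar>f (x - h) - f x\<bar>) < e"
    by (rule L1_translation_continuous[OF f e]) auto
  show thesis
  \<comment> \<open>For smaller \<open>\<epsilon>\<close> the support radius
    \<open>\<epsilon> * DIM('a)\<close> of the kernel stays below \<open>d\<close>.\<close>
  proof (rule that[of "d / (2 * real DIM('a))"])
    show "0 < d / (2 * real DIM('a))" using d by simp
    fix \<epsilon> :: real assume eps: "0 < \<epsilon>" "\<epsilon> < d / (2 * real DIM('a))"
    have kd: "ennreal (kern \<epsilon> z) * (\<integral>\<^sup>+y. ennreal \<bar>f (y - z) - f y\<bar> \<partial>lborel) \<le> ennreal (kern \<epsilon> z) * ennreal e" for z :: 'a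
    proof (cases "norm z > \<epsilon> * real DIM('a)")
      case True then show ?thesis using kern_support[OF eps(1), of z] by simp
    next
      case False
      have "\<epsilon> * real DIM('a) < d"
      proof -
        have "\<epsilon> * (2 * real DIM('a)) < d" using eps by (simp add: field_simps)
        moreover have "\<epsilon> * real DIM('a) > 0" using eps by simp
        ultimately show ?thesis by linarith
      qed
      then have "norm z < d" using False by simp
      have "integrable lborel (\<lambda>y. \<bar>f (y - z) - f y\<bar>)" using f lborel_translate_integrable[OF f] by simp
      then have "(\<integral>\<^sup>+y. ennreal \<bar>f (y - z) - f y\<bar> \<partial>lborel) \<le> ennreal e"
        using d(2)[OF \<open>norm z < d\<close>] by (subst nn_integral_eq_integral) (auto intro!: ennreal_leI)
      then show ?thesis by (intro mult_left_mono) auto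
    qed
    have "(\<integral>\<^sup>+y. ennreal \<bar>moll \<epsilon> f y - f y\<bar> \<partial>lborel) \<le> (\<integral>\<^sup>+y. \<integral>\<^sup>+z. ennreal (kern \<epsilon> z * \<bar>f (y - z) - f y\<bar>) \<partial>lborel \<partial>lborel)"
      by (intro nn_integral_mono moll_diff_le loc_int_integrable f eps)
    also have "\<dots> = (\<integral>\<^sup>+z. \<integral>\<^sup>+y. ennreal (kern \<epsilon> z * \<bar>f (y - z) - f y\<bar>) \<partial>lborel \<partial>lborel)"
      by (rule lborel_pair.Fubini') simp
    also have "\<dots> = (\<integral>\<^sup>+z. ennreal (kern \<epsilon> z) * \<integral>\<^sup>+y. ennreal \<bar>f (y - z) - f y\<bar> \<partial>lborel \<partial>lborel)"
      by (simp add: kern_nonneg[OF eps(1)] ennreal_mult nn_integral_cmult)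
    also have "\<dots> \<le> (\<integral>\<^sup>+z. ennreal (kern \<epsilon> (z::'a)) * ennreal e \<partial>lborel)"
      by (intro nn_integral_mono kd)
    also have "\<dots> = ennreal e"
      using kern_nn_integral[OF eps(1), where 'a='a] by (simp add: nn_integral_multc)
    finally show "(\<integral>\<^sup>+y. ennreal \<bar>moll \<epsilon> f y - f y\<bar> \<partial>lborel) \<le> ennreal e" .
  qed
qed

text \<open>Once \<open>\<epsilon> * DIM('a) < 1\<close>, the mollification on the ball of radius
  \<open>r\<close> sees \<open>f\<close> on the ball of radius \<open>r + 1\<close> only, where
  \<open>f\<close> may be replaced by an integrable function.\<close>

lemma moll_L1_loc:
  fixes f :: "'a::euclidean_space \<Rightarrow> real"
  assumes f: "loc_int f" and e: "e > 0"
  obtains d where "d > 0" "\<And>\<epsilon>. 0 < \<epsilon> \<Longrightarrow> \<epsilon> < d \<Longrightarrow>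
    (\<integral>\<^sup>+y. indicator (cball 0 r) y * ennreal \<bar>moll \<epsilon> f y - f y\<bar> \<partial>lborel) \<le> ennreal e"
proof -
  let ?f = "\<lambda>x. indicator (cball 0 (r + 1)) x * f x"
  have fi: "integrable lborel ?f" using f by (auto simp: loc_int_def)
  obtain d where d: "d > 0" "\<And>\<epsilon>. 0 < \<epsilon> \<Longrightarrow> \<epsilon> < d \<Longrightarrow> (\<integral>\<^sup>+y. ennreal \<bar>moll \<epsilon> ?f y - ?f y\<bar> \<partial>lborel) \<le> ennreal e"
    by (rule moll_L1[OF fi e]) auto
  show thesis
  proof (rule that[of "min d (1 / real DIM('a))"])
    show "0 < min d (1 / real DIM('a))" using d by simp
    fix \<epsilon> :: real assume eps: "0 < \<epsilon>" "\<epsilon> < min d (1 / real DIM('a))"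
    then have small: "\<epsilon> * real DIM('a) < 1" by (simp add: field_simps)
    have "moll \<epsilon> f y = moll \<epsilon> ?f y" if "norm y \<le> r" for y
      unfolding moll_def
    proof (rule Bochner_Integration.integral_cong[OF refl])
      fix x :: 'a
      show "kern \<epsilon> (y - x) * f x = kern \<epsilon> (y - x) * ?f x"
      proof (cases "norm x \<le> r + 1")
        case False
        then have "norm (y - x) > \<epsilon> * real DIM('a)"
          using that small norm_triangle_ineq2[of x y] by (simp add: norm_minus_commute)
        then show ?thesis using kern_support[OF eps(1), of "y - x"] by simp
      qed simp
    qed
    then have "(\<integral>\<^sup>+y. indicator (cball 0 r) y * ennreal \<bar>moll \<epsilon> f y - f y\<bar> \<partial>lborel) \<le> (\<integral>\<^sup>+y. ennreal \<bar>moll \<epsilon> ?f y - ?f y\<bar> \<partial>lborel)"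
      by (intro nn_integral_mono) (auto simp: indicator_def)
    also have "\<dots> \<le> ennreal e" using eps by (intro d(2)) auto
    finally show "(\<integral>\<^sup>+y. indicator (cball 0 r) y * ennreal \<bar>moll \<epsilon> f y - f y\<bar> \<partial>lborel) \<le> ennreal e" .
  qed
qed

text \<open>The fundamental lemma of the calculus of variations, with the translated mollifier
  kernels as test functions.\<close>

lemma moll_eq_0_imp_AE_0:
  fixes f :: "'a::euclidean_space \<Rightarrow> real"
  assumes f: "loc_int f" and 0: "\<And>\<epsilon> y. \<epsilon> > 0 \<Longrightarrow> moll \<epsilon> f y = 0"
  shows "AE x in lborel. f x = 0"
proof -
  have [measurable]: "f \<in> borel_measurable borel" using f by (simp add: loc_int_def)
  have "AE y in lborel. indicator (cball 0 (real n)) y * ennreal \<bar>f y\<bar> = 0" for n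
  proof -
    have le: "(\<integral>\<^sup>+y. indicator (cball 0 (real n)) y * ennreal \<bar>f y\<bar> \<partial>lborel) \<le> ennreal e" if epos: "e > 0" for e
    proof -
      obtain d where d: "d > 0" "\<And>\<epsilon>. 0 < \<epsilon> \<Longrightarrow> \<epsilon> < d \<Longrightarrow>
        (\<integral>\<^sup>+y. indicator (cball 0 (real n)) y * ennreal \<bar>moll \<epsilon> f y - f y\<bar> \<partial>lborel) \<le> ennreal e"
        by (rule moll_L1_loc[OF f epos, of "real n"]) blast
      show ?thesis using d(2)[of "d/2"] d(1) 0[of "d/2"] by simp
    qed
    have "(\<integral>\<^sup>+y. indicator (cball 0 (real n)) y * ennreal \<bar>f y\<bar> \<partial>lborel) \<le> 0"
      by (rule ennreal_le_epsilon, unfold add_0_left, rule le)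
    moreover have "(\<lambda>y. indicator (cball 0 (real n)) y * ennreal \<bar>f y\<bar>) \<in> borel_measurable lborel"
      by (auto intro!: borel_measurable_times_ennreal borel_measurable_indicator)
    ultimately show ?thesis by (simp add: nn_integral_0_iff_AE)
  qed
  then have "AE y in lborel. \<forall>n. indicator (cball 0 (real n)) y * ennreal \<bar>f y\<bar> = 0" by (simp only: AE_all_countable) blast
  then show ?thesis
  proof eventually_elim
    case (elim y)
    obtain n where "norm y \<le> real n" using real_arch_simple by blast
    then show ?case using elim[rule_format, of n] by simp
  qed
qed

section \<open>Continuity of translations in Lp\<close>

lemma powr_sum3_le:
  fixes a b c p :: real
  assumes "a \<ge> 0" "b \<ge> 0" "c \<ge> 0" "p > 0"
  shows "(a + b + c) powr p \<le> 3 powr p * (a powr p + b powr p + c powr p)"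
proof -
  let ?m = "max a (max b c)"
  have "(a + b + c) powr p \<le> (3 * ?m) powr p" using assms by (intro powr_mono2) auto
  also have "\<dots> = 3 powr p * ?m powr p" using assms by (simp add: powr_mult)
  also have "?m powr p \<le> a powr p + b powr p + c powr p"
    by (auto simp: max_def)
  finally show ?thesis by simp
qed

text \<open>Discarding the values of modulus below \<open>1 / M\<close> or above \<open>M\<close>
  loses little in the p-norm. The lower bound makes the truncation integrable and the upper bound
  makes it bounded; p-th powers of its differences are then dominated by the differences themselves,
  and the case of exponent 1 applies.\<close>

lemma Lp_translation_continuous:
  fixes u :: "'a::euclidean_space \<Rightarrow> real"
  assumes [measurable]: "u \<in> borel_measurable borel" and u: "integrable lborel (\<lambda>x. \<bar>u x\<bar> powr p)"
    and p: "p > 1" and e: "e > 0"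
  obtains d where "d > 0" "\<And>h. norm h < d \<Longrightarrow> (\<integral>\<^sup>+x. ennreal (\<bar>u (x - h) - u x\<bar> powr p) \<partial>lborel) \<le> ennreal e"
proof -
  define v where "v M x = (if 1 / real M \<le> \<bar>u x\<bar> \<and> \<bar>u x\<bar> \<le> real M then u x else 0)" for M x
  have [measurable]: "v M \<in> borel_measurable borel" for M unfolding v_def[abs_def] by measurable
  have "(\<lambda>M. LINT x|lborel. \<bar>u x - v M x\<bar> powr p) \<longlonglongrightarrow> (LINT x|(lborel::'a measure). 0)"
  proof (rule integral_dominated_convergence[where w="\<lambda>x. \<bar>u x\<bar> powr p"])
    show "AE x in lborel. (\<lambda>M. \<bar>u x - v M x\<bar> powr p) \<longlonglongrightarrow> 0"
    proof (rule AE_I2, rule tendsto_eventually)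
      fix x
      show "\<forall>\<^sub>F M in sequentially. \<bar>u x - v M x\<bar> powr p = 0"
      proof (cases "u x = 0")
        case False
        obtain M where M: "real M \<ge> max \<bar>u x\<bar> (1 / \<bar>u x\<bar>)" using real_arch_simple by blast
        have "\<bar>u x - v m x\<bar> powr p = 0" if "m \<ge> M" for m
        proof -
          have "real m \<ge> \<bar>u x\<bar>" "real m \<ge> 1 / \<bar>u x\<bar>" using M that by auto
          moreover then have "1 / real m \<le> \<bar>u x\<bar>" using False by (simp add: field_simps)
          ultimately show ?thesis by (simp add: v_def)
        qed
        then show ?thesis by (auto simp: eventually_sequentially)
      qed (simp add: v_def)
    qed
    show "AE x in lborel. norm (\<bar>u x - v M x\<bar> powr p) \<le> \<bar>u x\<bar> powr p" for M
      using p by (auto simp: v_def)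
  qed (use u in auto)
  then have "(\<lambda>M. LINT x|lborel. \<bar>u x - v M x\<bar> powr p) \<longlonglongrightarrow> 0" by simp
  \<comment> \<open>Three error terms of size at most \<open>\<delta>\<close>, times the constant
    \<open>3 powr p\<close> of the inequality for three summands, add up to
    \<open>e\<close>.\<close>
  define \<delta> where "\<delta> = e / (3 * 3 powr p)"
  have \<delta>: "\<delta> > 0" using e by (simp add: \<delta>_def)
  obtain M where M: "M > 0" "(LINT x|lborel. \<bar>u x - v M x\<bar> powr p) < \<delta>"
  proof -
    have "\<forall>\<^sub>F M in sequentially. (LINT x|lborel. \<bar>u x - v M x\<bar> powr p) < \<delta> \<and> M > 0"
      using order_tendstoD(2)[OF \<open>_ \<longlonglongrightarrow> 0\<close> \<delta>] eventually_gt_at_top[of 0] by eventually_elim auto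
    then show thesis using that by (auto simp: eventually_sequentially)
  qed
  let ?v = "v M"
  have vM: "\<bar>?v x\<bar> \<le> real M" for x by (auto simp: v_def)
  have vi: "integrable lborel ?v"
  proof (rule Bochner_Integration.integrable_bound)
    show "integrable lborel (\<lambda>x. real M powr (p - 1) * \<bar>u x\<bar> powr p)" using u by simp
    have "\<bar>u x\<bar> \<le> real M powr (p - 1) * \<bar>u x\<bar> powr p" if "1 / real M \<le> \<bar>u x\<bar>" for x
    proof -
      have "1 \<le> real M * \<bar>u x\<bar>" using that M(1) by (simp add: field_simps)
      then have "1 \<le> (real M * \<bar>u x\<bar>) powr (p - 1)" using p by (intro ge_one_powr_ge_zero) auto
      then have "\<bar>u x\<bar> * 1 \<le> \<bar>u x\<bar> * (real M * \<bar>u x\<bar>) powr (p - 1)" by (intro mult_left_mono) auto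
      also have "\<dots> = real M powr (p - 1) * (\<bar>u x\<bar> powr 1 * \<bar>u x\<bar> powr (p - 1))" by (simp add: powr_mult)
      also have "\<bar>u x\<bar> powr 1 * \<bar>u x\<bar> powr (p - 1) = \<bar>u x\<bar> powr p" by (simp only: powr_add[symmetric]) simp
      finally show ?thesis by simp
    qed
    then show "AE x in lborel. norm (?v x) \<le> norm (real M powr (p - 1) * \<bar>u x\<bar> powr p)"
      by (auto simp: v_def abs_mult)
  qed simp
  define \<delta>' where "\<delta>' = \<delta> / (2 * real M) powr (p - 1)"
  have \<delta>': "\<delta>' > 0" using \<delta> M(1) by (simp add: \<delta>'_def)
  obtain d where d: "d > 0" "\<And>h. norm h < d \<Longrightarrow> (LINT x|lborel. \<bar>?v (x - h) - ?v x\<bar>) < \<delta>'"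
    by (rule L1_translation_continuous[OF vi \<delta>']) auto
  show thesis
  proof (rule that[OF d(1)])
    fix h :: 'a assume h: "norm h < d"
    have uv: "(\<integral>\<^sup>+x. ennreal (\<bar>u x - ?v x\<bar> powr p) \<partial>lborel) \<le> ennreal \<delta>"
    proof (subst nn_integral_eq_integral)
      show "integrable lborel (\<lambda>x. \<bar>u x - ?v x\<bar> powr p)"
        by (rule Bochner_Integration.integrable_bound[OF u]) (use p in \<open>auto simp: v_def\<close>)
    qed (use M in \<open>auto intro!: ennreal_leI\<close>)
    have uv': "(\<integral>\<^sup>+x. ennreal (\<bar>u (x - h) - ?v (x - h)\<bar> powr p) \<partial>lborel) \<le> ennreal \<delta>"
      using uv lborel_translate_nn_integral(2)[of "\<lambda>x. ennreal (\<bar>u x - ?v x\<bar> powr p)" h] by simp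
    have pw: "\<bar>?v (x - h) - ?v x\<bar> powr p \<le> (2 * real M) powr (p - 1) * \<bar>?v (x - h) - ?v x\<bar>" for x
    proof -
      have "\<bar>?v (x - h) - ?v x\<bar> powr p = \<bar>?v (x - h) - ?v x\<bar> powr (p - 1) * \<bar>?v (x - h) - ?v x\<bar> powr 1"
        by (simp only: powr_add[symmetric]) simp
      also have "\<dots> \<le> (2 * real M) powr (p - 1) * \<bar>?v (x - h) - ?v x\<bar>"
        using vM[of x] vM[of "x - h"] p by (intro mult_mono powr_mono2) auto
      finally show ?thesis .
    qed
    have vv: "(\<integral>\<^sup>+x. ennreal (\<bar>?v (x - h) - ?v x\<bar> powr p) \<partial>lborel) \<le> ennreal \<delta>"
    proof -
      have "(\<integral>\<^sup>+x. ennreal (\<bar>?v (x - h) - ?v x\<bar> powr p) \<partial>lborel) \<le> (\<integral>\<^sup>+x. ennreal ((2 * real M) powr (p - 1) * \<bar>?v (x - h) - ?v x\<bar>) \<partial>lborel)"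
        by (intro nn_integral_mono ennreal_leI pw)
      also have "\<dots> = ennreal ((2 * real M) powr (p - 1) * (LINT x|lborel. \<bar>?v (x - h) - ?v x\<bar>))"
        using vi lborel_translate_integrable[OF vi] by (subst nn_integral_eq_integral) auto
      also have "\<dots> \<le> ennreal ((2 * real M) powr (p - 1) * \<delta>')"
        using d(2)[OF h] by (intro ennreal_leI mult_left_mono) auto
      also have "(2 * real M) powr (p - 1) * \<delta>' = \<delta>" using M(1) by (simp add: \<delta>'_def)
      finally show ?thesis .
    qed
    have "(\<integral>\<^sup>+x. ennreal (\<bar>u (x - h) - u x\<bar> powr p) \<partial>lborel) \<le>
      (\<integral>\<^sup>+x. ennreal (3 powr p) * (ennreal (\<bar>u (x - h) - ?v (x - h)\<bar> powr p) + (ennreal (\<bar>?v (x - h) - ?v x\<bar> powr p) + ennreal (\<bar>u x - ?v x\<bar> powr p))) \<partial>lborel)"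
    proof (rule nn_integral_mono)
      fix x
      have "\<bar>u (x - h) - u x\<bar> powr p \<le> (\<bar>u (x - h) - ?v (x - h)\<bar> + \<bar>?v (x - h) - ?v x\<bar> + \<bar>u x - ?v x\<bar>) powr p"
        using p by (intro powr_mono2) auto
      also have "\<dots> \<le> 3 powr p * (\<bar>u (x - h) - ?v (x - h)\<bar> powr p + \<bar>?v (x - h) - ?v x\<bar> powr p + \<bar>u x - ?v x\<bar> powr p)"
        using p by (intro powr_sum3_le) auto
      finally show "ennreal (\<bar>u (x - h) - u x\<bar> powr p) \<le> ennreal (3 powr p) * (ennreal (\<bar>u (x - h) - ?v (x - h)\<bar> powr p) + (ennreal (\<bar>?v (x - h) - ?v x\<bar> powr p) + ennreal (\<bar>u x - ?v x\<bar> powr p)))"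
        by (simp flip: ennreal_mult ennreal_plus) (simp add: ennreal_leI add.assoc)
    qed
    also have "\<dots> = ennreal (3 powr p) * ((\<integral>\<^sup>+x. ennreal (\<bar>u (x - h) - ?v (x - h)\<bar> powr p) \<partial>lborel) +
        ((\<integral>\<^sup>+x. ennreal (\<bar>?v (x - h) - ?v x\<bar> powr p) \<partial>lborel) + (\<integral>\<^sup>+x. ennreal (\<bar>u x - ?v x\<bar> powr p) \<partial>lborel)))"
      by (simp add: nn_integral_cmult nn_integral_add)
    also have "\<dots> \<le> ennreal (3 powr p) * (ennreal \<delta> + (ennreal \<delta> + ennreal \<delta>))"
      by (intro mult_left_mono add_mono uv uv' vv) auto
    also have "\<dots> = ennreal e"
      using \<delta> by (simp add: \<delta>_def flip: ennreal_mult ennreal_plus)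
    finally show "(\<integral>\<^sup>+x. ennreal (\<bar>u (x - h) - u x\<bar> powr p) \<partial>lborel) \<le> ennreal e" .
  qed
qed

section \<open>Convolutions and weak partial derivatives\<close>

text \<open>The gradient is an explicit parameter, so that product rule and integration by parts are
  statements about given functions and not about the description operator in
  \<open>grad\<close>.\<close>

definition C1 :: "('a::euclidean_space \<Rightarrow> real) \<Rightarrow> ('a \<Rightarrow> 'a) \<Rightarrow> bool" where
  "C1 w w' \<longleftrightarrow> (\<forall>x. GDERIV w x :> w' x) \<and> continuous_on UNIV w'"

definition C1c :: "('a::euclidean_space \<Rightarrow> real) \<Rightarrow> ('a \<Rightarrow> 'a) \<Rightarrow> bool" where
  "C1c w w' \<longleftrightarrow> C1 w w' \<and> (\<exists>r. \<forall>x. norm x > r \<longrightarrow> w x = 0 \<and> w' x = 0)"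

lemma C1_continuous: "C1 w w' \<Longrightarrow> continuous_on S w"
  unfolding C1_def gderiv_def by (intro continuous_at_imp_continuous_on ballI) (blast intro: has_derivative_continuous)

lemma C1_mult:
  assumes "C1 v v'" "C1 w w'" shows "C1 (\<lambda>x. v x * w x) (\<lambda>x. v x *\<^sub>R w' x + w x *\<^sub>R v' x)"
proof -
  have "GDERIV (\<lambda>x. v x * w x) x :> v x *\<^sub>R w' x + w x *\<^sub>R v' x" for x
    using assms unfolding C1_def by (intro GDERIV_mult) auto
  moreover have "continuous_on UNIV (\<lambda>x. v x *\<^sub>R w' x + w x *\<^sub>R v' x)"
    using assms C1_continuous[of v v' UNIV] C1_continuous[of w w' UNIV] unfolding C1_def by (intro continuous_intros) auto
  ultimately show ?thesis by (simp add: C1_def)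
qed

lemma C1c_mult:
  assumes "C1c v v'" "C1 w w'" shows "C1c (\<lambda>x. v x * w x) (\<lambda>x. v x *\<^sub>R w' x + w x *\<^sub>R v' x)"
  using assms C1_mult[of v v' w w'] unfolding C1c_def by fastforce

lemma C1c_kern: assumes "\<epsilon> > 0" shows "C1c (kern \<epsilon>) (gkern \<epsilon> :: 'a::euclidean_space \<Rightarrow> 'a)"
  unfolding C1c_def C1_def
  using kern_gderiv[OF assms, where 'a='a] continuous_gkern[where 'a='a]
    kern_support[OF assms, where 'a='a] gkern_support[OF assms, where 'a='a] by blast

lemma integrable_compact_mult_vector:
  fixes f :: "'a::euclidean_space \<Rightarrow> real" and k :: "'a \<Rightarrow> 'b::euclidean_space"
  assumes f: "loc_int f" and k: "continuous_on UNIV k" "\<And>x. norm x > r \<Longrightarrow> k x = 0"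
  shows "integrable lborel (\<lambda>x. f x *\<^sub>R k x)"
proof -
  obtain M where M: "\<And>x. norm (k x) \<le> M" using bounded_of_continuous_support[OF k] by metis
  show ?thesis
  proof (rule Bochner_Integration.integrable_bound)
  show "integrable lborel (\<lambda>x. M * (indicator (cball 0 r) x * f x))" using f by (simp add: loc_int_def)
  have [measurable]: "f \<in> borel_measurable borel" "k \<in> borel_measurable borel"
    using f k(1) by (auto simp: loc_int_def borel_measurable_continuous_onI)
  show "(\<lambda>x. f x *\<^sub>R k x) \<in> borel_measurable lborel" by simp
  have "norm (f x *\<^sub>R k x) \<le> norm (M * (indicator (cball 0 r) x * f x))" for x
  proof (cases "norm x > r")
    case False
    have "norm (k x) \<le> \<bar>M\<bar>" using M[of x] by simp
    then have "\<bar>f x\<bar> * norm (k x) \<le> \<bar>f x\<bar> * \<bar>M\<bar>" by (intro mult_left_mono) auto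
    then show ?thesis using False by (simp add: abs_mult mult.commute)
  qed (simp add: k(2))
  then show "AE x in lborel. norm (f x *\<^sub>R k x) \<le> norm (M * (indicator (cball 0 r) x * f x))" by simp
  qed
qed

section \<open>Convolution with continuous and differentiable kernels\<close>

lemma reflected_support:
  fixes k :: "'a::euclidean_space \<Rightarrow> 'b::euclidean_space"
  assumes "continuous_on UNIV k" "\<And>x. norm x > r \<Longrightarrow> k x = 0"
  shows "continuous_on UNIV (\<lambda>x. k (y - x))" "\<And>x. norm x > norm y + r \<Longrightarrow> k (y - x) = 0"
proof -
  show "continuous_on UNIV (\<lambda>x. k (y - x))"
    by (intro continuous_on_compose2[OF assms(1)] continuous_intros) auto
  fix x :: 'a assume "norm x > norm y + r"
  then have "norm (y - x) > r" using norm_triangle_ineq2[of x y] by (simp add: norm_minus_commute)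
  then show "k (y - x) = 0" by (rule assms)
qed

text \<open>A compactly supported continuous kernel is uniformly continuous, and moving
  \<open>y\<close> by less than 1 involves \<open>f\<close> on one fixed ball only.\<close>

lemma conv_continuous:
  fixes f :: "'a::euclidean_space \<Rightarrow> real" and k :: "'a \<Rightarrow> 'b::euclidean_space"
  assumes f: "loc_int f" and k: "continuous_on UNIV k" "\<And>x. norm x > r \<Longrightarrow> k x = 0"
  shows "continuous_on UNIV (\<lambda>y. LINT x|lborel. f x *\<^sub>R k (y - x))"
proof (simp only: continuous_on_iff, intro ballI allI impI)
  fix y :: 'a and e :: real assume e: "e > 0"
  define F where "F = (LINT x|lborel. \<bar>indicator (cball 0 (norm y + r + 1)) x * f x\<bar>)"
  have F: "F \<ge> 0" by (simp add: F_def)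
  have Fi: "integrable lborel (\<lambda>x. \<bar>indicator (cball 0 (norm y + r + 1)) x * f x\<bar>)"
    using f by (auto simp: loc_int_def)
  \<comment> \<open>Dividing by \<open>F + 1\<close> instead of \<open>F\<close> covers the case
    that \<open>f\<close> vanishes on the ball.\<close>
  obtain d where d: "d > 0" "\<And>x y. norm (x - y) < d \<Longrightarrow> norm (k x - k y) < e / (F + 1)"
  proof (rule uniformly_continuous_support[OF k])
    show "e / (F + 1) > 0" using e F by simp
  qed blast+
  show "\<exists>d>0. \<forall>x'\<in>UNIV. dist x' y < d \<longrightarrow> dist (LINT x|lborel. f x *\<^sub>R k (x' - x)) (LINT x|lborel. f x *\<^sub>R k (y - x)) < e"
  proof (intro exI[of _ "min d 1"] conjI ballI impI)
    show "min d 1 > 0" using d by simp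
    fix x' assume x': "dist x' y < min d 1"
    have i: "integrable lborel (\<lambda>x. f x *\<^sub>R k (z - x))" for z
      by (rule integrable_compact_mult_vector[OF f reflected_support(1)[OF k] reflected_support(2)[OF k]])
    have "norm ((LINT x|lborel. f x *\<^sub>R k (x' - x)) - (LINT x|lborel. f x *\<^sub>R k (y - x)))
      = norm (LINT x|lborel. f x *\<^sub>R (k (x' - x) - k (y - x)))"
      using i by (simp add: scaleR_diff_right)
    also have "\<dots> \<le> (LINT x|lborel. e / (F + 1) * \<bar>indicator (cball 0 (norm y + r + 1)) x * f x\<bar>)"
    proof (rule Bochner_Integration.integral_norm_bound_integral)
      show "integrable lborel (\<lambda>x. f x *\<^sub>R (k (x' - x) - k (y - x)))"
        using i by (simp add: scaleR_diff_right)
      show "integrable lborel (\<lambda>x. e / (F + 1) * \<bar>indicator (cball 0 (norm y + r + 1)) x * f x\<bar>)" using Fi by simp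
      fix x
      show "norm (f x *\<^sub>R (k (x' - x) - k (y - x))) \<le> e / (F + 1) * \<bar>indicator (cball 0 (norm y + r + 1)) x * f x\<bar>"
      proof (cases "norm x \<le> norm y + r + 1")
        case True
        have "norm (k (x' - x) - k (y - x)) < e / (F + 1)" by (rule d(2)) (use x' in \<open>simp add: dist_norm\<close>)
        then have "norm (k (x' - x) - k (y - x)) * \<bar>f x\<bar> \<le> e / (F + 1) * \<bar>f x\<bar>" by (intro mult_right_mono) auto
        then show ?thesis using True by (simp add: mult.commute)
      next
        case False
        have "norm x' \<le> norm y + 1" using x' norm_triangle_ineq2[of x' y] by (simp add: dist_norm)
        then have "k (x' - x) = 0" "k (y - x) = 0"
          using False by (auto intro!: reflected_support(2)[OF k])
        then show ?thesis using e F by simp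
      qed
    qed
    also have "\<dots> = e / (F + 1) * F" by (simp add: F_def)
    also have "\<dots> < e" using e F by (simp add: field_simps)
    finally show "dist (LINT x|lborel. f x *\<^sub>R k (x' - x)) (LINT x|lborel. f x *\<^sub>R k (y - x)) < e" by (simp add: dist_norm)
  qed
qed

text \<open>Differentiation under the integral sign: uniform continuity of \<open>k'\<close> makes
  the error of the linearisation of \<open>k\<close> a small multiple of \<open>norm h\<close>,
  uniformly in the base point.\<close>

lemma conv_gderiv:
  fixes f :: "'a::euclidean_space \<Rightarrow> real"
  assumes f: "loc_int f" and k: "C1c k k'"
  shows "GDERIV (\<lambda>y. LINT x|lborel. k (y - x) * f x) y :> (LINT x|lborel. f x *\<^sub>R k' (y - x))"
proof -
  obtain r where r: "\<And>x. norm x > r \<Longrightarrow> k x = 0" "\<And>x. norm x > r \<Longrightarrow> k' x = 0"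
    using k unfolding C1c_def by auto
  have c: "continuous_on UNIV k" "continuous_on UNIV k'" using k C1_continuous unfolding C1c_def C1_def by auto
  have i: "integrable lborel (\<lambda>x. k (z - x) * f x)" for z
    by (rule integrable_compact_mult[OF f reflected_support(1)[OF c(1) r(1)] reflected_support(2)[OF c(1) r(1)]])
  have i': "integrable lborel (\<lambda>x. f x *\<^sub>R k' (z - x))" for z
    by (rule integrable_compact_mult_vector[OF f reflected_support(1)[OF c(2) r(2)] reflected_support(2)[OF c(2) r(2)]])
  define F where "F = (LINT x|lborel. \<bar>indicator (cball 0 (norm y + r + 1)) x * f x\<bar>)"
  have F: "F \<ge> 0" by (simp add: F_def)
  have Fi: "integrable lborel (\<lambda>x. \<bar>indicator (cball 0 (norm y + r + 1)) x * f x\<bar>)"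
    using f by (auto simp: loc_int_def)
  show ?thesis
    unfolding gderiv_def has_derivative_at_alt
  proof (intro conjI allI impI)
    show "bounded_linear (\<lambda>h. h \<bullet> (LINT x|lborel. f x *\<^sub>R k' (y - x)))" by (rule bounded_linear_inner_left)
    fix e :: real assume e: "e > 0"
    obtain d where d: "d > 0" "\<And>x y. norm (x - y) < d \<Longrightarrow> norm (k' x - k' y) < e / (F + 1)"
    proof (rule uniformly_continuous_support[OF c(2) r(2)])
      show "e / (F + 1) > 0" using e F by simp
    qed blast+
    have kd: "\<bar>k (z + h) - k z - h \<bullet> k' z\<bar> \<le> norm h * (e / (F + 1))" if h: "norm h < d" for z h
    proof -
      have "norm (k (z + h) - k z - (z + h - z) \<bullet> k' z) \<le> norm (z + h - z) * (e / (F + 1))"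
      proof (rule differentiable_bound_linearization[where f'="\<lambda>x h. h \<bullet> k' x" and S="ball z d" and a=z and b="z + h"])
        show "z + t *\<^sub>R (z + h - z) \<in> ball z d" if "t \<in> {0..1}" for t
        proof -
          have "\<bar>t\<bar> * norm h \<le> 1 * norm h" using that by (intro mult_right_mono) auto
          then show ?thesis using h by (simp add: dist_norm)
        qed
        show "(k has_derivative (\<lambda>h. h \<bullet> k' x)) (at x within ball z d)" for x
          using k unfolding C1c_def C1_def gderiv_def by (auto intro: has_derivative_at_withinI)
        show "onorm ((\<lambda>h. h \<bullet> k' x) - (\<lambda>h. h \<bullet> k' z)) \<le> e / (F + 1)" if "x \<in> ball z d" for x
        proof (rule onorm_bound)
          show "0 \<le> e / (F + 1)" using e F by simp
          fix v :: 'a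
          have "norm (k' x - k' z) < e / (F + 1)" using that by (intro d(2)) (simp add: dist_norm norm_minus_commute)
          then have "norm v * norm (k' x - k' z) \<le> norm v * (e / (F + 1))"
            by (intro mult_left_mono) auto
          with Cauchy_Schwarz_ineq2[of v "k' x - k' z"]
          have "\<bar>v \<bullet> (k' x - k' z)\<bar> \<le> norm v * (e / (F + 1))" by linarith
          then show "norm (((\<lambda>h. h \<bullet> k' x) - (\<lambda>h. h \<bullet> k' z)) v) \<le> e / (F + 1) * norm v"
            by (simp add: inner_diff_right mult.commute)
        qed
        show "z \<in> ball z d" using d by simp
      qed
      then show ?thesis by simp
    qed
    show "\<exists>d>0. \<forall>y'. norm (y' - y) < d \<longrightarrow> norm ((LINT x|lborel. k (y' - x) * f x) - (LINT x|lborel. k (y - x) * f x) - (y' - y) \<bullet> (LINT x|lborel. f x *\<^sub>R k' (y - x))) \<le> e * norm (y' - y)"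
    proof (intro exI[of _ "min d 1"] conjI allI impI)
      show "min d 1 > 0" using d by simp
      fix y' assume y': "norm (y' - y) < min d 1"
      define h where "h = y' - y"
      have hy: "y' - x = (y - x) + h" for x by (simp add: h_def)
      have "(y' - y) \<bullet> (LINT x|lborel. f x *\<^sub>R k' (y - x)) = (LINT x|lborel. h \<bullet> (f x *\<^sub>R k' (y - x)))"
        unfolding h_def by (rule integral_inner_right[symmetric]) (rule i')
      then have "norm ((LINT x|lborel. k (y' - x) * f x) - (LINT x|lborel. k (y - x) * f x) - (y' - y) \<bullet> (LINT x|lborel. f x *\<^sub>R k' (y - x)))
        = norm ((LINT x|lborel. k (y' - x) * f x) - (LINT x|lborel. k (y - x) * f x) - (LINT x|lborel. h \<bullet> (f x *\<^sub>R k' (y - x))))" by simp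
      also have "\<dots> = norm (LINT x|lborel. k (y' - x) * f x - k (y - x) * f x - h \<bullet> (f x *\<^sub>R k' (y - x)))"
        using i i' integrable_inner_right[of h lborel "\<lambda>x. f x *\<^sub>R k' (y - x)"] by simp
      also have "\<dots> \<le> (LINT x|lborel. (norm h * (e / (F + 1))) * \<bar>indicator (cball 0 (norm y + r + 1)) x * f x\<bar>)"
      proof (rule Bochner_Integration.integral_norm_bound_integral)
        show "integrable lborel (\<lambda>x. k (y' - x) * f x - k (y - x) * f x - h \<bullet> (f x *\<^sub>R k' (y - x)))"
          by (intro Bochner_Integration.integrable_diff i integrable_inner_right i')
        show "integrable lborel (\<lambda>x. norm h * (e / (F + 1)) * \<bar>indicator (cball 0 (norm y + r + 1)) x * f x\<bar>)" using Fi by simp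
        fix x
        show "norm (k (y' - x) * f x - k (y - x) * f x - h \<bullet> (f x *\<^sub>R k' (y - x))) \<le> norm h * (e / (F + 1)) * \<bar>indicator (cball 0 (norm y + r + 1)) x * f x\<bar>"
        proof (cases "norm x \<le> norm y + r + 1")
          case True
          have "norm (k (y' - x) * f x - k (y - x) * f x - h \<bullet> (f x *\<^sub>R k' (y - x))) = \<bar>k ((y - x) + h) - k (y - x) - h \<bullet> k' (y - x)\<bar> * \<bar>f x\<bar>"
            unfolding abs_mult[symmetric] hy by (simp add: algebra_simps)
          also have "\<dots> \<le> norm h * (e / (F + 1)) * \<bar>f x\<bar>"
            by (intro mult_right_mono kd) (use y' in \<open>auto simp: h_def\<close>)
          finally show ?thesis using True by simp
        next
          case False
          have "norm y' \<le> norm y + 1" using y' norm_triangle_ineq2[of y' y] by simp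
          then have "k (y' - x) = 0" "k (y - x) = 0" "k' (y - x) = 0"
            using False by (auto intro!: reflected_support(2)[OF c(1) r(1)] reflected_support(2)[OF c(2) r(2)])
          then show ?thesis using e F by simp
        qed
      qed
      also have "\<dots> = norm h * (e / (F + 1)) * F" by (simp add: F_def)
      also have "\<dots> \<le> e * norm (y' - y)"
      proof -
        have "e / (F + 1) * F \<le> e" using e F by (simp add: field_simps)
        then have "norm h * (e / (F + 1) * F) \<le> norm h * e" by (intro mult_left_mono) auto
        then show ?thesis by (simp add: h_def mult.assoc mult.commute)
      qed
      finally show "norm ((LINT x|lborel. k (y' - x) * f x) - (LINT x|lborel. k (y - x) * f x) - (y' - y) \<bullet> (LINT x|lborel. f x *\<^sub>R k' (y - x))) \<le> e * norm (y' - y)" .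
    qed
  qed
qed

lemma loc_int_continuous:
  fixes f :: "'a::euclidean_space \<Rightarrow> 'b::euclidean_space"
  assumes "continuous_on UNIV f" shows "loc_int f"
  unfolding loc_int_def
  by (auto intro!: borel_measurable_continuous_onI assms borel_integrable_compact continuous_on_subset[OF assms])

text \<open>The convolution of \<open>w\<close> with the constant 1 does not depend on the point,
  and its gradient is the integral of \<open>w'\<close>. This takes the place of integration along
  lines.\<close>

lemma C1c_integral_gradient:
  assumes w: "C1c w (w' :: 'a::euclidean_space \<Rightarrow> 'a)" shows "(LINT x|lborel. w' x) = 0"
proof -
  have c: "continuous_on UNIV w" "continuous_on UNIV w'" using w C1_continuous unfolding C1c_def C1_def by auto
  have [measurable]: "w \<in> borel_measurable borel" "w' \<in> borel_measurable borel" using c by (auto simp: borel_measurable_continuous_onI)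
  have "GDERIV (\<lambda>y. LINT x|lborel. w (y - x) * 1) 0 :> (LINT x|lborel. 1 *\<^sub>R w' (0 - x))"
    by (rule conv_gderiv[OF loc_int_continuous w]) auto
  moreover have "(LINT x|lborel. w (y - x)) = (LINT x|lborel. w x)" for y by (rule lborel_reflect_integral) simp
  ultimately have "GDERIV (\<lambda>y::'a. LINT x|lborel. w x) 0 :> (LINT x|lborel. w' (0 - x))" by simp
  moreover have "GDERIV (\<lambda>y::'a. LINT x|lborel. w x) 0 :> 0" by (rule GDERIV_const)
  ultimately have "(LINT x|lborel. w' (0 - x)) = 0" by (rule gderiv_unique)
  then show ?thesis using lborel_reflect_integral[of w' 0] by simp
qed

definition gmoll :: "real \<Rightarrow> ('a::euclidean_space \<Rightarrow> real) \<Rightarrow> 'a \<Rightarrow> 'a" where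
  "gmoll \<epsilon> f y = (LINT x|lborel. f x *\<^sub>R gkern \<epsilon> (y - x))"

lemma C1_moll:
  assumes "loc_int f" "\<epsilon> > 0" shows "C1 (moll \<epsilon> f) (gmoll \<epsilon> f)"
  unfolding C1_def
proof
  show "\<forall>x. GDERIV (moll \<epsilon> f) x :> gmoll \<epsilon> f x"
    using conv_gderiv[OF assms(1) C1c_kern[OF assms(2)]] unfolding moll_def[abs_def] gmoll_def[abs_def] by simp
  show "continuous_on UNIV (gmoll \<epsilon> f)"
    unfolding gmoll_def[abs_def] by (rule conv_continuous[OF assms(1) continuous_gkern gkern_support[OF assms(2)]])
qed

lemma C1c_integrable_products:
  assumes "C1c v (v'::'a::euclidean_space \<Rightarrow> 'a)" "loc_int (f :: 'a \<Rightarrow> real)"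
  shows "integrable lborel (\<lambda>x. v x * f x)" "integrable lborel (\<lambda>x. (v' x \<bullet> i) * f x)"
proof -
  obtain r where r: "\<And>x. norm x > r \<Longrightarrow> v x = 0" "\<And>x. norm x > r \<Longrightarrow> v' x = 0"
    using assms unfolding C1c_def by auto
  have c: "continuous_on UNIV v" "continuous_on UNIV v'" using assms C1_continuous unfolding C1c_def C1_def by auto
  show "integrable lborel (\<lambda>x. v x * f x)" by (rule integrable_compact_mult[OF assms(2) c(1) r(1)])
  show "integrable lborel (\<lambda>x. (v' x \<bullet> i) * f x)"
    by (rule integrable_compact_mult[OF assms(2), of _ r]) (auto intro!: continuous_intros c simp: r)
qed

lemma C1c_by_parts:
  assumes v: "C1c v (v'::'a::euclidean_space \<Rightarrow> 'a)" and w: "C1 w w'"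
  shows "(LINT x|lborel. v x * (w' x \<bullet> i)) = - (LINT x|lborel. (v' x \<bullet> i) * w x)"
proof -
  have 1: "integrable lborel (\<lambda>x. v x * (w' x \<bullet> i))"
    using w unfolding C1_def by (intro C1c_integrable_products(1)[OF v] loc_int_continuous continuous_intros) auto
  have 2: "integrable lborel (\<lambda>x. (v' x \<bullet> i) * w x)"
    by (intro C1c_integrable_products(2)[OF v] loc_int_continuous C1_continuous[OF w])
  obtain r where r: "\<And>x. norm x > r \<Longrightarrow> v x = 0" "\<And>x. norm x > r \<Longrightarrow> v' x = 0"
    using v unfolding C1c_def by auto
  have c: "continuous_on UNIV v" "continuous_on UNIV v'" "continuous_on UNIV w" "continuous_on UNIV w'"
    using v w C1_continuous unfolding C1c_def C1_def by auto
  have "integrable lborel (\<lambda>x. v x *\<^sub>R w' x + w x *\<^sub>R v' x)"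
    by (rule integrable_continuous_support[of _ r]) (auto intro!: continuous_intros c simp: r)
  then have "(LINT x|lborel. (v x *\<^sub>R w' x + w x *\<^sub>R v' x) \<bullet> i) = (LINT x|lborel. v x *\<^sub>R w' x + w x *\<^sub>R v' x) \<bullet> i"
    by (rule integral_inner_left)
  also have "\<dots> = 0" using C1c_integral_gradient[OF C1c_mult[OF v w]] by simp
  finally have "(LINT x|lborel. v x * (w' x \<bullet> i) + (v' x \<bullet> i) * w x) = 0" by (simp add: inner_simps mult.commute)
  then show ?thesis using 1 2 by simp
qed

text \<open>
  Testing with the mollifier kernels only keeps the test functions explicit; \<open>kweak_C1c\<close> recovers
  all compactly supported functions of class \<open>C\<^sup>1\<close>.
\<close>

definition kweak :: "'a::euclidean_space \<Rightarrow> ('a \<Rightarrow> real) \<Rightarrow> ('a \<Rightarrow> real) \<Rightarrow> bool" where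
  "kweak i f g \<longleftrightarrow> loc_int f \<and> loc_int g \<and> (\<forall>\<epsilon>>0. \<forall>y. gmoll \<epsilon> f y \<bullet> i = moll \<epsilon> g y)"

text \<open>Only a ball that contains the support of \<open>v\<close> matters, and there the
  mollifications converge in L1.\<close>

lemma moll_weak_limit:
  assumes g: "loc_int g" and c: "continuous_on UNIV v" and r: "\<And>x. norm x > r \<Longrightarrow> v x = 0"
  shows "(\<lambda>n. LINT y|lborel. v y * moll (1 / Suc n) g y) \<longlonglongrightarrow> (LINT y|lborel. v y * g y)"
proof (rule LIMSEQ_I)
  fix e :: real assume e: "e > 0"
  obtain M where M: "M > 0" "\<And>x. norm (v x) \<le> M" using bounded_of_continuous_support[OF c r] by metis
  obtain d where d: "d > 0" "\<And>\<epsilon>. 0 < \<epsilon> \<Longrightarrow> \<epsilon> < d \<Longrightarrow> (\<integral>\<^sup>+y. indicator (cball 0 r) y * ennreal \<bar>moll \<epsilon> g y - g y\<bar> \<partial>lborel) \<le> ennreal (e / (2 * M))"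
  proof (rule moll_L1_loc[OF g])
    show "e / (2 * M) > 0" using e M(1) by simp
  qed blast+
  obtain N where N: "1 / real (Suc N) < d" using d(1) reals_Archimedean by (metis inverse_eq_divide)
  have [measurable]: "g \<in> borel_measurable borel" "v \<in> borel_measurable borel"
    using g c by (auto simp: loc_int_def borel_measurable_continuous_onI)
  show "\<exists>N. \<forall>n\<ge>N. norm ((LINT y|lborel. v y * moll (1 / Suc n) g y) - (LINT y|lborel. v y * g y)) < e"
  proof (intro exI allI impI)
    fix n assume n: "n \<ge> N"
    have "1 / real (Suc n) \<le> 1 / real (Suc N)" using n by (intro divide_left_mono) auto
    then have nd: "0 < 1 / real (Suc n)" "1 / real (Suc n) < d" using N by auto
    have i: "integrable lborel (\<lambda>y. v y * moll (1 / Suc n) g y)" "integrable lborel (\<lambda>y. v y * g y)"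
      using nd by (auto intro!: integrable_compact_mult[OF _ c r] g loc_int_continuous C1_continuous[OF C1_moll[OF g]])
    have "ennreal (norm ((LINT y|lborel. v y * moll (1 / Suc n) g y) - (LINT y|lborel. v y * g y)))
      = ennreal (norm (LINT y|lborel. v y * moll (1 / Suc n) g y - v y * g y))" using i by simp
    also have "\<dots> \<le> (\<integral>\<^sup>+y. ennreal (norm (v y * moll (1 / Suc n) g y - v y * g y)) \<partial>lborel)"
      using i by (intro integral_norm_bound_ennreal) auto
    also have "\<dots> \<le> (\<integral>\<^sup>+y. ennreal M * (indicator (cball 0 r) y * ennreal \<bar>moll (1 / Suc n) g y - g y\<bar>) \<partial>lborel)"
    proof (rule nn_integral_mono)
      fix y
      have "norm (v y * moll (1 / Suc n) g y - v y * g y) = \<bar>v y\<bar> * \<bar>moll (1 / Suc n) g y - g y\<bar>"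
        unfolding abs_mult[symmetric] by (simp add: algebra_simps)
      also have "ennreal \<dots> \<le> ennreal M * (indicator (cball 0 r) y * ennreal \<bar>moll (1 / Suc n) g y - g y\<bar>)"
        using r[of y] M(2)[of y] M(1) by (cases "norm y > r") (auto simp: ennreal_mult'[symmetric] intro!: ennreal_leI mult_right_mono)
      finally show "ennreal (norm (v y * moll (1 / Suc n) g y - v y * g y)) \<le> ennreal M * (indicator (cball 0 r) y * ennreal \<bar>moll (1 / Suc n) g y - g y\<bar>)" .
    qed
    also have "\<dots> = ennreal M * (\<integral>\<^sup>+y. indicator (cball 0 r) y * ennreal \<bar>moll (1 / Suc n) g y - g y\<bar> \<partial>lborel)"
      by (rule nn_integral_cmult) (auto intro!: borel_measurable_times_ennreal borel_measurable_indicator)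
    also have "\<dots> \<le> ennreal M * ennreal (e / (2 * M))" by (intro mult_left_mono d(2) nd) auto
    also have "\<dots> = ennreal (e / 2)" using M(1) e by (simp flip: ennreal_mult)
    finally show "norm ((LINT y|lborel. v y * moll (1 / Suc n) g y) - (LINT y|lborel. v y * g y)) < e" using e by simp
  qed
qed

text \<open>For the mollified functions the hypothesis is a statement on classical derivatives, so
  classical integration by parts applies with \<open>v\<close>; then the mollification is removed on
  both sides.\<close>

lemma kweak_C1c:
  assumes fg: "kweak i f g" and v: "C1c v (v'::'a::euclidean_space \<Rightarrow> 'a)"
  shows "(LINT x|lborel. (v' x \<bullet> i) * f x) = - (LINT x|lborel. v x * g x)"
proof -
  have f: "loc_int f" and g: "loc_int g" using fg by (auto simp: kweak_def)
  obtain r where r: "\<And>x. norm x > r \<Longrightarrow> v x = 0" "\<And>x. norm x > r \<Longrightarrow> v' x = 0"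
    using v unfolding C1c_def by auto
  have c: "continuous_on UNIV v" "continuous_on UNIV v'" using v C1_continuous unfolding C1c_def C1_def by auto
  have "(LINT y|lborel. v y * moll (1 / Suc n) g y) = - (LINT y|lborel. (v' y \<bullet> i) * moll (1 / Suc n) f y)" for n
    using C1c_by_parts[OF v C1_moll[OF f], of "1 / Suc n" i] fg by (simp add: kweak_def)
  moreover have "(\<lambda>n. LINT y|lborel. v y * moll (1 / Suc n) g y) \<longlonglongrightarrow> (LINT y|lborel. v y * g y)"
    by (rule moll_weak_limit[OF g c(1) r(1)])
  moreover have "(\<lambda>n. - (LINT y|lborel. (v' y \<bullet> i) * moll (1 / Suc n) f y)) \<longlonglongrightarrow> - (LINT y|lborel. (v' y \<bullet> i) * f y)"
    by (intro tendsto_minus moll_weak_limit[OF f, of _ r] continuous_intros c) (simp add: r)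
  ultimately have "(LINT y|lborel. v y * g y) = - (LINT y|lborel. (v' y \<bullet> i) * f y)" using LIMSEQ_unique by simp
  then show ?thesis by simp
qed

section \<open>Chain rule and Gronwall inequality for absolutely continuous functions\<close>

lemma absolutely_integrable_continuous_mult:
  fixes f g :: "real \<Rightarrow> real"
  assumes f: "f absolutely_integrable_on {a..b}" and g: "continuous_on {a..b} g"
  shows "(\<lambda>x. g x * f x) absolutely_integrable_on {a..b}"
proof (rule absolutely_integrable_bounded_measurable_product_real)
  show "g \<in> borel_measurable (lebesgue_on {a..b})"
    by (rule continuous_imp_measurable_on_sets_lebesgue[OF g]) auto
  show "bounded (g ` {a..b})" by (intro compact_imp_bounded compact_continuous_image g) auto
qed (use f in auto)

text \<open>\<open>U\<close> is absolutely continuous and need not be differentiable everywhere.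
  Instead of differentiating, the error over an interval is compared with \<open>e\<close> times the
  integral of the modulus of \<open>F\<close>: this comparison is additive over adjacent intervals
  and holds on all short intervals around each point, so it extends to \<open>{a..b}\<close> by
  bisection.\<close>

lemma chain_rule_integral:
  fixes F :: "real \<Rightarrow> real"
  assumes F: "F absolutely_integrable_on {a..b}" and ab: "a \<le> b"
    and U: "\<And>t. t \<in> {a..b} \<Longrightarrow> U t = U a + integral {a..t} F"
    and \<beta>: "\<And>x. x \<in> S \<Longrightarrow> (\<beta> has_real_derivative \<beta>' x) (at x)" and c\<beta>: "continuous_on S \<beta>'"
    and S: "open S" "U ` {a..b} \<subseteq> S"
  shows "\<beta> (U b) = \<beta> (U a) + integral {a..b} (\<lambda>s. \<beta>' (U s) * F s)"
proof -
  have FI: "F integrable_on {a..b}" using F by (simp add: absolutely_integrable_on_def)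
  have AI: "(\<lambda>x. \<bar>F x\<bar>) integrable_on {a..b}" using F by (simp add: absolutely_integrable_on_def)
  have "continuous_on {a..b} (\<lambda>t. U a + integral {a..t} F)"
    by (intro continuous_intros indefinite_integral_continuous_1 FI)
  then have cU: "continuous_on {a..b} U" by (subst continuous_on_cong[OF refl U]) auto
  have cbU: "continuous_on {a..b} (\<lambda>s. \<beta>' (U s))"
    using S(2) by (auto intro: continuous_on_compose2[OF c\<beta> cU])
  have PI: "(\<lambda>s. \<beta>' (U s) * F s) absolutely_integrable_on {a..b}"
    by (rule absolutely_integrable_continuous_mult[OF F cbU])
  have PI': "(\<lambda>s. \<beta>' (U s) * F s) integrable_on {a..b}" using PI by (simp add: absolutely_integrable_on_def)
  have Udiff: "U y - U x = integral {x..y} F" if "a \<le> x" "x \<le> y" "y \<le> b" for x y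
  proof -
    have "integral {a..x} F + integral {x..y} F = integral {a..y} F"
      by (rule Henstock_Kurzweil_Integration.integral_combine) (use that in \<open>auto intro: integrable_on_subinterval[OF FI]\<close>)
    then show ?thesis using U[of x] U[of y] that by simp
  qed
  have main: "\<bar>\<beta> (U b) - \<beta> (U a) - integral {a..b} (\<lambda>s. \<beta>' (U s) * F s)\<bar> \<le> e * integral {a..b} (\<lambda>s. \<bar>F s\<bar>)" if e: "e > 0" for e
  proof -
    define P where "P x y \<longleftrightarrow> (a \<le> x \<and> y \<le> b \<longrightarrow> \<bar>\<beta> (U y) - \<beta> (U x) - integral {x..y} (\<lambda>s. \<beta>' (U s) * F s)\<bar> \<le> e * integral {x..y} (\<lambda>s. \<bar>F s\<bar>))" for x y
    have "P a b" using ab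
    proof (induction rule: Bolzano)
      case (trans x y z)
      show ?case unfolding P_def
      proof
        assume xz: "a \<le> x \<and> z \<le> b"
        have 1: "integral {x..y} (\<lambda>s. \<beta>' (U s) * F s) + integral {y..z} (\<lambda>s. \<beta>' (U s) * F s) = integral {x..z} (\<lambda>s. \<beta>' (U s) * F s)"
          by (rule Henstock_Kurzweil_Integration.integral_combine) (use xz trans in \<open>auto intro: integrable_on_subinterval[OF PI']\<close>)
        have 2: "integral {x..y} (\<lambda>s. \<bar>F s\<bar>) + integral {y..z} (\<lambda>s. \<bar>F s\<bar>) = integral {x..z} (\<lambda>s. \<bar>F s\<bar>)"
          by (rule Henstock_Kurzweil_Integration.integral_combine) (use xz trans in \<open>auto intro: integrable_on_subinterval[OF AI]\<close>)
        have 3: "\<bar>\<beta> (U y) - \<beta> (U x) - integral {x..y} (\<lambda>s. \<beta>' (U s) * F s)\<bar> \<le> e * integral {x..y} (\<lambda>s. \<bar>F s\<bar>)"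
          "\<bar>\<beta> (U z) - \<beta> (U y) - integral {y..z} (\<lambda>s. \<beta>' (U s) * F s)\<bar> \<le> e * integral {y..z} (\<lambda>s. \<bar>F s\<bar>)"
          using trans xz unfolding P_def by auto
        have "e * integral {x..z} (\<lambda>s. \<bar>F s\<bar>) = e * integral {x..y} (\<lambda>s. \<bar>F s\<bar>) + e * integral {y..z} (\<lambda>s. \<bar>F s\<bar>)"
          using 2 by (simp add: algebra_simps flip: 2)
        then show "\<bar>\<beta> (U z) - \<beta> (U x) - integral {x..z} (\<lambda>s. \<beta>' (U s) * F s)\<bar> \<le> e * integral {x..z} (\<lambda>s. \<bar>F s\<bar>)"
          using 1 3 by linarith
      qed
    next
      case (local s)
      then have Us: "U s \<in> S" using S by auto
      have "continuous (at (U s)) \<beta>'" using c\<beta> S Us by (simp add: continuous_on_eq_continuous_at)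
      then obtain \<delta>1 where \<delta>1: "\<delta>1 > 0" "\<And>x. \<bar>x - U s\<bar> < \<delta>1 \<Longrightarrow> \<bar>\<beta>' x - \<beta>' (U s)\<bar> < e / 2"
        using e unfolding continuous_at_eps_delta dist_real_def by (meson half_gt_zero)
      obtain \<delta>2 where \<delta>2: "\<delta>2 > 0" "ball (U s) \<delta>2 \<subseteq> S" using S Us by (auto simp: open_contains_ball)
      obtain d where d: "d > 0" "\<And>x. x \<in> {a..b} \<Longrightarrow> \<bar>x - s\<bar> < d \<Longrightarrow> \<bar>U x - U s\<bar> < min \<delta>1 \<delta>2"
        using cU local \<delta>1(1) \<delta>2(1) unfolding continuous_on_iff dist_real_def by (metis atLeastAtMost_iff min_less_iff_conj)
      show ?case
      proof (intro exI[of _ d] conjI allI impI)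
        show "d > 0" by fact
        fix x y assume xy: "x \<le> s \<and> s \<le> y \<and> y - x < d"
        show "P x y" unfolding P_def
        proof
          assume "a \<le> x \<and> y \<le> b"
          then have ax: "a \<le> x" "x \<le> s" "s \<le> y" "y \<le> b" "x \<le> y" using xy by auto
          have close: "\<bar>U r - U s\<bar> < min \<delta>1 \<delta>2" if "r \<in> {x..y}" for r using d(2)[of r] that xy ax by auto
          have I1: "F integrable_on {x..y}" "(\<lambda>x. \<bar>F x\<bar>) integrable_on {x..y}" "(\<lambda>s. \<beta>' (U s) * F s) integrable_on {x..y}"
            using integrable_on_subinterval[OF FI] integrable_on_subinterval[OF AI] integrable_on_subinterval[OF PI'] ax by auto
          \<comment> \<open>One half of the error comes from linearising \<open>\<beta>\<close> at
            \<open>U s\<close>, the other half from freezing the factor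
            \<open>\<beta>' (U r)\<close> at \<open>r = s\<close> under the integral.\<close>
          have lin: "\<bar>\<beta> (U y) - \<beta> (U x) - \<beta>' (U s) * (U y - U x)\<bar> \<le> (e / 2) * \<bar>U y - U x\<bar>"
          proof -
            have "norm (\<beta> (U y) - \<beta> (U x) - (\<lambda>h. h * \<beta>' (U s)) (U y - U x)) \<le> norm (U y - U x) * (e / 2)"
            proof (rule differentiable_bound_linearization[where f'="\<lambda>x h. h * \<beta>' x" and S="ball (U s) (min \<delta>1 \<delta>2)"])
              show "U x + t *\<^sub>R (U y - U x) \<in> ball (U s) (min \<delta>1 \<delta>2)" if "t \<in> {0..1}" for t
              proof -
                have "(1 - t) *\<^sub>R U x + t *\<^sub>R U y \<in> ball (U s) (min \<delta>1 \<delta>2)"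
                  using close[of x] close[of y] ax that
                  by (intro convexD[OF convex_ball]) (auto simp: dist_real_def abs_minus_commute)
                then show ?thesis by (simp add: algebra_simps)
              qed
              show "(\<beta> has_derivative (\<lambda>h. h * \<beta>' r)) (at r within ball (U s) (min \<delta>1 \<delta>2))" if "r \<in> ball (U s) (min \<delta>1 \<delta>2)" for r
              proof -
                have "r \<in> S" using that \<delta>2 by auto
                moreover have "times (\<beta>' r) = (\<lambda>h. h * \<beta>' r)" by (simp add: fun_eq_iff)
                ultimately show ?thesis using \<beta>[of r] by (auto simp: has_field_derivative_def intro: has_derivative_at_withinI)
              qed
              show "onorm ((\<lambda>h. h * \<beta>' r) - (\<lambda>h. h * \<beta>' (U s))) \<le> e / 2" if "r \<in> ball (U s) (min \<delta>1 \<delta>2)" for r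
              proof (rule onorm_bound)
                show "0 \<le> e / 2" using e by simp
                fix v :: real
                have "\<bar>\<beta>' r - \<beta>' (U s)\<bar> < e / 2"
                  using that by (intro \<delta>1(2)) (simp add: dist_real_def abs_minus_commute)
                then have "\<bar>\<beta>' r - \<beta>' (U s)\<bar> * \<bar>v\<bar> \<le> e / 2 * \<bar>v\<bar>" by (intro mult_right_mono) auto
                then show "norm (((\<lambda>h. h * \<beta>' r) - (\<lambda>h. h * \<beta>' (U s))) v) \<le> e / 2 * norm v"
                  by (simp add: abs_mult[symmetric] algebra_simps)
              qed
              show "U s \<in> ball (U s) (min \<delta>1 \<delta>2)" using \<delta>1 \<delta>2 by simp
            qed
            then show ?thesis by (simp add: mult.commute)
          qed
          have A: "\<bar>U y - U x\<bar> \<le> integral {x..y} (\<lambda>s. \<bar>F s\<bar>)"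
            using Udiff[of x y] ax integral_norm_bound_integral[OF I1(1,2)] by simp
          have B: "\<bar>\<beta>' (U s) * (U y - U x) - integral {x..y} (\<lambda>s. \<beta>' (U s) * F s)\<bar> \<le> e / 2 * integral {x..y} (\<lambda>s. \<bar>F s\<bar>)"
          proof -
            have "\<beta>' (U s) * (U y - U x) - integral {x..y} (\<lambda>s. \<beta>' (U s) * F s) = integral {x..y} (\<lambda>r. \<beta>' (U s) * F r - \<beta>' (U r) * F r)"
              using Udiff[of x y] ax I1 by (subst Henstock_Kurzweil_Integration.integral_diff) (auto intro: integrable_on_mult_right)
            also have "norm \<dots> \<le> integral {x..y} (\<lambda>r. e / 2 * \<bar>F r\<bar>)"
            proof (rule integral_norm_bound_integral)
              fix r assume r: "r \<in> {x..y}"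
              have "\<bar>\<beta>' (U s) - \<beta>' (U r)\<bar> \<le> e / 2" using \<delta>1(2)[of "U r"] close[OF r] by (simp add: abs_minus_commute)
              then have "\<bar>\<beta>' (U s) - \<beta>' (U r)\<bar> * \<bar>F r\<bar> \<le> e / 2 * \<bar>F r\<bar>" by (intro mult_right_mono) auto
              then show "norm (\<beta>' (U s) * F r - \<beta>' (U r) * F r) \<le> e / 2 * \<bar>F r\<bar>" by (simp add: abs_mult[symmetric] algebra_simps)
            qed (use I1 in \<open>auto intro: integrable_diff integrable_on_mult_right\<close>)
            finally show ?thesis by simp
          qed
          have "e / 2 * \<bar>U y - U x\<bar> \<le> e / 2 * integral {x..y} (\<lambda>s. \<bar>F s\<bar>)" using A e by (intro mult_left_mono) auto
          then have "\<bar>\<beta> (U y) - \<beta> (U x) - integral {x..y} (\<lambda>s. \<beta>' (U s) * F s)\<bar> \<le> e / 2 * integral {x..y} (\<lambda>s. \<bar>F s\<bar>) + e / 2 * integral {x..y} (\<lambda>s. \<bar>F s\<bar>)"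
            using lin B by linarith
          then show "\<bar>\<beta> (U y) - \<beta> (U x) - integral {x..y} (\<lambda>s. \<beta>' (U s) * F s)\<bar> \<le> e * integral {x..y} (\<lambda>s. \<bar>F s\<bar>)" by simp
        qed
      qed
    qed
    then show ?thesis by (simp add: P_def)
  qed
  define I where "I = integral {a..b} (\<lambda>s. \<bar>F s\<bar>)"
  have I: "I \<ge> 0" unfolding I_def by (intro Henstock_Kurzweil_Integration.integral_nonneg AI) auto
  have "\<bar>\<beta> (U b) - \<beta> (U a) - integral {a..b} (\<lambda>s. \<beta>' (U s) * F s)\<bar> \<le> 0 + e" if "e > 0" for e
  proof -
    have "e / (I + 1) * I \<le> e" using that I by (simp add: field_simps)
    then show ?thesis using main[of "e / (I + 1)"] that I unfolding I_def[symmetric] by (smt (verit) divide_pos_pos)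
  qed
  then have "\<bar>\<beta> (U b) - \<beta> (U a) - integral {a..b} (\<lambda>s. \<beta>' (U s) * F s)\<bar> \<le> 0" by (rule field_le_epsilon)
  then show ?thesis by simp
qed

text \<open>The right-hand side \<open>U\<close> of the integral inequality is absolutely continuous
  and bounded below by \<open>A > 0\<close>, so the chain rule applies to its logarithm; the
  derivative of that is at most \<open>m * w\<close>, since \<open>Y\<close> is at most
  \<open>U\<close>.\<close>

lemma gronwall_integral:
  fixes w Y :: "real \<Rightarrow> real"
  assumes w: "w absolutely_integrable_on {t0..t1}" "\<And>s. s \<in> {t0..t1} \<Longrightarrow> 0 \<le> w s"
    and Y: "continuous_on {t0..t1} Y" "\<And>t. t \<in> {t0..t1} \<Longrightarrow> 0 \<le> Y t"
    and le: "\<And>t. t \<in> {t0..t1} \<Longrightarrow> Y t \<le> A + m * integral {t0..t} (\<lambda>s. w s * Y s)"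
    and A: "A > 0" and m: "m \<ge> 0" and t: "t0 \<le> t1"
  shows "Y t1 \<le> A * exp (m * integral {t0..t1} w)"
proof -
  define F where "F = (\<lambda>s. m * (w s * Y s))"
  define U where "U = (\<lambda>t. A + integral {t0..t} F)"
  have WY: "(\<lambda>s. w s * Y s) absolutely_integrable_on {t0..t1}"
    using absolutely_integrable_continuous_mult[OF w(1) Y(1)] by (simp add: mult.commute)
  have F: "F absolutely_integrable_on {t0..t1}" unfolding F_def by (intro set_integrable_mult_right WY)
  have FI: "F integrable_on {t0..t1}" using F by (simp add: absolutely_integrable_on_def)
  have F0: "F s \<ge> 0" if "s \<in> {t0..t1}" for s using w Y m that by (simp add: F_def)
  have Ut: "U t = U t0 + integral {t0..t} F" for t by (simp add: U_def)
  have UA: "U t \<ge> A" if "t \<in> {t0..t1}" for t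
    unfolding U_def using that F0
    by (auto intro!: Henstock_Kurzweil_Integration.integral_nonneg integrable_on_subinterval[OF FI])
  have YU: "Y t \<le> U t" if "t \<in> {t0..t1}" for t
    using le[OF that] by (simp add: U_def F_def)
  have "ln (U t1) = ln (U t0) + integral {t0..t1} (\<lambda>s. (1 / U s) * F s)"
  proof (rule chain_rule_integral[OF F t Ut])
    show "(ln has_real_derivative 1 / x) (at x)" if "x \<in> {0<..}" for x :: real
      using that by (auto intro!: derivative_eq_intros)
    show "continuous_on {0<..} (\<lambda>x. 1 / x :: real)" by (auto intro!: continuous_intros)
    show "U ` {t0..t1} \<subseteq> {0<..}" using UA A by force
  qed auto
  also have "integral {t0..t1} (\<lambda>s. (1 / U s) * F s) \<le> integral {t0..t1} (\<lambda>s. m * w s)"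
  proof (rule Henstock_Kurzweil_Integration.integral_le)
    have "continuous_on {t0..t1} U" unfolding U_def by (intro continuous_intros indefinite_integral_continuous_1 FI)
    then have "continuous_on {t0..t1} (\<lambda>s. 1 / U s)" using less_le_trans[OF A UA] by (intro continuous_intros) force+
    then show "(\<lambda>s. (1 / U s) * F s) integrable_on {t0..t1}"
      using absolutely_integrable_continuous_mult[OF F, of "\<lambda>s. 1 / U s"] unfolding absolutely_integrable_on_def by blast
    show "(\<lambda>s. m * w s) integrable_on {t0..t1}" using w(1) by (auto simp: absolutely_integrable_on_def intro: integrable_on_mult_right)
    fix s assume s: "s \<in> {t0..t1}"
    have "Y s / U s \<le> 1" using YU[OF s] UA[OF s] A by simp
    then have "(m * w s) * (Y s / U s) \<le> (m * w s) * 1" using m w(2)[OF s] by (intro mult_left_mono) auto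
    then show "(1 / U s) * F s \<le> m * w s" by (simp add: F_def mult.assoc)
  qed
  also have "integral {t0..t1} (\<lambda>s. m * w s) = m * integral {t0..t1} w" by simp
  also have "U t0 = A" by (simp add: U_def)
  finally have "ln (U t1) \<le> ln A + m * integral {t0..t1} w" by simp
  moreover have "U t1 > 0" using UA[of t1] A t by simp
  ultimately have "U t1 \<le> exp (ln A + m * integral {t0..t1} w)" by (metis exp_le_cancel_iff exp_ln)
  then have "U t1 \<le> A * exp (m * integral {t0..t1} w)" using A by (simp add: exp_add)
  then show ?thesis using YU[of t1] t by simp
qed

section \<open>Difference quotients of Sobolev functions\<close>

lemma gmoll_component:
  assumes "\<And>i. i \<in> Basis \<Longrightarrow> kweak i f (g i)" "\<epsilon> > 0"
  shows "h \<bullet> gmoll \<epsilon> f y = (\<Sum>i\<in>Basis. (h \<bullet> i) * moll \<epsilon> (g i) y)"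
  using assms by (subst euclidean_inner) (simp add: kweak_def)

text \<open>The fundamental theorem of calculus along the segment from \<open>y\<close> to
  \<open>y - h\<close>; the gradient of the mollification consists of mollified weak
  partials.\<close>

lemma moll_difference_le:
  fixes f :: "'a::euclidean_space \<Rightarrow> real"
  assumes kw: "\<And>i. i \<in> Basis \<Longrightarrow> kweak i f (g i)" and e: "\<epsilon> > 0"
  shows "ennreal \<bar>moll \<epsilon> f y - moll \<epsilon> f (y - h)\<bar> \<le>
    (\<integral>\<^sup>+s. indicator {0..1::real} s * ennreal (norm h * (\<Sum>i\<in>Basis. \<bar>moll \<epsilon> (g i) (y - s *\<^sub>R h)\<bar>)) \<partial>lborel)"
proof -
  obtain i0 :: 'a where "i0 \<in> Basis" using nonempty_Basis by blast
  then have f: "loc_int f" using kw by (auto simp: kweak_def)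
  have C1: "C1 (moll \<epsilon> f) (gmoll \<epsilon> f)" by (rule C1_moll[OF f e])
  let ?\<phi> = "\<lambda>s. moll \<epsilon> f (y - s *\<^sub>R h)" and ?\<phi>' = "\<lambda>s. - (h \<bullet> gmoll \<epsilon> f (y - s *\<^sub>R h))"
  have d: "(?\<phi> has_real_derivative ?\<phi>' s) (at s)" for s
  proof -
    have "(?\<phi> has_derivative (\<lambda>v. (- (v *\<^sub>R h)) \<bullet> gmoll \<epsilon> f (y - s *\<^sub>R h))) (at s)"
      by (rule has_derivative_compose[of "\<lambda>s. y - s *\<^sub>R h" "\<lambda>v. - (v *\<^sub>R h)" s UNIV "moll \<epsilon> f"])
        (use C1 in \<open>auto intro!: derivative_eq_intros simp: C1_def gderiv_def\<close>)
    moreover have "times (?\<phi>' s) = (\<lambda>v. (- (v *\<^sub>R h)) \<bullet> gmoll \<epsilon> f (y - s *\<^sub>R h))" by (simp add: fun_eq_iff)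
    ultimately show ?thesis by (simp only: has_field_derivative_def)
  qed
  have c: "continuous_on UNIV ?\<phi>'"
  proof -
    have cg: "continuous_on UNIV (gmoll \<epsilon> f)" using C1 by (simp add: C1_def)
    show ?thesis by (intro continuous_intros continuous_on_compose2[OF cg]) auto
  qed
  have ic: "isCont ?\<phi>' s" for s using c by (simp add: continuous_on_eq_continuous_at)
  have "(\<integral>s. ?\<phi>' s * indicator {0..1} s \<partial>lborel) = ?\<phi> 1 - ?\<phi> 0"
    by (rule integral_FTC_Icc_real) (auto intro: d ic)
  then have "ennreal \<bar>moll \<epsilon> f y - moll \<epsilon> f (y - h)\<bar> = ennreal (norm (\<integral>s. ?\<phi>' s * indicator {0..1} s \<partial>lborel))"
    by (simp add: abs_minus_commute)
  also have "\<dots> \<le> (\<integral>\<^sup>+s. ennreal (norm (?\<phi>' s * indicator {0..1} s)) \<partial>lborel)"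
    by (rule integral_norm_bound_ennreal) (rule integrable.intros, rule has_bochner_integral_FTC_Icc_real, auto intro: d ic)
  also have "\<dots> \<le> (\<integral>\<^sup>+s. indicator {0..1::real} s * ennreal (norm h * (\<Sum>i\<in>Basis. \<bar>moll \<epsilon> (g i) (y - s *\<^sub>R h)\<bar>)) \<partial>lborel)"
  proof (rule nn_integral_mono)
    fix s :: real
    have "\<bar>h \<bullet> gmoll \<epsilon> f (y - s *\<^sub>R h)\<bar> \<le> (\<Sum>i\<in>Basis. \<bar>(h \<bullet> i) * moll \<epsilon> (g i) (y - s *\<^sub>R h)\<bar>)"
    proof -
      have "h \<bullet> gmoll \<epsilon> f (y - s *\<^sub>R h) = (\<Sum>i\<in>Basis. (h \<bullet> i) * moll \<epsilon> (g i) (y - s *\<^sub>R h))"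
        by (rule gmoll_component[OF kw e])
      then show ?thesis by (simp only: sum_abs)
    qed
    also have "\<dots> \<le> (\<Sum>i\<in>Basis. norm h * \<bar>moll \<epsilon> (g i) (y - s *\<^sub>R h)\<bar>)"
      by (intro sum_mono) (auto simp: abs_mult Basis_le_norm intro!: mult_right_mono)
    also have "\<dots> = norm h * (\<Sum>i\<in>Basis. \<bar>moll \<epsilon> (g i) (y - s *\<^sub>R h)\<bar>)" by (simp add: sum_distrib_left)
    finally show "ennreal (norm (?\<phi>' s * indicator {0..1} s)) \<le> indicator {0..1::real} s * ennreal (norm h * (\<Sum>i\<in>Basis. \<bar>moll \<epsilon> (g i) (y - s *\<^sub>R h)\<bar>))"
      by (auto simp: indicator_def intro!: ennreal_leI)
  qed
  finally show ?thesis .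
qed

lemma eventually_moll_L1_loc:
  fixes f :: "'a::euclidean_space \<Rightarrow> real"
  assumes f: "loc_int f" and e: "e > 0"
  shows "\<forall>\<^sub>F \<epsilon> in at_right 0. (\<integral>\<^sup>+y. indicator (cball 0 r) y * ennreal \<bar>moll \<epsilon> f y - f y\<bar> \<partial>lborel) \<le> ennreal e"
proof -
  obtain d where d: "d > 0" "\<And>\<epsilon>. 0 < \<epsilon> \<Longrightarrow> \<epsilon> < d \<Longrightarrow>
    (\<integral>\<^sup>+y. indicator (cball 0 r) y * ennreal \<bar>moll \<epsilon> f y - f y\<bar> \<partial>lborel) \<le> ennreal e"
    by (rule moll_L1_loc[OF f e]) blast
  show ?thesis unfolding eventually_at_right_field using d by (intro exI[of _ d]) auto
qed

lemma nn_integral_shift_cball: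
  fixes F :: "'a::euclidean_space \<Rightarrow> ennreal"
  assumes [measurable]: "F \<in> borel_measurable borel" and "norm h \<le> a"
  shows "(\<integral>\<^sup>+y. indicator (cball 0 r) y * F (y - h) \<partial>lborel) \<le> (\<integral>\<^sup>+y. indicator (cball 0 (r + a)) y * F y \<partial>lborel)"
proof -
  have "(\<integral>\<^sup>+y. indicator (cball 0 r) y * F (y - h) \<partial>lborel) \<le> (\<integral>\<^sup>+y. indicator (cball 0 (r + a)) (y - h) * F (y - h) \<partial>lborel)"
  proof (rule nn_integral_mono)
    fix y :: 'a
    have "norm (y - h) \<le> r + a" if "norm y \<le> r" using norm_triangle_ineq4[of y h] that assms(2) by simp
    then show "indicator (cball 0 r) y * F (y - h) \<le> indicator (cball 0 (r + a)) (y - h) * F (y - h)"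
      by (auto simp: indicator_def)
  qed
  also have "\<dots> = (\<integral>\<^sup>+y. indicator (cball 0 (r + a)) y * F y \<partial>lborel)"
    by (rule lborel_translate_nn_integral(2)[of "\<lambda>y. indicator (cball 0 (r + a)) y * F y"])
      (auto intro!: borel_measurable_times_ennreal borel_measurable_indicator)
  finally show ?thesis .
qed

lemma indicator_cball_measurable [measurable]: 
  "(\<lambda>x. indicator (cball c r) (f x) :: ennreal) \<in> borel_measurable M" if [measurable]: "f \<in> borel_measurable M"
  for f :: "'b \<Rightarrow> 'a::euclidean_space"
  by (rule measurable_compose[OF that]) (auto intro!: borel_measurable_indicator)

lemma indicator_cball_measurable_real [measurable]: 
  "(\<lambda>x. indicator (cball c r) (f x) :: real) \<in> borel_measurable M" if [measurable]: "f \<in> borel_measurable M"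
  for f :: "'b \<Rightarrow> 'a::euclidean_space"
  by (rule measurable_compose[OF that]) (auto intro!: borel_measurable_indicator)

text \<open>The inequality holds for mollifications up to an error \<open>E\<close>, and the
  integral of \<open>E\<close> over a ball becomes small with \<open>\<epsilon>\<close>, because the
  translations involved have length at most \<open>norm h\<close> and only enlarge the ball. A
  nonnegative integral on the right is meaningful even where it is infinite.\<close>

lemma difference_quotient:
  fixes f :: "'a::euclidean_space \<Rightarrow> real"
  assumes kw: "\<And>i. i \<in> Basis \<Longrightarrow> kweak i f (g i)"
  shows "AE y in lborel. ennreal \<bar>f y - f (y - h)\<bar> \<le>
    (\<integral>\<^sup>+s. indicator {0..1::real} s * ennreal (norm h * (\<Sum>i\<in>Basis. \<bar>g i (y - s *\<^sub>R h)\<bar>)) \<partial>lborel)"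
proof -
  obtain i0 :: 'a where "i0 \<in> Basis" using nonempty_Basis by blast
  then have f: "loc_int f" using kw by (auto simp: kweak_def)
  then have fm [measurable]: "f \<in> borel_measurable borel" by (simp add: loc_int_def)
  have gi: "loc_int (g i)" if "i \<in> Basis" for i using kw[OF that] by (simp add: kweak_def)
  then have gm [measurable]: "g i \<in> borel_measurable borel" if "i \<in> Basis" for i using that by (simp add: loc_int_def)
  define A where "A y = ennreal \<bar>f y - f (y - h)\<bar>" for y
  define B where "B y = (\<integral>\<^sup>+s. indicator {0..1::real} s * ennreal (norm h * (\<Sum>i\<in>Basis. \<bar>g i (y - s *\<^sub>R h)\<bar>)) \<partial>lborel)" for y
  have [measurable]: "A \<in> borel_measurable borel" unfolding A_def[abs_def] by measurable
  have [measurable]: "B \<in> borel_measurable borel" unfolding B_def[abs_def] by measurable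
  define e where "e \<epsilon> F y = ennreal \<bar>moll \<epsilon> F y - F y\<bar>" for \<epsilon> and F :: "'a \<Rightarrow> real" and y
  have em [measurable]: "e \<epsilon> F \<in> borel_measurable borel" if [measurable]: "F \<in> borel_measurable borel" for \<epsilon> F
    unfolding e_def[abs_def] by measurable
  define E where "E \<epsilon> y = e \<epsilon> f y + (e \<epsilon> f (y - h) + (\<integral>\<^sup>+s. indicator {0..1::real} s * (ennreal (norm h) * (\<Sum>i\<in>Basis. e \<epsilon> (g i) (y - s *\<^sub>R h))) \<partial>lborel))" for \<epsilon> y
  have Em [measurable]: "E \<epsilon> \<in> borel_measurable borel" for \<epsilon> unfolding E_def[abs_def] by measurable
  have Afin: "A y \<noteq> top" for y by (simp add: A_def)
  have ABE: "A y \<le> B y + E \<epsilon> y" if eps: "\<epsilon> > 0" for \<epsilon> y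
  proof -
    have "A y \<le> ennreal (\<bar>moll \<epsilon> f y - f y\<bar> + (\<bar>moll \<epsilon> f (y - h) - f (y - h)\<bar> + \<bar>moll \<epsilon> f y - moll \<epsilon> f (y - h)\<bar>))"
      unfolding A_def by (rule ennreal_leI) linarith
    also have "\<dots> = e \<epsilon> f y + (e \<epsilon> f (y - h) + ennreal \<bar>moll \<epsilon> f y - moll \<epsilon> f (y - h)\<bar>)"
      by (simp add: e_def)
    also have "ennreal \<bar>moll \<epsilon> f y - moll \<epsilon> f (y - h)\<bar> \<le> (\<integral>\<^sup>+s. indicator {0..1::real} s * ennreal (norm h * (\<Sum>i\<in>Basis. \<bar>moll \<epsilon> (g i) (y - s *\<^sub>R h)\<bar>)) \<partial>lborel)"
      by (rule moll_difference_le[OF kw eps])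
    also have "\<dots> \<le> (\<integral>\<^sup>+s. indicator {0..1::real} s * ennreal (norm h * (\<Sum>i\<in>Basis. \<bar>g i (y - s *\<^sub>R h)\<bar>)) + indicator {0..1::real} s * (ennreal (norm h) * (\<Sum>i\<in>Basis. e \<epsilon> (g i) (y - s *\<^sub>R h))) \<partial>lborel)"
    proof (rule nn_integral_mono)
      fix s :: real
      have "norm h * (\<Sum>i\<in>Basis. \<bar>moll \<epsilon> (g i) (y - s *\<^sub>R h)\<bar>) \<le> norm h * (\<Sum>i\<in>Basis. \<bar>g i (y - s *\<^sub>R h)\<bar> + \<bar>moll \<epsilon> (g i) (y - s *\<^sub>R h) - g i (y - s *\<^sub>R h)\<bar>)"
        by (intro mult_left_mono sum_mono) auto
      also have "\<dots> = norm h * (\<Sum>i\<in>Basis. \<bar>g i (y - s *\<^sub>R h)\<bar>) + norm h * (\<Sum>i\<in>Basis. \<bar>moll \<epsilon> (g i) (y - s *\<^sub>R h) - g i (y - s *\<^sub>R h)\<bar>)"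
        by (simp add: sum.distrib algebra_simps)
      finally have "ennreal (norm h * (\<Sum>i\<in>Basis. \<bar>moll \<epsilon> (g i) (y - s *\<^sub>R h)\<bar>)) \<le> ennreal (norm h * (\<Sum>i\<in>Basis. \<bar>g i (y - s *\<^sub>R h)\<bar>)) + ennreal (norm h * (\<Sum>i\<in>Basis. \<bar>moll \<epsilon> (g i) (y - s *\<^sub>R h) - g i (y - s *\<^sub>R h)\<bar>))"
        by (simp only: ennreal_plus[symmetric] mult_nonneg_nonneg norm_ge_zero sum_nonneg abs_ge_zero ennreal_leI)
      also have "ennreal (norm h * (\<Sum>i\<in>Basis. \<bar>moll \<epsilon> (g i) (y - s *\<^sub>R h) - g i (y - s *\<^sub>R h)\<bar>)) = ennreal (norm h) * (\<Sum>i\<in>Basis. e \<epsilon> (g i) (y - s *\<^sub>R h))"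
        by (simp add: e_def ennreal_mult sum_nonneg sum_ennreal)
      finally show "indicator {0..1::real} s * ennreal (norm h * (\<Sum>i\<in>Basis. \<bar>moll \<epsilon> (g i) (y - s *\<^sub>R h)\<bar>)) \<le> indicator {0..1::real} s * ennreal (norm h * (\<Sum>i\<in>Basis. \<bar>g i (y - s *\<^sub>R h)\<bar>)) + indicator {0..1::real} s * (ennreal (norm h) * (\<Sum>i\<in>Basis. e \<epsilon> (g i) (y - s *\<^sub>R h)))"
        by (auto simp: indicator_def)
    qed
    also have "\<dots> = B y + (\<integral>\<^sup>+s. indicator {0..1::real} s * (ennreal (norm h) * (\<Sum>i\<in>Basis. e \<epsilon> (g i) (y - s *\<^sub>R h))) \<partial>lborel)"
      unfolding B_def by (rule nn_integral_add) measurable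
    finally show ?thesis by (simp add: E_def add_left_mono ac_simps)
  qed
  \<comment> \<open>Subtraction in \<open>ennreal\<close> is truncated at 0, so a vanishing integral
    of \<open>A - B\<close> says that \<open>A \<le> B\<close> almost everywhere, also where
    \<open>B\<close> is infinite.\<close>
  have "AE y in lborel. indicator (cball 0 (real n)) y * (A y - B y) = 0" for n
  proof -
    have le: "(\<integral>\<^sup>+y. indicator (cball 0 (real n)) y * (A y - B y) \<partial>lborel) \<le> ennreal \<delta>" if \<delta>: "\<delta> > 0" for \<delta>
    proof -
      \<comment> \<open>One share for the error at \<open>y\<close>, one for the error at
        \<open>y - h\<close>, and \<open>norm h * DIM('a)\<close> shares for the errors of the
        partial derivatives.\<close>
      define N where "N = 2 + norm h * real DIM('a)"
      have N: "N > 0" by (simp add: N_def add_pos_nonneg)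
      have dN: "\<delta> / N > 0" using \<delta> N by simp
      let ?r = "real n + norm h"
      have "\<forall>\<^sub>F \<epsilon> in at_right 0. (\<integral>\<^sup>+y. indicator (cball 0 ?r) y * e \<epsilon> f y \<partial>lborel) \<le> ennreal (\<delta> / N)"
        unfolding e_def by (rule eventually_moll_L1_loc[OF f dN])
      moreover have "\<forall>\<^sub>F \<epsilon> in at_right 0. \<forall>i\<in>Basis. (\<integral>\<^sup>+y. indicator (cball 0 ?r) y * e \<epsilon> (g i) y \<partial>lborel) \<le> ennreal (\<delta> / N)"
        unfolding e_def by (intro eventually_ball_finite ballI eventually_moll_L1_loc gi dN) auto
      moreover have "\<forall>\<^sub>F \<epsilon> in at_right 0. (\<epsilon>::real) > 0" by (simp add: eventually_at_right_less)
      ultimately have "\<forall>\<^sub>F \<epsilon> in at_right 0. (\<integral>\<^sup>+y. indicator (cball 0 ?r) y * e \<epsilon> f y \<partial>lborel) \<le> ennreal (\<delta> / N) \<and> (\<forall>i\<in>Basis. (\<integral>\<^sup>+y. indicator (cball 0 ?r) y * e \<epsilon> (g i) y \<partial>lborel) \<le> ennreal (\<delta> / N)) \<and> \<epsilon> > 0"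
        by eventually_elim blast
      then obtain \<epsilon> where eps: "\<epsilon> > 0" and ef: "(\<integral>\<^sup>+y. indicator (cball 0 ?r) y * e \<epsilon> f y \<partial>lborel) \<le> ennreal (\<delta> / N)"
        and eg: "\<And>i. i \<in> Basis \<Longrightarrow> (\<integral>\<^sup>+y. indicator (cball 0 ?r) y * e \<epsilon> (g i) y \<partial>lborel) \<le> ennreal (\<delta> / N)"
        by (auto dest!: eventually_happens'[rotated])
      have 1: "(\<integral>\<^sup>+y. indicator (cball 0 (real n)) y * e \<epsilon> f y \<partial>lborel) \<le> ennreal (\<delta> / N)"
        by (rule order_trans[OF _ ef], rule nn_integral_mono) (auto simp: indicator_def intro: order_trans)
      have 2: "(\<integral>\<^sup>+y. indicator (cball 0 (real n)) y * e \<epsilon> f (y - h) \<partial>lborel) \<le> ennreal (\<delta> / N)"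
        by (rule order_trans[OF nn_integral_shift_cball ef]) auto
      have 3: "(\<integral>\<^sup>+y. indicator (cball 0 (real n)) y * e \<epsilon> (g i) (y - s *\<^sub>R h) \<partial>lborel) \<le> ennreal (\<delta> / N)"
        if "i \<in> Basis" "0 \<le> s" "s \<le> 1" for i s
      proof (rule order_trans[OF nn_integral_shift_cball eg[OF that(1)]])
        show "norm (s *\<^sub>R h) \<le> norm h" using that by (simp add: mult_left_le_one_le)
      qed (use that in auto)
      have "(\<integral>\<^sup>+y. indicator (cball 0 (real n)) y * (\<integral>\<^sup>+s. indicator {0..1::real} s * (ennreal (norm h) * (\<Sum>i\<in>Basis. e \<epsilon> (g i) (y - s *\<^sub>R h))) \<partial>lborel) \<partial>lborel)
        = (\<integral>\<^sup>+y. (\<integral>\<^sup>+s. indicator (cball 0 (real n)) y * (indicator {0..1::real} s * (ennreal (norm h) * (\<Sum>i\<in>Basis. e \<epsilon> (g i) (y - s *\<^sub>R h)))) \<partial>lborel) \<partial>lborel)"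
        by (intro nn_integral_cong nn_integral_cmult[symmetric]) measurable
      also have "\<dots> = (\<integral>\<^sup>+s. (\<integral>\<^sup>+y. indicator (cball 0 (real n)) y * (indicator {0..1::real} s * (ennreal (norm h) * (\<Sum>i\<in>Basis. e \<epsilon> (g i) (y - s *\<^sub>R h)))) \<partial>lborel) \<partial>lborel)"
        by (rule lborel_pair.Fubini') measurable
      also have "\<dots> = (\<integral>\<^sup>+s. (\<integral>\<^sup>+y. indicator {0..1::real} s * (ennreal (norm h) * (\<Sum>i\<in>Basis. indicator (cball 0 (real n)) y * e \<epsilon> (g i) (y - s *\<^sub>R h))) \<partial>lborel) \<partial>lborel)"
        by (simp only: sum_distrib_left ac_simps)
      also have "\<dots> = (\<integral>\<^sup>+s. indicator {0..1::real} s * (ennreal (norm h) * (\<Sum>i\<in>Basis. \<integral>\<^sup>+y. indicator (cball 0 (real n)) y * e \<epsilon> (g i) (y - s *\<^sub>R h) \<partial>lborel)) \<partial>lborel)"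
      proof (rule nn_integral_cong)
        fix s :: real
        let ?F = "\<lambda>i y. indicator (cball 0 (real n)) y * e \<epsilon> (g i) (y - s *\<^sub>R h)"
        have m: "?F i \<in> borel_measurable lborel" if "i \<in> Basis" for i
        proof -
          have [measurable]: "g i \<in> borel_measurable borel" by (rule gm[OF that])
          show ?thesis by measurable
        qed
        have m2: "(\<lambda>y. \<Sum>i\<in>Basis. ?F i y) \<in> borel_measurable lborel" by (rule borel_measurable_sum) (rule m)
        show "(\<integral>\<^sup>+y. indicator {0..1::real} s * (ennreal (norm h) * (\<Sum>i\<in>Basis. ?F i y)) \<partial>lborel) =
           indicator {0..1::real} s * (ennreal (norm h) * (\<Sum>i\<in>Basis. \<integral>\<^sup>+y. ?F i y \<partial>lborel))"
          by (simp only: nn_integral_cmult[OF borel_measurable_times_ennreal[OF borel_measurable_const m2]]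
            nn_integral_cmult[OF m2] nn_integral_sum[OF m])
      qed
      also have "\<dots> \<le> (\<integral>\<^sup>+s. indicator {0..1::real} s * (ennreal (norm h) * (\<Sum>i\<in>(Basis::'a set). ennreal (\<delta> / N))) \<partial>lborel)"
      proof (rule nn_integral_mono)
        fix s :: real
        show "indicator {0..1::real} s * (ennreal (norm h) * (\<Sum>i\<in>Basis. \<integral>\<^sup>+y. indicator (cball 0 (real n)) y * e \<epsilon> (g i) (y - s *\<^sub>R h) \<partial>lborel)) \<le> indicator {0..1::real} s * (ennreal (norm h) * (\<Sum>i\<in>(Basis::'a set). ennreal (\<delta> / N)))"
        proof (cases "s \<in> {0..1}")
          case True
          then show ?thesis by (intro mult_left_mono sum_mono 3) auto
        next
          case False
          then show ?thesis by simp
        qed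
      qed
      also have "\<dots> = ennreal (norm h) * (\<Sum>i\<in>(Basis::'a set). ennreal (\<delta> / N))"
        by (simp add: nn_integral_multc)
      also have "\<dots> = ennreal (norm h * real DIM('a) * (\<delta> / N))"
      proof -
        have "ennreal (norm h * real DIM('a) * (\<delta> / N)) = ennreal (norm h) * ennreal (real DIM('a)) * ennreal (\<delta> / N)"
          using dN by (simp only: ennreal_mult less_imp_le norm_ge_zero of_nat_0_le_iff mult_nonneg_nonneg)
        then show ?thesis by (simp add: ennreal_of_nat_eq_real_of_nat mult.assoc)
      qed
      finally have 4: "(\<integral>\<^sup>+y. indicator (cball 0 (real n)) y * (\<integral>\<^sup>+s. indicator {0..1::real} s * (ennreal (norm h) * (\<Sum>i\<in>Basis. e \<epsilon> (g i) (y - s *\<^sub>R h))) \<partial>lborel) \<partial>lborel) \<le> ennreal (norm h * real DIM('a) * (\<delta> / N))" .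
      have "(\<integral>\<^sup>+y. indicator (cball 0 (real n)) y * (A y - B y) \<partial>lborel) \<le> (\<integral>\<^sup>+y. indicator (cball 0 (real n)) y * E \<epsilon> y \<partial>lborel)"
        by (intro nn_integral_mono mult_left_mono) (auto simp: ennreal_minus_le_iff ABE[OF eps] Afin)
      also have "\<dots> = (\<integral>\<^sup>+y. indicator (cball 0 (real n)) y * e \<epsilon> f y \<partial>lborel) + ((\<integral>\<^sup>+y. indicator (cball 0 (real n)) y * e \<epsilon> f (y - h) \<partial>lborel) +
          (\<integral>\<^sup>+y. indicator (cball 0 (real n)) y * (\<integral>\<^sup>+s. indicator {0..1::real} s * (ennreal (norm h) * (\<Sum>i\<in>Basis. e \<epsilon> (g i) (y - s *\<^sub>R h))) \<partial>lborel) \<partial>lborel))"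
        (is "_ = _ + ((\<integral>\<^sup>+y. ?F2 y \<partial>lborel) + (\<integral>\<^sup>+y. ?F3 y \<partial>lborel))")
      proof -
        have m: "(\<lambda>y. indicator (cball 0 (real n)) y * e \<epsilon> f y) \<in> borel_measurable lborel"
          "?F2 \<in> borel_measurable lborel" "?F3 \<in> borel_measurable lborel" by measurable
        show ?thesis unfolding E_def distrib_left
          by (simp only: nn_integral_add[OF m(1) borel_measurable_add[OF m(2,3)]] nn_integral_add[OF m(2,3)])
      qed
      also have "\<dots> \<le> ennreal (\<delta> / N) + (ennreal (\<delta> / N) + ennreal (norm h * real DIM('a) * (\<delta> / N)))"
        by (intro add_mono 1 2 4)
      also have "\<dots> = ennreal (\<delta> / N + (\<delta> / N + norm h * real DIM('a) * (\<delta> / N)))"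
        using dN by (simp only: ennreal_plus less_imp_le mult_nonneg_nonneg add_nonneg_nonneg norm_ge_zero of_nat_0_le_iff)
      also have "\<delta> / N + (\<delta> / N + norm h * real DIM('a) * (\<delta> / N)) = N * (\<delta> / N)"
      proof -
        have "x + (x + norm h * real DIM('a) * x) = N * x" for x :: real by (simp add: N_def algebra_simps)
        then show ?thesis .
      qed
      also have "\<dots> = \<delta>" using N by simp
      finally show ?thesis .
    qed
    have "(\<integral>\<^sup>+y. indicator (cball 0 (real n)) y * (A y - B y) \<partial>lborel) \<le> 0"
      by (rule ennreal_le_epsilon, unfold add_0_left, rule le)
    moreover have "(\<lambda>y. indicator (cball 0 (real n)) y * (A y - B y)) \<in> borel_measurable lborel" by measurable
    ultimately show ?thesis by (simp add: nn_integral_0_iff_AE)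
  qed
  then have "AE y in lborel. \<forall>n. indicator (cball 0 (real n)) y * (A y - B y) = 0" by (simp only: AE_all_countable) blast
  then have "AE y in lborel. A y \<le> B y"
  proof eventually_elim
    case (elim y)
    obtain n where "norm y \<le> real n" using real_arch_simple by blast
    then have "A y - B y = 0" using elim[rule_format, of n] by simp
    then show ?case by (simp add: diff_eq_0_iff_ennreal)
  qed
  then show ?thesis unfolding A_def B_def .
qed

section \<open>Hoelder's inequality\<close>

definition Lnorm :: "real \<Rightarrow> ('a::euclidean_space \<Rightarrow> real) \<Rightarrow> real" where
  "Lnorm p f = (LINT x|lborel. \<bar>f x\<bar> powr p) powr (1 / p)"

lemma Lnorm_nonneg: "Lnorm p f \<ge> 0" by (simp add: Lnorm_def)

text \<open>Young's inequality for the normalised functions; if one of the norms is 0, the product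
  vanishes almost everywhere. With a nonnegative integral on the left, integrability of the product
  is part of the conclusion.\<close>

lemma Hoelder:
  fixes f g :: "'a::euclidean_space \<Rightarrow> real"
  assumes [measurable]: "f \<in> borel_measurable borel" "g \<in> borel_measurable borel"
    and f: "integrable lborel (\<lambda>x. \<bar>f x\<bar> powr p)" and g: "integrable lborel (\<lambda>x. \<bar>g x\<bar> powr q)"
    and pq: "p > 1" "q > 1" "1 / p + 1 / q = 1"
  shows "(\<integral>\<^sup>+x. ennreal (\<bar>f x\<bar> * \<bar>g x\<bar>) \<partial>lborel) \<le> ennreal (Lnorm p f * Lnorm q g)"
proof -
  define a where "a = (LINT x|lborel. \<bar>f x\<bar> powr p)"
  define b where "b = (LINT x|lborel. \<bar>g x\<bar> powr q)"
  have ab: "a \<ge> 0" "b \<ge> 0" by (simp_all add: a_def b_def)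
  have z: "(\<integral>\<^sup>+x. ennreal (\<bar>f x\<bar> * \<bar>g x\<bar>) \<partial>lborel) = 0" if "a = 0 \<or> b = 0"
  proof -
    have "AE x in lborel. ennreal (\<bar>f x\<bar> * \<bar>g x\<bar>) = 0"
    proof (cases "a = 0")
      case True
      then have "AE x in lborel. \<bar>f x\<bar> powr p = 0"
        unfolding a_def using f by (subst (asm) integral_nonneg_eq_0_iff_AE) auto
      then show ?thesis by eventually_elim simp
    next
      case False
      then have "b = 0" using that by simp
      then have "AE x in lborel. \<bar>g x\<bar> powr q = 0"
        unfolding b_def using g by (subst (asm) integral_nonneg_eq_0_iff_AE) auto
      then show ?thesis by eventually_elim simp
    qed
    then show ?thesis by (subst nn_integral_0_iff_AE) auto
  qed
  show ?thesis
  proof (cases "a = 0 \<or> b = 0")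
    case True then show ?thesis using z by simp
  next
    case False
    then have pos: "a > 0" "b > 0" using ab by auto
    define \<alpha> where "\<alpha> = a powr (1 / p)"
    define \<beta> where "\<beta> = b powr (1 / q)"
    have \<alpha>\<beta>: "\<alpha> > 0" "\<beta> > 0" using pos by (auto simp: \<alpha>_def \<beta>_def)
    have \<alpha>p: "\<alpha> powr p = a" "\<beta> powr q = b" using pos pq by (auto simp: \<alpha>_def \<beta>_def powr_powr)
    have pw: "\<bar>f x\<bar> * \<bar>g x\<bar> \<le> \<alpha> * \<beta> * ((1 / (p * a)) * \<bar>f x\<bar> powr p + (1 / (q * b)) * \<bar>g x\<bar> powr q)" for x
    proof -
      have "(\<bar>f x\<bar> / \<alpha>) * (\<bar>g x\<bar> / \<beta>) \<le> (\<bar>f x\<bar> / \<alpha>) powr p / p + (\<bar>g x\<bar> / \<beta>) powr q / q"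
        using \<alpha>\<beta> by (intro Youngs_inequality pq) auto
      also have "\<dots> = (1 / (p * a)) * \<bar>f x\<bar> powr p + (1 / (q * b)) * \<bar>g x\<bar> powr q"
        using \<alpha>\<beta> by (simp add: powr_divide \<alpha>p mult.commute)
      finally have "(\<alpha> * \<beta>) * ((\<bar>f x\<bar> / \<alpha>) * (\<bar>g x\<bar> / \<beta>)) \<le> (\<alpha> * \<beta>) * ((1 / (p * a)) * \<bar>f x\<bar> powr p + (1 / (q * b)) * \<bar>g x\<bar> powr q)"
        using \<alpha>\<beta> by (intro mult_left_mono) auto
      then show ?thesis using \<alpha>\<beta> by simp
    qed
    have "(\<integral>\<^sup>+x. ennreal (\<bar>f x\<bar> * \<bar>g x\<bar>) \<partial>lborel) \<le> (\<integral>\<^sup>+x. ennreal (\<alpha> * \<beta> * ((1 / (p * a)) * \<bar>f x\<bar> powr p + (1 / (q * b)) * \<bar>g x\<bar> powr q)) \<partial>lborel)"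
      by (intro nn_integral_mono ennreal_leI pw)
    also have "\<dots> = ennreal (LINT x|lborel. \<alpha> * \<beta> * ((1 / (p * a)) * \<bar>f x\<bar> powr p + (1 / (q * b)) * \<bar>g x\<bar> powr q))"
      using f g \<alpha>\<beta> pos pq by (intro nn_integral_eq_integral AE_I2) auto
    also have "(LINT x|lborel. \<alpha> * \<beta> * ((1 / (p * a)) * \<bar>f x\<bar> powr p + (1 / (q * b)) * \<bar>g x\<bar> powr q)) = \<alpha> * \<beta> * ((1 / (p * a)) * a + (1 / (q * b)) * b)"
      using f g by (simp add: a_def b_def)
    also have "\<dots> = \<alpha> * \<beta>" using pos pq by simp
    finally show ?thesis by (simp add: \<alpha>_def \<beta>_def a_def b_def Lnorm_def)
  qed
qed

section \<open>The commutator and the localised energy at a fixed time\<close>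

lemma conjugate_exponent_gt_1:
  fixes p q :: real
  assumes "p > 1" "1 / p + 1 / q = 1" shows "q > 1"
proof -
  have "1 / q = 1 - 1 / p" using assms by simp
  moreover have "0 < 1 - 1 / p" "1 - 1 / p < 1" using assms by (auto simp: field_simps)
  ultimately have "0 < 1 / q" "1 / q < 1" by auto
  then show ?thesis by (simp add: field_simps split: if_splits)
qed

lemma Lnorm_mono:
  assumes "integrable lborel (\<lambda>x. \<bar>g x\<bar> powr p)" "f \<in> borel_measurable borel" "\<And>x. \<bar>f x\<bar> \<le> \<bar>g x\<bar>" "p > 0"
  shows "Lnorm p f \<le> Lnorm p g" "integrable lborel (\<lambda>x. \<bar>f x\<bar> powr p)"
proof -
  have [measurable]: "f \<in> borel_measurable borel" by fact
  show i: "integrable lborel (\<lambda>x. \<bar>f x\<bar> powr p)"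
    by (rule Bochner_Integration.integrable_bound[OF assms(1)]) (use assms in \<open>auto intro!: powr_mono2\<close>)
  show "Lnorm p f \<le> Lnorm p g"
    unfolding Lnorm_def using assms(3,4)
    by (intro powr_mono2 Bochner_Integration.integral_mono i assms(1)) auto
qed

lemma Lnorm_translate:
  assumes [measurable]: "f \<in> borel_measurable borel"
  shows "Lnorm p (\<lambda>x. f (x - h)) = Lnorm p f"
  unfolding Lnorm_def using lborel_translate_integral[of "\<lambda>x. \<bar>f x\<bar> powr p" "- h"] by simp

lemma Lp_difference_bound:
  fixes u :: "'a::euclidean_space \<Rightarrow> real"
  assumes [measurable]: "u \<in> borel_measurable borel" and u: "integrable lborel (\<lambda>x. \<bar>u x\<bar> powr p)" and p: "p > 1"
  shows "integrable lborel (\<lambda>x. \<bar>u (x - h) - u x\<bar> powr p)"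
    "Lnorm p (\<lambda>x. u (x - h) - u x) \<le> (3 powr p * (2 * (LINT x|lborel. \<bar>u x\<bar> powr p))) powr (1 / p)"
proof -
  have uh: "integrable lborel (\<lambda>x. \<bar>u (x - h)\<bar> powr p)" using lborel_translate_integrable[OF u] by simp
  have I: "integrable lborel (\<lambda>x. 3 powr p * (\<bar>u (x - h)\<bar> powr p + \<bar>u x\<bar> powr p))" using u uh by simp
  have le: "\<bar>u (x - h) - u x\<bar> powr p \<le> 3 powr p * (\<bar>u (x - h)\<bar> powr p + \<bar>u x\<bar> powr p)" for x
  proof -
    have "\<bar>u (x - h) - u x\<bar> powr p \<le> (\<bar>u (x - h)\<bar> + \<bar>u x\<bar> + 0) powr p" using p by (intro powr_mono2) auto
    also have "\<dots> \<le> 3 powr p * (\<bar>u (x - h)\<bar> powr p + \<bar>u x\<bar> powr p + 0 powr p)" using p by (intro powr_sum3_le) auto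
    finally show ?thesis by simp
  qed
  show i: "integrable lborel (\<lambda>x. \<bar>u (x - h) - u x\<bar> powr p)"
    by (rule Bochner_Integration.integrable_bound[OF I]) (use le in auto)
  have "(LINT x|lborel. \<bar>u (x - h) - u x\<bar> powr p) \<le> (LINT x|lborel. 3 powr p * (\<bar>u (x - h)\<bar> powr p + \<bar>u x\<bar> powr p))"
    by (intro Bochner_Integration.integral_mono i I le)
  also have "\<dots> = 3 powr p * (2 * (LINT x|lborel. \<bar>u x\<bar> powr p))"
    using u uh lborel_translate_integral[of "\<lambda>x. \<bar>u x\<bar> powr p" "- h"] by simp
  finally show "Lnorm p (\<lambda>x. u (x - h) - u x) \<le> (3 powr p * (2 * (LINT x|lborel. \<bar>u x\<bar> powr p))) powr (1 / p)"
    unfolding Lnorm_def using p by (intro powr_mono2) auto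
qed

text \<open>The ball on which the translated factor is seen grows by the length of the translation;
  translation invariance then makes the bound independent of \<open>w\<close>.\<close>

lemma Hoelder_cball_shift:
  fixes f G :: "'a::euclidean_space \<Rightarrow> real"
  assumes [measurable]: "f \<in> borel_measurable borel" "G \<in> borel_measurable borel"
    and f: "integrable lborel (\<lambda>x. \<bar>f x\<bar> powr p)" and G: "\<And>r. integrable lborel (\<lambda>x. indicator (cball 0 r) x * \<bar>G x\<bar> powr q)"
    and pq: "p > 1" "1 / p + 1 / q = 1" and w: "norm w \<le> a"
  shows "(\<integral>\<^sup>+y. indicator (cball 0 k) y * ennreal (\<bar>f y\<bar> * \<bar>G (y - w)\<bar>) \<partial>lborel) \<le> ennreal (Lnorm p f * Lnorm q (\<lambda>x. indicator (cball 0 (k + a)) x * G x))"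
proof -
  have q: "q > 1" by (rule conjugate_exponent_gt_1[OF pq])
  let ?G = "\<lambda>x. indicator (cball 0 (k + a)) x * G x" and ?H = "\<lambda>y. indicator (cball 0 k) y * G (y - w)"
  have Gi: "integrable lborel (\<lambda>x. \<bar>?G x\<bar> powr q)"
    by (rule Bochner_Integration.integrable_cong[THEN iffD1, OF refl _ G[of "k + a"]]) (use q in \<open>auto simp: indicator_def\<close>)
  have Gi': "integrable lborel (\<lambda>x. \<bar>?G (x - w)\<bar> powr q)" using lborel_translate_integrable[OF Gi] by simp
  have le: "\<bar>?H x\<bar> \<le> \<bar>?G (x - w)\<bar>" for x
  proof -
    have "norm (x - w) \<le> k + a" if "norm x \<le> k" using norm_triangle_ineq4[of x w] that w by simp
    then show ?thesis by (auto simp: indicator_def)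
  qed
  have Hm: "?H \<in> borel_measurable borel" by measurable
  have "(\<integral>\<^sup>+y. indicator (cball 0 k) y * ennreal (\<bar>f y\<bar> * \<bar>G (y - w)\<bar>) \<partial>lborel) = (\<integral>\<^sup>+y. ennreal (\<bar>f y\<bar> * \<bar>?H y\<bar>) \<partial>lborel)"
    by (intro nn_integral_cong) (auto simp: indicator_def)
  also have "\<dots> \<le> ennreal (Lnorm p f * Lnorm q ?H)"
    by (rule Hoelder) (use f pq q Lnorm_mono(2)[OF Gi' Hm le] in auto)
  also have "\<dots> \<le> ennreal (Lnorm p f * Lnorm q ?G)"
  proof (intro ennreal_leI mult_left_mono Lnorm_nonneg)
    have "Lnorm q ?H \<le> Lnorm q (\<lambda>x. ?G (x - w))" by (rule Lnorm_mono(1)[OF Gi' Hm le]) (use q in simp)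
    also have "\<dots> = Lnorm q ?G" by (rule Lnorm_translate) measurable
    finally show "Lnorm q ?H \<le> Lnorm q ?G" .
  qed
  finally show ?thesis .
qed

lemma loc_int_Hoelder:
  fixes f G :: "'a::euclidean_space \<Rightarrow> real"
  assumes [measurable]: "f \<in> borel_measurable borel" "G \<in> borel_measurable borel"
    and f: "integrable lborel (\<lambda>x. \<bar>f x\<bar> powr p)" and G: "\<And>r. integrable lborel (\<lambda>x. indicator (cball 0 r) x * \<bar>G x\<bar> powr q)"
    and pq: "p > 1" "1 / p + 1 / q = 1"
  shows "loc_int (\<lambda>x. f x * G x)"
  unfolding loc_int_def
proof (intro conjI allI)
  fix r
  show "integrable lborel (\<lambda>x. indicator (cball 0 r) x *\<^sub>R (f x * G x))"
  proof (subst integrable_iff_bounded, intro conjI)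
    have "(\<integral>\<^sup>+x. ennreal (norm (indicator (cball 0 r) x *\<^sub>R (f x * G x))) \<partial>lborel) = (\<integral>\<^sup>+y. indicator (cball 0 r) y * ennreal (\<bar>f y\<bar> * \<bar>G (y - 0)\<bar>) \<partial>lborel)"
      by (intro nn_integral_cong) (auto simp: indicator_def abs_mult)
    also have "\<dots> \<le> ennreal (Lnorm p f * Lnorm q (\<lambda>x. indicator (cball 0 (r + 0)) x * G x))"
      by (rule Hoelder_cball_shift) (use f G pq in auto)
    also have "\<dots> < \<infinity>" by simp
    finally show "(\<integral>\<^sup>+x. ennreal (norm (indicator (cball 0 r) x *\<^sub>R (f x * G x))) \<partial>lborel) < \<infinity>" .
  qed measurable
qed measurable

lemma loc_int_sum:
  fixes f :: "'i \<Rightarrow> 'a::euclidean_space \<Rightarrow> real"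
  assumes "\<And>i. i \<in> I \<Longrightarrow> loc_int (f i)" shows "loc_int (\<lambda>x. \<Sum>i\<in>I. f i x)"
  using assms unfolding loc_int_def
  by (auto simp: sum_distrib_left intro!: borel_measurable_sum Bochner_Integration.integrable_sum)

text \<open>A constant fixed once for the space, hence independent of the scale, of the time and of
  the fields.\<close>

definition kern_const :: "'a::euclidean_space itself \<Rightarrow> real" where
  "kern_const _ = (SOME M. M > 0 \<and> (\<forall>\<epsilon> z. \<epsilon> > 0 \<longrightarrow> kern \<epsilon> (\<epsilon> *\<^sub>R (z::'a)) * \<epsilon> ^ DIM('a) \<le> M \<and>
     norm (gkern \<epsilon> (\<epsilon> *\<^sub>R (z::'a))) * \<epsilon> ^ Suc DIM('a) \<le> M))"

lemma kern_const:
  "kern_const TYPE('a::euclidean_space) > 0"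
  "\<epsilon> > 0 \<Longrightarrow> kern \<epsilon> (\<epsilon> *\<^sub>R (z::'a)) * \<epsilon> ^ DIM('a) \<le> kern_const TYPE('a)"
  "\<epsilon> > 0 \<Longrightarrow> norm (gkern \<epsilon> (\<epsilon> *\<^sub>R (z::'a))) * \<epsilon> ^ Suc DIM('a) \<le> kern_const TYPE('a)"
proof -
  have "\<exists>M. M > 0 \<and> (\<forall>\<epsilon> z. \<epsilon> > 0 \<longrightarrow> kern \<epsilon> (\<epsilon> *\<^sub>R (z::'a)) * \<epsilon> ^ DIM('a) \<le> M \<and>
     norm (gkern \<epsilon> (\<epsilon> *\<^sub>R (z::'a))) * \<epsilon> ^ Suc DIM('a) \<le> M)"
    by (rule kern_bounds[where 'a='a]) blast
  from someI_ex[OF this] show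
    "kern_const TYPE('a::euclidean_space) > 0"
    "\<epsilon> > 0 \<Longrightarrow> kern \<epsilon> (\<epsilon> *\<^sub>R (z::'a)) * \<epsilon> ^ DIM('a) \<le> kern_const TYPE('a)"
    "\<epsilon> > 0 \<Longrightarrow> norm (gkern \<epsilon> (\<epsilon> *\<^sub>R (z::'a))) * \<epsilon> ^ Suc DIM('a) \<le> kern_const TYPE('a)"
    unfolding kern_const_def by auto
qed

text \<open>The p-norm distances between \<open>u\<close> and its translates at scale
  \<open>\<epsilon>\<close>, integrated over a ball that contains the support of the unscaled
  kernel. In the commutator bound it is the factor that tends to 0.\<close>

definition trans_mod :: "real \<Rightarrow> ('a::euclidean_space \<Rightarrow> real) \<Rightarrow> real \<Rightarrow> ennreal" where
  "trans_mod p u \<epsilon> = (\<integral>\<^sup>+z. indicator (cball 0 (real DIM('a))) z * ennreal (Lnorm p (\<lambda>y. u (y - \<epsilon> *\<^sub>R z) - u y)) \<partial>lborel)"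

lemma Lnorm_measurable [measurable]:
  fixes f :: "'b \<Rightarrow> 'a::euclidean_space \<Rightarrow> real"
  assumes [measurable]: "(\<lambda>(z, y). f z y) \<in> borel_measurable (M \<Otimes>\<^sub>M lborel)"
  shows "(\<lambda>z. Lnorm p (f z)) \<in> borel_measurable M"
  unfolding Lnorm_def by measurable

text \<open>The bound depends neither on \<open>\<epsilon>\<close> nor on \<open>u\<close> beyond
  \<open>C\<close>; it yields a majorant in time for the removal of the mollification.\<close>

lemma trans_mod_bound:
  fixes u :: "'a::euclidean_space \<Rightarrow> real"
  assumes "u \<in> borel_measurable borel" "integrable lborel (\<lambda>x. \<bar>u x\<bar> powr p)" "p > 1" "(LINT x|lborel. \<bar>u x\<bar> powr p) \<le> C"
  shows "trans_mod p u \<epsilon> \<le> ennreal (measure lborel (cball (0::'a) (real DIM('a))) * (3 powr p * (2 * C)) powr (1 / p))"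
proof -
  have fin: "emeasure lborel (cball (0::'a) (real DIM('a))) = ennreal (measure lborel (cball (0::'a) (real DIM('a))))"
    by (intro emeasure_eq_ennreal_measure) (use emeasure_bounded_finite[OF bounded_cball] in \<open>auto simp: less_top\<close>)
  have "trans_mod p u \<epsilon> \<le> (\<integral>\<^sup>+z. indicator (cball (0::'a) (real DIM('a))) z * ennreal ((3 powr p * (2 * C)) powr (1 / p)) \<partial>lborel)"
    unfolding trans_mod_def
  proof (intro nn_integral_mono mult_left_mono ennreal_leI)
    fix z
    have "0 \<le> (LINT x|lborel. \<bar>u x\<bar> powr p)" by simp
    then have "(3 powr p * (2 * (LINT x|lborel. \<bar>u x\<bar> powr p))) powr (1 / p) \<le> (3 powr p * (2 * C)) powr (1 / p)"
      using assms by (intro powr_mono2 mult_left_mono) auto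
    with Lp_difference_bound(2)[OF assms(1-3), of "\<epsilon> *\<^sub>R z"]
    show "Lnorm p (\<lambda>y. u (y - \<epsilon> *\<^sub>R z) - u y) \<le> (3 powr p * (2 * C)) powr (1 / p)" by linarith
  qed auto
  also have "\<dots> = ennreal (measure lborel (cball (0::'a) (real DIM('a)))) * ennreal ((3 powr p * (2 * C)) powr (1 / p))"
    by (subst nn_integral_multc) (auto simp: fin)
  finally show ?thesis by (simp add: ennreal_mult)
qed

text \<open>The vectors \<open>z\<close> range over a fixed ball, so all translations by multiples
  \<open>1 / Suc n\<close> of them become short at once, and continuity of translations applies
  uniformly under the integral.\<close>

lemma trans_mod_tendsto:
  fixes u :: "'a::euclidean_space \<Rightarrow> real"
  assumes um: "u \<in> borel_measurable borel" and u: "integrable lborel (\<lambda>x. \<bar>u x\<bar> powr p)" and p: "p > 1"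
  shows "(\<lambda>n. trans_mod p u (1 / Suc n)) \<longlonglongrightarrow> 0"
proof (rule order_tendstoI)
  note [measurable] = um
  fix e :: ennreal assume "0 < e"
  then obtain e' where e': "0 < ennreal e'" "ennreal e' < e" using dense[of 0 e]
    by (metis ennreal_cases less_irrefl order_less_trans top.not_eq_extremum)
  then have e'0: "e' > 0" by simp
  define m where "m = measure lborel (cball (0::'a) (real DIM('a)))"
  have m: "m \<ge> 0" by (simp add: m_def)
  have fin: "emeasure lborel (cball (0::'a) (real DIM('a))) = ennreal m"
    unfolding m_def by (intro emeasure_eq_ennreal_measure) (use emeasure_bounded_finite[OF bounded_cball] in \<open>auto simp: less_top\<close>)
  \<comment> \<open>A p-th power, so that the p-norm of each difference is at most
    \<open>e' / (m + 1)\<close>.\<close>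
  define \<delta> where "\<delta> = (e' / (m + 1)) powr p"
  have \<delta>: "\<delta> > 0" using e'0 m by (simp add: \<delta>_def)
  obtain d where d: "d > 0" "\<And>h. norm h < d \<Longrightarrow> (\<integral>\<^sup>+x. ennreal (\<bar>u (x - h) - u x\<bar> powr p) \<partial>lborel) \<le> ennreal \<delta>"
    by (rule Lp_translation_continuous[OF um u p \<delta>]) blast
  have small: "Lnorm p (\<lambda>x. u (x - h) - u x) \<le> e' / (m + 1)" if "norm h < d" for h
  proof -
    have "ennreal (LINT x|lborel. \<bar>u (x - h) - u x\<bar> powr p) \<le> ennreal \<delta>"
      using d(2)[OF that] Lp_difference_bound(1)[OF um u p, of h] by (subst nn_integral_eq_integral[symmetric]) auto
    then have "(LINT x|lborel. \<bar>u (x - h) - u x\<bar> powr p) \<le> \<delta>" using \<delta> by simp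
    then have "Lnorm p (\<lambda>x. u (x - h) - u x) \<le> \<delta> powr (1 / p)" unfolding Lnorm_def using p by (intro powr_mono2) auto
    also have "\<dots> = e' / (m + 1)" using p e'0 m by (simp add: \<delta>_def powr_powr)
    finally show ?thesis .
  qed
  obtain N where N: "real DIM('a) / d < real (Suc N)" using reals_Archimedean2 by (metis less_trans lessI of_nat_less_iff)
  show "\<forall>\<^sub>F n in sequentially. trans_mod p u (1 / Suc n) < e"
  proof (rule eventually_sequentiallyI)
    fix n assume n: "N \<le> n"
    have nd: "real DIM('a) / real (Suc n) < d"
    proof -
      have "real DIM('a) / d < real (Suc n)" using N n by linarith
      then show ?thesis using d(1) by (simp add: field_simps)
    qed
    have "trans_mod p u (1 / Suc n) \<le> (\<integral>\<^sup>+z. indicator (cball (0::'a) (real DIM('a))) z * ennreal (e' / (m + 1)) \<partial>lborel)"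
      unfolding trans_mod_def
    proof (rule nn_integral_mono)
      fix z :: 'a
      show "indicator (cball 0 (real DIM('a))) z * ennreal (Lnorm p (\<lambda>y. u (y - (1 / Suc n) *\<^sub>R z) - u y)) \<le> indicator (cball (0::'a) (real DIM('a))) z * ennreal (e' / (m + 1))"
      proof (cases "norm z \<le> real DIM('a)")
        case True
        then have "norm z / real (Suc n) \<le> real DIM('a) / real (Suc n)" by (intro divide_right_mono) auto
        then have "norm ((1 / Suc n) *\<^sub>R z) < d" using nd by simp
        from small[OF this] show ?thesis by (intro mult_left_mono ennreal_leI) auto
      qed simp
    qed
    also have "\<dots> = ennreal m * ennreal (e' / (m + 1))" by (subst nn_integral_multc) (auto simp: fin)
    also have "\<dots> = ennreal (m * (e' / (m + 1)))" using m e'0 by (subst ennreal_mult[symmetric]) auto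
    also have "\<dots> \<le> ennreal e'" using m e'0 by (intro ennreal_leI) (simp add: field_simps)
    also have "\<dots> < e" by (rule e')
    finally show "trans_mod p u (1 / Suc n) < e" .
  qed
qed auto

text \<open>The data at one fixed time: a slice of the solution, a slice of the field, and
  \<open>g i\<close> as the weak derivative of the field in direction \<open>i\<close>.\<close>

locale spatial =
  fixes u :: "'a::euclidean_space \<Rightarrow> real" and b :: "'a \<Rightarrow> 'a" and g :: "'a \<Rightarrow> 'a \<Rightarrow> 'a" and p q :: real
  assumes pq: "p > 1" "1 / p + 1 / q = 1"
    and um [measurable]: "u \<in> borel_measurable borel" and up: "integrable lborel (\<lambda>x. \<bar>u x\<bar> powr p)"
    and bm [measurable]: "b \<in> borel_measurable borel"
    and gm0: "\<And>i. i \<in> Basis \<Longrightarrow> g i \<in> borel_measurable borel"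
    and bq: "\<And>r. integrable lborel (\<lambda>x. indicator (cball 0 r) x * norm (b x) powr q)"
    and gq: "\<And>i r. i \<in> Basis \<Longrightarrow> integrable lborel (\<lambda>x. indicator (cball 0 r) x * norm (g i x) powr q)"
    and kw: "\<And>i j. i \<in> Basis \<Longrightarrow> j \<in> Basis \<Longrightarrow> kweak i (\<lambda>x. b x \<bullet> j) (\<lambda>x. g i x \<bullet> j)"
begin

section \<open>Mollified equation and commutator of a single time slice\<close>

definition d :: "'a \<Rightarrow> real" where "d x = (\<Sum>i\<in>Basis. g i x \<bullet> i)"

definition NG :: "real \<Rightarrow> real" where "NG r = (\<Sum>i\<in>Basis. Lnorm q (\<lambda>x. indicator (cball 0 r) x * norm (g i x)))"

lemma gm [measurable]: "i \<in> Basis \<Longrightarrow> g i \<in> borel_measurable borel" by (rule gm0)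

lemma dm [measurable]: "d \<in> borel_measurable borel"
  unfolding d_def[abs_def] by measurable

lemma d_le: "\<bar>d x\<bar> \<le> (\<Sum>i\<in>Basis. norm (g i x))"
  unfolding d_def by (intro order_trans[OF sum_abs] sum_mono Basis_le_norm)

lemma loc_int_d: "loc_int d"
  unfolding d_def[abs_def] using kw by (intro loc_int_sum) (auto simp: kweak_def)

lemma loc_int_u: "loc_int u"
proof -
  have "integrable lborel (\<lambda>x::'a. indicator (cball 0 r) x * \<bar>1::real\<bar> powr q)" for r :: real
    using emeasure_bounded_finite[OF bounded_cball, of "0::'a" r] by (auto intro!: integrable_real_indicator)
  from loc_int_Hoelder[of u "\<lambda>_. 1", OF _ _ up this pq] show ?thesis by simp
qed

lemma component_powr_integrable:
  assumes "\<And>r. integrable lborel (\<lambda>x. indicator (cball 0 r) x * norm (F x) powr q)" "j \<in> Basis"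
    and [measurable]: "F \<in> borel_measurable borel"
  shows "integrable lborel (\<lambda>x. indicator (cball 0 r) x * \<bar>(F x :: 'a) \<bullet> j\<bar> powr q)"
proof (rule Bochner_Integration.integrable_bound[OF assms(1)[of r]])
  have "q > 1" by (rule conjugate_exponent_gt_1[OF pq])
  then show "AE x in lborel. norm (indicator (cball 0 r) x * \<bar>F x \<bullet> j\<bar> powr q) \<le> norm (indicator (cball 0 r) x * norm (F x) powr q)"
    using Basis_le_norm[OF assms(2)] by (auto simp: indicator_def intro!: powr_mono2 AE_I2)
qed measurable

lemma loc_int_ub: "j \<in> Basis \<Longrightarrow> loc_int (\<lambda>x. u x * (b x \<bullet> j))"
  by (rule loc_int_Hoelder[OF _ _ up component_powr_integrable[OF bq] pq]) auto

lemma loc_int_ud: "loc_int (\<lambda>x. u x * d x)"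
proof -
  have "loc_int (\<lambda>x. u x * (g i x \<bullet> i))" if "i \<in> Basis" for i
    using gm[OF that] by (intro loc_int_Hoelder[OF _ _ up component_powr_integrable[OF gq] pq]) (auto simp: that)
  then show ?thesis unfolding d_def sum_distrib_left by (rule loc_int_sum)
qed

text \<open>The right-hand side of the mollified equation: testing with the kernel centred at
  \<open>y\<close> makes this the time derivative of \<open>moll \<epsilon> u y\<close>. The minus
  sign comes from differentiating \<open>kern \<epsilon> (y - x)\<close> with respect to
  \<open>x\<close>.\<close>

definition Fl :: "real \<Rightarrow> 'a \<Rightarrow> real" where
  "Fl \<epsilon> y = (LINT x|lborel. u x * (d x * kern \<epsilon> (y - x) - b x \<bullet> gkern \<epsilon> (y - x)))"

text \<open>The DiPerna--Lions commutator: the defect with which the mollification of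
  \<open>u\<close> satisfies the transport equation.\<close>

definition comm :: "real \<Rightarrow> 'a \<Rightarrow> real" where
  "comm \<epsilon> y = Fl \<epsilon> y + b y \<bullet> gmoll \<epsilon> u y"

lemma gkern_integrable: "loc_int f \<Longrightarrow> \<epsilon> > 0 \<Longrightarrow> integrable lborel (\<lambda>x. f x *\<^sub>R gkern \<epsilon> ((y::'a) - x))"
  by (rule integrable_compact_mult_vector[OF _ reflected_support[OF continuous_gkern gkern_support]])

lemma inner_gkern_eq: "f * (v \<bullet> gkern \<epsilon> z) = (\<Sum>j\<in>Basis. ((f * (v \<bullet> j)) *\<^sub>R gkern \<epsilon> z) \<bullet> j)" for v z :: 'a
  by (subst euclidean_inner) (simp add: sum_distrib_left mult.assoc)

lemma integrable_ub: "\<epsilon> > 0 \<Longrightarrow> integrable lborel (\<lambda>x. u x * (b x \<bullet> gkern \<epsilon> (y - x)))"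
  unfolding inner_gkern_eq by (intro Bochner_Integration.integrable_sum integrable_inner_left gkern_integrable loc_int_ub)

lemma integrable_ud: "\<epsilon> > 0 \<Longrightarrow> integrable lborel (\<lambda>x. u x * (d x * kern \<epsilon> (y - x)))"
  using kern_mult_integrable[OF loc_int_ud, of \<epsilon> y] by (simp add: ac_simps)

lemma integrable_b: "\<epsilon> > 0 \<Longrightarrow> integrable lborel (\<lambda>x. b x \<bullet> gkern \<epsilon> (y - x))"
proof -
  assume "\<epsilon> > 0"
  have "integrable lborel (\<lambda>x. 1 * (b x \<bullet> gkern \<epsilon> (y - x)))"
    unfolding inner_gkern_eq using kw nonempty_Basis \<open>\<epsilon> > 0\<close>
    by (intro Bochner_Integration.integrable_sum integrable_inner_left gkern_integrable) (auto simp: kweak_def)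
  then show ?thesis by simp
qed

lemma Fl_eq: "\<epsilon> > 0 \<Longrightarrow> Fl \<epsilon> y = moll \<epsilon> (\<lambda>x. u x * d x) y - (\<Sum>j\<in>Basis. gmoll \<epsilon> (\<lambda>x. u x * (b x \<bullet> j)) y \<bullet> j)"
proof -
  assume e: "\<epsilon> > 0"
  have "Fl \<epsilon> y = (LINT x|lborel. u x * (d x * kern \<epsilon> (y - x))) - (LINT x|lborel. u x * (b x \<bullet> gkern \<epsilon> (y - x)))"
    unfolding Fl_def using integrable_ub[OF e] integrable_ud[OF e] by (simp add: right_diff_distrib)
  also have "(LINT x|lborel. u x * (b x \<bullet> gkern \<epsilon> (y - x))) = (\<Sum>j\<in>Basis. gmoll \<epsilon> (\<lambda>x. u x * (b x \<bullet> j)) y \<bullet> j)"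
    unfolding inner_gkern_eq gmoll_def using e
    by (subst Bochner_Integration.integral_sum)
      (auto intro!: integrable_inner_left gkern_integrable loc_int_ub sum.cong integral_inner_left simp del: inner_scaleR_left)
  finally show ?thesis by (simp add: moll_def ac_simps)
qed

lemma continuous_Fl: "\<epsilon> > 0 \<Longrightarrow> continuous_on UNIV (Fl \<epsilon>)"
proof -
  assume e: "\<epsilon> > 0"
  have "continuous_on UNIV (\<lambda>y. moll \<epsilon> (\<lambda>x. u x * d x) y - (\<Sum>j\<in>Basis. gmoll \<epsilon> (\<lambda>x. u x * (b x \<bullet> j)) y \<bullet> j))"
    using C1_moll[OF loc_int_ud e] C1_moll[OF loc_int_ub e]
    by (intro continuous_intros) (auto simp: C1_def intro: C1_continuous[OF C1_moll[OF loc_int_ud e]])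
  then show ?thesis using Fl_eq[OF e] by (simp add: fun_eq_iff[symmetric] cong: continuous_on_cong)
qed

text \<open>The weak partial derivatives are summed over the directions. Test functions of class C1
  are required because \<open>v\<close> will be a cutoff times a function of a mollification, and
  also a reflected kernel.\<close>

lemma weak_div_C1c:
  assumes v: "C1c v v'"
  shows "integrable lborel (\<lambda>x. b x \<bullet> v' x)" "integrable lborel (\<lambda>x. d x * v x)"
    "(LINT x|lborel. b x \<bullet> v' x) = - (LINT x|lborel. d x * v x)"
proof -
  have i1: "integrable lborel (\<lambda>x. (v' x \<bullet> i) * (b x \<bullet> i))" if "i \<in> Basis" for i
    using kw that by (intro C1c_integrable_products(2)[OF v]) (auto simp: kweak_def)
  have i2: "integrable lborel (\<lambda>x. v x * (g i x \<bullet> i))" if "i \<in> Basis" for i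
    using kw that by (intro C1c_integrable_products(1)[OF v]) (auto simp: kweak_def)
  have e1: "b x \<bullet> v' x = (\<Sum>i\<in>Basis. (v' x \<bullet> i) * (b x \<bullet> i))" for x by (subst euclidean_inner) (simp add: mult.commute)
  have e2: "d x * v x = (\<Sum>i\<in>Basis. v x * (g i x \<bullet> i))" for x by (subst mult.commute) (simp add: d_def sum_distrib_left)
  show "integrable lborel (\<lambda>x. b x \<bullet> v' x)" "integrable lborel (\<lambda>x. d x * v x)"
    unfolding e1 e2 by (auto intro!: Bochner_Integration.integrable_sum i1 i2)
  show "(LINT x|lborel. b x \<bullet> v' x) = - (LINT x|lborel. d x * v x)"
    unfolding e1 e2 using i1 i2 kweak_C1c[OF kw v]
    by (simp add: Bochner_Integration.integral_sum sum_negf)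
qed

lemma kern_reflected_C1c: "\<epsilon> > 0 \<Longrightarrow> C1c (\<lambda>x. kern \<epsilon> ((y::'a) - x)) (\<lambda>x. - gkern \<epsilon> (y - x))"
proof -
  assume e: "\<epsilon> > 0"
  have "GDERIV (\<lambda>x. kern \<epsilon> (y - x)) x :> - gkern \<epsilon> (y - x)" for x
    using kern_reflected_gderiv[OF e, of 1 y x] by simp
  moreover note reflected_support[OF continuous_kern kern_support[OF e], where y=y]
    reflected_support[OF continuous_gkern gkern_support[OF e], where y=y]
  ultimately show ?thesis unfolding C1c_def C1_def
    by (intro conjI allI exI[of _ "norm y + \<epsilon> * real DIM('a)"]) (auto intro: continuous_on_minus)
qed

text \<open>
  The integral of \<open>d x * kern \<epsilon> (y - x) + (b y - b x) \<bullet> gkern \<epsilon> (y - x)\<close> vanishes because \<open>d\<close> is the weak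
  divergence of \<open>b\<close>.  So \<open>u y\<close> may be subtracted from \<open>u x\<close>, and the commutator is controlled by the
  \<open>L\<^sub>p\<close> modulus of continuity of \<open>u\<close> alone; no limit of the difference quotients of \<open>b\<close> is needed.
\<close>

lemma comm_eq:
  assumes e: "\<epsilon> > 0"
  shows "comm \<epsilon> y = (LINT x|lborel. (u x - u y) * (d x * kern \<epsilon> (y - x) + (b y - b x) \<bullet> gkern \<epsilon> (y - x)))"
    (is "_ = (LINT x|lborel. (u x - u y) * ?K x)")
    and "integrable lborel (\<lambda>x. (u x - u y) * (d x * kern \<epsilon> (y - x) + (b y - b x) \<bullet> gkern \<epsilon> (y - x)))"
proof -
  have k: "integrable lborel (\<lambda>x. gkern \<epsilon> (y - x))"
    using gkern_integrable[OF loc_int_continuous[of "\<lambda>_. 1"] e, of y] by simp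
  have K: "?K x = d x * kern \<epsilon> (y - x) - b x \<bullet> gkern \<epsilon> (y - x) + b y \<bullet> gkern \<epsilon> (y - x)" for x
    by (simp add: inner_diff_left)
  have i1: "integrable lborel (\<lambda>x. d x * kern \<epsilon> (y - x))" by (rule weak_div_C1c(2)[OF kern_reflected_C1c[OF e]])
  have uK: "u x * ?K x = (u x * (d x * kern \<epsilon> (y - x)) - u x * (b x \<bullet> gkern \<epsilon> (y - x))) + b y \<bullet> (u x *\<^sub>R gkern \<epsilon> (y - x))" for x
    unfolding K by (simp add: algebra_simps)
  have iuK: "integrable lborel (\<lambda>x. u x * ?K x)"
    unfolding uK by (intro Bochner_Integration.integrable_add Bochner_Integration.integrable_diff integrable_ud integrable_ub e integrable_inner_right gkern_integrable loc_int_u)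
  have iK: "integrable lborel ?K"
    unfolding K by (intro Bochner_Integration.integrable_add Bochner_Integration.integrable_diff i1 integrable_b e integrable_inner_right k)
  have "(LINT x|lborel. gkern \<epsilon> (y - x)) = 0"
    using lborel_reflect_integral[of "gkern \<epsilon>" y] C1c_integral_gradient[OF C1c_kern[OF e, where 'a='a]] by simp
  then have "(LINT x|lborel. b y \<bullet> gkern \<epsilon> (y - x)) = 0" by (subst integral_inner_right) (auto simp: k)
  moreover have "(LINT x|lborel. b x \<bullet> gkern \<epsilon> (y - x)) = (LINT x|lborel. d x * kern \<epsilon> (y - x))"
    using weak_div_C1c(3)[OF kern_reflected_C1c[OF e], of y] by simp
  ultimately have K0: "(LINT x|lborel. ?K x) = 0"
    unfolding K using i1 integrable_b[OF e] k by simp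
  have "(LINT x|lborel. u x * ?K x) = Fl \<epsilon> y + b y \<bullet> gmoll \<epsilon> u y"
    unfolding uK Fl_def gmoll_def right_diff_distrib
    using integrable_ud[OF e, of y] integrable_ub[OF e, of y] gkern_integrable[OF loc_int_u e, of y]
    by (subst Bochner_Integration.integral_add) (auto simp del: inner_scaleR_right intro!: integrable_inner_right integral_inner_right)
  then show "comm \<epsilon> y = (LINT x|lborel. (u x - u y) * ?K x)"
    using iuK iK K0 by (simp add: comm_def left_diff_distrib)
  show "integrable lborel (\<lambda>x. (u x - u y) * ?K x)" using iuK iK by (simp add: left_diff_distrib)
qed

text \<open>The difference of \<open>b\<close> is bounded by the sum over its components, and each
  component of a partial derivative by its norm; this is the origin of the factor
  \<open>DIM('a)\<close>.\<close>

lemma vector_difference: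
  "AE y in lborel. ennreal (norm (b y - b (y - h))) \<le>
    (\<integral>\<^sup>+s. indicator {0..1::real} s * ennreal (real DIM('a) * norm h * (\<Sum>i\<in>Basis. norm (g i (y - s *\<^sub>R h)))) \<partial>lborel)"
proof -
  have "AE y in lborel. \<forall>j\<in>Basis. ennreal \<bar>b y \<bullet> j - b (y - h) \<bullet> j\<bar> \<le>
    (\<integral>\<^sup>+s. indicator {0..1::real} s * ennreal (norm h * (\<Sum>i\<in>Basis. \<bar>g i (y - s *\<^sub>R h) \<bullet> j\<bar>)) \<partial>lborel)"
    by (rule AE_finite_allI) (auto intro!: difference_quotient kw)
  then show ?thesis
  proof eventually_elim
    case (elim y)
    let ?G = "\<lambda>s. \<Sum>i\<in>Basis. norm (g i (y - s *\<^sub>R h))"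
    have m: "(\<lambda>s. indicator {0..1::real} s * ennreal (norm h * ?G s)) \<in> borel_measurable lborel" by measurable
    have "ennreal (norm (b y - b (y - h))) \<le> ennreal (\<Sum>j\<in>Basis. \<bar>b y \<bullet> j - b (y - h) \<bullet> j\<bar>)"
      using norm_le_l1[of "b y - b (y - h)"] by (intro ennreal_leI) (simp add: inner_diff_left)
    also have "\<dots> = (\<Sum>j\<in>Basis. ennreal \<bar>b y \<bullet> j - b (y - h) \<bullet> j\<bar>)" by (simp add: sum_ennreal)
    also have "\<dots> \<le> (\<Sum>j\<in>(Basis::'a set). \<integral>\<^sup>+s. indicator {0..1::real} s * ennreal (norm h * ?G s) \<partial>lborel)"
    proof (rule sum_mono)
      fix j :: 'a assume j: "j \<in> Basis"
      have "(\<integral>\<^sup>+s. indicator {0..1::real} s * ennreal (norm h * (\<Sum>i\<in>Basis. \<bar>g i (y - s *\<^sub>R h) \<bullet> j\<bar>)) \<partial>lborel) \<le> (\<integral>\<^sup>+s. indicator {0..1::real} s * ennreal (norm h * ?G s) \<partial>lborel)"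
        by (intro nn_integral_mono mult_left_mono ennreal_leI sum_mono Basis_le_norm j) auto
      with elim j show "ennreal \<bar>b y \<bullet> j - b (y - h) \<bullet> j\<bar> \<le> (\<integral>\<^sup>+s. indicator {0..1::real} s * ennreal (norm h * ?G s) \<partial>lborel)"
        using order_trans by blast
    qed
    also have "\<dots> = ennreal (real DIM('a)) * (\<integral>\<^sup>+s. indicator {0..1::real} s * ennreal (norm h * ?G s) \<partial>lborel)"
      by (simp add: ennreal_of_nat_eq_real_of_nat)
    also have "\<dots> = (\<integral>\<^sup>+s. ennreal (real DIM('a)) * (indicator {0..1::real} s * ennreal (norm h * ?G s)) \<partial>lborel)"
      by (rule nn_integral_cmult[OF m, symmetric])
    also have "\<dots> = (\<integral>\<^sup>+s. indicator {0..1::real} s * ennreal (real DIM('a) * norm h * ?G s) \<partial>lborel)"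
      by (intro nn_integral_cong) (simp add: ennreal_mult' mult.assoc mult.left_commute)
    finally show ?case .
  qed
qed

lemma Hoelder_sum_g:
  assumes "norm w \<le> a"
  shows "(\<integral>\<^sup>+y. indicator (cball 0 k) y * ennreal (\<bar>u (y - h) - u y\<bar> * (\<Sum>i\<in>Basis. norm (g i (y - w)))) \<partial>lborel)
    \<le> ennreal (Lnorm p (\<lambda>y. u (y - h) - u y) * NG (k + a))"
proof -
  have m: "(\<lambda>y. indicator (cball 0 k) y * ennreal (\<bar>u (y - h) - u y\<bar> * \<bar>norm (g i (y - w))\<bar>)) \<in> borel_measurable lborel" if "i \<in> Basis" for i
    using gm[OF that] by measurable
  have "(\<integral>\<^sup>+y. indicator (cball 0 k) y * ennreal (\<bar>u (y - h) - u y\<bar> * (\<Sum>i\<in>Basis. norm (g i (y - w)))) \<partial>lborel)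
    = (\<integral>\<^sup>+y. (\<Sum>i\<in>Basis. indicator (cball 0 k) y * ennreal (\<bar>u (y - h) - u y\<bar> * \<bar>norm (g i (y - w))\<bar>)) \<partial>lborel)"
    unfolding sum_distrib_left[symmetric] by (simp add: sum_distrib_left sum_ennreal)
  also have "\<dots> = (\<Sum>i\<in>Basis. \<integral>\<^sup>+y. indicator (cball 0 k) y * ennreal (\<bar>u (y - h) - u y\<bar> * \<bar>norm (g i (y - w))\<bar>) \<partial>lborel)"
    by (rule nn_integral_sum[OF m])
  also have "\<dots> \<le> (\<Sum>i\<in>Basis. ennreal (Lnorm p (\<lambda>y. u (y - h) - u y) * Lnorm q (\<lambda>x. indicator (cball 0 (k + a)) x * norm (g i x))))"
  proof (rule sum_mono)
    fix i :: 'a assume i: "i \<in> Basis"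
    note [measurable] = gm[OF i]
    show "(\<integral>\<^sup>+y. indicator (cball 0 k) y * ennreal (\<bar>u (y - h) - u y\<bar> * \<bar>norm (g i (y - w))\<bar>) \<partial>lborel)
      \<le> ennreal (Lnorm p (\<lambda>y. u (y - h) - u y) * Lnorm q (\<lambda>x. indicator (cball 0 (k + a)) x * norm (g i x)))"
      by (rule Hoelder_cball_shift[OF _ _ Lp_difference_bound(1)[OF um up pq(1)] _ pq assms]) (use gq[OF i] in auto)
  qed
  also have "\<dots> = ennreal (Lnorm p (\<lambda>y. u (y - h) - u y) * NG (k + a))"
    unfolding NG_def by (simp add: sum_ennreal sum_distrib_left Lnorm_nonneg)
  finally show ?thesis .
qed

lemma NG_nonneg: "NG r \<ge> 0" unfolding NG_def by (intro sum_nonneg Lnorm_nonneg)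

text \<open>The substitution \<open>x = y - \<epsilon> *\<^sub>R z\<close> confines \<open>z\<close>
  to a fixed ball. The kernel leaves a bounded factor; its gradient leaves a further
  \<open>1 / \<epsilon>\<close>, kept next to the difference of \<open>b\<close> that will cancel
  it.\<close>

lemma comm_pointwise:
  assumes e: "0 < \<epsilon>"
  shows "ennreal \<bar>comm \<epsilon> y\<bar> \<le> (\<integral>\<^sup>+z. indicator (cball 0 (real DIM('a))) z * (ennreal (kern_const TYPE('a)) *
    (ennreal (\<bar>u (y - \<epsilon> *\<^sub>R z) - u y\<bar> * \<bar>d (y - \<epsilon> *\<^sub>R z)\<bar>) +
     ennreal \<bar>u (y - \<epsilon> *\<^sub>R z) - u y\<bar> * (ennreal (1 / \<epsilon>) * ennreal (norm (b y - b (y - \<epsilon> *\<^sub>R z)))))) \<partial>lborel)"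
proof -
  let ?n = "DIM('a)" and ?M = "kern_const TYPE('a)"
  let ?J = "\<lambda>x. \<bar>u x - u y\<bar> * (\<bar>d x\<bar> * kern \<epsilon> (y - x) + norm (b y - b x) * norm (gkern \<epsilon> (y - x)))"
  have "ennreal \<bar>comm \<epsilon> y\<bar> = ennreal (norm (LINT x|lborel. (u x - u y) * (d x * kern \<epsilon> (y - x) + (b y - b x) \<bullet> gkern \<epsilon> (y - x))))"
    by (simp add: comm_eq(1)[OF e])
  also have "\<dots> \<le> (\<integral>\<^sup>+x. ennreal (norm ((u x - u y) * (d x * kern \<epsilon> (y - x) + (b y - b x) \<bullet> gkern \<epsilon> (y - x)))) \<partial>lborel)"
    by (rule integral_norm_bound_ennreal[OF comm_eq(2)[OF e]])
  also have "\<dots> \<le> (\<integral>\<^sup>+x. ennreal (?J x) \<partial>lborel)"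
  proof (intro nn_integral_mono ennreal_leI)
    fix x
    have "\<bar>d x * kern \<epsilon> (y - x) + (b y - b x) \<bullet> gkern \<epsilon> (y - x)\<bar> \<le> \<bar>d x * kern \<epsilon> (y - x)\<bar> + \<bar>(b y - b x) \<bullet> gkern \<epsilon> (y - x)\<bar>"
      by (rule abs_triangle_ineq)
    also have "\<dots> \<le> \<bar>d x\<bar> * kern \<epsilon> (y - x) + norm (b y - b x) * norm (gkern \<epsilon> (y - x))"
      using Cauchy_Schwarz_ineq2[of "b y - b x" "gkern \<epsilon> (y - x)"] kern_nonneg[OF e, of "y - x"] by (simp add: abs_mult)
    finally show "norm ((u x - u y) * (d x * kern \<epsilon> (y - x) + (b y - b x) \<bullet> gkern \<epsilon> (y - x))) \<le> ?J x"
      unfolding real_norm_def abs_mult by (rule mult_left_mono) simp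
  qed
  also have "\<dots> = ennreal (\<bar>- \<epsilon>\<bar> ^ ?n) * (\<integral>\<^sup>+z. ennreal (?J (y + (- \<epsilon>) *\<^sub>R z)) \<partial>lborel)"
    by (rule lborel_affine_nn_integral) (use e in \<open>measurable, auto\<close>)
  also have "\<dots> = (\<integral>\<^sup>+z. ennreal (\<epsilon> ^ ?n) * ennreal (?J (y - \<epsilon> *\<^sub>R z)) \<partial>lborel)"
    using e by (subst nn_integral_cmult) auto
  also have "\<dots> \<le> (\<integral>\<^sup>+z. indicator (cball 0 (real DIM('a))) z * (ennreal ?M *
    (ennreal (\<bar>u (y - \<epsilon> *\<^sub>R z) - u y\<bar> * \<bar>d (y - \<epsilon> *\<^sub>R z)\<bar>) +
     ennreal \<bar>u (y - \<epsilon> *\<^sub>R z) - u y\<bar> * (ennreal (1 / \<epsilon>) * ennreal (norm (b y - b (y - \<epsilon> *\<^sub>R z)))))) \<partial>lborel)"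
  proof (rule nn_integral_mono)
    fix z :: 'a
    show "ennreal (\<epsilon> ^ ?n) * ennreal (?J (y - \<epsilon> *\<^sub>R z)) \<le> indicator (cball 0 (real DIM('a))) z * (ennreal ?M *
      (ennreal (\<bar>u (y - \<epsilon> *\<^sub>R z) - u y\<bar> * \<bar>d (y - \<epsilon> *\<^sub>R z)\<bar>) +
       ennreal \<bar>u (y - \<epsilon> *\<^sub>R z) - u y\<bar> * (ennreal (1 / \<epsilon>) * ennreal (norm (b y - b (y - \<epsilon> *\<^sub>R z))))))"
    proof (cases "norm z \<le> real ?n")
      case False
      then have "norm (\<epsilon> *\<^sub>R z) > \<epsilon> * real ?n" using e by simp
      then show ?thesis using kern_support[OF e, of "\<epsilon> *\<^sub>R z"] gkern_support[OF e, of "\<epsilon> *\<^sub>R z"] by simp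
    next
      case True
      let ?D = "\<bar>u (y - \<epsilon> *\<^sub>R z) - u y\<bar>" and ?d = "\<bar>d (y - \<epsilon> *\<^sub>R z)\<bar>" and ?b = "norm (b y - b (y - \<epsilon> *\<^sub>R z))"
      have 1: "?D * ?d * (kern \<epsilon> (\<epsilon> *\<^sub>R z) * \<epsilon> ^ ?n) \<le> ?D * ?d * ?M"
        by (intro mult_left_mono kern_const e) auto
      have 2: "?D * ?b * (1 / \<epsilon>) * (norm (gkern \<epsilon> (\<epsilon> *\<^sub>R z)) * \<epsilon> ^ Suc ?n) \<le> ?D * ?b * (1 / \<epsilon>) * ?M"
        using e by (intro mult_left_mono kern_const) auto
      have "\<epsilon> ^ ?n * ?J (y - \<epsilon> *\<^sub>R z) = ?D * ?d * (kern \<epsilon> (\<epsilon> *\<^sub>R z) * \<epsilon> ^ ?n) + ?D * ?b * (1 / \<epsilon>) * (norm (gkern \<epsilon> (\<epsilon> *\<^sub>R z)) * \<epsilon> ^ Suc ?n)"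
        using e by (simp add: algebra_simps)
      also have "\<dots> \<le> ?M * (?D * ?d + ?D * ((1 / \<epsilon>) * ?b))"
        using add_mono[OF 1 2] by (simp add: algebra_simps)
      finally have "ennreal (\<epsilon> ^ ?n * ?J (y - \<epsilon> *\<^sub>R z)) \<le> ennreal (?M * (?D * ?d + ?D * ((1 / \<epsilon>) * ?b)))" by (rule ennreal_leI)
      moreover have "ennreal (\<epsilon> ^ ?n * ?J (y - \<epsilon> *\<^sub>R z)) = ennreal (\<epsilon> ^ ?n) * ennreal (?J (y - \<epsilon> *\<^sub>R z))"
        using e by (intro ennreal_mult) (auto intro!: mult_nonneg_nonneg add_nonneg_nonneg kern_nonneg)
      moreover have "ennreal (?M * (?D * ?d + ?D * ((1 / \<epsilon>) * ?b))) = ennreal ?M * (ennreal (?D * ?d) + ennreal ?D * (ennreal (1 / \<epsilon>) * ennreal ?b))"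
        using e kern_const(1)[where 'a='a]
        by (simp only: ennreal_mult ennreal_plus mult_nonneg_nonneg add_nonneg_nonneg abs_ge_zero norm_ge_zero less_imp_le divide_nonneg_nonneg zero_le_one)
      ultimately show ?thesis using True by simp
    qed
  qed
  finally show ?thesis .
qed

text \<open>The difference of \<open>b\<close> over a distance \<open>\<epsilon> * norm z\<close> is
  bounded by that distance times an integral of partial derivatives, which cancels
  \<open>1 / \<epsilon>\<close>. With the integral over \<open>y\<close> innermost, Hoelder's
  inequality separates the translation difference of \<open>u\<close> from the derivatives of
  \<open>b\<close>. In the constant, 1 belongs to the divergence, one factor \<open>DIM('a)\<close>
  to the components of \<open>b\<close> and one to \<open>norm z\<close>.\<close>

lemma comm_bound:
  assumes e: "0 < \<epsilon>" "\<epsilon> \<le> 1"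
  shows "(\<integral>\<^sup>+y. indicator (cball 0 k) y * ennreal \<bar>comm \<epsilon> y\<bar> \<partial>lborel) \<le>
    ennreal (kern_const TYPE('a) * (1 + real DIM('a) * real DIM('a)) * NG (k + real DIM('a))) * trans_mod p u \<epsilon>"
proof -
  let ?n = "real DIM('a)" and ?M = "kern_const TYPE('a)"
  define L where "L z = Lnorm p (\<lambda>y. u (y - \<epsilon> *\<^sub>R z) - u y)" for z
  have [measurable]: "L \<in> borel_measurable borel" unfolding L_def[abs_def]
    by (rule Lnorm_measurable[where M=borel, simplified]) measurable
  have L0: "L z \<ge> 0" for z by (simp add: L_def Lnorm_nonneg)
  define N where "N = NG (k + ?n)"
  have N: "N \<ge> 0" by (simp add: N_def NG_nonneg)
  define D where "D z y = \<bar>u (y - \<epsilon> *\<^sub>R z) - u y\<bar>" for z y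
  define G where "G w y = (\<Sum>i\<in>Basis. norm (g i (y - w)))" for w y
  have G0: "G w y \<ge> 0" for w y by (simp add: G_def sum_nonneg)
  have D0: "D z y \<ge> 0" for z y by (simp add: D_def)
  have Dm [measurable]: "(\<lambda>(z, y). D z y) \<in> borel_measurable (lborel \<Otimes>\<^sub>M lborel)" unfolding D_def[abs_def] by measurable
  have Gm [measurable]: "(\<lambda>(w, y). G w y) \<in> borel_measurable (lborel \<Otimes>\<^sub>M lborel)" unfolding G_def[abs_def] by measurable
  define H1 where "H1 z y = ennreal (D z y * \<bar>d (y - \<epsilon> *\<^sub>R z)\<bar>)" for z y
  define H2 where "H2 z y = ennreal (D z y) * (ennreal (1 / \<epsilon>) * ennreal (norm (b y - b (y - \<epsilon> *\<^sub>R z))))" for z y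
  have H1m [measurable]: "(\<lambda>(z, y). H1 z y) \<in> borel_measurable (lborel \<Otimes>\<^sub>M lborel)" unfolding H1_def[abs_def] D_def[abs_def] by measurable
  have H2m [measurable]: "(\<lambda>(z, y). H2 z y) \<in> borel_measurable (lborel \<Otimes>\<^sub>M lborel)" unfolding H2_def[abs_def] D_def[abs_def] by measurable
  have H1m' [measurable]: "H1 z \<in> borel_measurable borel" "H2 z \<in> borel_measurable borel" for z
    unfolding H1_def[abs_def] H2_def[abs_def] D_def[abs_def] by measurable
  have Hol: "(\<integral>\<^sup>+y. indicator (cball 0 k) y * ennreal (D z y * G w y) \<partial>lborel) \<le> ennreal (L z * N)" if "norm w \<le> ?n" for z w
    unfolding D_def G_def L_def N_def by (rule Hoelder_sum_g[OF that])
  \<comment> \<open>The condition \<open>\<epsilon> \<le> 1\<close> keeps all shifts within the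
    radius \<open>DIM('a)\<close>, whatever the scale.\<close>
  have nz: "norm (\<epsilon> *\<^sub>R z) \<le> ?n" if "norm z \<le> ?n" for z :: 'a
    using that e mult_mono[of \<epsilon> 1 "norm z" ?n] by simp
  have B1: "(\<integral>\<^sup>+y. indicator (cball 0 k) y * H1 z y \<partial>lborel) \<le> ennreal (L z * N)" if z: "norm z \<le> ?n" for z
  proof -
    have "(\<integral>\<^sup>+y. indicator (cball 0 k) y * H1 z y \<partial>lborel) \<le> (\<integral>\<^sup>+y. indicator (cball 0 k) y * ennreal (D z y * G (\<epsilon> *\<^sub>R z) y) \<partial>lborel)"
      unfolding H1_def G_def by (intro nn_integral_mono mult_left_mono ennreal_leI d_le D0) auto
    also have "\<dots> \<le> ennreal (L z * N)" by (rule Hol[OF nz[OF z]])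
    finally show ?thesis .
  qed
  have B2: "(\<integral>\<^sup>+y. indicator (cball 0 k) y * H2 z y \<partial>lborel) \<le> ennreal (?n * ?n) * ennreal (L z * N)" if z: "norm z \<le> ?n" for z
  proof -
    let ?I = "\<lambda>s y. indicator {0..1::real} s * ennreal (?n * ?n * (D z y * G (s *\<^sub>R \<epsilon> *\<^sub>R z) y))"
    have "AE y in lborel. indicator (cball 0 k) y * H2 z y \<le> (\<integral>\<^sup>+s. indicator (cball 0 k) y * ?I s y \<partial>lborel)"
      using vector_difference[of "\<epsilon> *\<^sub>R z"]
    proof eventually_elim
      case (elim y)
      have m1: "(\<lambda>s. indicator {0..1::real} s * ennreal (?n * norm (\<epsilon> *\<^sub>R z) * G (s *\<^sub>R \<epsilon> *\<^sub>R z) y)) \<in> borel_measurable lborel"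
        unfolding G_def by measurable
      have m2: "(\<lambda>s. ?I s y) \<in> borel_measurable lborel" unfolding G_def by measurable
      have "H2 z y \<le> ennreal (D z y / \<epsilon>) * (\<integral>\<^sup>+s. indicator {0..1::real} s * ennreal (?n * norm (\<epsilon> *\<^sub>R z) * G (s *\<^sub>R \<epsilon> *\<^sub>R z) y) \<partial>lborel)"
        using elim e D0[of z y] unfolding H2_def G_def mult.assoc[symmetric]
        by (subst ennreal_mult[symmetric]) (auto intro!: mult_left_mono)
      also have "\<dots> = (\<integral>\<^sup>+s. ennreal (D z y / \<epsilon>) * (indicator {0..1::real} s * ennreal (?n * norm (\<epsilon> *\<^sub>R z) * G (s *\<^sub>R \<epsilon> *\<^sub>R z) y)) \<partial>lborel)"
        by (rule nn_integral_cmult[OF m1, symmetric])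
      also have "\<dots> \<le> (\<integral>\<^sup>+s. ?I s y \<partial>lborel)"
      proof (rule nn_integral_mono)
        fix s :: real
        have "D z y / \<epsilon> * (?n * norm (\<epsilon> *\<^sub>R z) * G (s *\<^sub>R \<epsilon> *\<^sub>R z) y) = (?n * norm z) * (D z y * G (s *\<^sub>R \<epsilon> *\<^sub>R z) y)"
          using e by simp
        also have "\<dots> \<le> (?n * ?n) * (D z y * G (s *\<^sub>R \<epsilon> *\<^sub>R z) y)"
          using z by (intro mult_right_mono mult_left_mono mult_nonneg_nonneg D0 G0) auto
        finally have "ennreal (D z y / \<epsilon>) * ennreal (?n * norm (\<epsilon> *\<^sub>R z) * G (s *\<^sub>R \<epsilon> *\<^sub>R z) y) \<le> ennreal (?n * ?n * (D z y * G (s *\<^sub>R \<epsilon> *\<^sub>R z) y))"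
          using e D0[of z y] G0[of "s *\<^sub>R \<epsilon> *\<^sub>R z" y] by (subst ennreal_mult[symmetric]) (auto intro!: ennreal_leI)
        then show "ennreal (D z y / \<epsilon>) * (indicator {0..1::real} s * ennreal (?n * norm (\<epsilon> *\<^sub>R z) * G (s *\<^sub>R \<epsilon> *\<^sub>R z) y)) \<le> ?I s y"
          by (auto simp: indicator_def)
      qed
      finally have "indicator (cball 0 k) y * H2 z y \<le> indicator (cball 0 k) y * (\<integral>\<^sup>+s. ?I s y \<partial>lborel)" by (rule mult_left_mono) simp
      also have "\<dots> = (\<integral>\<^sup>+s. indicator (cball 0 k) y * ?I s y \<partial>lborel)" by (rule nn_integral_cmult[OF m2, symmetric])
      finally show ?case .
    qed
    then have "(\<integral>\<^sup>+y. indicator (cball 0 k) y * H2 z y \<partial>lborel) \<le> (\<integral>\<^sup>+y. \<integral>\<^sup>+s. indicator (cball 0 k) y * ?I s y \<partial>lborel \<partial>lborel)"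
      by (rule nn_integral_mono_AE)
    also have "\<dots> = (\<integral>\<^sup>+s. \<integral>\<^sup>+y. indicator (cball 0 k) y * ?I s y \<partial>lborel \<partial>lborel)"
      by (rule lborel_pair.Fubini') (unfold G_def D_def, measurable)
    also have "\<dots> \<le> (\<integral>\<^sup>+s. indicator {0..1::real} s * (ennreal (?n * ?n) * ennreal (L z * N)) \<partial>lborel)"
    proof (rule nn_integral_mono)
      fix s :: real
      show "(\<integral>\<^sup>+y. indicator (cball 0 k) y * ?I s y \<partial>lborel) \<le> indicator {0..1::real} s * (ennreal (?n * ?n) * ennreal (L z * N))"
      proof (cases "s \<in> {0..1}")
        case True
        have m: "(\<lambda>y. indicator (cball 0 k) y * ennreal (D z y * G (s *\<^sub>R \<epsilon> *\<^sub>R z) y)) \<in> borel_measurable lborel"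
          unfolding D_def G_def by measurable
        have "(\<integral>\<^sup>+y. indicator (cball 0 k) y * ?I s y \<partial>lborel) = (\<integral>\<^sup>+y. ennreal (?n * ?n) * (indicator (cball 0 k) y * ennreal (D z y * G (s *\<^sub>R \<epsilon> *\<^sub>R z) y)) \<partial>lborel)"
        proof (rule nn_integral_cong)
          fix y
          have "ennreal (?n * ?n * (D z y * G (s *\<^sub>R \<epsilon> *\<^sub>R z) y)) = ennreal (?n * ?n) * ennreal (D z y * G (s *\<^sub>R \<epsilon> *\<^sub>R z) y)"
            by (intro ennreal_mult mult_nonneg_nonneg D0 G0) auto
          then show "indicator (cball 0 k) y * ?I s y = ennreal (?n * ?n) * (indicator (cball 0 k) y * ennreal (D z y * G (s *\<^sub>R \<epsilon> *\<^sub>R z) y))"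
            using True by (simp only: indicator_simps mult_1_left mult.left_commute)
        qed
        also have "\<dots> = ennreal (?n * ?n) * (\<integral>\<^sup>+y. indicator (cball 0 k) y * ennreal (D z y * G (s *\<^sub>R \<epsilon> *\<^sub>R z) y) \<partial>lborel)"
          by (rule nn_integral_cmult[OF m])
        also have "\<dots> \<le> ennreal (?n * ?n) * ennreal (L z * N)"
        proof (intro mult_left_mono Hol)
          have "norm (s *\<^sub>R \<epsilon> *\<^sub>R z) \<le> 1 * norm (\<epsilon> *\<^sub>R z)" using True unfolding norm_scaleR[of s] by (intro mult_right_mono) auto
          then show "norm (s *\<^sub>R \<epsilon> *\<^sub>R z) \<le> ?n" using nz[OF z] by simp
        qed simp
        finally show ?thesis using True by simp
      qed simp
    qed
    also have "\<dots> = ennreal (?n * ?n) * ennreal (L z * N)" by (simp add: nn_integral_multc)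
    finally show ?thesis .
  qed
  have m12: "(\<lambda>y. indicator (cball 0 k) y * H1 z y) \<in> borel_measurable lborel" "(\<lambda>y. indicator (cball 0 k) y * H2 z y) \<in> borel_measurable lborel" for z
    by measurable
  have "(\<integral>\<^sup>+y. indicator (cball 0 k) y * ennreal \<bar>comm \<epsilon> y\<bar> \<partial>lborel) \<le>
    (\<integral>\<^sup>+y. indicator (cball 0 k) y * (\<integral>\<^sup>+z. indicator (cball 0 ?n) z * (ennreal ?M * (H1 z y + H2 z y)) \<partial>lborel) \<partial>lborel)"
    unfolding H1_def H2_def D_def by (intro nn_integral_mono mult_left_mono comm_pointwise e) auto
  also have "\<dots> = (\<integral>\<^sup>+y. (\<integral>\<^sup>+z. indicator (cball 0 k) y * (indicator (cball 0 ?n) z * (ennreal ?M * (H1 z y + H2 z y))) \<partial>lborel) \<partial>lborel)"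
  proof (intro nn_integral_cong nn_integral_cmult[symmetric])
    fix y
    show "(\<lambda>z. indicator (cball 0 ?n) z * (ennreal ?M * (H1 z y + H2 z y))) \<in> borel_measurable lborel"
      unfolding H1_def H2_def D_def by measurable
  qed
  also have "\<dots> = (\<integral>\<^sup>+z. (\<integral>\<^sup>+y. indicator (cball 0 k) y * (indicator (cball 0 ?n) z * (ennreal ?M * (H1 z y + H2 z y))) \<partial>lborel) \<partial>lborel)"
    by (rule lborel_pair.Fubini') (unfold H1_def H2_def D_def, measurable)
  also have "\<dots> \<le> (\<integral>\<^sup>+z. ennreal (?M * (1 + ?n * ?n) * N) * (indicator (cball 0 ?n) z * ennreal (L z)) \<partial>lborel)"
  proof (rule nn_integral_mono)
    fix z :: 'a
    show "(\<integral>\<^sup>+y. indicator (cball 0 k) y * (indicator (cball 0 ?n) z * (ennreal ?M * (H1 z y + H2 z y))) \<partial>lborel) \<le> ennreal (?M * (1 + ?n * ?n) * N) * (indicator (cball 0 ?n) z * ennreal (L z))"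
    proof (cases "norm z \<le> ?n")
      case True
      have "(\<integral>\<^sup>+y. indicator (cball 0 k) y * (indicator (cball 0 ?n) z * (ennreal ?M * (H1 z y + H2 z y))) \<partial>lborel)
        = (\<integral>\<^sup>+y. ennreal ?M * (indicator (cball 0 k) y * H1 z y + indicator (cball 0 k) y * H2 z y) \<partial>lborel)"
        using True by (intro nn_integral_cong) (simp add: distrib_left mult.left_commute)
      also have "\<dots> = ennreal ?M * ((\<integral>\<^sup>+y. indicator (cball 0 k) y * H1 z y \<partial>lborel) + (\<integral>\<^sup>+y. indicator (cball 0 k) y * H2 z y \<partial>lborel))"
        by (simp only: nn_integral_cmult[OF borel_measurable_add[OF m12]] nn_integral_add[OF m12])
      also have "\<dots> \<le> ennreal ?M * (ennreal (L z * N) + ennreal (?n * ?n) * ennreal (L z * N))"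
        by (intro mult_left_mono add_mono B1 B2 True) auto
      also have "\<dots> = ennreal (?M * (L z * N + ?n * ?n * (L z * N)))"
        using kern_const(1)[where 'a='a] L0[of z] N
        by (simp only: ennreal_mult ennreal_plus mult_nonneg_nonneg add_nonneg_nonneg of_nat_0_le_iff less_imp_le)
      also have "?M * (L z * N + ?n * ?n * (L z * N)) = (?M * (1 + ?n * ?n) * N) * L z" by (simp add: algebra_simps)
      also have "ennreal ((?M * (1 + ?n * ?n) * N) * L z) = ennreal (?M * (1 + ?n * ?n) * N) * ennreal (L z)"
        using kern_const(1)[where 'a='a] L0[of z] N by (intro ennreal_mult) auto
      finally show ?thesis using True by simp
    qed simp
  qed
  also have "\<dots> = ennreal (?M * (1 + ?n * ?n) * N) * trans_mod p u \<epsilon>"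
  proof -
    have "(\<lambda>z. indicator (cball 0 ?n) z * ennreal (L z)) \<in> borel_measurable lborel" by measurable
    from nn_integral_cmult[OF this] show ?thesis unfolding trans_mod_def L_def by simp
  qed
  finally show ?thesis unfolding N_def .
qed

text \<open>\<open>Fl \<epsilon>\<close> is continuous, and in the remaining term a locally
  integrable field is multiplied by the continuous gradient of the mollification.\<close>

lemma loc_int_comm: "\<epsilon> > 0 \<Longrightarrow> loc_int (comm \<epsilon>)"
proof -
  assume e: "\<epsilon> > 0"
  have cg: "continuous_on UNIV (gmoll \<epsilon> u)" using C1_moll[OF loc_int_u e] by (simp add: C1_def)
  have 1: "loc_int (Fl \<epsilon>)" by (rule loc_int_continuous[OF continuous_Fl[OF e]])
  have 2: "loc_int (\<lambda>y. (b y \<bullet> j) * (gmoll \<epsilon> u y \<bullet> j))" if j: "j \<in> Basis" for j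
    unfolding loc_int_def
  proof (intro conjI allI)
    have bj: "loc_int (\<lambda>y. b y \<bullet> j)" using kw j nonempty_Basis by (auto simp: kweak_def)
    have [measurable]: "gmoll \<epsilon> u \<in> borel_measurable borel" by (rule borel_measurable_continuous_onI[OF cg])
    show "(\<lambda>y. (b y \<bullet> j) * (gmoll \<epsilon> u y \<bullet> j)) \<in> borel_measurable borel" by measurable
    fix r
    have "bounded ((\<lambda>y. gmoll \<epsilon> u y \<bullet> j) ` cball 0 r)"
      by (intro compact_imp_bounded compact_continuous_image continuous_intros continuous_on_subset[OF cg]) auto
    then obtain M where M: "M > 0" "\<And>y. norm y \<le> r \<Longrightarrow> \<bar>gmoll \<epsilon> u y \<bullet> j\<bar> \<le> M" unfolding bounded_pos by auto
    have "integrable lborel (\<lambda>x. (indicator (cball 0 r) x * (gmoll \<epsilon> u x \<bullet> j)) * (indicator (cball 0 r) x * (b x \<bullet> j)))"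
    proof (rule integrable_mult_bounded)
      show "integrable lborel (\<lambda>x. indicator (cball 0 r) x * (b x \<bullet> j))" using bj by (simp add: loc_int_def)
      show "(\<lambda>x. indicator (cball 0 r) x * (gmoll \<epsilon> u x \<bullet> j)) \<in> borel_measurable borel" by measurable
      show "\<bar>indicator (cball 0 r) x * (gmoll \<epsilon> u x \<bullet> j)\<bar> \<le> M" for x using M by (auto simp: indicator_def less_imp_le)
    qed
    then show "integrable lborel (\<lambda>x. indicator (cball 0 r) x *\<^sub>R ((b x \<bullet> j) * (gmoll \<epsilon> u x \<bullet> j)))"
      by (rule Bochner_Integration.integrable_cong[THEN iffD1, rotated -1]) (auto simp: indicator_def)
  qed
  have "loc_int (\<lambda>y. \<Sum>j\<in>Basis. (b y \<bullet> j) * (gmoll \<epsilon> u y \<bullet> j))" by (rule loc_int_sum[OF 2])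
  moreover have "(\<Sum>j\<in>Basis. (b y \<bullet> j) * (gmoll \<epsilon> u y \<bullet> j)) = b y \<bullet> gmoll \<epsilon> u y" for y
    by (rule euclidean_inner[symmetric])
  ultimately have 3: "loc_int (\<lambda>y. b y \<bullet> gmoll \<epsilon> u y)" by simp
  show ?thesis using 1 3 unfolding loc_int_def comm_def
    by (auto simp: distrib_left intro!: Bochner_Integration.integrable_add borel_measurable_add)
qed

text \<open>The mollified equation is multiplied by
  \<open>\<psi> * \<beta>' (moll \<epsilon> u)\<close>. Apart from the commutator, what remains is
  minus \<open>b\<close> against the gradient of
  \<open>\<psi> * \<beta> (moll \<epsilon> u)\<close>, plus a term with the gradient of
  \<open>\<psi>\<close>; the weak divergence turns the former into an integral of \<open>d\<close>.
  The factor 2 is the bound on \<open>\<beta>'\<close>.\<close>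

lemma energy_inequality:
  assumes e: "\<epsilon> > 0" and \<psi>: "C1c \<psi> \<psi>'" and \<psi>k: "\<And>x. norm x > k \<Longrightarrow> \<psi> x = 0 \<and> \<psi>' x = 0" and \<psi>01: "\<And>x. 0 \<le> \<psi> x \<and> \<psi> x \<le> 1"
    and \<beta>: "\<And>x. (\<beta> has_real_derivative \<beta>' x) (at x)" "continuous_on UNIV \<beta>'" "\<And>x. 0 \<le> \<beta> x \<and> \<beta> x \<le> 1" "\<And>x. \<bar>\<beta>' x\<bar> \<le> 2"
  shows "(LINT y|lborel. \<psi> y * (\<beta>' (moll \<epsilon> u y) * Fl \<epsilon> y)) \<le>
    (LINT y|lborel. \<bar>d y\<bar> * (\<psi> y * \<beta> (moll \<epsilon> u y))) + (LINT y|lborel. norm (b y) * norm (\<psi>' y)) + 2 * (LINT y|lborel. indicator (cball 0 k) y * \<bar>comm \<epsilon> y\<bar>)"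
proof -
  have cu: "continuous_on UNIV (moll \<epsilon> u)" and cg: "continuous_on UNIV (gmoll \<epsilon> u)"
    using C1_moll[OF loc_int_u e] C1_continuous by (auto simp: C1_def)
  have cb: "continuous_on UNIV (\<lambda>y. \<beta> (moll \<epsilon> u y))" "continuous_on UNIV (\<lambda>y. \<beta>' (moll \<epsilon> u y))"
    using DERIV_continuous_on[of UNIV \<beta> \<beta>'] \<beta>(1,2) by (auto intro!: continuous_on_compose2[OF _ cu])
  have c\<psi>: "continuous_on UNIV \<psi>" "continuous_on UNIV \<psi>'" using \<psi> C1_continuous unfolding C1c_def C1_def by auto
  have C1b: "C1 (\<lambda>y. \<beta> (moll \<epsilon> u y)) (\<lambda>y. \<beta>' (moll \<epsilon> u y) *\<^sub>R gmoll \<epsilon> u y)"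
    unfolding C1_def
  proof (intro conjI allI)
    fix y
    have "((\<lambda>y. \<beta> (moll \<epsilon> u y)) has_derivative (\<lambda>h. \<beta>' (moll \<epsilon> u y) * (h \<bullet> gmoll \<epsilon> u y))) (at y)"
      by (rule has_derivative_compose[OF _ \<beta>(1)[unfolded has_field_derivative_def], of "moll \<epsilon> u"])
        (use C1_moll[OF loc_int_u e] in \<open>auto simp: C1_def gderiv_def\<close>)
    then show "GDERIV (\<lambda>y. \<beta> (moll \<epsilon> u y)) y :> \<beta>' (moll \<epsilon> u y) *\<^sub>R gmoll \<epsilon> u y" by (simp add: gderiv_def)
  qed (intro continuous_intros cb cg)
  define v where "v y = \<psi> y * \<beta> (moll \<epsilon> u y)" for y
  define v' where "v' y = \<psi> y *\<^sub>R (\<beta>' (moll \<epsilon> u y) *\<^sub>R gmoll \<epsilon> u y) + \<beta> (moll \<epsilon> u y) *\<^sub>R \<psi>' y" for y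
  have v: "C1c v v'" unfolding v_def[abs_def] v'_def[abs_def] by (rule C1c_mult[OF \<psi> C1b])
  have v01: "0 \<le> v y" for y using \<psi>01[of y] \<beta>(3) by (simp add: v_def)
  have bi: "loc_int (\<lambda>x. b x \<bullet> j)" if "j \<in> Basis" for j using kw that nonempty_Basis by (auto simp: kweak_def)
  have bw: "integrable lborel (\<lambda>y. b y \<bullet> w y)" if "continuous_on UNIV w" "\<And>x. norm x > k \<Longrightarrow> w x = 0" for w
    proof (subst euclidean_inner, rule Bochner_Integration.integrable_sum)
    fix j :: 'a assume "j \<in> Basis"
    then have "integrable lborel (\<lambda>x. (w x \<bullet> j) * (b x \<bullet> j))"
      by (intro integrable_compact_mult[OF bi, of _ _ k]) (auto intro!: continuous_intros that simp: that(2))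
    then show "integrable lborel (\<lambda>x. (b x \<bullet> j) * (w x \<bullet> j))" by (simp add: mult.commute)
  qed
  have iF: "integrable lborel (\<lambda>y. \<psi> y * (\<beta>' (moll \<epsilon> u y) * Fl \<epsilon> y))"
    by (rule integrable_continuous_support[of _ k]) (use \<psi>k in \<open>auto intro!: continuous_intros c\<psi> cb continuous_Fl[OF e]\<close>)
  have ib: "integrable lborel (\<lambda>y. b y \<bullet> (\<beta> (moll \<epsilon> u y) *\<^sub>R \<psi>' y))"
    by (rule bw) (use \<psi>k in \<open>auto intro!: continuous_intros c\<psi> cb\<close>)
  note wd = weak_div_C1c[OF v]
  \<comment> \<open>The product rule for \<open>v\<close>: its gradient contains the transport term
    by which \<open>Fl\<close> and the commutator differ, and one term with \<open>\<psi>'\<close>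
    that has to be restored.\<close>
  have eq: "\<psi> y * (\<beta>' (moll \<epsilon> u y) * Fl \<epsilon> y) = \<psi> y * (\<beta>' (moll \<epsilon> u y) * comm \<epsilon> y) - b y \<bullet> v' y + b y \<bullet> (\<beta> (moll \<epsilon> u y) *\<^sub>R \<psi>' y)" for y
    by (simp add: comm_def v'_def algebra_simps)
  have ic: "integrable lborel (\<lambda>y. \<psi> y * (\<beta>' (moll \<epsilon> u y) * comm \<epsilon> y))"
  proof -
    have "(\<lambda>y. \<psi> y * (\<beta>' (moll \<epsilon> u y) * comm \<epsilon> y)) = (\<lambda>y. \<psi> y * (\<beta>' (moll \<epsilon> u y) * Fl \<epsilon> y) + b y \<bullet> v' y - b y \<bullet> (\<beta> (moll \<epsilon> u y) *\<^sub>R \<psi>' y))"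
      using eq by (auto simp: fun_eq_iff)
    then show ?thesis using iF wd(1) ib by simp
  qed
  have "(LINT y|lborel. \<psi> y * (\<beta>' (moll \<epsilon> u y) * Fl \<epsilon> y)) = (LINT y|lborel. \<psi> y * (\<beta>' (moll \<epsilon> u y) * comm \<epsilon> y)) + (LINT y|lborel. d y * v y) + (LINT y|lborel. b y \<bullet> (\<beta> (moll \<epsilon> u y) *\<^sub>R \<psi>' y))"
    unfolding eq using ic wd ib by simp
  also have "(LINT y|lborel. \<psi> y * (\<beta>' (moll \<epsilon> u y) * comm \<epsilon> y)) \<le> (LINT y|lborel. 2 * (indicator (cball 0 k) y * \<bar>comm \<epsilon> y\<bar>))"
  proof (rule Bochner_Integration.integral_mono[OF ic])
    show "integrable lborel (\<lambda>y. 2 * (indicator (cball 0 k) y * \<bar>comm \<epsilon> y\<bar>))"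
      using loc_int_comm[OF e] integrable_abs[of lborel "\<lambda>x. indicator (cball 0 k) x * comm \<epsilon> x"] by (simp add: loc_int_def abs_mult)
    fix y
    show "\<psi> y * (\<beta>' (moll \<epsilon> u y) * comm \<epsilon> y) \<le> 2 * (indicator (cball 0 k) y * \<bar>comm \<epsilon> y\<bar>)"
    proof (cases "norm y \<le> k")
      case True
      have "\<psi> y * (\<beta>' (moll \<epsilon> u y) * comm \<epsilon> y) \<le> \<bar>\<psi> y\<bar> * (\<bar>\<beta>' (moll \<epsilon> u y)\<bar> * \<bar>comm \<epsilon> y\<bar>)"
        unfolding abs_mult[symmetric] by (rule abs_ge_self)
      also have "\<dots> \<le> 1 * (2 * \<bar>comm \<epsilon> y\<bar>)"
        using \<psi>01[of y] \<beta>(4) by (intro mult_mono) auto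
      finally show ?thesis using True by simp
    next
      case False
      then show ?thesis using \<psi>k[of y] by simp
    qed
  qed
  also have "(LINT y|lborel. d y * v y) \<le> (LINT y|lborel. \<bar>d y\<bar> * v y)"
  proof (rule Bochner_Integration.integral_mono[OF wd(2)])
    show "integrable lborel (\<lambda>y. \<bar>d y\<bar> * v y)" using integrable_abs[OF wd(2)] v01 by (simp add: abs_mult)
    show "d y * v y \<le> \<bar>d y\<bar> * v y" for y using v01[of y] by (intro mult_right_mono) auto
  qed
  also have "(LINT y|lborel. b y \<bullet> (\<beta> (moll \<epsilon> u y) *\<^sub>R \<psi>' y)) \<le> (LINT y|lborel. norm (b y) * norm (\<psi>' y))"
  proof (rule Bochner_Integration.integral_mono[OF ib])
    have "integrable lborel (\<lambda>y. \<Sum>j\<in>Basis. \<bar>norm (\<psi>' y) * (b y \<bullet> j)\<bar>)"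
    proof (intro Bochner_Integration.integrable_sum integrable_abs)
      fix j :: 'a assume "j \<in> Basis"
      then show "integrable lborel (\<lambda>y. norm (\<psi>' y) * (b y \<bullet> j))"
        by (intro integrable_compact_mult[OF bi, of _ _ k]) (auto intro!: continuous_intros c\<psi> simp: \<psi>k)
    qed
    then show "integrable lborel (\<lambda>y. norm (b y) * norm (\<psi>' y))"
    proof (rule Bochner_Integration.integrable_bound)
      have [measurable]: "\<psi>' \<in> borel_measurable borel" by (rule borel_measurable_continuous_onI[OF c\<psi>(2)])
      show "(\<lambda>y. norm (b y) * norm (\<psi>' y)) \<in> borel_measurable lborel" by measurable
      have "norm (b y) * norm (\<psi>' y) \<le> (\<Sum>j\<in>Basis. \<bar>norm (\<psi>' y) * (b y \<bullet> j)\<bar>)" for y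
        using mult_left_mono[OF norm_le_l1[of "b y"], of "norm (\<psi>' y)"] by (simp add: abs_mult sum_distrib_left mult.commute)
      then show "AE y in lborel. norm (norm (b y) * norm (\<psi>' y)) \<le> norm (\<Sum>j\<in>Basis. \<bar>norm (\<psi>' y) * (b y \<bullet> j)\<bar>)"
        by (auto intro!: AE_I2 order_trans[OF _ abs_ge_self])
    qed
    fix y
    have "b y \<bullet> (\<beta> (moll \<epsilon> u y) *\<^sub>R \<psi>' y) \<le> norm (b y) * norm (\<beta> (moll \<epsilon> u y) *\<^sub>R \<psi>' y)" by (rule norm_cauchy_schwarz)
    also have "\<dots> \<le> norm (b y) * (1 * norm (\<psi>' y))"
      unfolding norm_scaleR using \<beta>(3) by (intro mult_left_mono mult_right_mono) auto
    finally show "b y \<bullet> (\<beta> (moll \<epsilon> u y) *\<^sub>R \<psi>' y) \<le> norm (b y) * norm (\<psi>' y)" by simp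
  qed
  finally show ?thesis by (simp add: v_def)
qed

end

section \<open>Bounded mean oscillation\<close>

text \<open>
  Bisecting the longest side preserves the bound 2 on the ratio of the sides, so a good box is always
  comparable with a ball.
\<close>

definition good_box :: "'a::euclidean_space \<Rightarrow> 'a \<Rightarrow> bool" where
  "good_box l r \<longleftrightarrow> (\<forall>i\<in>Basis. l \<bullet> i < r \<bullet> i) \<and> (\<forall>i\<in>Basis. \<forall>j\<in>Basis. r \<bullet> i - l \<bullet> i \<le> 2 * (r \<bullet> j - l \<bullet> j))"

lemma content_good_box: "good_box l r \<Longrightarrow> measure lborel (cbox l r) = (\<Prod>i\<in>Basis. r \<bullet> i - l \<bullet> i)"
  by (rule content_cbox) (auto simp: good_box_def less_imp_le)

lemma content_good_box_pos: "good_box l r \<Longrightarrow> 0 < measure lborel (cbox l r)"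
  unfolding content_good_box by (rule prod_pos) (auto simp: good_box_def)

lemma good_box_bisect:
  fixes l r :: "'a::euclidean_space"
  assumes "good_box l r"
  obtains l' r' where "good_box l r'" "good_box l' r" "cbox l r' \<subseteq> cbox l r" "cbox l' r \<subseteq> cbox l r"
    "measure lborel (cbox l r') = measure lborel (cbox l r) / 2" "measure lborel (cbox l' r) = measure lborel (cbox l r) / 2"
    "\<And>f::'a \<Rightarrow> real. f integrable_on cbox l r \<Longrightarrow> integral (cbox l r) f = integral (cbox l r') f + integral (cbox l' r) f"
proof -
  have pos: "l \<bullet> i < r \<bullet> i" if "i \<in> Basis" for i using assms that by (simp add: good_box_def)
  have ratio: "r \<bullet> i - l \<bullet> i \<le> 2 * (r \<bullet> j - l \<bullet> j)" if "i \<in> Basis" "j \<in> Basis" for i j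
    using assms that by (simp add: good_box_def)
  have "Max ((\<lambda>i. r \<bullet> i - l \<bullet> i) ` Basis) \<in> (\<lambda>i. r \<bullet> i - l \<bullet> i) ` Basis" by (intro Max_in) auto
  then obtain k where k: "k \<in> Basis" "r \<bullet> k - l \<bullet> k = Max ((\<lambda>i. r \<bullet> i - l \<bullet> i) ` Basis)" by (elim imageE) simp
  have kmax: "r \<bullet> i - l \<bullet> i \<le> r \<bullet> k - l \<bullet> k" if "i \<in> Basis" for i using that k by auto
  \<comment> \<open>Half of the longest side: after the cut every other side is at most twice the
    side that was cut.\<close>
  define s where "s = (r \<bullet> k - l \<bullet> k) / 2"
  define r' where "r' = r - s *\<^sub>R k"
  define l' where "l' = l + s *\<^sub>R k"
  have s: "s > 0" using pos[OF k(1)] by (simp add: s_def)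
  have ri: "r' \<bullet> i = (if i = k then r \<bullet> k - s else r \<bullet> i)" if "i \<in> Basis" for i
    using that k(1) by (auto simp: r'_def inner_diff_left inner_Basis)
  have li: "l' \<bullet> i = (if i = k then l \<bullet> k + s else l \<bullet> i)" if "i \<in> Basis" for i
    using that k(1) by (auto simp: l'_def inner_add_left inner_Basis)
  have mid: "r \<bullet> k - s = l \<bullet> k + s" by (simp add: s_def field_simps)
  then have rk2: "r \<bullet> k - l \<bullet> k = 2 * s" by simp
  have g1: "good_box l r'" unfolding good_box_def
  proof (intro conjI ballI)
    fix i j :: 'a assume ij: "i \<in> Basis" "j \<in> Basis"
    show "l \<bullet> i < r' \<bullet> i" using pos[OF ij(1)] s mid ij ri by auto
    show "r' \<bullet> i - l \<bullet> i \<le> 2 * (r' \<bullet> j - l \<bullet> j)"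
      using ratio[OF ij] kmax[OF ij(1)] ratio[OF k(1) ij(2)] rk2 s unfolding ri[OF ij(1)] ri[OF ij(2)]
      by (cases "i = k"; cases "j = k"; simp)
  qed
  have g2: "good_box l' r" unfolding good_box_def
  proof (intro conjI ballI)
    fix i j :: 'a assume ij: "i \<in> Basis" "j \<in> Basis"
    show "l' \<bullet> i < r \<bullet> i" using pos[OF ij(1)] s mid ij li by auto
    show "r \<bullet> i - l' \<bullet> i \<le> 2 * (r \<bullet> j - l' \<bullet> j)"
      using ratio[OF ij] kmax[OF ij(1)] ratio[OF k(1) ij(2)] rk2 s unfolding li[OF ij(1)] li[OF ij(2)]
      by (cases "i = k"; cases "j = k"; simp)
  qed
  have c1: "cbox l r' = cbox l r \<inter> {x. x \<bullet> k \<le> l \<bullet> k + s}"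
  proof (intro set_eqI iffI)
    fix x assume "x \<in> cbox l r'"
    then have a: "l \<bullet> i \<le> x \<bullet> i" "x \<bullet> i \<le> r' \<bullet> i" if "i \<in> Basis" for i using that by (auto simp: mem_box)
    have "x \<bullet> i \<le> r \<bullet> i" if "i \<in> Basis" for i using a(2)[OF that] ri[OF that] s by (auto split: if_splits)
    moreover have "x \<bullet> k \<le> l \<bullet> k + s" using a(2)[OF k(1)] ri[OF k(1)] mid by simp
    ultimately show "x \<in> cbox l r \<inter> {x. x \<bullet> k \<le> l \<bullet> k + s}" using a(1) by (simp add: mem_box)
  next
    fix x assume x: "x \<in> cbox l r \<inter> {x. x \<bullet> k \<le> l \<bullet> k + s}"
    then have a: "l \<bullet> i \<le> x \<bullet> i" "x \<bullet> i \<le> r \<bullet> i" if "i \<in> Basis" for i using that by (auto simp: mem_box)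
    have "x \<bullet> i \<le> r' \<bullet> i" if "i \<in> Basis" for i using a(2)[OF that] ri[OF that] mid x by auto
    then show "x \<in> cbox l r'" using a(1) by (simp add: mem_box)
  qed
  have c2: "cbox l' r = cbox l r \<inter> {x. x \<bullet> k \<ge> l \<bullet> k + s}"
  proof (intro set_eqI iffI)
    fix x assume "x \<in> cbox l' r"
    then have a: "l' \<bullet> i \<le> x \<bullet> i" "x \<bullet> i \<le> r \<bullet> i" if "i \<in> Basis" for i using that by (auto simp: mem_box)
    have "l \<bullet> i \<le> x \<bullet> i" if "i \<in> Basis" for i using a(1)[OF that] li[OF that] s by (auto split: if_splits)
    moreover have "x \<bullet> k \<ge> l \<bullet> k + s" using a(1)[OF k(1)] li[OF k(1)] by simp
    ultimately show "x \<in> cbox l r \<inter> {x. x \<bullet> k \<ge> l \<bullet> k + s}" using a(2) by (simp add: mem_box)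
  next
    fix x assume x: "x \<in> cbox l r \<inter> {x. x \<bullet> k \<ge> l \<bullet> k + s}"
    then have a: "l \<bullet> i \<le> x \<bullet> i" "x \<bullet> i \<le> r \<bullet> i" if "i \<in> Basis" for i using that by (auto simp: mem_box)
    have "l' \<bullet> i \<le> x \<bullet> i" if "i \<in> Basis" for i using a(1)[OF that] li[OF that] x by auto
    then show "x \<in> cbox l' r" using a(2) by (simp add: mem_box)
  qed
  have p: "(\<Prod>i\<in>Basis. r \<bullet> i - l \<bullet> i) = (2 * s) * (\<Prod>i\<in>Basis - {k}. r \<bullet> i - l \<bullet> i)"
    using k(1) by (subst prod.remove[of _ k]) (auto simp: s_def)
  have p1: "(\<Prod>i\<in>Basis. r' \<bullet> i - l \<bullet> i) = s * (\<Prod>i\<in>Basis - {k}. r \<bullet> i - l \<bullet> i)"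
  proof -
    have "(\<Prod>i\<in>Basis. r' \<bullet> i - l \<bullet> i) = (r' \<bullet> k - l \<bullet> k) * (\<Prod>i\<in>Basis - {k}. r' \<bullet> i - l \<bullet> i)" using k(1) by (intro prod.remove) auto
    also have "r' \<bullet> k - l \<bullet> k = s" using k(1) mid by (simp add: ri)
    also have "(\<Prod>i\<in>Basis - {k}. r' \<bullet> i - l \<bullet> i) = (\<Prod>i\<in>Basis - {k}. r \<bullet> i - l \<bullet> i)" by (intro prod.cong) (auto simp: ri)
    finally show ?thesis .
  qed
  have p2: "(\<Prod>i\<in>Basis. r \<bullet> i - l' \<bullet> i) = s * (\<Prod>i\<in>Basis - {k}. r \<bullet> i - l \<bullet> i)"
  proof -
    have "(\<Prod>i\<in>Basis. r \<bullet> i - l' \<bullet> i) = (r \<bullet> k - l' \<bullet> k) * (\<Prod>i\<in>Basis - {k}. r \<bullet> i - l' \<bullet> i)" using k(1) by (intro prod.remove) auto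
    also have "r \<bullet> k - l' \<bullet> k = s" using k(1) mid by (simp add: li)
    also have "(\<Prod>i\<in>Basis - {k}. r \<bullet> i - l' \<bullet> i) = (\<Prod>i\<in>Basis - {k}. r \<bullet> i - l \<bullet> i)" by (intro prod.cong) (auto simp: li)
    finally show ?thesis .
  qed
  show thesis
  proof (rule that[OF g1 g2])
    show "cbox l r' \<subseteq> cbox l r" "cbox l' r \<subseteq> cbox l r" using c1 c2 by auto
    show "measure lborel (cbox l r') = measure lborel (cbox l r) / 2" "measure lborel (cbox l' r) = measure lborel (cbox l r) / 2"
      unfolding content_good_box[OF g1] content_good_box[OF g2] content_good_box[OF assms] p p1 p2 by auto
    fix f :: "'a \<Rightarrow> real" assume "f integrable_on cbox l r"
    from integral_split[OF this k(1), of "l \<bullet> k + s"] show "integral (cbox l r) f = integral (cbox l r') f + integral (cbox l' r) f"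
      unfolding c1 c2 .
  qed
qed

text \<open>The shortest side is at most the root of the volume of order \<open>DIM('a)\<close>, and
  every side is at most twice the shortest; so small volume forces small diameter. The factor 4
  leaves \<open>\<delta> / 2\<close>.\<close>

lemma good_box_small_diameter:
  fixes l r :: "'a::euclidean_space"
  assumes "good_box l r" "measure lborel (cbox l r) \<le> (\<delta> / (4 * real DIM('a))) ^ DIM('a)" "\<delta> > 0" "x \<in> cbox l r" "y \<in> cbox l r"
  shows "norm (x - y) < \<delta>"
proof -
  have pos: "l \<bullet> i < r \<bullet> i" if "i \<in> Basis" for i using assms(1) that by (simp add: good_box_def)
  have "Min ((\<lambda>i. r \<bullet> i - l \<bullet> i) ` Basis) \<in> (\<lambda>i. r \<bullet> i - l \<bullet> i) ` Basis" by (intro Min_in) auto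
  then obtain k where k: "k \<in> Basis" "r \<bullet> k - l \<bullet> k = Min ((\<lambda>i. r \<bullet> i - l \<bullet> i) ` Basis)" by (elim imageE) simp
  define m where "m = r \<bullet> k - l \<bullet> k"
  have mmin: "m \<le> r \<bullet> i - l \<bullet> i" if "i \<in> Basis" for i using that k by (auto simp: m_def)
  have m: "m > 0" using pos[OF k(1)] by (simp add: m_def)
  have "m ^ DIM('a) = (\<Prod>i\<in>(Basis::'a set). m)" by simp
  also have "\<dots> \<le> (\<Prod>i\<in>Basis. r \<bullet> i - l \<bullet> i)" by (intro prod_mono) (use m mmin in auto)
  also have "\<dots> \<le> (\<delta> / (4 * real DIM('a))) ^ DIM('a)" using assms(2) by (simp add: content_good_box[OF assms(1)])
  finally have md: "m \<le> \<delta> / (4 * real DIM('a))"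
    using power_le_imp_le_base[of m "DIM('a) - 1" "\<delta> / (4 * real DIM('a))"] assms(3) by simp
  have "norm (x - y) \<le> (\<Sum>i\<in>Basis. \<bar>(x - y) \<bullet> i\<bar>)" by (rule norm_le_l1)
  also have "\<dots> \<le> (\<Sum>i\<in>(Basis::'a set). 2 * m)"
  proof (rule sum_mono)
    fix i :: 'a assume i: "i \<in> Basis"
    have "\<bar>(x - y) \<bullet> i\<bar> \<le> r \<bullet> i - l \<bullet> i" using assms(4,5) i unfolding mem_box inner_diff_left by (smt (verit))
    also have "\<dots> \<le> 2 * m" using assms(1) i k(1) by (simp add: good_box_def m_def)
    finally show "\<bar>(x - y) \<bullet> i\<bar> \<le> 2 * m" .
  qed
  also have "\<dots> = real DIM('a) * (2 * m)" by simp
  also have "\<dots> \<le> real DIM('a) * (2 * (\<delta> / (4 * real DIM('a))))" using md by (intro mult_left_mono) auto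
  also have "\<dots> = \<delta> / 2" by simp
  finally show ?thesis using assms(3) by simp
qed

section \<open>Weighted oscillation on boxes by repeated bisection\<close>

lemma exp_bounds: "exp (1/4 :: real) \<le> 3/2" "exp (1/10 :: real) \<le> 2"
proof -
  have "exp (1/4 :: real) \<le> 1 + 1/4 + (1/4)\<^sup>2" by (rule exp_bound) auto
  then show a: "exp (1/4 :: real) \<le> 3/2" by (simp add: power2_eq_square)
  have "exp (1/10 :: real) \<le> exp (1/4)" by simp
  then show "exp (1/10 :: real) \<le> 2" using a by linarith
qed

text \<open>On each good box the approximating constant \<open>a\<close> is left free; the argument
  compares the constants of nested boxes and never uses means. \<open>g\<close> is the weight to be
  paired with the oscillating function.\<close>

locale oscillation =
  fixes f g :: "'a::euclidean_space \<Rightarrow> real" and \<kappa> :: real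
  assumes f: "\<And>l r. f absolutely_integrable_on cbox l r" and \<kappa>: "\<kappa> > 0"
    and osc: "\<And>l r. good_box l r \<Longrightarrow> \<exists>a. integral (cbox l r) (\<lambda>x. \<bar>f x - a\<bar>) \<le> \<kappa> * measure lborel (cbox l r)"
    and g: "continuous_on UNIV g" "\<And>x. 0 \<le> g x" "\<And>x. g x \<le> 1"
begin

lemma fa: "(\<lambda>x. \<bar>f x - a\<bar>) integrable_on cbox l r"
proof -
  have "(\<lambda>x. f x - a) absolutely_integrable_on cbox l r" using f by (intro set_integral_diff) auto
  then show ?thesis by (simp add: absolutely_integrable_on_def)
qed

lemma fg: "(\<lambda>x. \<bar>f x - a\<bar> * g x) integrable_on cbox l r"
proof -
  have "(\<lambda>x. g x * (f x - a)) absolutely_integrable_on cbox l r"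
  proof (rule absolutely_integrable_bounded_measurable_product[OF bilinear_times])
    have cg: "continuous_on (cbox l r) g" by (rule continuous_on_subset[OF g(1)]) auto
    show "g \<in> borel_measurable (lebesgue_on (cbox l r))"
      by (rule continuous_imp_measurable_on_sets_lebesgue[OF cg]) auto
    show "bounded (g ` cbox l r)" by (intro compact_imp_bounded compact_continuous_image cg) auto
    show "(\<lambda>x. f x - a) absolutely_integrable_on cbox l r" using f by (intro set_integral_diff) auto
  qed auto
  then have "(\<lambda>x. \<bar>g x * (f x - a)\<bar>) integrable_on cbox l r" by (simp add: absolutely_integrable_on_def)
  then show ?thesis using g(2) by (simp add: abs_mult mult.commute)
qed

lemma gi: "g integrable_on cbox l r"
  by (rule integrable_continuous[OF continuous_on_subset[OF g(1)]]) auto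

lemma gi_nonneg: "0 \<le> integral (cbox l r) g"
  by (rule Henstock_Kurzweil_Integration.integral_nonneg[OF gi]) (rule g)

lemma gi_le: "integral (cbox l r) g \<le> measure lborel (cbox l r)"
  using Henstock_Kurzweil_Integration.integral_le[OF gi integrable_const[of 1 l r]] g(3) by simp

lemma fa_nonneg: "0 \<le> integral (cbox l r) (\<lambda>x. \<bar>f x - a\<bar>)"
  by (rule Henstock_Kurzweil_Integration.integral_nonneg[OF fa]) auto

text \<open>
  Induction on the number of bisections.  On a half of the box on which the mean of \<open>\<bar>f - a\<bar>\<close> exceeds
  \<open>2 * \<kappa>\<close>, the constant \<open>a\<close> is replaced by one adapted to the half; the change is paid for by
  decreasing \<open>m\<close>, which is why \<open>m\<close> must range over all reals.  Splitting only down to the volume \<open>v0\<close>,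
  below which the continuous weight \<open>g\<close> is nearly constant, avoids Lebesgue points.
\<close>

lemma oscillation_step:
  assumes \<omega>: "\<omega> \<ge> 0" and v0: "v0 > 0"
    and v: "\<And>l r x y. good_box l r \<Longrightarrow> cbox l r \<subseteq> Q \<Longrightarrow> measure lborel (cbox l r) \<le> v0 \<Longrightarrow> x \<in> cbox l r \<Longrightarrow> y \<in> cbox l r \<Longrightarrow> \<bar>g x - g y\<bar> \<le> \<omega>"
  shows "good_box l r \<Longrightarrow> cbox l r \<subseteq> Q \<Longrightarrow> measure lborel (cbox l r) \<le> v0 * 2 ^ k \<Longrightarrow>
    integral (cbox l r) (\<lambda>x. \<bar>f x - a\<bar>) \<le> 2 * \<kappa> * measure lborel (cbox l r) \<Longrightarrow>
    integral (cbox l r) (\<lambda>x. \<bar>f x - a\<bar> * g x) / (20 * \<kappa>) \<le> m * integral (cbox l r) g +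
      exp (- m) * (2 * measure lborel (cbox l r) + 2 / \<kappa> * integral (cbox l r) (\<lambda>x. \<bar>f x - a\<bar>)) + \<omega> / 5 * measure lborel (cbox l r)"
proof (induction k arbitrary: l r a m)
  case 0
  let ?\<mu> = "measure lborel (cbox l r)" and ?I = "integral (cbox l r) (\<lambda>x. \<bar>f x - a\<bar>)" and ?g = "integral (cbox l r) g"
  have lin: "l \<in> cbox l r" using 0(1) by (auto simp: good_box_def mem_box less_imp_le)
  \<comment> \<open>On a box this small the weight is its value at a corner, up to
    \<open>\<omega>\<close>.\<close>
  define \<gamma> where "\<gamma> = g l"
  have \<gamma>: "\<bar>g x - \<gamma>\<bar> \<le> \<omega>" if "x \<in> cbox l r" for x unfolding \<gamma>_def using 0 lin that by (intro v) auto
  have \<gamma>0: "0 \<le> \<gamma>" using g by (simp add: \<gamma>_def)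
  have \<mu>: "?\<mu> > 0" by (rule content_good_box_pos[OF 0(1)])
  have "integral (cbox l r) (\<lambda>x. \<bar>f x - a\<bar> * g x) \<le> integral (cbox l r) (\<lambda>x. \<bar>f x - a\<bar> * (\<gamma> + \<omega>))"
  proof (rule Henstock_Kurzweil_Integration.integral_le[OF fg])
    show "(\<lambda>x. \<bar>f x - a\<bar> * (\<gamma> + \<omega>)) integrable_on cbox l r" by (intro integrable_on_mult_left fa)
    show "\<bar>f x - a\<bar> * g x \<le> \<bar>f x - a\<bar> * (\<gamma> + \<omega>)" if "x \<in> cbox l r" for x
      using \<gamma>[OF that] by (intro mult_left_mono) auto
  qed
  also have "\<dots> = ?I * (\<gamma> + \<omega>)" by simp
  also have "\<dots> \<le> 2 * \<kappa> * ?\<mu> * (\<gamma> + \<omega>)" using 0(4) \<gamma>0 \<omega> by (intro mult_right_mono) auto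
  finally have "integral (cbox l r) (\<lambda>x. \<bar>f x - a\<bar> * g x) / (20 * \<kappa>) \<le> 2 * \<kappa> * ?\<mu> * (\<gamma> + \<omega>) / (20 * \<kappa>)"
    using \<kappa> by (intro divide_right_mono) auto
  also have "\<dots> = (?\<mu> * \<gamma>) / 10 + \<omega> / 10 * ?\<mu>" using \<kappa> by (simp add: field_simps)
  also have "?\<mu> * \<gamma> \<le> ?g + \<omega> * ?\<mu>"
  proof -
    have "integral (cbox l r) (\<lambda>x. \<gamma>) \<le> integral (cbox l r) (\<lambda>x. g x + \<omega>)"
    proof (rule Henstock_Kurzweil_Integration.integral_le)
      show "(\<lambda>x. g x + \<omega>) integrable_on cbox l r" using gi by (intro integrable_add) auto
      show "\<gamma> \<le> g x + \<omega>" if "x \<in> cbox l r" for x using \<gamma>[OF that] by linarith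
    qed auto
    moreover have "integral (cbox l r) (\<lambda>x. g x + \<omega>) = integral (cbox l r) g + integral (cbox l r) (\<lambda>x. \<omega>)"
      by (rule Henstock_Kurzweil_Integration.integral_add[OF gi]) auto
    ultimately show ?thesis by (simp add: mult.commute)
  qed
  finally have 1: "integral (cbox l r) (\<lambda>x. \<bar>f x - a\<bar> * g x) / (20 * \<kappa>) \<le> ?g / 10 + \<omega> / 5 * ?\<mu>" by (simp add: field_simps)
  \<comment> \<open>The inequality \<open>1 + x \<le> exp x\<close> is the source of the duality
    between linear rate and exponential price. It holds for negative \<open>m\<close> as well, as
    the induction demands.\<close>
  have "1/10 \<le> m + exp (1/10 - m)" using exp_ge_add_one_self[of "1/10 - m"] by linarith
  then have "(1/10) * ?g \<le> (m + exp (1/10 - m)) * ?g" by (intro mult_right_mono gi_nonneg)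
  also have "\<dots> = m * ?g + exp (- m) * (exp (1/10) * ?g)"
  proof -
    have "exp (1/10 - m) = exp (- m) * exp (1/10)" by (simp flip: exp_add)
    then show ?thesis by (simp add: algebra_simps)
  qed
  also have "\<dots> \<le> m * ?g + exp (- m) * (2 * ?\<mu> + 2 / \<kappa> * ?I)"
  proof -
    have "exp (1/10) * ?g \<le> 2 * ?\<mu>" using exp_bounds gi_le gi_nonneg by (intro mult_mono) auto
    moreover have "0 \<le> 2 / \<kappa> * ?I" using \<kappa> fa_nonneg by simp
    ultimately show ?thesis by (intro add_left_mono mult_left_mono) auto
  qed
  finally show ?case using 1 by simp
next
  case (Suc k)
  have child: "integral (cbox l' r') (\<lambda>x. \<bar>f x - a\<bar> * g x) / (20 * \<kappa>) \<le> m * integral (cbox l' r') g +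
      exp (- m) * (2 * measure lborel (cbox l' r') + 2 / \<kappa> * integral (cbox l' r') (\<lambda>x. \<bar>f x - a\<bar>)) + \<omega> / 5 * measure lborel (cbox l' r')"
    if gb: "good_box l' r'" and sub: "cbox l' r' \<subseteq> Q" and half: "measure lborel (cbox l' r') = measure lborel (cbox l r) / 2"
      and le: "integral (cbox l' r') (\<lambda>x. \<bar>f x - a\<bar>) \<le> integral (cbox l r) (\<lambda>x. \<bar>f x - a\<bar>)" for l' r'
  proof -
    let ?\<mu> = "measure lborel (cbox l' r')" and ?g = "integral (cbox l' r') g"
    let ?I = "\<lambda>a. integral (cbox l' r') (\<lambda>x. \<bar>f x - a\<bar>)"
    have \<mu>: "?\<mu> > 0" by (rule content_good_box_pos[OF gb])
    have small: "?\<mu> \<le> v0 * 2 ^ k" using half Suc.prems(3) by simp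
    show ?thesis
    proof (cases "?I a \<le> 2 * \<kappa> * ?\<mu>")
      case True
      then show ?thesis by (rule Suc.IH[OF gb sub small])
    next
      case False
      \<comment> \<open>The half has half of the volume but may carry the whole integral, so the
        bound on the mean doubles.\<close>
      have I4: "?I a \<le> 4 * \<kappa> * ?\<mu>"
      proof -
        have e: "measure lborel (cbox l r) = 2 * ?\<mu>" using half by simp
        show ?thesis using le Suc.prems(4) unfolding e by simp
      qed
      obtain a' where a': "?I a' \<le> \<kappa> * ?\<mu>" using osc[OF gb] by auto
      have "integral (cbox l' r') (\<lambda>x. \<bar>a - a'\<bar>) \<le> integral (cbox l' r') (\<lambda>x. \<bar>f x - a\<bar> + \<bar>f x - a'\<bar>)"
        by (rule Henstock_Kurzweil_Integration.integral_le) (auto intro!: integrable_add fa)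
      then have "\<bar>a - a'\<bar> * ?\<mu> \<le> ?I a + ?I a'"
        by (simp add: Henstock_Kurzweil_Integration.integral_add fa mult.commute)
      also have "\<dots> \<le> 5 * \<kappa> * ?\<mu>" using I4 a' by simp
      finally have aa: "\<bar>a - a'\<bar> \<le> 5 * \<kappa>" using \<mu> by simp
      \<comment> \<open>The two constants differ by at most \<open>4 * \<kappa> + \<kappa>\<close>;
        dividing the integral by \<open>20 * \<kappa>\<close> makes the decrease of \<open>m\<close>
        at most 1/4.\<close>
      define t where "t = \<bar>a - a'\<bar> / (20 * \<kappa>)"
      have t: "0 \<le> t" "t \<le> 1/4" using aa \<kappa> by (auto simp: t_def field_simps)
      have "?I a' \<le> 2 * \<kappa> * ?\<mu>" using a' \<kappa> \<mu> mult_pos_pos[OF \<kappa> \<mu>] by linarith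
      from Suc.IH[OF gb sub small this, of "m - t"]
      have IH: "integral (cbox l' r') (\<lambda>x. \<bar>f x - a'\<bar> * g x) / (20 * \<kappa>) \<le> (m - t) * ?g + exp (t - m) * (2 * ?\<mu> + 2 / \<kappa> * ?I a') + \<omega> / 5 * ?\<mu>"
        by simp
      have "integral (cbox l' r') (\<lambda>x. \<bar>f x - a\<bar> * g x) \<le> integral (cbox l' r') (\<lambda>x. \<bar>f x - a'\<bar> * g x + \<bar>a - a'\<bar> * g x)"
      proof (rule Henstock_Kurzweil_Integration.integral_le[OF fg])
        show "(\<lambda>x. \<bar>f x - a'\<bar> * g x + \<bar>a - a'\<bar> * g x) integrable_on cbox l' r'"
          by (intro integrable_add fg integrable_on_mult_right gi)
        show "\<bar>f x - a\<bar> * g x \<le> \<bar>f x - a'\<bar> * g x + \<bar>a - a'\<bar> * g x" for x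
          using g(2)[of x] unfolding distrib_right[symmetric] by (intro mult_right_mono) auto
      qed
      also have "\<dots> = integral (cbox l' r') (\<lambda>x. \<bar>f x - a'\<bar> * g x) + \<bar>a - a'\<bar> * ?g"
        by (simp add: Henstock_Kurzweil_Integration.integral_add fg integrable_on_mult_right gi)
      finally have "integral (cbox l' r') (\<lambda>x. \<bar>f x - a\<bar> * g x) / (20 * \<kappa>) \<le> (integral (cbox l' r') (\<lambda>x. \<bar>f x - a'\<bar> * g x) + \<bar>a - a'\<bar> * ?g) / (20 * \<kappa>)"
        using \<kappa> by (intro divide_right_mono) auto
      also have "\<dots> = integral (cbox l' r') (\<lambda>x. \<bar>f x - a'\<bar> * g x) / (20 * \<kappa>) + t * ?g"
        by (simp add: t_def add_divide_distrib)
      also have "\<dots> \<le> m * ?g + exp (t - m) * (2 * ?\<mu> + 2 / \<kappa> * ?I a') + \<omega> / 5 * ?\<mu>"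
        using IH by (simp add: algebra_simps)
      \<comment> \<open>With \<open>a'\<close> the bracket is at most 4 volumes, and the shift
        multiplies it by at most 3/2. With \<open>a\<close> it is at least \<open>2 + 4\<close>
        volumes, because the mean of \<open>\<bar>f - a\<bar>\<close> exceeds
        \<open>2 * \<kappa>\<close>. The coefficients 2 and \<open>2 / \<kappa>\<close> are balanced
        for this comparison.\<close>
      also have "exp (t - m) * (2 * ?\<mu> + 2 / \<kappa> * ?I a') \<le> exp (- m) * (2 * ?\<mu> + 2 / \<kappa> * ?I a)"
      proof -
        have "2 / \<kappa> * ?I a' \<le> 2 / \<kappa> * (\<kappa> * ?\<mu>)" using a' \<kappa> by (intro mult_left_mono) auto
        then have b1: "2 * ?\<mu> + 2 / \<kappa> * ?I a' \<le> 4 * ?\<mu>" using \<kappa> by simp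
        have "exp t \<le> exp (1/4)" using t by simp
        then have et: "exp t \<le> 3/2" using exp_bounds(1) by linarith
        have "exp t * (2 * ?\<mu> + 2 / \<kappa> * ?I a') \<le> 3/2 * (4 * ?\<mu>)"
          using b1 et \<mu> \<kappa> fa_nonneg[of l' r' a'] by (intro mult_mono) auto
        also have "\<dots> \<le> 2 * ?\<mu> + 2 / \<kappa> * ?I a"
        proof -
          have "2 / \<kappa> * (2 * \<kappa> * ?\<mu>) \<le> 2 / \<kappa> * ?I a" using False \<kappa> by (intro mult_left_mono) auto
          then show ?thesis using \<kappa> by simp
        qed
        finally have "exp (- m) * (exp t * (2 * ?\<mu> + 2 / \<kappa> * ?I a')) \<le> exp (- m) * (2 * ?\<mu> + 2 / \<kappa> * ?I a)"
          by (intro mult_left_mono) auto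
        then show ?thesis by (simp add: exp_diff exp_minus field_simps)
      qed
      finally show ?thesis by simp
    qed
  qed
  obtain l' r' where b: "good_box l r'" "good_box l' r" "cbox l r' \<subseteq> cbox l r" "cbox l' r \<subseteq> cbox l r"
    "measure lborel (cbox l r') = measure lborel (cbox l r) / 2" "measure lborel (cbox l' r) = measure lborel (cbox l r) / 2"
    and split: "\<And>f::'a \<Rightarrow> real. f integrable_on cbox l r \<Longrightarrow> integral (cbox l r) f = integral (cbox l r') f + integral (cbox l' r) f"
    by (rule good_box_bisect[OF Suc.prems(1)]) blast
  have sI: "integral (cbox l r) (\<lambda>x. \<bar>f x - a\<bar>) = integral (cbox l r') (\<lambda>x. \<bar>f x - a\<bar>) + integral (cbox l' r) (\<lambda>x. \<bar>f x - a\<bar>)"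
    by (rule split[OF fa])
  have c1: "integral (cbox l r') (\<lambda>x. \<bar>f x - a\<bar> * g x) / (20 * \<kappa>) \<le> m * integral (cbox l r') g +
      exp (- m) * (2 * measure lborel (cbox l r') + 2 / \<kappa> * integral (cbox l r') (\<lambda>x. \<bar>f x - a\<bar>)) + \<omega> / 5 * measure lborel (cbox l r')"
    using sI fa_nonneg[of l' r a] by (intro child b) (use b Suc.prems in auto)
  have c2: "integral (cbox l' r) (\<lambda>x. \<bar>f x - a\<bar> * g x) / (20 * \<kappa>) \<le> m * integral (cbox l' r) g +
      exp (- m) * (2 * measure lborel (cbox l' r) + 2 / \<kappa> * integral (cbox l' r) (\<lambda>x. \<bar>f x - a\<bar>)) + \<omega> / 5 * measure lborel (cbox l' r)"
    using sI fa_nonneg[of l r' a] by (intro child b) (use b Suc.prems in auto)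
  have \<mu>: "measure lborel (cbox l r) = measure lborel (cbox l r') + measure lborel (cbox l' r)" using b by simp
  show ?case unfolding split[OF fg] split[OF gi] sI \<mu> using add_mono[OF c1 c2] by (simp add: algebra_simps add_divide_distrib)
qed

text \<open>The induction is started with \<open>a = 0\<close>, which the bound on the mean of the
  modulus permits. The variation of the weight on the smallest boxes contributes an arbitrarily
  small \<open>e\<close>, and the coefficient 6 is
  \<open>2 + 2 / \<kappa> * (2 * \<kappa>)\<close>.\<close>

lemma oscillation_weighted:
  assumes Q: "good_box l r" and start: "integral (cbox l r) (\<lambda>x. \<bar>f x\<bar>) \<le> 2 * \<kappa> * measure lborel (cbox l r)"
  shows "integral (cbox l r) (\<lambda>x. \<bar>f x\<bar> * g x) \<le> 20 * \<kappa> * (m * integral (cbox l r) g + 6 * measure lborel (cbox l r) * exp (- m))"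
proof -
  let ?Q = "cbox l r" and ?\<mu> = "measure lborel (cbox l r)"
  have \<mu>: "?\<mu> > 0" by (rule content_good_box_pos[OF Q])
  have "integral ?Q (\<lambda>x. \<bar>f x\<bar> * g x) / (20 * \<kappa>) \<le> (m * integral ?Q g + 6 * ?\<mu> * exp (- m)) + e" if e: "e > 0" for e
  proof -
    define \<omega> where "\<omega> = 5 * e / ?\<mu>"
    have \<omega>: "\<omega> > 0" using e \<mu> by (simp add: \<omega>_def)
    have "uniformly_continuous_on ?Q g"
      by (intro compact_uniformly_continuous continuous_on_subset[OF g(1)]) auto
    then obtain \<delta> where \<delta>: "\<delta> > 0" "\<And>x y. x \<in> ?Q \<Longrightarrow> y \<in> ?Q \<Longrightarrow> dist y x < \<delta> \<Longrightarrow> dist (g y) (g x) < \<omega>"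
      unfolding uniformly_continuous_on_def using \<omega> by meson
    define v0 where "v0 = (\<delta> / (4 * real DIM('a))) ^ DIM('a)"
    have v0: "v0 > 0" using \<delta> by (simp add: v0_def)
    have vv: "\<bar>g x - g y\<bar> \<le> \<omega>" if "good_box l' r'" "cbox l' r' \<subseteq> ?Q" "measure lborel (cbox l' r') \<le> v0" "x \<in> cbox l' r'" "y \<in> cbox l' r'" for l' r' x y
    proof -
      have "norm (x - y) < \<delta>" using that \<delta>(1) by (intro good_box_small_diameter[of l' r']) (auto simp: v0_def)
      then show ?thesis using \<delta>(2)[of y x] that by (force simp: dist_norm)
    qed
    \<comment> \<open>The number of bisections that brings the volume below \<open>v0\<close>; the
      final bound does not depend on it.\<close>
    obtain k where "?\<mu> / v0 < 2 ^ k" using real_arch_pow[of 2 "?\<mu> / v0"] by auto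
    then have k: "?\<mu> \<le> v0 * 2 ^ k" using v0 by (simp add: field_simps)
    have "integral ?Q (\<lambda>x. \<bar>f x - 0\<bar> * g x) / (20 * \<kappa>) \<le> m * integral ?Q g +
      exp (- m) * (2 * ?\<mu> + 2 / \<kappa> * integral ?Q (\<lambda>x. \<bar>f x - 0\<bar>)) + \<omega> / 5 * ?\<mu>"
      using oscillation_step[OF less_imp_le[OF \<omega>] v0 vv Q subset_refl k, where a=0 and m=m] start by simp
    also have "\<omega> / 5 * ?\<mu> = e" using \<mu> by (simp add: \<omega>_def)
    also have "exp (- m) * (2 * ?\<mu> + 2 / \<kappa> * integral ?Q (\<lambda>x. \<bar>f x - 0\<bar>)) \<le> exp (- m) * (6 * ?\<mu>)"
    proof (rule mult_left_mono)
      have "2 / \<kappa> * integral ?Q (\<lambda>x. \<bar>f x\<bar>) \<le> 2 / \<kappa> * (2 * \<kappa> * ?\<mu>)" using start \<kappa> by (intro mult_left_mono) auto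
      then show "2 * ?\<mu> + 2 / \<kappa> * integral ?Q (\<lambda>x. \<bar>f x - 0\<bar>) \<le> 6 * ?\<mu>" using \<kappa> by simp
    qed simp
    finally show ?thesis by (simp add: mult.commute)
  qed
  then have "integral ?Q (\<lambda>x. \<bar>f x\<bar> * g x) / (20 * \<kappa>) \<le> m * integral ?Q g + 6 * ?\<mu> * exp (- m)" by (rule field_le_epsilon)
  then show ?thesis using \<kappa> by (simp add: field_simps)
qed

end

section \<open>From mean oscillation over balls to the weighted inequality\<close>

lemma locally_integrable_measurable:
  fixes f :: "'a::euclidean_space \<Rightarrow> 'b::euclidean_space"
  assumes "locally_integrable f" shows "f \<in> borel_measurable lebesgue"
proof (rule borel_measurable_LIMSEQ_metric)
  show "(\<lambda>x. indicat_real (cball 0 (real n)) x *\<^sub>R f x) \<in> borel_measurable lebesgue" for n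
    using assms unfolding locally_integrable_def set_integrable_def by (auto intro: borel_measurable_integrable)
  fix x :: 'a
  obtain N where N: "norm x \<le> real N" using real_arch_simple by blast
  have "\<forall>\<^sub>F n in sequentially. indicat_real (cball 0 (real n)) x *\<^sub>R f x = f x"
    using eventually_ge_at_top[of N] by eventually_elim (use N in auto)
  then show "(\<lambda>n. indicat_real (cball 0 (real n)) x *\<^sub>R f x) \<longlonglongrightarrow> f x" by (rule tendsto_eventually)
qed

lemma set_lebesgue_integral_abs:
  fixes f :: "'a::euclidean_space \<Rightarrow> real"
  assumes "f absolutely_integrable_on S" "bounded S" "S \<in> sets lebesgue"
  shows "(\<lambda>y. \<bar>f y - c\<bar>) absolutely_integrable_on S"
proof -
  have "S \<in> lmeasurable" using assms(2,3) by (simp add: bounded_set_imp_lmeasurable)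
  then have "(\<lambda>y. f y - c) absolutely_integrable_on S"
    using assms(1) by (intro set_integral_diff absolutely_integrable_on_const) auto
  from absolutely_integrable_norm[OF this] show ?thesis by (simp add: o_def)
qed

text \<open>The volume of the unit ball times \<open>(8 * n) ^ n\<close>, with \<open>n\<close> the
  dimension, bounds the ratio between the volumes of an enclosing ball and of a good box; the
  summand 2 makes room for the bound on the initial cube.\<close>

definition osc_const :: "'a::euclidean_space itself \<Rightarrow> real" where
  "osc_const _ = measure lebesgue (ball (0::'a) 1) * (2 + (8 * real DIM('a)) ^ DIM('a))"

lemma measure_ball_scale:
  fixes c :: "'a::euclidean_space"
  assumes "r > 0" shows "measure lebesgue (ball c r) = r ^ DIM('a) * measure lebesgue (ball (0::'a) 1)"
  using content_ball_conv_unit_ball[of r c] assms by (simp add: measure_completion)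

lemma measure_unit_ball_pos: "measure lebesgue (ball (0::'a::euclidean_space) 1) > 0"
  using content_ball_pos[of 1 "0::'a"] by simp

text \<open>Two facts start the bisection. On good boxes the oscillation is controlled by that on an
  enclosing ball of comparable volume. On the initial cube the mean of the modulus of
  \<open>f\<close> is controlled because \<open>f\<close> vanishes on at least half of the ball of
  radius \<open>2 * R\<close>, so that its mean over that ball is bounded by the oscillation
  alone.\<close>

lemma bounded_oscillation_weighted:
  fixes f g :: "'a::euclidean_space \<Rightarrow> real"
  assumes fl: "locally_integrable f" and N: "N > 0" and osc: "\<And>x r. r > 0 \<Longrightarrow> mean_oscillation f x r \<le> N"
    and R: "R > 0" and supp: "AE x in lebesgue. x \<notin> ball 0 R \<longrightarrow> f x = 0"
    and g: "continuous_on UNIV g" "\<And>x. 0 \<le> g x" "\<And>x. g x \<le> 1" and gint: "integrable lebesgue g" and m: "m \<ge> 0"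
  shows "(LINT x|lebesgue. \<bar>f x\<bar> * g x) \<le> 20 * (osc_const TYPE('a) * N) * (m * (LINT x|lebesgue. g x) + 6 * (2 * R) ^ DIM('a) * exp (- m))"
proof -
  let ?n = "DIM('a)" and ?V = "measure lebesgue (ball (0::'a) 1)"
  have V: "?V > 0" by (rule measure_unit_ball_pos)
  have fB: "f absolutely_integrable_on cball c r" for c r using fl by (simp add: locally_integrable_def)
  have fb: "f absolutely_integrable_on ball c r" for c r
    by (rule set_integrable_subset[OF fB[of c r]]) auto
  have fba: "(\<lambda>y. \<bar>f y - a\<bar>) absolutely_integrable_on ball c r" for a c r
    by (rule set_lebesgue_integral_abs[OF fb]) auto
  have ball_osc: "integral (ball c r) (\<lambda>y. \<bar>f y - ball_mean f c r\<bar>) \<le> N * measure lebesgue (ball c r)" if "r > 0" for c r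
  proof -
    have pos: "measure lebesgue (ball c r) > 0" using that V by (simp add: measure_ball_scale)
    have "(LINT y:ball c r|lebesgue. \<bar>f y - ball_mean f c r\<bar>) / measure lebesgue (ball c r) \<le> N"
      using osc[OF that, where x=c] by (simp add: mean_oscillation_def ball_mean_def)
    then show ?thesis using pos set_lebesgue_integral_eq_integral(2)[OF fba] by (simp add: pos_divide_le_eq)
  qed
  have cont_abs: "(\<lambda>x. \<bar>f x\<bar>) integrable_on ball c r" for c r using fba[where a=0 and c=c and r=r] by (simp add: absolutely_integrable_on_def)
  let ?\<kappa> = "osc_const TYPE('a) * N"
  have \<kappa>: "?\<kappa> > 0" using V N by (simp add: osc_const_def add_pos_nonneg)
  interpret oscillation f g ?\<kappa>
  proof
    show "f absolutely_integrable_on cbox l r" for l r using fl by (simp add: locally_integrable_def)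
    fix l r :: 'a assume lr: "good_box l r"
    obtain k :: 'a where k: "k \<in> Basis" using nonempty_Basis by blast
    define s where "s = r \<bullet> k - l \<bullet> k"
    have s: "s > 0" using lr k by (simp add: good_box_def s_def)
    have sides: "r \<bullet> i - l \<bullet> i \<le> 2 * s" "s / 2 \<le> r \<bullet> i - l \<bullet> i" if "i \<in> Basis" for i
      using lr k that unfolding good_box_def s_def by (auto simp: field_simps)
    \<comment> \<open>Each of the \<open>?n\<close> sides has length at most \<open>2 * s\<close>,
      so this bounds the distance from the corner \<open>l\<close>. Open balls call for a larger
      radius, hence \<open>2 * \<rho>\<close> below, which equals \<open>8 * ?n\<close> times
      \<open>s / 2\<close>.\<close>
    define \<rho> where "\<rho> = 2 * s * real ?n"
    have \<rho>: "\<rho> > 0" using s by (simp add: \<rho>_def)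
    have sub: "cbox l r \<subseteq> cball l \<rho>"
    proof
      fix x assume x: "x \<in> cbox l r"
      have "norm (x - l) \<le> (\<Sum>i\<in>Basis. \<bar>(x - l) \<bullet> i\<bar>)" by (rule norm_le_l1)
      also have "\<dots> \<le> (\<Sum>i\<in>(Basis::'a set). 2 * s)"
      proof (rule sum_mono)
        fix i :: 'a assume i: "i \<in> Basis"
        have "l \<bullet> i \<le> x \<bullet> i" "x \<bullet> i \<le> r \<bullet> i" using x i by (auto simp: mem_box)
        then show "\<bar>(x - l) \<bullet> i\<bar> \<le> 2 * s" using sides(1)[OF i] by (simp add: inner_diff_left)
      qed
      also have "\<dots> = \<rho>" by (simp add: \<rho>_def)
      finally show "x \<in> cball l \<rho>" by (simp add: dist_norm norm_minus_commute)
    qed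
    have sub': "cbox l r \<subseteq> ball l (2 * \<rho>)" using sub \<rho> by (force simp: subset_eq)
    have "(s / 2) ^ ?n = (\<Prod>i\<in>(Basis::'a set). s / 2)" by simp
    also have "\<dots> \<le> (\<Prod>i\<in>Basis. r \<bullet> i - l \<bullet> i)" using s sides(2) by (intro prod_mono) auto
    finally have vol: "(s / 2) ^ ?n \<le> measure lborel (cbox l r)" by (simp add: content_good_box[OF lr])
    define a where "a = ball_mean f l (2 * \<rho>)"
    have "integral (cbox l r) (\<lambda>x. \<bar>f x - a\<bar>) \<le> integral (ball l (2 * \<rho>)) (\<lambda>x. \<bar>f x - a\<bar>)"
    proof (rule integral_subset_le[OF sub'])
      have "f absolutely_integrable_on cbox l r" using fl by (simp add: locally_integrable_def)
      from set_lebesgue_integral_abs[OF this] show "(\<lambda>x. \<bar>f x - a\<bar>) integrable_on cbox l r" by (simp add: absolutely_integrable_on_def)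
      show "(\<lambda>x. \<bar>f x - a\<bar>) integrable_on ball l (2 * \<rho>)" using fba by (simp add: absolutely_integrable_on_def)
    qed auto
    also have "\<dots> \<le> N * measure lebesgue (ball l (2 * \<rho>))" unfolding a_def using \<rho> by (intro ball_osc) auto
    also have "measure lebesgue (ball l (2 * \<rho>)) = (8 * real ?n) ^ ?n * (s / 2) ^ ?n * ?V"
    proof -
      have "2 * \<rho> = (8 * real ?n) * (s / 2)" by (simp add: \<rho>_def)
      then have "(2 * \<rho>) ^ ?n = (8 * real ?n) ^ ?n * (s / 2) ^ ?n" by (simp only: power_mult_distrib)
      then show ?thesis using \<rho> by (subst measure_ball_scale) (simp, simp only:)
    qed
    also have "N * ((8 * real ?n) ^ ?n * (s / 2) ^ ?n * ?V) \<le> N * ((8 * real ?n) ^ ?n * measure lborel (cbox l r) * ?V)"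
      using N V vol by (intro mult_left_mono mult_right_mono) auto
    also have "\<dots> \<le> ?\<kappa> * measure lborel (cbox l r)"
      using N V by (simp add: osc_const_def algebra_simps)
    finally show "\<exists>a. integral (cbox l r) (\<lambda>x. \<bar>f x - a\<bar>) \<le> ?\<kappa> * measure lborel (cbox l r)" by blast
  qed (use \<kappa> g in auto)
  let ?l = "- R *\<^sub>R One :: 'a" and ?r = "R *\<^sub>R One :: 'a"
  have gb: "good_box ?l ?r" using R by (simp add: good_box_def inner_simps)
  have vQ: "measure lborel (cbox ?l ?r) = (2 * R) ^ ?n" unfolding content_good_box[OF gb] by (simp add: inner_simps)
  have ballQ: "ball 0 R \<subseteq> cbox ?l ?r"
  proof
    fix x :: 'a assume x: "x \<in> ball 0 R"
    have "\<bar>x \<bullet> i\<bar> \<le> R" if "i \<in> Basis" for i using Basis_le_norm[OF that, of x] x by simp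
    then show "x \<in> cbox ?l ?r" by (auto simp: mem_box abs_le_iff inner_simps) (metis minus_le_iff)
  qed
  let ?B = "ball (0::'a) R" and ?B2 = "ball (0::'a) (2 * R)"
  define \<mu> where "\<mu> = ball_mean f 0 (2 * R)"
  have R2: "2 * R > 0" using R by simp
  \<comment> \<open>Doubling the radius at least doubles the volume, so the outer ring occupies at
    least half of the large ball.\<close>
  have m2: "2 * measure lebesgue ?B \<le> measure lebesgue ?B2"
  proof -
    have "(2::real) ^ 1 \<le> 2 ^ ?n" by (intro power_increasing) auto
    then have "2 * (R ^ ?n * ?V) \<le> 2 ^ ?n * (R ^ ?n * ?V)" using R V by (intro mult_right_mono) auto
    then show ?thesis by (simp only: measure_ball_scale[OF R] measure_ball_scale[OF R2] power_mult_distrib mult.assoc)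
  qed
  have Npos: "measure lebesgue ?B2 > 0" using R V by (simp add: measure_ball_scale)
  have Bsub: "?B \<subseteq> ?B2" using R by auto
  have "integral (?B2 - ?B) (\<lambda>y. \<bar>f y - \<mu>\<bar>) \<le> integral ?B2 (\<lambda>y. \<bar>f y - \<mu>\<bar>)"
  proof (rule integral_subset_le)
    show "(\<lambda>y. \<bar>f y - \<mu>\<bar>) integrable_on ?B2" using fba by (simp add: absolutely_integrable_on_def)
    have "(\<lambda>y. \<bar>f y - \<mu>\<bar>) absolutely_integrable_on (?B2 - ?B)" by (rule set_integrable_subset[OF fba[where a=\<mu> and c=0 and r="2 * R"]]) auto
    then show "(\<lambda>y. \<bar>f y - \<mu>\<bar>) integrable_on (?B2 - ?B)" by (simp add: absolutely_integrable_on_def)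
  qed auto
  also have "\<dots> \<le> N * measure lebesgue ?B2" unfolding \<mu>_def using R by (intro ball_osc) auto
  \<comment> \<open>On the ring \<open>f\<close> is 0, so its distance from the mean is the modulus
    of the mean; this bounds the mean by \<open>2 * N\<close>.\<close>
  also have "integral (?B2 - ?B) (\<lambda>y. \<bar>f y - \<mu>\<bar>) = integral (?B2 - ?B) (\<lambda>y. \<bar>\<mu>\<bar>)"
  proof -
    obtain Z where Z: "{x. \<not> (x \<notin> ball 0 R \<longrightarrow> f x = 0)} \<subseteq> Z" "Z \<in> null_sets lebesgue"
      using supp by (auto simp: eventually_ae_filter)
    show ?thesis
      by (rule integral_spike[of Z]) (use Z in \<open>auto simp: negligible_iff_null_sets\<close>)
  qed
  also have "\<dots> = \<bar>\<mu>\<bar> * measure lebesgue (?B2 - ?B)"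
    by (subst lmeasure_integral) (auto simp flip: integral_mult_right)
  also have "measure lebesgue (?B2 - ?B) = measure lebesgue ?B2 - measure lebesgue ?B"
    by (rule measurable_measure_Diff) (use Bsub in auto)
  finally have "\<bar>\<mu>\<bar> * (measure lebesgue ?B2 - measure lebesgue ?B) \<le> N * measure lebesgue ?B2" .
  moreover have "\<bar>\<mu>\<bar> * (measure lebesgue ?B2 / 2) \<le> \<bar>\<mu>\<bar> * (measure lebesgue ?B2 - measure lebesgue ?B)"
    using m2 by (intro mult_left_mono) auto
  ultimately have "\<bar>\<mu>\<bar> * measure lebesgue ?B2 \<le> (2 * N) * measure lebesgue ?B2" by simp
  then have \<mu>: "\<bar>\<mu>\<bar> \<le> 2 * N" using Npos by simp
  have "integral (cbox ?l ?r) (\<lambda>x. \<bar>f x\<bar>) = integral ?B (\<lambda>x. \<bar>f x\<bar>)"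
  proof -
    obtain Z where Z: "{x. \<not> (x \<notin> ball 0 R \<longrightarrow> f x = 0)} \<subseteq> Z" "Z \<in> null_sets lebesgue"
      using supp by (auto simp: eventually_ae_filter)
    have "integral (cbox ?l ?r) (\<lambda>x. \<bar>f x\<bar>) = integral (cbox ?l ?r) (\<lambda>x. if x \<in> ?B then \<bar>f x\<bar> else 0)"
      by (rule integral_spike[of Z]) (use Z in \<open>auto simp: negligible_iff_null_sets\<close>)
    also have "\<dots> = integral (?B \<inter> cbox ?l ?r) (\<lambda>x. \<bar>f x\<bar>)"
      by (simp only: integral_restrict_Int Int_commute)
    also have "?B \<inter> cbox ?l ?r = ?B" using ballQ by auto
    finally show ?thesis .
  qed
  also have "\<dots> \<le> integral ?B2 (\<lambda>x. \<bar>f x\<bar>)" by (rule integral_subset_le[OF Bsub]) (auto intro: cont_abs)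
  also have "\<dots> \<le> integral ?B2 (\<lambda>x. \<bar>f x - \<mu>\<bar> + \<bar>\<mu>\<bar>)"
    by (rule Henstock_Kurzweil_Integration.integral_le[OF cont_abs])
      (use fba in \<open>auto intro!: integrable_add simp: absolutely_integrable_on_def integrable_on_const\<close>)
  also have "\<dots> = integral ?B2 (\<lambda>x. \<bar>f x - \<mu>\<bar>) + integral ?B2 (\<lambda>x. \<bar>\<mu>\<bar>)"
    by (rule Henstock_Kurzweil_Integration.integral_add) (use fba in \<open>auto simp: absolutely_integrable_on_def integrable_on_const\<close>)
  also have "integral ?B2 (\<lambda>x. \<bar>\<mu>\<bar>) = \<bar>\<mu>\<bar> * measure lebesgue ?B2"
    by (subst lmeasure_integral) (auto simp flip: integral_mult_right)
  also have "integral ?B2 (\<lambda>x. \<bar>f x - \<mu>\<bar>) + \<bar>\<mu>\<bar> * measure lebesgue ?B2 \<le> N * measure lebesgue ?B2 + 2 * N * measure lebesgue ?B2"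
    unfolding \<mu>_def[symmetric] using ball_osc[of "2 * R" 0] R \<mu> Npos by (intro add_mono mult_right_mono) (auto simp: \<mu>_def)
  also have "\<dots> = 3 * N * ((2 * R) ^ ?n * ?V)" by (simp only: measure_ball_scale[OF R2])
  also have "\<dots> \<le> 2 * ?\<kappa> * measure lborel (cbox ?l ?r)"
  proof -
    have "0 \<le> N * ((2 * R) ^ ?n * ?V)" "0 \<le> N * ((2 * R) ^ ?n * ?V) * (8 * real ?n) ^ ?n" using N R V by auto
    then show ?thesis unfolding vQ osc_const_def by (simp add: algebra_simps)
  qed
  finally have start: "integral (cbox ?l ?r) (\<lambda>x. \<bar>f x\<bar>) \<le> 2 * ?\<kappa> * measure lborel (cbox ?l ?r)" .
  have fgA: "(\<lambda>x. \<bar>f x\<bar> * g x) absolutely_integrable_on cbox ?l ?r"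
    using fg[of 0 ?l ?r] g(2) by (intro nonnegative_absolutely_integrable_1) auto
  have "(LINT x|lebesgue. \<bar>f x\<bar> * g x) = (LINT x:cbox ?l ?r|lebesgue. \<bar>f x\<bar> * g x)"
    unfolding set_lebesgue_integral_def
  proof (rule integral_cong_AE)
    show "AE x in lebesgue. \<bar>f x\<bar> * g x = indicat_real (cbox ?l ?r) x *\<^sub>R (\<bar>f x\<bar> * g x)"
      using supp by eventually_elim (use ballQ in \<open>auto simp: indicator_def\<close>)
    have fm: "f \<in> borel_measurable lebesgue" by (rule locally_integrable_measurable[OF fl])
    show "(\<lambda>x. \<bar>f x\<bar> * g x) \<in> borel_measurable lebesgue" using fm borel_measurable_integrable[OF gint] by measurable
    show "(\<lambda>x. indicat_real (cbox ?l ?r) x *\<^sub>R (\<bar>f x\<bar> * g x)) \<in> borel_measurable lebesgue"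
      using fgA unfolding set_integrable_def by (rule borel_measurable_integrable)
  qed
  also have "\<dots> = integral (cbox ?l ?r) (\<lambda>x. \<bar>f x\<bar> * g x)" by (rule set_lebesgue_integral_eq_integral(2)[OF fgA])
  also have "\<dots> \<le> 20 * ?\<kappa> * (m * integral (cbox ?l ?r) g + 6 * measure lborel (cbox ?l ?r) * exp (- m))"
    by (rule oscillation_weighted[OF gb start])
  also have "\<dots> \<le> 20 * ?\<kappa> * (m * (LINT x|lebesgue. g x) + 6 * (2 * R) ^ ?n * exp (- m))"
  proof -
    have gA: "g absolutely_integrable_on cbox ?l ?r"
      using integrable_mult_indicator[OF _ gint, of "cbox ?l ?r"] by (auto simp: set_integrable_def)
    have "integral (cbox ?l ?r) g = (LINT x:cbox ?l ?r|lebesgue. g x)" by (rule set_lebesgue_integral_eq_integral(2)[OF gA, symmetric])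
    also have "\<dots> \<le> (LINT x|lebesgue. g x)"
      unfolding set_lebesgue_integral_def using gA g(2)
      by (intro Bochner_Integration.integral_mono gint) (auto simp: set_integrable_def indicator_def)
    finally show ?thesis using \<kappa> m unfolding vQ by (intro mult_left_mono add_right_mono) auto
  qed
  finally show ?thesis .
qed

section \<open>Weak derivatives in time\<close>

text \<open>A passage between the gauge integral, convenient for indefinite integrals and
  subintervals, and the integral of Borel functions, to which Fubini's theorem applies.\<close>

lemma Icc_integral_conv:
  fixes F :: "real \<Rightarrow> real"
  assumes "integrable lborel (\<lambda>s. indicator {a..b} s * F s)"
  shows "F absolutely_integrable_on {a..b}" "integral {a..b} F = (LINT s|lborel. indicator {a..b} s * F s)"
proof -
  have s: "set_integrable lborel {a..b} F" using assms by (simp add: set_integrable_def)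
  then have "integrable lebesgue (\<lambda>s. indicator {a..b} s *\<^sub>R F s)"
    unfolding set_integrable_def by (subst integrable_completion) (auto dest: borel_measurable_integrable)
  then show "F absolutely_integrable_on {a..b}" by (simp add: set_integrable_def)
  show "integral {a..b} F = (LINT s|lborel. indicator {a..b} s * F s)"
    using set_borel_integral_eq_integral(2)[OF s] by (simp add: set_lebesgue_integral_def)
qed

lemma integrable_Icc_subset:
  fixes F :: "real \<Rightarrow> real"
  assumes "integrable lborel (\<lambda>s. indicator {a..b} s * F s)" "a \<le> c" "d \<le> b"
  shows "integrable lborel (\<lambda>s. indicator {c..d} s * F s)"
proof -
  have "integrable lborel (\<lambda>s. indicator {c..d} s *\<^sub>R (indicator {a..b} s * F s))"
    by (rule integrable_mult_indicator[OF _ assms(1)]) simp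
  then show ?thesis by (rule Bochner_Integration.integrable_cong[THEN iffD1, rotated -1]) (use assms in \<open>auto simp: indicator_def\<close>)
qed

lemma antiderivative_exists:
  fixes \<theta> :: "real \<Rightarrow> real"
  assumes "continuous_on UNIV \<theta>"
  obtains H where "\<And>x. (H has_real_derivative \<theta> x) (at x)"
proof -
  have "\<exists>F. \<forall>x::real. (-\<infinity>::ereal) < ereal x \<longrightarrow> ereal x < \<infinity> \<longrightarrow> (F has_vector_derivative \<theta> x) (at x)"
    by (rule einterval_antiderivative) (use assms in \<open>auto simp: continuous_on_eq_continuous_at\<close>)
  then show thesis using that by (auto simp: has_real_derivative_iff_has_vector_derivative)
qed

text \<open>Polarisation: the chain rule for the square is applied to \<open>\<Phi> + H\<close> and
  \<open>\<Phi> - H\<close>, where \<open>\<Phi>\<close> is the indefinite integral of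
  \<open>F\<close>, and the results are subtracted. The boundary terms cancel since \<open>H\<close>
  vanishes at \<open>T\<close> and \<open>\<Phi>\<close> at 0.\<close>

lemma integral_by_parts_ac:
  fixes F :: "real \<Rightarrow> real"
  assumes F: "F absolutely_integrable_on {0..T}" and T: "T > 0" and \<theta>: "continuous_on UNIV \<theta>"
    and H: "\<And>x. (H has_real_derivative \<theta> x) (at x)" and HT: "H T = 0"
  shows "integral {0..T} (\<lambda>s. \<theta> s * integral {0..s} F) = - integral {0..T} (\<lambda>s. H s * F s)"
proof -
  define \<Phi> where "\<Phi> t = integral {0..t} F" for t
  have FI: "F integrable_on {0..T}" using F by (simp add: absolutely_integrable_on_def)
  have c\<theta>: "continuous_on {0..T} \<theta>" by (rule continuous_on_subset[OF \<theta>]) auto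
  have cH: "continuous_on {0..T} H" by (rule DERIV_continuous_on[OF has_field_derivative_at_within[OF H]])
  have c\<Phi>: "continuous_on {0..T} \<Phi>" unfolding \<Phi>_def[abs_def] by (rule indefinite_integral_continuous_1[OF FI])
  have \<theta>A: "\<theta> absolutely_integrable_on {0..T}"
    using absolutely_integrable_continuous_real[OF c\<theta>] .
  have H\<theta>: "integral {0..t} \<theta> = H t - H 0" if "t \<in> {0..T}" for t
    using that H by (intro integral_unique fundamental_theorem_of_calculus)
      (auto simp: has_real_derivative_iff_has_vector_derivative[symmetric] intro: has_field_derivative_at_within)
  have A0: "(\<lambda>s. \<theta> s * c + F s) absolutely_integrable_on {0..T}" for c
    by (intro set_integral_add set_integrable_mult_left F) (use \<theta>A in auto)
  have sq: "(H T * c + \<Phi> T)\<^sup>2 = (H 0 * c + \<Phi> 0)\<^sup>2 + integral {0..T} (\<lambda>s. 2 * (H s * c + \<Phi> s) * (\<theta> s * c + F s))" for c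
  proof (rule chain_rule_integral[where \<beta>="\<lambda>x. x\<^sup>2" and U="\<lambda>t. H t * c + \<Phi> t" and S=UNIV, OF A0])
    fix t assume t: "t \<in> {0..T}"
    have i1: "(\<lambda>s. \<theta> s * c) integrable_on {0..t}"
      using t by (intro integrable_continuous_real continuous_intros continuous_on_subset[OF \<theta>]) auto
    have i2: "F integrable_on {0..t}" by (rule integrable_on_subinterval[OF FI]) (use t in auto)
    have "integral {0..t} (\<lambda>s. \<theta> s * c + F s) = (H t - H 0) * c + \<Phi> t"
      using Henstock_Kurzweil_Integration.integral_add[OF i1 i2] H\<theta>[OF t] by (simp add: \<Phi>_def)
    then show "H t * c + \<Phi> t = H 0 * c + \<Phi> 0 + integral {0..t} (\<lambda>s. \<theta> s * c + F s)" by (simp add: \<Phi>_def algebra_simps)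
  qed (use T in \<open>auto intro!: derivative_eq_intros continuous_intros\<close>)
  have A: "(\<lambda>s. 2 * (H s * c + \<Phi> s) * (\<theta> s * c + F s)) integrable_on {0..T}" for c
  proof -
    have "continuous_on {0..T} (\<lambda>s. 2 * (H s * c + \<Phi> s))" by (intro continuous_intros cH c\<Phi>)
    from absolutely_integrable_continuous_mult[OF A0 this]
    show ?thesis by (simp add: absolutely_integrable_on_def)
  qed
  have "integral {0..T} (\<lambda>s. 2 * (H s * 1 + \<Phi> s) * (\<theta> s * 1 + F s)) - integral {0..T} (\<lambda>s. 2 * (H s * (-1) + \<Phi> s) * (\<theta> s * (-1) + F s)) = 0"
    using sq[of 1] sq[of "-1"] HT by (simp add: \<Phi>_def)
  then have "integral {0..T} (\<lambda>s. 2 * (H s * 1 + \<Phi> s) * (\<theta> s * 1 + F s) - 2 * (H s * (-1) + \<Phi> s) * (\<theta> s * (-1) + F s)) = 0"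
    using Henstock_Kurzweil_Integration.integral_diff[OF A[of 1] A[of "-1"]] by simp
  moreover have "2 * (H s * 1 + \<Phi> s) * (\<theta> s * 1 + F s) - 2 * (H s * (-1) + \<Phi> s) * (\<theta> s * (-1) + F s) = 4 * (\<theta> s * \<Phi> s + H s * F s)" for s
    by (simp add: algebra_simps)
  ultimately have "integral {0..T} (\<lambda>s. 4 * (\<theta> s * \<Phi> s + H s * F s)) = 0" by simp
  then have "integral {0..T} (\<lambda>s. \<theta> s * \<Phi> s + H s * F s) = 0" by (simp only: integral_mult_right)
  moreover have "(\<lambda>s. H s * F s) integrable_on {0..T}"
    using absolutely_integrable_continuous_mult[OF F cH] by (simp add: absolutely_integrable_on_def)
  moreover have "(\<lambda>s. \<theta> s * \<Phi> s) integrable_on {0..T}"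
    by (intro integrable_continuous_real continuous_intros c\<theta> c\<Phi>)
  ultimately show ?thesis unfolding \<Phi>_def by (subst (asm) Henstock_Kurzweil_Integration.integral_add) auto
qed

lemma integrable_Icc_continuous_mult:
  fixes K G :: "real \<Rightarrow> real"
  assumes K: "continuous_on UNIV K" and G: "integrable lborel (\<lambda>t. indicator {0..T} t * G t)"
  shows "integrable lborel (\<lambda>t. indicator {0..T} t * (K t * G t))"
proof -
  have "bounded (K ` {0..T})" by (intro compact_imp_bounded compact_continuous_image continuous_on_subset[OF K]) auto
  then obtain M where M: "M > 0" "\<And>t. 0 \<le> t \<Longrightarrow> t \<le> T \<Longrightarrow> \<bar>K t\<bar> \<le> M" unfolding bounded_pos by auto
  have [measurable]: "K \<in> borel_measurable borel" by (rule borel_measurable_continuous_onI[OF K])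
  have "integrable lborel (\<lambda>t. (indicator {0..T} t * K t) * (indicator {0..T} t * G t))"
  proof (rule integrable_mult_bounded[OF G])
    show "\<bar>indicator {0..T} x * K x\<bar> \<le> M" for x using M by (auto simp: indicator_def less_imp_le)
  qed measurable
  then show ?thesis by (rule Bochner_Integration.integrable_cong[THEN iffD1, rotated -1]) (auto simp: indicator_def)
qed

text \<open>Test functions may be nonzero at time 0, so there is no constant of integration and the
  initial value 0 is part of the conclusion. Taking a mollifier kernel as the derivative of the test
  function shows that every mollification of the difference \<open>W\<close> vanishes.\<close>

lemma du_bois_reymond:
  fixes F v :: "real \<Rightarrow> real"
  assumes [measurable]: "F \<in> borel_measurable borel" "v \<in> borel_measurable borel" and T: "T > 0"
    and F: "integrable lborel (\<lambda>s. indicator {0..T} s * F s)" and v: "integrable lborel (\<lambda>s. indicator {0..T} s * v s)"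
    and weak: "\<And>\<eta>. smooth1 \<eta> \<Longrightarrow> \<eta> 0 T = 0 \<Longrightarrow>
      (LINT t|lborel. indicator {0..T} t * (\<eta> (Suc 0) t * v t)) + (LINT t|lborel. indicator {0..T} t * (\<eta> 0 t * F t)) = 0"
  shows "AE t in lborel. t \<in> {0..T} \<longrightarrow> v t = integral {0..t} F"
proof -
  define \<Phi> where "\<Phi> t = (LINT s|lborel. indicator {0..t} s * F s)" for t
  have \<Phi>: "integral {0..t} F = \<Phi> t" if "t \<in> {0..T}" for t
    unfolding \<Phi>_def using that by (intro Icc_integral_conv(2) integrable_Icc_subset[OF F]) auto
  have FA: "F absolutely_integrable_on {0..T}" by (rule Icc_integral_conv(1)[OF F])
  have FI: "F integrable_on {0..T}" using FA by (simp add: absolutely_integrable_on_def)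
  have c\<Phi>: "continuous_on {0..T} \<Phi>"
    using indefinite_integral_continuous_1[OF FI] \<Phi> by (subst continuous_on_cong[OF refl, of _ _ "\<lambda>t. integral {0..t} F"]) auto
  define W where "W t = indicator {0..T} t * (v t - \<Phi> t)" for t
  have i\<Phi>: "integrable lborel (\<lambda>t. indicator {0..T} t * \<Phi> t)"
    using borel_integrable_compact[of "{0..T}" \<Phi>] c\<Phi> by simp
  have Wi: "integrable lborel W" unfolding W_def[abs_def] using v i\<Phi> by (simp add: right_diff_distrib)
  have "moll \<epsilon> W y = 0" if e: "\<epsilon> > 0" for \<epsilon> y
  proof -
    define D where "D n s = inverse (kmass TYPE(real) * \<epsilon> ^ 1) * shifted_bump \<epsilon> y n s" for n s
    have D: "smooth1 D" unfolding D_def[abs_def] by (rule smooth1_cmult[OF smooth1_shifted_bump])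
    have Dk: "kern \<epsilon> (y - t) = D 0 t" for t by (simp add: kern_eq_prod D_def divide_inverse)
    have cD: "continuous_on S (D 0)" for S by (rule smooth1_continuous[OF D])
    obtain H0 where H0: "\<And>x. (H0 has_real_derivative D 0 x) (at x)" by (rule antiderivative_exists[OF cD]) blast
    \<comment> \<open>The antiderivative of the kernel that vanishes at \<open>T\<close>, as an
      admissible test function must. The derivatives of \<open>H\<close> are the kernel and its
      derivatives, shifted by one place in \<open>\<eta>\<close>.\<close>
    define H where "H t = H0 t - H0 T" for t
    have H: "(H has_real_derivative D 0 x) (at x)" for x unfolding H_def[abs_def] using DERIV_diff[OF H0 DERIV_const] by simp
    define \<eta> where "\<eta> n = (case n of 0 \<Rightarrow> H | Suc m \<Rightarrow> D m)" for n
    have s\<eta>: "smooth1 \<eta>" unfolding smooth1_def \<eta>_def using H smooth1D[OF D] by (auto split: nat.split)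
    have w: "(LINT t|lborel. indicator {0..T} t * (D 0 t * v t)) + (LINT t|lborel. indicator {0..T} t * (H t * F t)) = 0"
      using weak[OF s\<eta>] by (simp add: \<eta>_def H_def)
    have cH: "continuous_on S H" for S by (rule DERIV_continuous_on[OF has_field_derivative_at_within[OF H]])
    have "moll \<epsilon> W y = (LINT t|lborel. indicator {0..T} t * (D 0 t * v t) - indicator {0..T} t * (D 0 t * \<Phi> t))"
      unfolding moll_def W_def Dk by (intro Bochner_Integration.integral_cong) (auto simp: algebra_simps)
    also have "\<dots> = (LINT t|lborel. indicator {0..T} t * (D 0 t * v t)) - (LINT t|lborel. indicator {0..T} t * (D 0 t * \<Phi> t))"
      by (intro Bochner_Integration.integral_diff integrable_Icc_continuous_mult v i\<Phi> cD)
    also have "(LINT t|lborel. indicator {0..T} t * (D 0 t * \<Phi> t)) = integral {0..T} (\<lambda>t. D 0 t * \<Phi> t)"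
      by (rule Icc_integral_conv(2)[symmetric]) (intro integrable_Icc_continuous_mult i\<Phi> cD)
    also have "\<dots> = integral {0..T} (\<lambda>t. D 0 t * integral {0..t} F)"
      by (rule Henstock_Kurzweil_Integration.integral_cong) (simp add: \<Phi>)
    also have "\<dots> = - integral {0..T} (\<lambda>s. H s * F s)"
      by (rule integral_by_parts_ac[OF FA T cD H]) (simp add: H_def)
    also have "integral {0..T} (\<lambda>s. H s * F s) = (LINT t|lborel. indicator {0..T} t * (H t * F t))"
      by (rule Icc_integral_conv(2)) (intro integrable_Icc_continuous_mult F cH)
    finally show ?thesis using w by simp
  qed
  then have "AE t in lborel. W t = 0" by (rule moll_eq_0_imp_AE_0[OF loc_int_integrable[OF Wi]])
  then show ?thesis by eventually_elim (auto simp: W_def \<Phi>)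
qed

text \<open>The integrand is written with \<open>v\<close> itself rather than with its continuous
  version, so that for a family of such functions it inherits joint measurability in time and
  space.\<close>

lemma weak_chain_rule:
  fixes F v :: "real \<Rightarrow> real"
  assumes [measurable]: "F \<in> borel_measurable borel" "v \<in> borel_measurable borel" and T: "T > 0"
    and F: "integrable lborel (\<lambda>s. indicator {0..T} s * F s)"
    and eq: "AE t in lborel. t \<in> {0..T} \<longrightarrow> v t = integral {0..t} F"
    and \<beta>: "\<And>x. (\<beta> has_real_derivative \<beta>' x) (at x)" "continuous_on UNIV \<beta>'" "\<beta> 0 = 0"
  shows "AE t in lborel. t \<in> {0..T} \<longrightarrow> \<beta> (v t) = (LINT s|lborel. indicator {0..t} s * (\<beta>' (v s) * F s))"
  using eq
proof eventually_elim
  case (elim t)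
  show ?case
  proof
    assume t: "t \<in> {0..T}"
    define U where "U s = integral {0..s} F" for s
    have Ft: "integrable lborel (\<lambda>s. indicator {0..t} s * F s)" by (rule integrable_Icc_subset[OF F]) (use t in auto)
    have FA: "F absolutely_integrable_on {0..t}" by (rule Icc_integral_conv(1)[OF Ft])
    have FI: "F integrable_on {0..t}" using FA by (simp add: absolutely_integrable_on_def)
    have cU: "continuous_on {0..t} U" unfolding U_def[abs_def] by (rule indefinite_integral_continuous_1[OF FI])
    have c: "continuous_on {0..t} (\<lambda>s. \<beta>' (U s))" by (intro continuous_on_compose2[OF \<beta>(2) cU]) auto
    have A: "(\<lambda>s. \<beta>' (U s) * F s) absolutely_integrable_on {0..t}" by (rule absolutely_integrable_continuous_mult[OF FA c])
    have bm [measurable]: "\<beta>' \<in> borel_measurable borel" by (rule borel_measurable_continuous_onI[OF \<beta>(2)])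
    have vm: "(\<lambda>s. indicator {0..t} s * (\<beta>' (v s) * F s)) \<in> borel_measurable lborel" by measurable
    have "\<beta> (U t) = \<beta> (U 0) + integral {0..t} (\<lambda>s. \<beta>' (U s) * F s)"
      by (rule chain_rule_integral[OF FA _ _ \<beta>(1,2)]) (use t in \<open>auto simp: U_def\<close>)
    then have "\<beta> (v t) = integral {0..t} (\<lambda>s. \<beta>' (U s) * F s)" using elim t \<beta>(3) by (simp add: U_def)
    also have "\<dots> = (LINT s:{0..t}|lebesgue. \<beta>' (U s) * F s)" by (rule set_lebesgue_integral_eq_integral(2)[OF A, symmetric])
    also have "\<dots> = (LINT s|lebesgue. indicator {0..t} s * (\<beta>' (v s) * F s))"
      unfolding set_lebesgue_integral_def
    proof (rule integral_cong_AE)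
      show "(\<lambda>s. indicat_real {0..t} s *\<^sub>R (\<beta>' (U s) * F s)) \<in> borel_measurable lebesgue"
        using A by (auto simp: set_integrable_def dest: borel_measurable_integrable)
      show "(\<lambda>s. indicator {0..t} s * (\<beta>' (v s) * F s)) \<in> borel_measurable lebesgue" by (rule measurable_completion[OF vm])
      have "AE s in lebesgue. s \<in> {0..T} \<longrightarrow> v s = U s" unfolding U_def by (rule AE_completion[OF eq])
      then show "AE s in lebesgue. indicat_real {0..t} s *\<^sub>R (\<beta>' (U s) * F s) = indicator {0..t} s * (\<beta>' (v s) * F s)"
        by eventually_elim (use t in \<open>auto simp: indicator_def\<close>)
    qed
    also have "\<dots> = (LINT s|lborel. indicator {0..t} s * (\<beta>' (v s) * F s))" by (rule integral_completion[OF vm])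
    finally show "\<beta> (v t) = (LINT s|lborel. indicator {0..t} s * (\<beta>' (v s) * F s))" .
  qed
qed

section \<open>Evolution of the localised energy\<close>

text \<open>The function \<beta> of the energy. Its values lie between 0 and 1, which makes it
  admissible as a weight in the oscillation inequality; it vanishes only at 0, which lets the energy
  detect \<open>u = 0\<close>; and its bounded derivative controls the commutator term.\<close>

definition renorm :: "real \<Rightarrow> real" where "renorm s = s\<^sup>2 / (1 + s\<^sup>2)"

definition renorm' :: "real \<Rightarrow> real" where "renorm' s = 2 * s / (1 + s\<^sup>2)\<^sup>2"

lemma one_plus_square_pos: "0 < 1 + (s::real)\<^sup>2" by (rule add_pos_nonneg) auto

lemma renorm_deriv: "(renorm has_real_derivative renorm' s) (at s)"
  unfolding renorm_def[abs_def] renorm'_def using one_plus_square_pos[of s]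
  by (auto intro!: derivative_eq_intros simp: field_simps power2_eq_square)

lemma continuous_renorm': "continuous_on UNIV renorm'"
  unfolding renorm'_def[abs_def] using one_plus_square_pos by (intro continuous_intros) (auto simp: less_imp_neq[symmetric])

lemma renorm_range: "0 \<le> renorm s \<and> renorm s \<le> 1"
  using one_plus_square_pos[of s] by (simp add: renorm_def)

lemma renorm'_le: "\<bar>renorm' s\<bar> \<le> 2"
proof -
  have "\<bar>s\<bar> \<le> 1 + s\<^sup>2"
    using sum_squares_bound[of 1 "\<bar>s\<bar>"] by (simp add: power2_eq_square)
  also have "\<dots> \<le> (1 + s\<^sup>2)\<^sup>2"
    using mult_left_mono[of 1 "1 + s\<^sup>2" "1 + s\<^sup>2"] by (simp add: power2_eq_square)
  finally show ?thesis using one_plus_square_pos[of s] by (simp add: renorm'_def abs_mult pos_divide_le_eq)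
qed

lemma renorm_eq_0: "renorm s = 0 \<longleftrightarrow> s = 0"
  using one_plus_square_pos[of s] by (auto simp: renorm_def)

lemma renorm_Lipschitz: "\<bar>renorm s - renorm r\<bar> \<le> 2 * \<bar>s - r\<bar>"
  using field_differentiable_bound[of UNIV renorm renorm' 2 s r] renorm_deriv renorm'_le
  by (auto intro: has_field_derivative_at_within)

lemma renorm_measurable [measurable]: "renorm \<in> borel_measurable borel" "renorm' \<in> borel_measurable borel"
  unfolding renorm_def[abs_def] renorm'_def[abs_def] by measurable

text \<open>Squaring the positive part makes the function continuously differentiable across the
  sphere of radius \<open>k\<close>, with an explicit gradient.\<close>

definition cutoff :: "real \<Rightarrow> 'a::euclidean_space \<Rightarrow> real" where
  "cutoff k x = (max 0 (1 - (x \<bullet> x) / k\<^sup>2))\<^sup>2"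

definition cutoff' :: "real \<Rightarrow> 'a::euclidean_space \<Rightarrow> 'a" where
  "cutoff' k x = (- (4 / k\<^sup>2) * max 0 (1 - (x \<bullet> x) / k\<^sup>2)) *\<^sub>R x"

lemma pos_part_square_deriv: "((\<lambda>s::real. (max 0 s)\<^sup>2) has_real_derivative 2 * max 0 s) (at s)"
proof -
  consider "s > 0" | "s < 0" | "s = 0" by linarith
  then show ?thesis
  proof cases
    case 1
    have "((\<lambda>s. s\<^sup>2) has_real_derivative 2 * max 0 s) (at s)" using 1 by (auto intro!: derivative_eq_intros)
    then show ?thesis
      by (rule has_field_derivative_transform_within[where d=s]) (use 1 in \<open>auto simp: dist_real_def\<close>)
  next
    case 2
    have "((\<lambda>s. 0) has_real_derivative 2 * max 0 s) (at s)" using 2 by auto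
    then show ?thesis
      by (rule has_field_derivative_transform_within[where d="-s"]) (use 2 in \<open>auto simp: dist_real_def\<close>)
  next
    case 3
    have "((\<lambda>h::real. (max 0 h)\<^sup>2 / h) \<longlongrightarrow> 0) (at 0)"
    proof (rule Lim_null_comparison)
      show "\<forall>\<^sub>F h in at 0. norm ((max 0 h)\<^sup>2 / h) \<le> \<bar>h::real\<bar>"
        by (rule always_eventually) (auto simp: max_def power2_eq_square)
      show "((\<lambda>h::real. \<bar>h\<bar>) \<longlongrightarrow> 0) (at 0)" by (intro tendsto_eq_intros) auto
    qed
    then show ?thesis using 3 by (simp add: DERIV_def)
  qed
qed

lemma cutoff_gderiv: "GDERIV (cutoff k) x :> cutoff' k x"
proof -
  have "((\<lambda>x. 1 - (x \<bullet> x) / k\<^sup>2) has_derivative (\<lambda>h. - (2 * (h \<bullet> x) / k\<^sup>2))) (at x)"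
    unfolding divide_inverse by (auto intro!: derivative_eq_intros simp: inner_commute)
  from has_derivative_compose[OF this pos_part_square_deriv[unfolded has_field_derivative_def]]
  show ?thesis unfolding gderiv_def cutoff_def[abs_def] cutoff'_def by (simp add: field_simps)
qed

text \<open>The two gradient bounds have different purposes. The bound
  \<open>8 / (1 + norm x)\<close> is uniform in \<open>k\<close> and gives a majorant through the
  growth condition on \<open>b\<close>; the bound \<open>4 * norm x / k\<^sup>2\<close> tends to 0
  at each point as \<open>k\<close> grows.\<close>

lemma cutoff_props:
  fixes x :: "'a::euclidean_space"
  assumes "k \<ge> 1"
  shows "C1c (cutoff k) (cutoff' k :: 'a \<Rightarrow> 'a)" "0 \<le> cutoff k x \<and> cutoff k x \<le> 1" "norm x > k \<Longrightarrow> cutoff k x = 0 \<and> cutoff' k x = 0"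
    "norm (cutoff' k x) \<le> 8 / (1 + norm x)" "norm (cutoff' k x) \<le> 4 * norm x / k\<^sup>2" "k \<le> k' \<Longrightarrow> cutoff k x \<le> cutoff k' x"
    "norm x < k \<Longrightarrow> cutoff k x > 0"
proof -
  have x0: "0 \<le> (x \<bullet> x) / k\<^sup>2" by simp
  have out: "cutoff k x = 0 \<and> cutoff' k x = 0" if "norm x > k" for x :: 'a
  proof -
    have "k\<^sup>2 \<le> x \<bullet> x" using power_mono[of k "norm x" 2] that assms by (simp add: power2_norm_eq_inner)
    then have "1 \<le> (x \<bullet> x) / k\<^sup>2" using assms by simp
    then show ?thesis by (simp add: cutoff_def cutoff'_def max_def)
  qed
  then show "norm x > k \<Longrightarrow> cutoff k x = 0 \<and> cutoff' k x = 0" .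
  have "continuous_on UNIV (cutoff' k :: 'a \<Rightarrow> 'a)" unfolding cutoff'_def[abs_def] using assms by (intro continuous_intros) auto
  then show "C1c (cutoff k) (cutoff' k :: 'a \<Rightarrow> 'a)" unfolding C1c_def C1_def using cutoff_gderiv out by blast
  have m: "0 \<le> max 0 (1 - (x \<bullet> x) / k\<^sup>2)" "max 0 (1 - (x \<bullet> x) / k\<^sup>2) \<le> 1" using x0 by auto
  show "0 \<le> cutoff k x \<and> cutoff k x \<le> 1" unfolding cutoff_def using m power_mono[OF m(2) m(1), of 2] by simp
  have n: "norm (cutoff' k x) = (4 / k\<^sup>2) * max 0 (1 - (x \<bullet> x) / k\<^sup>2) * norm x"
    unfolding cutoff'_def norm_scaleR abs_mult using m(1) by simp
  also have "\<dots> \<le> (4 / k\<^sup>2) * 1 * norm x" using m by (intro mult_right_mono mult_left_mono) auto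
  finally show n2: "norm (cutoff' k x) \<le> 4 * norm x / k\<^sup>2" by simp
  show "norm (cutoff' k x) \<le> 8 / (1 + norm x)"
  proof (cases "norm x > k")
    case True then show ?thesis using out by simp
  next
    case False
    have "norm x * (1 + norm x) \<le> k * (k + k)" using False assms by (intro mult_mono) auto
    then have "4 * norm x * (1 + norm x) \<le> 8 * k\<^sup>2" by (simp add: power2_eq_square)
    moreover have "1 + norm x > 0" by (rule add_pos_nonneg) auto
    ultimately have "4 * norm x / k\<^sup>2 \<le> 8 / (1 + norm x)" using assms by (simp add: field_simps)
    with n2 show ?thesis by linarith
  qed
  show "cutoff k x \<le> cutoff k' x" if "k \<le> k'"
  proof -
    have "(x \<bullet> x) / k'\<^sup>2 \<le> (x \<bullet> x) / k\<^sup>2" using that assms by (intro divide_left_mono) auto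
    then show ?thesis unfolding cutoff_def by (intro power_mono) auto
  qed
  show "cutoff k x > 0" if "norm x < k"
  proof -
    have "x \<bullet> x < k\<^sup>2" using power_strict_mono[of "norm x" k 2] that by (simp add: power2_norm_eq_inner)
    then have "(x \<bullet> x) / k\<^sup>2 < 1" using assms by simp
    then show ?thesis unfolding cutoff_def by (intro zero_less_power) auto
  qed
qed

section \<open>Space-time integrability for the mollified equation\<close>

lemma integrable_product_pair:
  fixes f :: "'b::euclidean_space \<Rightarrow> real" and h :: "'c::euclidean_space \<Rightarrow> real"
  assumes f: "integrable lborel f" and h: "integrable lborel h"
  shows "integrable (lborel \<Otimes>\<^sub>M lborel) (\<lambda>(x, y). f x * h y)"
proof (rule lborel_pair.Fubini_integrable)
  have [measurable]: "f \<in> borel_measurable borel" "h \<in> borel_measurable borel" using f h by auto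
  show "(\<lambda>(x, y). f x * h y) \<in> borel_measurable (lborel \<Otimes>\<^sub>M lborel)" by measurable
  show "integrable lborel (\<lambda>x. LINT y|lborel. norm (case (x, y) of (x, y) \<Rightarrow> f x * h y))"
    using f by (simp add: abs_mult)
  show "AE x in lborel. integrable lborel (\<lambda>y. case (x, y) of (x, y) \<Rightarrow> f x * h y)"
    using h by simp
qed

lemma kern_bounded: "\<epsilon> > 0 \<Longrightarrow> \<exists>M>0. \<forall>x::'a::euclidean_space. norm (kern \<epsilon> x) \<le> M"
  using bounded_of_continuous_support[OF continuous_kern kern_support] by metis

lemma gkern_bounded: "\<epsilon> > 0 \<Longrightarrow> \<exists>M>0. \<forall>x::'a::euclidean_space. norm (gkern \<epsilon> x) \<le> M"
  using bounded_of_continuous_support[OF continuous_gkern gkern_support] by metis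

lemma spatial_u_zero:
  fixes u :: "'a::euclidean_space \<Rightarrow> real"
  assumes "AE x in lborel. u x = 0" "spatial u b g p q"
  shows "spatial.Fl u b g \<epsilon> y = 0"
proof -
  have "AE x in lborel. u x * (spatial.d g x * kern \<epsilon> (y - x) - b x \<bullet> gkern \<epsilon> (y - x)) = 0"
    using assms(1) by eventually_elim simp
  then show ?thesis unfolding spatial.Fl_def[OF assms(2)] by (rule integral_eq_zero_AE)
qed

text \<open>The slices are good at every time, which is arranged by setting all functions to 0 at
  the exceptional times. The p-th powers of \<open>u\<close> are bounded uniformly in time, the
  local norms of the field and of its derivatives are integrable in time.\<close>

locale transport_data =
  fixes u :: "real \<Rightarrow> 'a::euclidean_space \<Rightarrow> real" and b :: "real \<Rightarrow> 'a \<Rightarrow> 'a" and g :: "'a \<Rightarrow> real \<Rightarrow> 'a \<Rightarrow> 'a"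
    and p q C :: real
  assumes S: "\<And>t. spatial (u t) (b t) (\<lambda>i. g i t) p q"
    and um [measurable]: "(\<lambda>(t, x). u t x) \<in> borel_measurable (borel \<Otimes>\<^sub>M borel)"
    and bm [measurable]: "(\<lambda>(t, x). b t x) \<in> borel_measurable (borel \<Otimes>\<^sub>M borel)"
    and gm0: "\<And>i. i \<in> Basis \<Longrightarrow> (\<lambda>(t, x). g i t x) \<in> borel_measurable (borel \<Otimes>\<^sub>M borel)"
    and uC: "\<And>t. (LINT x|lborel. \<bar>u t x\<bar> powr p) \<le> C"
    and NGi: "\<And>r. integrable lborel (\<lambda>t. spatial.NG (\<lambda>i. g i t) q r)"
    and NBi: "\<And>r. integrable lborel (\<lambda>t. Lnorm q (\<lambda>x. indicator (cball 0 r) x * norm (b t x)))"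
begin

abbreviation dv :: "real \<Rightarrow> 'a \<Rightarrow> real" where "dv t \<equiv> spatial.d (\<lambda>i. g i t)"
abbreviation FF :: "real \<Rightarrow> real \<Rightarrow> 'a \<Rightarrow> real" where "FF \<epsilon> t y \<equiv> spatial.Fl (u t) (b t) (\<lambda>i. g i t) \<epsilon> y"
abbreviation cm :: "real \<Rightarrow> real \<Rightarrow> 'a \<Rightarrow> real" where "cm \<epsilon> t y \<equiv> spatial.comm (u t) (b t) (\<lambda>i. g i t) \<epsilon> y"
abbreviation NN :: "real \<Rightarrow> real \<Rightarrow> real" where "NN t r \<equiv> spatial.NG (\<lambda>i. g i t) q r"
abbreviation NB :: "real \<Rightarrow> real \<Rightarrow> real" where "NB t r \<equiv> Lnorm q (\<lambda>x. indicator (cball 0 r) x * norm (b t x))"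

lemma gm [measurable]: "i \<in> Basis \<Longrightarrow> (\<lambda>(t, x). g i t x) \<in> borel_measurable (borel \<Otimes>\<^sub>M borel)" by (rule gm0)

lemma pq: "p > 1" "1 / p + 1 / q = 1" using S[of 0] by (auto simp: spatial_def)

lemma dvm [measurable]: "(\<lambda>(t, x). dv t x) \<in> borel_measurable (borel \<Otimes>\<^sub>M borel)"
  unfolding spatial.d_def[OF S] by measurable

lemma mollm [measurable]: "(\<lambda>(t, y). moll \<epsilon> (u t) y) \<in> borel_measurable (borel \<Otimes>\<^sub>M borel)"
  unfolding moll_def by measurable

lemma gmollm [measurable]: "(\<lambda>(t, y). gmoll \<epsilon> (u t) y) \<in> borel_measurable (borel \<Otimes>\<^sub>M borel)"
  unfolding gmoll_def by measurable

lemma FFm [measurable]: "(\<lambda>(t, y). FF \<epsilon> t y) \<in> borel_measurable (borel \<Otimes>\<^sub>M borel)"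
  unfolding spatial.Fl_def[OF S] by measurable

lemma cmm [measurable]: "(\<lambda>(t, y). cm \<epsilon> t y) \<in> borel_measurable (borel \<Otimes>\<^sub>M borel)"
  unfolding spatial.comm_def[OF S] by measurable

definition U :: real where "U = C powr (1 / p)"

lemma Lnorm_u: "Lnorm p (u t) \<le> U"
  unfolding Lnorm_def U_def using pq uC by (intro powr_mono2) auto

lemma U0: "U \<ge> 0" by (simp add: U_def)

lemma Hoelder_u:
  assumes [measurable]: "f \<in> borel_measurable borel" and "\<And>r. integrable lborel (\<lambda>x. indicator (cball 0 r) x * norm (f x) powr q)"
  shows "(\<integral>\<^sup>+x. indicator (cball 0 k) x * ennreal (\<bar>u t x\<bar> * norm (f x)) \<partial>lborel) \<le> ennreal (U * Lnorm q (\<lambda>x. indicator (cball 0 k) x * norm (f x)))"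
proof -
  interpret spatial "u t" "b t" "\<lambda>i. g i t" p q by (rule S)
  have "(\<integral>\<^sup>+x. indicator (cball 0 k) x * ennreal (\<bar>u t x\<bar> * \<bar>norm (f (x - 0))\<bar>) \<partial>lborel) \<le> ennreal (Lnorm p (u t) * Lnorm q (\<lambda>x. indicator (cball 0 (k + 0)) x * norm (f x)))"
    by (rule Hoelder_cball_shift) (use up pq assms in \<open>auto simp: norm_minus_commute\<close>)
  also have "\<dots> \<le> ennreal (U * Lnorm q (\<lambda>x. indicator (cball 0 k) x * norm (f x)))"
    by (intro ennreal_leI) (simp add: mult_right_mono Lnorm_u Lnorm_nonneg)
  finally show ?thesis by simp
qed

lemma Hoelder_ud:
  "(\<integral>\<^sup>+x. indicator (cball 0 k) x * ennreal (\<bar>u t x\<bar> * \<bar>dv t x\<bar>) \<partial>lborel) \<le> ennreal (U * NN t k)"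
proof -
  interpret spatial "u t" "b t" "\<lambda>i. g i t" p q by (rule S)
  have m: "(\<lambda>x. indicator (cball 0 k) x * ennreal (\<bar>u t x\<bar> * norm (g i t x))) \<in> borel_measurable lborel" if "i \<in> Basis" for i
  proof -
    have [measurable]: "g i t \<in> borel_measurable borel" using spatial.gm0[OF S that] .
    show ?thesis by measurable
  qed
  have "(\<integral>\<^sup>+x. indicator (cball 0 k) x * ennreal (\<bar>u t x\<bar> * \<bar>dv t x\<bar>) \<partial>lborel) \<le> (\<integral>\<^sup>+x. (\<Sum>i\<in>Basis. indicator (cball 0 k) x * ennreal (\<bar>u t x\<bar> * norm (g i t x))) \<partial>lborel)"
  proof (rule nn_integral_mono)
    fix x
    have "ennreal (\<bar>u t x\<bar> * \<bar>dv t x\<bar>) \<le> ennreal (\<Sum>i\<in>Basis. \<bar>u t x\<bar> * norm (g i t x))"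
      unfolding sum_distrib_left[symmetric] by (intro ennreal_leI mult_left_mono d_le) auto
    also have "\<dots> = (\<Sum>i\<in>Basis. ennreal (\<bar>u t x\<bar> * norm (g i t x)))" by (simp add: sum_ennreal)
    finally show "indicator (cball 0 k) x * ennreal (\<bar>u t x\<bar> * \<bar>dv t x\<bar>) \<le> (\<Sum>i\<in>Basis. indicator (cball 0 k) x * ennreal (\<bar>u t x\<bar> * norm (g i t x)))"
      by (simp only: sum_distrib_left[symmetric] mult_left_mono zero_le)
  qed
  also have "\<dots> = (\<Sum>i\<in>Basis. \<integral>\<^sup>+x. indicator (cball 0 k) x * ennreal (\<bar>u t x\<bar> * norm (g i t x)) \<partial>lborel)"
    by (rule nn_integral_sum[OF m])
  also have "\<dots> \<le> (\<Sum>i\<in>Basis. ennreal (U * Lnorm q (\<lambda>x. indicator (cball 0 k) x * norm (g i t x))))"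
    by (intro sum_mono Hoelder_u spatial.gm0[OF S] spatial.gq[OF S])
  also have "\<dots> = ennreal (U * NN t k)" unfolding NG_def by (simp add: sum_ennreal sum_distrib_left Lnorm_nonneg U0)
  finally show ?thesis .
qed

lemma kern_pointwise_bound:
  assumes e: "0 < \<epsilon>" "\<epsilon> \<le> 1"
  obtains M where "M > 0" "\<And>x y k. norm y \<le> k \<Longrightarrow> kern \<epsilon> (y - x) \<le> M * indicator (cball (0::'a) (k + real DIM('a))) x"
    "\<And>x y k. norm y \<le> k \<Longrightarrow> norm (gkern \<epsilon> (y - x)) \<le> M * indicator (cball (0::'a) (k + real DIM('a))) x"
proof -
  obtain M1 where M1: "M1 > 0" "\<And>x::'a. norm (kern \<epsilon> x) \<le> M1" using kern_bounded[OF e(1), where 'a='a] by blast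
  obtain M2 where M2: "M2 > 0" "\<And>x::'a. norm (gkern \<epsilon> x) \<le> M2" using gkern_bounded[OF e(1), where 'a='a] by blast
  have far: "norm (y - x) > \<epsilon> * real DIM('a)" if "norm y \<le> k" "x \<notin> cball (0::'a) (k + real DIM('a))" for x y k
  proof -
    have "norm x - norm y \<le> norm (y - x)" using norm_triangle_ineq2[of x y] by (simp add: norm_minus_commute)
    moreover have "\<epsilon> * real DIM('a) \<le> real DIM('a)" using e by (simp add: mult_left_le_one_le)
    moreover have "norm x > k + real DIM('a)" using that by simp
    ultimately show ?thesis using that(1) by linarith
  qed
  show thesis
  proof (rule that[of "M1 + M2"])
    show "M1 + M2 > 0" using M1 M2 by simp
    fix x y :: 'a and k assume y: "norm y \<le> k"
    show "kern \<epsilon> (y - x) \<le> (M1 + M2) * indicator (cball (0::'a) (k + real DIM('a))) x"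
      using M1(2)[of "y - x"] M2(1) kern_support[OF e(1) far[OF y]]
      by (cases "x \<in> cball 0 (k + real DIM('a))") auto
    show "norm (gkern \<epsilon> (y - x)) \<le> (M1 + M2) * indicator (cball (0::'a) (k + real DIM('a))) x"
      using M2(2)[of "y - x"] M1(1) gkern_support[OF e(1) far[OF y]]
      by (cases "x \<in> cball 0 (k + real DIM('a))") auto
  qed
qed

text \<open>A bound uniform for \<open>y\<close> in a ball, with a majorant integrable in time; it
  justifies Fubini's theorem at a fixed scale. \<open>M\<close> depends on
  \<open>\<epsilon>\<close>, which is harmless because the limit of small \<open>\<epsilon>\<close>
  is taken in the commutator only.\<close>

lemma FF_bound:
  assumes e: "0 < \<epsilon>" "\<epsilon> \<le> 1"
  obtains M where "M > 0" "\<And>t y k. norm y \<le> k \<Longrightarrow> \<bar>FF \<epsilon> t y\<bar> \<le> M * (NN t (k + real DIM('a)) + NB t (k + real DIM('a)))"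
proof -
  obtain M where M: "M > 0" "\<And>x y k. norm y \<le> k \<Longrightarrow> kern \<epsilon> (y - x) \<le> M * indicator (cball (0::'a) (k + real DIM('a))) x"
    "\<And>x y k. norm y \<le> k \<Longrightarrow> norm (gkern \<epsilon> (y - x)) \<le> M * indicator (cball (0::'a) (k + real DIM('a))) x"
    by (rule kern_pointwise_bound[OF e]) blast
  have "\<bar>FF \<epsilon> t y\<bar> \<le> (M * (U + 1)) * (NN t (k + real DIM('a)) + NB t (k + real DIM('a)))" if y: "norm y \<le> k" for t y k
  proof -
    interpret spatial "u t" "b t" "\<lambda>i. g i t" p q by (rule S)
    let ?B = "cball (0::'a) (k + real DIM('a))"
    have m: "(\<lambda>x. indicator ?B x * ennreal (\<bar>u t x\<bar> * \<bar>dv t x\<bar>)) \<in> borel_measurable lborel"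
      "(\<lambda>x. indicator ?B x * ennreal (\<bar>u t x\<bar> * norm (b t x))) \<in> borel_measurable lborel" by measurable
    have i: "integrable lborel (\<lambda>x. u t x * (dv t x * kern \<epsilon> (y - x) - b t x \<bullet> gkern \<epsilon> (y - x)))"
      using integrable_ub[OF e(1)] integrable_ud[OF e(1)] by (simp add: right_diff_distrib)
    have "ennreal \<bar>FF \<epsilon> t y\<bar> = ennreal (norm (LINT x|lborel. u t x * (dv t x * kern \<epsilon> (y - x) - b t x \<bullet> gkern \<epsilon> (y - x))))"
      by (simp add: Fl_def)
    also have "\<dots> \<le> (\<integral>\<^sup>+x. ennreal (norm (u t x * (dv t x * kern \<epsilon> (y - x) - b t x \<bullet> gkern \<epsilon> (y - x)))) \<partial>lborel)"
      by (rule integral_norm_bound_ennreal[OF i])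
    also have "\<dots> \<le> (\<integral>\<^sup>+x. ennreal M * (indicator ?B x * ennreal (\<bar>u t x\<bar> * \<bar>dv t x\<bar>) + indicator ?B x * ennreal (\<bar>u t x\<bar> * norm (b t x))) \<partial>lborel)"
    proof (rule nn_integral_mono)
      fix x
      let ?I = "indicator ?B x :: real"
      have "\<bar>dv t x * kern \<epsilon> (y - x) - b t x \<bullet> gkern \<epsilon> (y - x)\<bar> \<le> \<bar>dv t x\<bar> * kern \<epsilon> (y - x) + norm (b t x) * norm (gkern \<epsilon> (y - x))"
        using Cauchy_Schwarz_ineq2[of "b t x" "gkern \<epsilon> (y - x)"] kern_nonneg[OF e(1), of "y - x"]
          abs_triangle_ineq4[of "dv t x * kern \<epsilon> (y - x)" "b t x \<bullet> gkern \<epsilon> (y - x)"] by (simp add: abs_mult)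
      also have "\<dots> \<le> \<bar>dv t x\<bar> * (M * ?I) + norm (b t x) * (M * ?I)"
        by (intro add_mono mult_left_mono M y) auto
      finally have "norm (u t x * (dv t x * kern \<epsilon> (y - x) - b t x \<bullet> gkern \<epsilon> (y - x))) \<le> \<bar>u t x\<bar> * (\<bar>dv t x\<bar> * (M * ?I) + norm (b t x) * (M * ?I))"
        unfolding real_norm_def abs_mult by (intro mult_left_mono) auto
      also have "\<dots> = M * (?I * (\<bar>u t x\<bar> * \<bar>dv t x\<bar>) + ?I * (\<bar>u t x\<bar> * norm (b t x)))" by (simp add: algebra_simps)
      finally have "ennreal (norm (u t x * (dv t x * kern \<epsilon> (y - x) - b t x \<bullet> gkern \<epsilon> (y - x)))) \<le> ennreal (M * (?I * (\<bar>u t x\<bar> * \<bar>dv t x\<bar>) + ?I * (\<bar>u t x\<bar> * norm (b t x))))"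
        by (rule ennreal_leI)
      also have "\<dots> = ennreal M * (ennreal (?I * (\<bar>u t x\<bar> * \<bar>dv t x\<bar>)) + ennreal (?I * (\<bar>u t x\<bar> * norm (b t x))))"
        using M(1) by (simp only: ennreal_mult ennreal_plus mult_nonneg_nonneg add_nonneg_nonneg abs_ge_zero norm_ge_zero less_imp_le indicator_pos_le)
      finally show "ennreal (norm (u t x * (dv t x * kern \<epsilon> (y - x) - b t x \<bullet> gkern \<epsilon> (y - x)))) \<le> ennreal M * (indicator ?B x * ennreal (\<bar>u t x\<bar> * \<bar>dv t x\<bar>) + indicator ?B x * ennreal (\<bar>u t x\<bar> * norm (b t x)))"
        by (auto simp: indicator_def)
    qed
    also have "\<dots> = ennreal M * ((\<integral>\<^sup>+x. indicator ?B x * ennreal (\<bar>u t x\<bar> * \<bar>dv t x\<bar>) \<partial>lborel) + (\<integral>\<^sup>+x. indicator ?B x * ennreal (\<bar>u t x\<bar> * norm (b t x)) \<partial>lborel))"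
      by (simp only: nn_integral_cmult[OF borel_measurable_add[OF m]] nn_integral_add[OF m])
    also have "\<dots> \<le> ennreal M * (ennreal (U * NN t (k + real DIM('a))) + ennreal (U * NB t (k + real DIM('a))))"
      by (intro mult_left_mono add_mono Hoelder_ud Hoelder_u bq) auto
    also have "\<dots> = ennreal (M * (U * NN t (k + real DIM('a)) + U * NB t (k + real DIM('a))))"
      using M(1) U0 NG_nonneg by (simp only: ennreal_mult ennreal_plus mult_nonneg_nonneg add_nonneg_nonneg Lnorm_nonneg less_imp_le)
    finally have "\<bar>FF \<epsilon> t y\<bar> \<le> M * (U * NN t (k + real DIM('a)) + U * NB t (k + real DIM('a)))"
      using M(1) U0 NG_nonneg Lnorm_nonneg by (subst (asm) ennreal_le_iff) (auto intro!: mult_nonneg_nonneg add_nonneg_nonneg)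
    also have "\<dots> = (M * U) * (NN t (k + real DIM('a)) + NB t (k + real DIM('a)))" by (simp add: algebra_simps)
    also have "\<dots> \<le> (M * (U + 1)) * (NN t (k + real DIM('a)) + NB t (k + real DIM('a)))"
      using M(1) U0 NG_nonneg Lnorm_nonneg by (intro mult_right_mono mult_left_mono add_nonneg_nonneg) auto
    finally show ?thesis .
  qed
  moreover have "M * (U + 1) > 0" using M(1) U0 by simp
  ultimately show thesis using that by blast
qed

text \<open>Hoelder's inequality against the kernel; the bound is uniform in time because that of
  the p-norms is.\<close>

lemma moll_u_bound:
  assumes e: "0 < \<epsilon>"
  obtains M where "\<And>t. \<bar>moll \<epsilon> (u t) y\<bar> \<le> M"
proof -
  have q: "q > 1" by (rule conjugate_exponent_gt_1[OF pq])
  have supp: "norm (y - x) > \<epsilon> * real DIM('a)" if "norm x > norm y + \<epsilon> * real DIM('a)" for x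
    using that norm_triangle_ineq2[of x y] by (simp add: norm_minus_commute)
  have ki: "integrable lborel (\<lambda>x. \<bar>kern \<epsilon> (y - x)\<bar> powr q)"
  proof (rule integrable_continuous_support[of _ "norm y + \<epsilon> * real DIM('a)"])
    have c: "continuous_on UNIV (\<lambda>x. kern \<epsilon> (y - x))" by (rule reflected_support(1)[OF continuous_kern kern_support[OF e]])
    show "continuous_on UNIV (\<lambda>x. \<bar>kern \<epsilon> (y - x)\<bar> powr q)"
      using q by (intro continuous_on_powr' continuous_intros c) auto
    show "\<bar>kern \<epsilon> (y - x)\<bar> powr q = 0" if "norm x > norm y + \<epsilon> * real DIM('a)" for x
      using kern_support[OF e supp[OF that]] q by simp
  qed
  have "\<bar>moll \<epsilon> (u t) y\<bar> \<le> U * Lnorm q (\<lambda>x. kern \<epsilon> (y - x))" for t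
  proof -
    interpret spatial "u t" "b t" "\<lambda>i. g i t" p q by (rule S)
    have "ennreal \<bar>moll \<epsilon> (u t) y\<bar> = ennreal (norm (LINT x|lborel. kern \<epsilon> (y - x) * u t x))" by (simp add: moll_def)
    also have "\<dots> \<le> (\<integral>\<^sup>+x. ennreal (norm (kern \<epsilon> (y - x) * u t x)) \<partial>lborel)"
      by (rule integral_norm_bound_ennreal[OF kern_mult_integrable[OF loc_int_u e]])
    also have "\<dots> = (\<integral>\<^sup>+x. ennreal (\<bar>u t x\<bar> * \<bar>kern \<epsilon> (y - x)\<bar>) \<partial>lborel)" by (simp add: abs_mult mult.commute)
    also have "\<dots> \<le> ennreal (Lnorm p (u t) * Lnorm q (\<lambda>x. kern \<epsilon> (y - x)))"
      by (rule Hoelder) (use up ki pq q in auto)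
    also have "\<dots> \<le> ennreal (U * Lnorm q (\<lambda>x. kern \<epsilon> (y - x)))" by (intro ennreal_leI mult_right_mono Lnorm_u Lnorm_nonneg)
    finally show ?thesis by (subst (asm) ennreal_le_iff) (auto simp: U0 Lnorm_nonneg)
  qed
  then show thesis using that by blast
qed

lemma FF_integrable:
  assumes e: "0 < \<epsilon>" "\<epsilon> \<le> 1" shows "integrable lborel (\<lambda>t. indicator {0..s} t * FF \<epsilon> t y)"
proof -
  obtain M where M: "M > 0" "\<And>t y k. norm y \<le> k \<Longrightarrow> \<bar>FF \<epsilon> t y\<bar> \<le> M * (NN t (k + real DIM('a)) + NB t (k + real DIM('a)))"
    by (rule FF_bound[OF e]) blast
  show ?thesis
  proof (rule Bochner_Integration.integrable_bound)
    show "integrable lborel (\<lambda>t. M * (NN t (norm y + real DIM('a)) + NB t (norm y + real DIM('a))))" using NGi NBi by simp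
    show "(\<lambda>t. indicator {0..s} t * FF \<epsilon> t y) \<in> borel_measurable lborel" by measurable
    show "AE t in lborel. norm (indicator {0..s} t * FF \<epsilon> t y) \<le> norm (M * (NN t (norm y + real DIM('a)) + NB t (norm y + real DIM('a))))"
      using M(2)[of y "norm y"] by (auto simp: indicator_def intro!: AE_I2 order_trans[OF _ abs_ge_self])
  qed
qed

text \<open>Each term of the tested equation is integrable by itself, so the equations of two
  solutions may be subtracted term by term.\<close>

lemma weak_terms_integrable:
  assumes e: "0 < \<epsilon>" "\<epsilon> \<le> 1" and \<eta>: "continuous_on UNIV \<eta>"
  shows "integrable lborel (\<lambda>t. indicator {0..s} t * (\<eta> t * moll \<epsilon> (u t) y))"
    and "integrable lborel (\<lambda>t. indicator {0..s} t * (\<eta> t * (LINT x|lborel. u t x * (dv t x * kern \<epsilon> (y - x)))))"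
    and "integrable lborel (\<lambda>t. indicator {0..s} t * (\<eta> t * (LINT x|lborel. u t x * (b t x \<bullet> gkern \<epsilon> (y - x)))))"
proof -
  have [measurable]: "\<eta> \<in> borel_measurable borel" using \<eta> by (rule borel_measurable_continuous_onI)
  have "bounded (\<eta> ` {0..s})" by (intro compact_imp_bounded compact_continuous_image continuous_on_subset[OF \<eta>]) auto
  then obtain E where E: "\<And>t. t \<in> {0..s} \<Longrightarrow> \<bar>\<eta> t\<bar> \<le> E" unfolding bounded_iff by (metis imageI real_norm_def)
  have gen: "integrable lborel (\<lambda>t. indicator {0..s} t * (\<eta> t * f t))"
    if [measurable]: "f \<in> borel_measurable borel" and h: "integrable lborel (\<lambda>t. indicator {0..s} t * h t)" and fh: "\<And>t. \<bar>f t\<bar> \<le> h t" for f h :: "real \<Rightarrow> real"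
  proof (rule Bochner_Integration.integrable_bound)
    show "integrable lborel (\<lambda>t. E * (indicator {0..s} t * h t))" using h by simp
    show "AE t in lborel. norm (indicator {0..s} t * (\<eta> t * f t)) \<le> norm (E * (indicator {0..s} t * h t))"
    proof (rule AE_I2)
      fix t
      show "norm (indicator {0..s} t * (\<eta> t * f t)) \<le> norm (E * (indicator {0..s} t * h t))"
      proof (cases "t \<in> {0..s}")
        case True
        have "\<bar>\<eta> t\<bar> * \<bar>f t\<bar> \<le> E * h t" using E[OF True] fh[of t] by (intro mult_mono) auto
        then show ?thesis using True abs_ge_self[of "E * h t"] by (simp add: abs_mult)
      qed simp
    qed
  qed measurable
  obtain M where M: "\<And>t. \<bar>moll \<epsilon> (u t) y\<bar> \<le> M" by (rule moll_u_bound[OF e(1)]) blast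
  show "integrable lborel (\<lambda>t. indicator {0..s} t * (\<eta> t * moll \<epsilon> (u t) y))"
    by (rule gen[OF _ _ M]) (auto intro!: integrable_real_indicator simp: emeasure_lborel_Icc_eq)
  obtain K where K: "K > 0" "\<And>x y k. norm y \<le> k \<Longrightarrow> kern \<epsilon> (y - x) \<le> K * indicator (cball (0::'a) (k + real DIM('a))) x"
    "\<And>x y k. norm y \<le> k \<Longrightarrow> norm (gkern \<epsilon> (y - x)) \<le> K * indicator (cball (0::'a) (k + real DIM('a))) x"
    by (rule kern_pointwise_bound[OF e]) blast
  let ?r = "norm y + real DIM('a)"
  have bound: "\<bar>LINT x|lborel. F x\<bar> \<le> K * (U * N)"
    if F: "integrable lborel F" and FH: "\<And>x. \<bar>F x\<bar> \<le> K * (indicator (cball 0 ?r) x * H x)" and H: "\<And>x. 0 \<le> H x" and N: "0 \<le> N"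
      and [measurable]: "H \<in> borel_measurable borel" and HN: "(\<integral>\<^sup>+x. indicator (cball 0 ?r) x * ennreal (H x) \<partial>lborel) \<le> ennreal (U * N)" for F H :: "'a \<Rightarrow> real" and N
  proof -
    have "ennreal \<bar>LINT x|lborel. F x\<bar> \<le> (\<integral>\<^sup>+x. ennreal (norm (F x)) \<partial>lborel)"
      using integral_norm_bound_ennreal[OF F] by simp
    also have "\<dots> \<le> (\<integral>\<^sup>+x. ennreal K * (indicator (cball 0 ?r) x * ennreal (H x)) \<partial>lborel)"
    proof (rule nn_integral_mono)
      fix x
      have "ennreal (norm (F x)) \<le> ennreal (K * (indicator (cball 0 ?r) x * H x))" using FH[of x] by (intro ennreal_leI) simp
      also have "\<dots> = ennreal K * (indicator (cball 0 ?r) x * ennreal (H x))" using K(1) H[of x] by (auto simp: ennreal_mult indicator_def)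
      finally show "ennreal (norm (F x)) \<le> \<dots>" .
    qed
    also have "\<dots> = ennreal K * (\<integral>\<^sup>+x. indicator (cball 0 ?r) x * ennreal (H x) \<partial>lborel)" by (rule nn_integral_cmult) measurable
    also have "\<dots> \<le> ennreal K * ennreal (U * N)" by (intro mult_left_mono HN) auto
    also have "\<dots> = ennreal (K * (U * N))" using K(1) U0 N by (simp add: ennreal_mult)
    finally show ?thesis using K(1) U0 N by (subst (asm) ennreal_le_iff) auto
  qed
  have dbound: "\<bar>LINT x|lborel. u t x * (dv t x * kern \<epsilon> (y - x))\<bar> \<le> K * (U * NN t ?r)" for t
  proof -
    interpret spatial "u t" "b t" "\<lambda>i. g i t" p q by (rule S)
    show ?thesis
    proof (rule bound[where H="\<lambda>x. \<bar>u t x\<bar> * \<bar>dv t x\<bar>"])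
      show "integrable lborel (\<lambda>x. u t x * (dv t x * kern \<epsilon> (y - x)))" by (rule integrable_ud[OF e(1)])
      fix x
      have "\<bar>u t x * (dv t x * kern \<epsilon> (y - x))\<bar> = (\<bar>u t x\<bar> * \<bar>dv t x\<bar>) * kern \<epsilon> (y - x)" using kern_nonneg[OF e(1), of "y - x"] by (simp add: abs_mult)
      also have "\<dots> \<le> (\<bar>u t x\<bar> * \<bar>dv t x\<bar>) * (K * indicator (cball 0 ?r) x)" by (intro mult_left_mono K(2)) auto
      finally show "\<bar>u t x * (dv t x * kern \<epsilon> (y - x))\<bar> \<le> K * (indicator (cball 0 ?r) x * (\<bar>u t x\<bar> * \<bar>dv t x\<bar>))" by (simp add: ac_simps)
    qed (auto intro: NG_nonneg Hoelder_ud)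
  qed
  have bbound: "\<bar>LINT x|lborel. u t x * (b t x \<bullet> gkern \<epsilon> (y - x))\<bar> \<le> K * (U * NB t ?r)" for t
  proof -
    interpret spatial "u t" "b t" "\<lambda>i. g i t" p q by (rule S)
    show ?thesis
    proof (rule bound[where H="\<lambda>x. \<bar>u t x\<bar> * norm (b t x)"])
      show "integrable lborel (\<lambda>x. u t x * (b t x \<bullet> gkern \<epsilon> (y - x)))" by (rule integrable_ub[OF e(1)])
      fix x
      have "\<bar>u t x * (b t x \<bullet> gkern \<epsilon> (y - x))\<bar> \<le> \<bar>u t x\<bar> * (norm (b t x) * norm (gkern \<epsilon> (y - x)))" unfolding abs_mult by (intro mult_left_mono Cauchy_Schwarz_ineq2) auto
      also have "\<dots> \<le> \<bar>u t x\<bar> * (norm (b t x) * (K * indicator (cball 0 ?r) x))" by (intro mult_left_mono K(3)) auto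
      finally show "\<bar>u t x * (b t x \<bullet> gkern \<epsilon> (y - x))\<bar> \<le> K * (indicator (cball 0 ?r) x * (\<bar>u t x\<bar> * norm (b t x)))" by (simp add: ac_simps)
    qed (auto intro: Lnorm_nonneg Hoelder_u bq)
  qed
  show "integrable lborel (\<lambda>t. indicator {0..s} t * (\<eta> t * (LINT x|lborel. u t x * (dv t x * kern \<epsilon> (y - x)))))"
  proof (rule gen[OF _ _ dbound])
    show "integrable lborel (\<lambda>t. indicator {0..s} t * (K * (U * NN t ?r)))"
      using integrable_mult_indicator[of "{0..s}" lborel "\<lambda>t. K * (U * NN t ?r)"] NGi[of ?r] by simp
  qed measurable
  show "integrable lborel (\<lambda>t. indicator {0..s} t * (\<eta> t * (LINT x|lborel. u t x * (b t x \<bullet> gkern \<epsilon> (y - x)))))"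
  proof (rule gen[OF _ _ bbound])
    show "integrable lborel (\<lambda>t. indicator {0..s} t * (K * (U * NB t ?r)))"
      using integrable_mult_indicator[of "{0..s}" lborel "\<lambda>t. K * (U * NB t ?r)"] NBi[of ?r] by simp
  qed measurable
qed

end

text \<open>
  In \<open>bmo\<close> the parameter \<open>m\<close> is free: the inequality is a weighted, dual form of the exponential
  integrability of functions of bounded mean oscillation.
\<close>

locale transport = transport_data u b g p q C
  for u :: "real \<Rightarrow> 'a::euclidean_space \<Rightarrow> real" and b :: "real \<Rightarrow> 'a \<Rightarrow> 'a" and g :: "'a \<Rightarrow> real \<Rightarrow> 'a \<Rightarrow> 'a" and p q C :: real +
  fixes T C' :: real and w :: "real \<Rightarrow> real"
  assumes T: "T > 0"
    and bglob: "integrable (lborel \<Otimes>\<^sub>M lborel) (\<lambda>(t, x). norm (b t x) / (1 + norm x))"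
    and wm [measurable]: "w \<in> borel_measurable borel" and w0: "\<And>t. 0 \<le> w t" and wi: "integrable lborel w"
    and C': "C' > 0"
    and bmo: "\<And>t G m. continuous_on UNIV G \<Longrightarrow> (\<And>x. 0 \<le> G x) \<Longrightarrow> (\<And>x. G x \<le> 1) \<Longrightarrow> integrable lborel G \<Longrightarrow> m \<ge> 0 \<Longrightarrow>
      (LINT x|lborel. \<bar>spatial.d (\<lambda>i. g i t) x\<bar> * G x) \<le> w t * (m * (LINT x|lborel. G x) + C' * exp (- m))"
    and weak: "\<And>\<epsilon> y \<eta>. 0 < \<epsilon> \<Longrightarrow> \<epsilon> \<le> 1 \<Longrightarrow> smooth1 \<eta> \<Longrightarrow> \<eta> 0 T = 0 \<Longrightarrow>
      (LINT t|lborel. indicator {0..T} t * (\<eta> (Suc 0) t * moll \<epsilon> (u t) y)) +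
      (LINT t|lborel. indicator {0..T} t * (\<eta> 0 t * spatial.Fl (u t) (b t) (\<lambda>i. g i t) \<epsilon> y)) = 0"
begin

section \<open>Growth of the energy for a fixed mollification and cutoff\<close>

lemma moll_evolution:
  assumes e: "0 < \<epsilon>" "\<epsilon> \<le> 1"
  shows "AE t in lborel. t \<in> {0..T} \<longrightarrow> moll \<epsilon> (u t) y = integral {0..t} (\<lambda>s. FF \<epsilon> s y)"
proof (rule du_bois_reymond[OF _ _ T FF_integrable[OF e]])
  show "(\<lambda>s. FF \<epsilon> s y) \<in> borel_measurable borel" "(\<lambda>t. moll \<epsilon> (u t) y) \<in> borel_measurable borel" by measurable
  obtain M where M: "\<And>t. \<bar>moll \<epsilon> (u t) y\<bar> \<le> M" by (rule moll_u_bound[OF e(1)]) blast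
  have "integrable lborel (\<lambda>t. moll \<epsilon> (u t) y * indicator {0..T} t)"
    by (rule integrable_mult_bounded[OF _ _ M]) (use T in \<open>auto intro!: integrable_real_indicator\<close>)
  then show "integrable lborel (\<lambda>t. indicator {0..T} t * moll \<epsilon> (u t) y)" by (simp add: mult.commute)
qed (rule weak[OF e])

lemma cont_moll: "\<epsilon> > 0 \<Longrightarrow> continuous_on UNIV (moll \<epsilon> (u t))"
  using C1_continuous[OF C1_moll[OF spatial.loc_int_u[OF S]]] by blast

context
  fixes \<epsilon> k :: real and \<psi> :: "'a \<Rightarrow> real" and \<psi>' :: "'a \<Rightarrow> 'a"
  assumes e: "0 < \<epsilon>" "\<epsilon> \<le> 1" and \<psi>: "C1c \<psi> \<psi>'" and \<psi>k: "\<And>x. norm x > k \<Longrightarrow> \<psi> x = 0 \<and> \<psi>' x = 0"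
    and \<psi>01: "\<And>x. 0 \<le> \<psi> x \<and> \<psi> x \<le> 1" and \<psi>b: "\<And>x. norm (\<psi>' x) \<le> 8 / (1 + norm x)"
begin

text \<open>\<open>X\<close> is the localised energy and \<open>hX\<close> its rate of change;
  \<open>bX\<close> bounds the flux through the region where the cutoff varies, and
  \<open>rX\<close> measures the commutator on the ball that carries the cutoff.\<close>

definition X :: "real \<Rightarrow> real" where "X t = (LINT y|lborel. \<psi> y * renorm (moll \<epsilon> (u t) y))"
definition hX :: "real \<Rightarrow> real" where "hX t = (LINT y|lborel. \<psi> y * (renorm' (moll \<epsilon> (u t) y) * FF \<epsilon> t y))"
definition bX :: "real \<Rightarrow> real" where "bX t = (LINT y|lborel. norm (b t y) * norm (\<psi>' y))"
definition rX :: "real \<Rightarrow> real" where "rX t = (LINT y|lborel. indicator (cball 0 k) y * \<bar>cm \<epsilon> t y\<bar>)"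

lemma c\<psi>: "continuous_on UNIV \<psi>" "continuous_on UNIV \<psi>'"
  using \<psi> C1_continuous unfolding C1c_def C1_def by auto

lemma \<psi>m [measurable]: "\<psi> \<in> borel_measurable borel" "\<psi>' \<in> borel_measurable borel"
  using c\<psi> by (auto intro: borel_measurable_continuous_onI)

lemma \<psi>i: "integrable lborel \<psi>"
  by (rule integrable_continuous_support[OF c\<psi>(1), of k]) (simp add: \<psi>k)

lemma X_meas [measurable]: "X \<in> borel_measurable borel" "hX \<in> borel_measurable borel" "bX \<in> borel_measurable borel" "rX \<in> borel_measurable borel"
  unfolding X_def[abs_def] hX_def[abs_def] bX_def[abs_def] rX_def[abs_def] by measurable

lemma cont_renorm: "continuous_on UNIV (\<lambda>y. renorm (moll \<epsilon> (u t) y))"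
  by (intro continuous_on_compose2[OF DERIV_continuous_on[OF has_field_derivative_at_within[OF renorm_deriv], of UNIV] cont_moll] e) auto

lemma Xi: "integrable lborel (\<lambda>y. \<psi> y * renorm (moll \<epsilon> (u t) y))"
  by (rule integrable_continuous_support[of _ k]) (auto intro!: continuous_intros c\<psi> cont_renorm simp: \<psi>k)

lemma X_bounds: "0 \<le> X t" "X t \<le> (LINT y|lborel. \<psi> y)"
proof -
  show "0 \<le> X t" unfolding X_def by (intro Bochner_Integration.integral_nonneg mult_nonneg_nonneg) (auto simp: \<psi>01 renorm_range)
  show "X t \<le> (LINT y|lborel. \<psi> y)" unfolding X_def
  proof (rule Bochner_Integration.integral_mono[OF Xi \<psi>i])
    show "\<psi> y * renorm (moll \<epsilon> (u t) y) \<le> \<psi> y" for y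
      using mult_left_mono[of "renorm (moll \<epsilon> (u t) y)" 1 "\<psi> y"] \<psi>01 renorm_range by simp
  qed
qed

text \<open>The evolution of the mollification is known for each \<open>y\<close> at almost every
  time, with an exceptional set that depends on \<open>y\<close>. Joint measurability allows the two
  quantifiers to be exchanged; Fubini's theorem then integrates over \<open>y\<close>.\<close>

lemma X_evolution: "AE t in lborel. t \<in> {0..T} \<longrightarrow> X t = (LINT s|lborel. indicator {0..t} s * hX s)"
proof -
  let ?P = "\<lambda>t y. t \<in> {0..T} \<longrightarrow> renorm (moll \<epsilon> (u t) y) = (LINT s|lborel. indicator {0..t} s * (renorm' (moll \<epsilon> (u s) y) * FF \<epsilon> s y))"
  have meq: "(\<lambda>(t, y). LINT s|lborel. indicator {0..t} s * (renorm' (moll \<epsilon> (u s) y) * FF \<epsilon> s y)) \<in> borel_measurable (borel \<Otimes>\<^sub>M borel)"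
  proof -
    have "(LINT s|lborel. indicator {0..t} s * (renorm' (moll \<epsilon> (u s) y) * FF \<epsilon> s y)) = (LINT s|lborel. (if 0 \<le> s \<and> s \<le> t then renorm' (moll \<epsilon> (u s) y) * FF \<epsilon> s y else 0))" for t y
      by (intro Bochner_Integration.integral_cong) (auto simp: indicator_def)
    then show ?thesis by simp
  qed
  have ae: "AE y in lborel. AE t in lborel. ?P t y"
  proof (rule AE_I2)
    fix y :: 'a
    show "AE t in lborel. ?P t y"
      by (rule weak_chain_rule[OF _ _ T FF_integrable[OF e] moll_evolution[OF e] renorm_deriv continuous_renorm'])
        (measurable, simp add: renorm_def)
  qed
  have swap: "{x \<in> space (lborel \<Otimes>\<^sub>M lborel). ?P (fst x) (snd x)} \<in> sets (lborel \<Otimes>\<^sub>M lborel)"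
  proof -
    have [measurable]: "(\<lambda>x. LINT s|lborel. indicator {0..fst x} s * (renorm' (moll \<epsilon> (u s) (snd x)) * FF \<epsilon> s (snd x))) \<in> borel_measurable (lborel \<Otimes>\<^sub>M lborel)"
      using meq by (simp add: split_beta')
    show ?thesis by measurable
  qed
  have "AE t in lborel. AE y in lborel. ?P t y"
    by (rule iffD2[OF lborel_pair.AE_commute[where P="\<lambda>t y. ?P t y", OF swap] ae])
  then show ?thesis
  proof eventually_elim
    case (elim t)
    show ?case
    proof
      assume t: "t \<in> {0..T}"
      let ?f = "\<lambda>s y. \<psi> y * (indicator {0..t} s * (renorm' (moll \<epsilon> (u s) y) * FF \<epsilon> s y))"
      obtain M where M: "M > 0" "\<And>t y k. norm y \<le> k \<Longrightarrow> \<bar>FF \<epsilon> t y\<bar> \<le> M * (NN t (k + real DIM('a)) + NB t (k + real DIM('a)))"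
        by (rule FF_bound[OF e]) blast
      have int: "integrable (lborel \<Otimes>\<^sub>M lborel) (\<lambda>(s, y). ?f s y)"
      proof (rule Bochner_Integration.integrable_bound)
        have "integrable lborel (indicator (cball (0::'a) k) :: 'a \<Rightarrow> real)"
          using emeasure_bounded_finite[OF bounded_cball, of "0::'a" k] by (intro integrable_real_indicator) auto
        moreover have "integrable lborel (\<lambda>s. 2 * (M * (NN s (k + real DIM('a)) + NB s (k + real DIM('a)))))"
          using NGi NBi by simp
        ultimately show "integrable (lborel \<Otimes>\<^sub>M lborel) (\<lambda>(s, y). (2 * (M * (NN s (k + real DIM('a)) + NB s (k + real DIM('a))))) * indicator (cball (0::'a) k) y)"
          by (intro integrable_product_pair)
        show "(\<lambda>(s, y). ?f s y) \<in> borel_measurable (lborel \<Otimes>\<^sub>M lborel)" by measurable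
        have "norm (?f s y) \<le> norm ((2 * (M * (NN s (k + real DIM('a)) + NB s (k + real DIM('a))))) * indicator (cball (0::'a) k) y)" for s y
        proof (cases "norm y \<le> k")
          case True
          have "norm (?f s y) \<le> 1 * (1 * (2 * (M * (NN s (k + real DIM('a)) + NB s (k + real DIM('a))))))"
            unfolding real_norm_def abs_mult
            by (intro mult_mono M(2)[OF True] renorm'_le mult_nonneg_nonneg) (use \<psi>01[of y] in \<open>auto simp: indicator_def\<close>)
          then show ?thesis using True by (simp add: order_trans[OF _ abs_ge_self])
        next
          case False
          then show ?thesis using \<psi>k[of y] by simp
        qed
        then show "AE x in lborel \<Otimes>\<^sub>M lborel. norm (case x of (s, y) \<Rightarrow> ?f s y) \<le> norm (case x of (s, y) \<Rightarrow> (2 * (M * (NN s (k + real DIM('a)) + NB s (k + real DIM('a))))) * indicator (cball (0::'a) k) y)"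
          by (intro AE_I2) auto
      qed
      have "X t = (LINT y|lborel. \<psi> y * (LINT s|lborel. indicator {0..t} s * (renorm' (moll \<epsilon> (u s) y) * FF \<epsilon> s y)))"
        unfolding X_def
      proof (rule integral_cong_AE)
        show "AE y in lborel. \<psi> y * renorm (moll \<epsilon> (u t) y) = \<psi> y * (LINT s|lborel. indicator {0..t} s * (renorm' (moll \<epsilon> (u s) y) * FF \<epsilon> s y))"
          using elim by eventually_elim (use t in simp)
        show "(\<lambda>y. \<psi> y * renorm (moll \<epsilon> (u t) y)) \<in> borel_measurable lborel" by measurable
        show "(\<lambda>y. \<psi> y * (LINT s|lborel. indicator {0..t} s * (renorm' (moll \<epsilon> (u s) y) * FF \<epsilon> s y))) \<in> borel_measurable lborel" by measurable
      qed
      also have "\<dots> = (LINT y|lborel. LINT s|lborel. ?f s y)" by simp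
      also have "\<dots> = (LINT s|lborel. LINT y|lborel. ?f s y)" by (rule lborel_pair.Fubini_integral[OF int])
      also have "\<dots> = (LINT s|lborel. indicator {0..t} s * hX s)"
        unfolding hX_def by (intro Bochner_Integration.integral_cong refl) (simp add: mult.left_commute[of "\<psi> _"])
      finally show "X t = (LINT s|lborel. indicator {0..t} s * hX s)" .
    qed
  qed
qed

text \<open>The weight in the divergence term is continuous, lies between 0 and 1 and has integral
  \<open>X t\<close>, so it is an admissible \<open>G\<close> in \<open>bmo\<close>.\<close>

lemma hX_le:
  assumes "m \<ge> 0" shows "hX t \<le> w t * (m * X t + C' * exp (- m)) + bX t + 2 * rX t"
proof -
  have "hX t \<le> (LINT y|lborel. \<bar>dv t y\<bar> * (\<psi> y * renorm (moll \<epsilon> (u t) y))) + bX t + 2 * rX t"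
    unfolding hX_def bX_def rX_def
    by (rule spatial.energy_inequality[OF S e(1) \<psi> \<psi>k \<psi>01 renorm_deriv continuous_renorm' renorm_range renorm'_le])
  moreover have "(LINT y|lborel. \<bar>dv t y\<bar> * (\<psi> y * renorm (moll \<epsilon> (u t) y))) \<le> w t * (m * X t + C' * exp (- m))"
    unfolding X_def
  proof (rule bmo[OF _ _ _ Xi assms])
    show "continuous_on UNIV (\<lambda>y. \<psi> y * renorm (moll \<epsilon> (u t) y))" by (intro continuous_intros c\<psi> cont_renorm)
    show "0 \<le> \<psi> x * renorm (moll \<epsilon> (u t) x)" for x using \<psi>01 renorm_range by simp
    show "\<psi> x * renorm (moll \<epsilon> (u t) x) \<le> 1" for x using \<psi>01[of x] renorm_range[of "moll \<epsilon> (u t) x"] by (intro mult_le_one) auto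
  qed
  ultimately show ?thesis by linarith
qed

text \<open>This removes the times before \<open>t0\<close> from the integral inequality.\<close>

lemma hX_zero: "AE x in lborel. u t x = 0 \<Longrightarrow> hX t = 0"
  unfolding hX_def using spatial_u_zero[OF _ S] by simp

lemma bX_props: "integrable lborel bX" "0 \<le> bX t"
proof -
  have "integrable (lborel \<Otimes>\<^sub>M lborel) (\<lambda>(t, y). norm (b t y) * norm (\<psi>' y))"
  proof (rule Bochner_Integration.integrable_bound)
    show "integrable (lborel \<Otimes>\<^sub>M lborel) (\<lambda>x. 8 * (case x of (t, y) \<Rightarrow> norm (b t y) / (1 + norm y)))" using bglob by (rule integrable_mult_right)
    show "(\<lambda>(t, y). norm (b t y) * norm (\<psi>' y)) \<in> borel_measurable (lborel \<Otimes>\<^sub>M lborel)" by measurable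
    have "norm (b t y) * norm (\<psi>' y) \<le> 8 * (norm (b t y) / (1 + norm y))" for t y
      using mult_left_mono[OF \<psi>b[of y], of "norm (b t y)"] by (simp add: mult.commute)
    then show "AE x in lborel \<Otimes>\<^sub>M lborel. norm (case x of (t, y) \<Rightarrow> norm (b t y) * norm (\<psi>' y)) \<le> norm (8 * (case x of (t, y) \<Rightarrow> norm (b t y) / (1 + norm y)))"
      by (intro AE_I2) (auto intro: order_trans[OF _ abs_ge_self])
  qed
  from lborel_pair.integrable_fst'[OF this] show "integrable lborel bX" by (simp add: bX_def[abs_def])
  show "0 \<le> bX t" unfolding bX_def by (rule Bochner_Integration.integral_nonneg) simp
qed

definition KR :: real where "KR = kern_const TYPE('a) * (1 + real DIM('a) * real DIM('a))"
definition CT :: real where "CT = measure lborel (cball (0::'a) (real DIM('a))) * (3 powr p * (2 * C)) powr (1 / p)"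

lemma KR_nonneg: "0 \<le> KR" "0 \<le> CT" unfolding KR_def CT_def using kern_const(1)[where 'a='a] by (auto simp: less_imp_le)

text \<open>The commutator bound is brought into the form required by dominated convergence: an
  integrable function of time that does not depend on \<open>\<epsilon>\<close>, times a translation
  modulus that is bounded in time and scale and tends to 0 at each time.\<close>

lemma rX_le: "rX t \<le> KR * NN t (k + real DIM('a)) * enn2real (trans_mod p (u t) \<epsilon>)" "enn2real (trans_mod p (u t) \<epsilon>) \<le> CT" "0 \<le> rX t"
proof -
  interpret spatial "u t" "b t" "\<lambda>i. g i t" p q by (rule S)
  have tm: "trans_mod p (u t) \<epsilon> \<le> ennreal CT" unfolding CT_def by (rule trans_mod_bound[OF um up pq(1) uC])
  show "enn2real (trans_mod p (u t) \<epsilon>) \<le> CT" by (rule enn2real_leI[OF KR_nonneg(2) tm])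
  have fin: "trans_mod p (u t) \<epsilon> < top" using tm by (rule le_less_trans) simp
  show "0 \<le> rX t" unfolding rX_def by (rule Bochner_Integration.integral_nonneg) simp
  have li: "integrable lborel (\<lambda>y. indicator (cball 0 k) y * \<bar>cm \<epsilon> t y\<bar>)"
    using loc_int_comm[OF e(1)] integrable_abs[of lborel "\<lambda>x. indicator (cball 0 k) x * comm \<epsilon> x"] by (simp add: loc_int_def abs_mult)
  have "ennreal (rX t) = (\<integral>\<^sup>+y. ennreal (indicator (cball 0 k) y * \<bar>cm \<epsilon> t y\<bar>) \<partial>lborel)"
    unfolding rX_def by (rule nn_integral_eq_integral[OF li, symmetric]) simp
  also have "\<dots> = (\<integral>\<^sup>+y. indicator (cball 0 k) y * ennreal \<bar>cm \<epsilon> t y\<bar> \<partial>lborel)"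
    by (intro nn_integral_cong) (auto simp: indicator_def)
  also have "\<dots> \<le> ennreal (KR * NN t (k + real DIM('a))) * trans_mod p (u t) \<epsilon>"
    unfolding KR_def by (rule comm_bound[OF e])
  also have "\<dots> = ennreal (KR * NN t (k + real DIM('a))) * ennreal (enn2real (trans_mod p (u t) \<epsilon>))" using fin by simp
  also have "\<dots> = ennreal (KR * NN t (k + real DIM('a)) * enn2real (trans_mod p (u t) \<epsilon>))"
    using KR_nonneg NG_nonneg by (intro ennreal_mult[symmetric]) auto
  finally show "rX t \<le> KR * NN t (k + real DIM('a)) * enn2real (trans_mod p (u t) \<epsilon>)"
    using KR_nonneg NG_nonneg by (subst (asm) ennreal_le_iff) (auto intro!: mult_nonneg_nonneg)
qed

lemma rX_bound: "rX t \<le> KR * NN t (k + real DIM('a)) * CT"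
  by (rule order_trans[OF rX_le(1) mult_left_mono[OF rX_le(2)]]) (use KR_nonneg spatial.NG_nonneg[OF S] in auto)

lemma rX_integrable: "integrable lborel rX"
proof (rule Bochner_Integration.integrable_bound)
  show "integrable lborel (\<lambda>t. KR * NN t (k + real DIM('a)) * CT)" using NGi by simp
  show "AE t in lborel. norm (rX t) \<le> norm (KR * NN t (k + real DIM('a)) * CT)"
    using rX_le(3) rX_bound by (intro AE_I2) (auto intro: order_trans[OF _ abs_ge_self])
qed measurable

text \<open>Flux and commutator are nonnegative, so their total integrals over time may be put into
  the initial value \<open>A\<close>, next to the price \<open>C' * exp (- m)\<close>; only the
  linear term is left for Gronwall's inequality.\<close>

lemma X_Gronwall:
  assumes t01: "0 \<le> t0" "t0 \<le> t1" "t1 \<le> T" and W: "(LINT s|lborel. indicator {t0..t1} s * w s) \<le> 1/2"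
    and z: "AE s in lborel. s \<in> {0..t0} \<longrightarrow> (AE x in lborel. u s x = 0)" and m: "m \<ge> 0"
  shows "AE t in lborel. t \<in> {t0..t1} \<longrightarrow> X t \<le> ((LINT t|lborel. bX t) + 2 * (LINT t|lborel. rX t) + C' * exp (- m)) * exp (m / 2)"
proof -
  define A where "A = (LINT t|lborel. bX t) + 2 * (LINT t|lborel. rX t) + C' * exp (- m)"
  have pos: "0 \<le> (LINT t|lborel. bX t)" "0 \<le> (LINT t|lborel. rX t)" using bX_props(2) rX_le(3) by auto
  have A: "A > 0" unfolding A_def using pos C' by (intro add_nonneg_pos) auto
  have iw: "integrable lborel (\<lambda>s. indicator {a..b} s * w s)" for a b
    using integrable_mult_indicator[OF _ wi, of "{a..b}"] by simp
  have iwX: "integrable lborel (\<lambda>s. indicator {a..b} s * (w s * X s))" for a b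
  proof -
    have "integrable lborel (\<lambda>s. X s * w s)"
      using X_bounds by (intro integrable_mult_bounded[OF wi]) auto
    from integrable_mult_indicator[OF _ this, of "{a..b}"] show ?thesis by (simp add: mult.commute)
  qed
  \<comment> \<open>\<open>X\<close> satisfies the integral inequality at almost every time.
    \<open>Y\<close> is continuous and satisfies it at every time, because replacing
    \<open>X\<close> by the larger \<open>Y\<close> under the integral increases the right-hand
    side.\<close>
  define Y where "Y t = A + m * integral {t0..t} (\<lambda>s. w s * X s)" for t
  have Yeq: "integral {t0..t} (\<lambda>s. w s * X s) = (LINT s|lborel. indicator {t0..t} s * (w s * X s))" for t
    by (rule Icc_integral_conv(2)[OF iwX])
  have XY: "AE t in lborel. t \<in> {t0..t1} \<longrightarrow> X t \<le> Y t"
    using X_evolution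
  proof eventually_elim
    case (elim t)
    show ?case
    proof
      assume t: "t \<in> {t0..t1}"
      then have "X t = (LINT s|lborel. indicator {0..t} s * hX s)" using elim t01 by auto
      also have "\<dots> \<le> (LINT s|lborel. m * (indicator {t0..t} s * (w s * X s)) + C' * exp (- m) * (indicator {t0..t} s * w s) + bX s + 2 * rX s)"
      proof (rule integral_mono_AE')
        show "integrable lborel (\<lambda>s. m * (indicator {t0..t} s * (w s * X s)) + C' * exp (- m) * (indicator {t0..t} s * w s) + bX s + 2 * rX s)"
          using iwX iw bX_props(1) rX_integrable by simp
        have nn: "0 \<le> m * (indicator {t0..t} s * (w s * X s)) + C' * exp (- m) * (indicator {t0..t} s * w s)" for s
          using m w0[of s] X_bounds(1)[of s] C' by (intro add_nonneg_nonneg mult_nonneg_nonneg) auto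
        show "AE s in lborel. indicator {0..t} s * hX s \<le> m * (indicator {t0..t} s * (w s * X s)) + C' * exp (- m) * (indicator {t0..t} s * w s) + bX s + 2 * rX s"
          using z
        proof eventually_elim
          case (elim s)
          show ?case
          proof (cases "s \<in> {t0..t}")
            case True
            then show ?thesis using hX_le[OF m, of s] t01 by (simp add: algebra_simps)
          next
            case False
            \<comment> \<open>Outside \<open>{t0..t}\<close> either the indicator vanishes or the
              time lies before \<open>t0\<close>, where the rate is 0.\<close>
            have "indicator {0..t} s * hX s = 0"
            proof (cases "s \<in> {0..t}")
              case True
              then have "s \<in> {0..t0}" using False by auto
              then show ?thesis using elim hX_zero by simp
            qed simp
            then show ?thesis using nn[of s] bX_props(2)[of s] rX_le(3)[of s] by linarith
          qed
        qed
        show "AE s in lborel. 0 \<le> m * (indicator {t0..t} s * (w s * X s)) + C' * exp (- m) * (indicator {t0..t} s * w s) + bX s + 2 * rX s"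
        proof (rule AE_I2)
          fix s show "0 \<le> m * (indicator {t0..t} s * (w s * X s)) + C' * exp (- m) * (indicator {t0..t} s * w s) + bX s + 2 * rX s"
            using nn[of s] bX_props(2)[of s] rX_le(3)[of s] by linarith
        qed
      qed
      also have "\<dots> = m * (LINT s|lborel. indicator {t0..t} s * (w s * X s)) + C' * exp (- m) * (LINT s|lborel. indicator {t0..t} s * w s) + (LINT s|lborel. bX s) + 2 * (LINT s|lborel. rX s)"
        using iwX iw bX_props(1) rX_integrable by simp
      \<comment> \<open>A bound by 1 for the constant term; the value 1/2 matters in the
        exponent.\<close>
      also have "(LINT s|lborel. indicator {t0..t} s * w s) \<le> 1"
      proof -
        have "(LINT s|lborel. indicator {t0..t} s * w s) \<le> (LINT s|lborel. indicator {t0..t1} s * w s)"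
          using iw w0 t by (intro Bochner_Integration.integral_mono) (auto simp: indicator_def)
        then show ?thesis using W by simp
      qed
      finally show "X t \<le> Y t" unfolding Y_def A_def Yeq using C' by (simp add: mult_left_mono)
    qed
  qed
  have wX: "(\<lambda>s. w s * X s) integrable_on {t0..t1}" using Icc_integral_conv(1)[OF iwX] by (simp add: absolutely_integrable_on_def)
  have cY: "continuous_on {t0..t1} Y"
    unfolding Y_def[abs_def] by (intro continuous_intros indefinite_integral_continuous_1 wX)
  have YA: "A \<le> Y t" for t
    unfolding Y_def Yeq using m w0 X_bounds(1) by (auto intro!: mult_nonneg_nonneg Bochner_Integration.integral_nonneg)
  have YE: "Y t \<le> A * exp (m / 2)" if t: "t \<in> {t0..t1}" for t
  proof -
    have wA: "w absolutely_integrable_on {t0..s}" for s by (rule Icc_integral_conv(1)[OF iw])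
    have "Y t \<le> A * exp (m * integral {t0..t} w)"
    proof (rule gronwall_integral[OF wA w0])
      show c: "continuous_on {t0..t} Y" by (rule continuous_on_subset[OF cY]) (use t in auto)
      show "0 \<le> Y s" for s using YA[of s] A by simp
      fix s assume s: "s \<in> {t0..t}"
      have c': "continuous_on {t0..s} Y" by (rule continuous_on_subset[OF c]) (use s in auto)
      have wY: "(\<lambda>r. w r * Y r) absolutely_integrable_on {t0..s}"
        using absolutely_integrable_continuous_mult[OF wA c'] by (simp add: mult.commute)
      have "integral {t0..s} (\<lambda>r. w r * X r) = (LINT r:{t0..s}|lebesgue. w r * X r)"
        by (rule set_lebesgue_integral_eq_integral(2)[OF Icc_integral_conv(1)[OF iwX], symmetric])
      also have "\<dots> \<le> (LINT r:{t0..s}|lebesgue. w r * Y r)"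
        unfolding set_lebesgue_integral_def
      proof (rule integral_mono_AE)
        show "integrable lebesgue (\<lambda>r. indicat_real {t0..s} r *\<^sub>R (w r * X r))" using Icc_integral_conv(1)[OF iwX] by (simp add: set_integrable_def)
        show "integrable lebesgue (\<lambda>r. indicat_real {t0..s} r *\<^sub>R (w r * Y r))" using wY by (simp add: set_integrable_def)
        show "AE r in lebesgue. indicat_real {t0..s} r *\<^sub>R (w r * X r) \<le> indicat_real {t0..s} r *\<^sub>R (w r * Y r)"
          using AE_completion[OF XY] by eventually_elim (use s t w0 in \<open>auto simp: indicator_def intro!: mult_left_mono\<close>)
      qed
      also have "\<dots> = integral {t0..s} (\<lambda>r. w r * Y r)" by (rule set_lebesgue_integral_eq_integral(2)[OF wY])
      finally show "Y s \<le> A + m * integral {t0..s} (\<lambda>r. w r * Y r)" unfolding Y_def using m by (simp add: mult_left_mono)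
    qed (use A m t in auto)
    also have "\<dots> \<le> A * exp (m / 2)"
    proof -
      have "integral {t0..t} w = (LINT s|lborel. indicator {t0..t} s * w s)" by (rule Icc_integral_conv(2)[OF iw])
      also have "\<dots> \<le> (LINT s|lborel. indicator {t0..t1} s * w s)"
        using iw w0 t by (intro Bochner_Integration.integral_mono) (auto simp: indicator_def)
      finally have "m * integral {t0..t} w \<le> m * (1/2)" using W m by (intro mult_left_mono) auto
      then show ?thesis using A by (intro mult_left_mono) auto
    qed
    finally show ?thesis .
  qed
  from XY show ?thesis
  proof eventually_elim
    case (elim t)
    then show ?case using YE[of t] order_trans[of "X t" "Y t"] unfolding A_def by blast
  qed
qed

end

lemma rX_tendsto:
  assumes "k \<ge> 1"
  shows "(\<lambda>n. LINT t|lborel. rX (1 / Suc n) k t) \<longlonglongrightarrow> 0"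
proof -
  have ctx: "0 < 1 / real (Suc n)" "1 / real (Suc n) \<le> 1" for n by auto
  note cut = cutoff_props[OF assms, where 'a='a]
  note rX = rX_le[OF ctx cut(1,3,2,4)] and rb = rX_bound[OF ctx cut(1,3,2,4)] and rm = X_meas(4)[OF ctx cut(1,3,2,4)]
  have "(\<lambda>n. LINT t|lborel. rX (1 / Suc n) k t) \<longlonglongrightarrow> (LINT t|(lborel :: real measure). 0)"
  \<comment> \<open>At each time the translation modulus tends to 0, with no uniformity in time; the
    bound \<open>CT\<close> on the modulus supplies the integrable majorant.\<close>
  proof (rule integral_dominated_convergence[where w="\<lambda>t. KR * NN t (k + real DIM('a)) * CT"])
    show "integrable lborel (\<lambda>t. KR * NN t (k + real DIM('a)) * CT)" using NGi by simp
    show "rX (1 / Suc n) k \<in> borel_measurable lborel" for n using rm by simp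
    show "AE t in lborel. norm (rX (1 / Suc n) k t) \<le> KR * NN t (k + real DIM('a)) * CT" for n
      using rX(3) rb by (intro AE_I2) simp
    show "AE t in lborel. (\<lambda>n. rX (1 / Suc n) k t) \<longlonglongrightarrow> 0"
    proof (rule AE_I2)
      fix t
      interpret spatial "u t" "b t" "\<lambda>i. g i t" p q by (rule S)
      have "(\<lambda>n. trans_mod p (u t) (1 / Suc n)) \<longlonglongrightarrow> ennreal 0" using trans_mod_tendsto[OF um up pq(1)] by simp
      then have "(\<lambda>n. enn2real (trans_mod p (u t) (1 / Suc n))) \<longlonglongrightarrow> 0" by (rule tendsto_enn2real) simp
      then have "(\<lambda>n. KR * NN t (k + real DIM('a)) * enn2real (trans_mod p (u t) (1 / Suc n))) \<longlonglongrightarrow> KR * NN t (k + real DIM('a)) * 0"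
        by (rule tendsto_mult_left)
      then have lim: "(\<lambda>n. KR * NN t (k + real DIM('a)) * enn2real (trans_mod p (u t) (1 / Suc n))) \<longlonglongrightarrow> 0" by simp
      show "(\<lambda>n. rX (1 / Suc n) k t) \<longlonglongrightarrow> 0"
        by (rule tendsto_sandwich[OF _ _ tendsto_const lim]) (use rX in auto)
    qed
  qed simp
  then show ?thesis by simp
qed

text \<open>The Lipschitz bound of \<open>renorm\<close> reduces the claim to L1 convergence of the
  mollifications on the ball that carries the cutoff.\<close>

lemma X_tendsto:
  assumes "k \<ge> 1"
  shows "(\<lambda>n. X (1 / Suc n) (cutoff k) t) \<longlonglongrightarrow> (LINT y|lborel. cutoff k y * renorm (u t y))"
proof (rule LIMSEQ_I)
  interpret spatial "u t" "b t" "\<lambda>i. g i t" p q by (rule S)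
  note cut = cutoff_props[OF assms, where 'a='a]
  have ctx: "0 < 1 / real (Suc n)" "1 / real (Suc n) \<le> 1" for n by auto
  have cc: "continuous_on UNIV (cutoff k :: 'a \<Rightarrow> real)" using cut(1) C1_continuous unfolding C1c_def by blast
  then have [measurable]: "(cutoff k :: 'a \<Rightarrow> real) \<in> borel_measurable borel" by (rule borel_measurable_continuous_onI)
  have ci: "integrable lborel (cutoff k :: 'a \<Rightarrow> real)" by (rule integrable_continuous_support[OF cc, of k]) (use cut(3) in blast)
  have i1: "integrable lborel (\<lambda>y. cutoff k y * renorm (moll (1 / Suc n) (u t) y))" for n
    by (rule Xi[OF ctx cut(1,3,2,4)])
  have i2: "integrable lborel (\<lambda>y. cutoff k y * renorm (u t y))"
    using integrable_mult_bounded[OF ci, of "\<lambda>y. renorm (u t y)" 1] renorm_range by (simp add: mult.commute)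
  have Xe: "X (1 / Suc n) (cutoff k) t = (LINT y|lborel. cutoff k y * renorm (moll (1 / Suc n) (u t) y))" for n
    by (rule X_def[OF ctx cut(1,3,2,4)])
  fix e :: real assume e: "e > 0"
  obtain d where d: "d > 0" "\<And>\<epsilon>. 0 < \<epsilon> \<Longrightarrow> \<epsilon> < d \<Longrightarrow> (\<integral>\<^sup>+y. indicator (cball 0 k) y * ennreal \<bar>moll \<epsilon> (u t) y - u t y\<bar> \<partial>lborel) \<le> ennreal (e / 4)"
    by (rule moll_L1_loc[OF loc_int_u, of "e / 4" k]) (use e in auto)
  obtain N where N: "1 / real (Suc N) < d" using d(1) reals_Archimedean by (metis inverse_eq_divide)
  show "\<exists>N. \<forall>n\<ge>N. norm (X (1 / Suc n) (cutoff k) t - (LINT y|lborel. cutoff k y * renorm (u t y))) < e"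
  proof (intro exI allI impI)
    fix n assume n: "n \<ge> N"
    have "1 / real (Suc n) \<le> 1 / real (Suc N)" using n by (intro divide_left_mono) auto
    then have nd: "1 / real (Suc n) < d" using N by linarith
    have m: "(\<lambda>y. indicator (cball 0 k) y * ennreal \<bar>moll (1 / Suc n) (u t) y - u t y\<bar>) \<in> borel_measurable lborel"
      using moll_measurable[OF um, of "1 / Suc n"] um by (auto intro!: borel_measurable_times_ennreal borel_measurable_indicator)
    have "ennreal (norm (X (1 / Suc n) (cutoff k) t - (LINT y|lborel. cutoff k y * renorm (u t y))))
      = ennreal (norm (LINT y|lborel. cutoff k y * renorm (moll (1 / Suc n) (u t) y) - cutoff k y * renorm (u t y)))"
      by (simp only: Xe[of n] Bochner_Integration.integral_diff[OF i1[of n] i2])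
    also have "\<dots> \<le> (\<integral>\<^sup>+y. ennreal (norm (cutoff k y * renorm (moll (1 / Suc n) (u t) y) - cutoff k y * renorm (u t y))) \<partial>lborel)"
      by (rule integral_norm_bound_ennreal) (use i1[of n] i2 in simp)
    also have "\<dots> \<le> (\<integral>\<^sup>+y. ennreal 2 * (indicator (cball 0 k) y * ennreal \<bar>moll (1 / Suc n) (u t) y - u t y\<bar>) \<partial>lborel)"
    proof (rule nn_integral_mono)
      fix y :: 'a
      let ?D = "\<bar>moll (1 / Suc n) (u t) y - u t y\<bar>"
      have "norm (cutoff k y * renorm (moll (1 / Suc n) (u t) y) - cutoff k y * renorm (u t y)) = cutoff k y * \<bar>renorm (moll (1 / Suc n) (u t) y) - renorm (u t y)\<bar>"
        using cut(2)[of y] by (simp add: abs_mult flip: right_diff_distrib)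
      also have "\<dots> \<le> cutoff k y * (2 * ?D)" using cut(2)[of y] renorm_Lipschitz by (intro mult_left_mono) auto
      also have "\<dots> \<le> 2 * (indicator (cball 0 k) y * ?D)"
      proof (cases "norm y \<le> k")
        case True
        then show ?thesis using mult_right_mono[of "cutoff k y" 1 "2 * ?D"] cut(2)[of y] by simp
      next
        case False
        then show ?thesis using cut(3)[of y] by simp
      qed
      finally have "ennreal (norm (cutoff k y * renorm (moll (1 / Suc n) (u t) y) - cutoff k y * renorm (u t y))) \<le> ennreal (2 * (indicator (cball 0 k) y * ?D))" by (rule ennreal_leI)
      also have "\<dots> = ennreal 2 * (indicator (cball 0 k) y * ennreal ?D)"
        by (subst ennreal_mult) (auto simp: indicator_def)
      finally show "ennreal (norm (cutoff k y * renorm (moll (1 / Suc n) (u t) y) - cutoff k y * renorm (u t y))) \<le> ennreal 2 * (indicator (cball 0 k) y * ennreal ?D)" .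
    qed
    also have "\<dots> = ennreal 2 * (\<integral>\<^sup>+y. indicator (cball 0 k) y * ennreal \<bar>moll (1 / Suc n) (u t) y - u t y\<bar> \<partial>lborel)"
      by (rule nn_integral_cmult[OF m])
    also have "\<dots> \<le> ennreal 2 * ennreal (e / 4)" by (intro mult_left_mono d(2) ctx nd) auto
    also have "\<dots> = ennreal (e / 2)" using e by (subst ennreal_mult[symmetric]) auto
    finally show "norm (X (1 / Suc n) (cutoff k) t - (LINT y|lborel. cutoff k y * renorm (u t y))) < e"
      using e by (subst (asm) ennreal_le_iff) auto
  qed
qed

text \<open>Dominated convergence on space-time: the gradient of the cutoff tends to 0 at each point
  as the radius grows, and the growth condition on \<open>b\<close> supplies the majorant.\<close>

lemma bX_tendsto: "(\<lambda>K. LINT t|lborel. bX (cutoff' (real (Suc K)) :: 'a \<Rightarrow> 'a) t) \<longlonglongrightarrow> 0"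
proof -
  let ?f = "\<lambda>K (t, y). norm (b t y) * norm (cutoff' (real (Suc K)) y)"
  have K1: "1 \<le> real (Suc K)" for K by simp
  note cut = cutoff_props[OF K1, where 'a='a]
  have cm: "(cutoff' (real (Suc K)) :: 'a \<Rightarrow> 'a) \<in> borel_measurable borel" for K
    using cut(1)[of K] unfolding C1c_def C1_def by (intro borel_measurable_continuous_onI) blast
  note [measurable] = cm
  have le: "norm (?f K (t, y)) \<le> 8 * (norm (b t y) / (1 + norm y))" for K t y
    using mult_left_mono[OF cut(4)[of K y], of "norm (b t y)"] by (simp add: mult.commute)
  have lim: "(\<lambda>K. LINT z|(lborel \<Otimes>\<^sub>M lborel). ?f K z) \<longlonglongrightarrow> (LINT z|(lborel \<Otimes>\<^sub>M lborel :: (real \<times> 'a) measure). 0)"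
  and fi: "integrable (lborel \<Otimes>\<^sub>M lborel) (?f K)" for K
  proof -
    have I: "integrable (lborel \<Otimes>\<^sub>M lborel) (\<lambda>z. 8 * (case z of (t, y) \<Rightarrow> norm (b t y) / (1 + norm y)))" using bglob by (rule integrable_mult_right)
    have M: "?f K \<in> borel_measurable (lborel \<Otimes>\<^sub>M lborel)" for K by measurable
    have L: "AE z in lborel \<Otimes>\<^sub>M lborel. norm (?f K z) \<le> 8 * (case z of (t, y) \<Rightarrow> norm (b t y) / (1 + norm y))" for K
      using le by (intro AE_I2) auto
    have P: "AE z in lborel \<Otimes>\<^sub>M lborel. (\<lambda>K. ?f K z) \<longlonglongrightarrow> 0"
    proof (rule AE_I2)
      fix z :: "real \<times> 'a"
      obtain t y where z: "z = (t, y)" by (cases z)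
      have 0: "(\<lambda>K. norm (b t y) * (4 * norm y * (inverse (real (Suc K)))\<^sup>2)) \<longlonglongrightarrow> norm (b t y) * (4 * norm y * 0\<^sup>2)"
        by (intro tendsto_intros LIMSEQ_inverse_real_of_nat)
      show "(\<lambda>K. ?f K z) \<longlonglongrightarrow> 0"
      proof (rule tendsto_sandwich[OF _ _ tendsto_const])
        show "(\<lambda>K. norm (b t y) * (4 * norm y * (inverse (real (Suc K)))\<^sup>2)) \<longlonglongrightarrow> 0" using 0 by simp
        show "\<forall>\<^sub>F K in sequentially. 0 \<le> ?f K z" by (simp add: z)
        show "\<forall>\<^sub>F K in sequentially. ?f K z \<le> norm (b t y) * (4 * norm y * (inverse (real (Suc K)))\<^sup>2)"
          using cut(5)[where x=y] unfolding z by (intro always_eventually allI) (auto intro!: mult_left_mono simp: divide_inverse power_inverse)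
      qed
    qed
    show "integrable (lborel \<Otimes>\<^sub>M lborel) (?f K)"
      by (rule integrable_dominated_convergence2[OF borel_measurable_const M I P L])
    show "(\<lambda>K. LINT z|(lborel \<Otimes>\<^sub>M lborel). ?f K z) \<longlonglongrightarrow> (LINT z|(lborel \<Otimes>\<^sub>M lborel :: (real \<times> 'a) measure). 0)"
      by (rule integral_dominated_convergence[OF borel_measurable_const M I P L])
  qed
  have eq: "(LINT t|lborel. bX (cutoff' (real (Suc K)) :: 'a \<Rightarrow> 'a) t) = (LINT z|(lborel \<Otimes>\<^sub>M lborel). ?f K z)" for K
  proof -
    have "bX (cutoff' (real (Suc K)) :: 'a \<Rightarrow> 'a) t = (LINT y|lborel. ?f K (t, y))" for t
      using bX_def[of 1, OF _ _ cut(1,3,2,4)[of K]] by simp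
    then show ?thesis using lborel_pair.integral_fst'[OF fi[of K]] by simp
  qed
  show ?thesis unfolding eq using lim by simp
qed

text \<open>Cutoff radius and \<open>m\<close> stay fixed while the scale runs through the sequence
  \<open>1 / Suc n\<close>, so that the exceptional sets of times are countably many.\<close>

lemma limit_Gronwall:
  assumes t01: "0 \<le> t0" "t0 \<le> t1" "t1 \<le> T" and W: "(LINT s|lborel. indicator {t0..t1} s * w s) \<le> 1/2"
    and z: "AE s in lborel. s \<in> {0..t0} \<longrightarrow> (AE x in lborel. u s x = 0)" and m: "m \<ge> 0" and k: "k \<ge> 1"
  shows "AE t in lborel. t \<in> {t0..t1} \<longrightarrow> (LINT y|lborel. cutoff k y * renorm (u t y)) \<le> ((LINT t|lborel. bX (cutoff' k :: 'a \<Rightarrow> 'a) t) + C' * exp (- m)) * exp (m / 2)"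
proof -
  note cut = cutoff_props[OF k, where 'a='a]
  have ctx: "0 < 1 / real (Suc n)" "1 / real (Suc n) \<le> 1" for n by auto
  let ?B = "LINT t|lborel. bX (cutoff' k :: 'a \<Rightarrow> 'a) t"
  have "AE t in lborel. \<forall>n. t \<in> {t0..t1} \<longrightarrow> X (1 / Suc n) (cutoff k) t \<le> (?B + 2 * (LINT t|lborel. rX (1 / Suc n) k t) + C' * exp (- m)) * exp (m / 2)"
    unfolding AE_all_countable
    using X_Gronwall[OF ctx cut(1,3,2,4) t01 W z m] by blast
  then show ?thesis
  proof eventually_elim
    case (elim t)
    show ?case
    proof
      assume t: "t \<in> {t0..t1}"
      have "(\<lambda>n. (?B + 2 * (LINT t|lborel. rX (1 / Suc n) k t) + C' * exp (- m)) * exp (m / 2)) \<longlonglongrightarrow> (?B + 2 * 0 + C' * exp (- m)) * exp (m / 2)"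
        by (intro tendsto_intros rX_tendsto k)
      then have "(LINT y|lborel. cutoff k y * renorm (u t y)) \<le> (?B + 2 * 0 + C' * exp (- m)) * exp (m / 2)"
        by (rule LIMSEQ_le[OF X_tendsto[OF k]]) (use elim t in blast)
      then show "(LINT y|lborel. cutoff k y * renorm (u t y)) \<le> (?B + C' * exp (- m)) * exp (m / 2)" by simp
    qed
  qed
qed

text \<open>The order of the limits is essential: for fixed \<open>m\<close> the growing cutoff
  removes the flux in spite of the factor \<open>exp (m / 2)\<close>, and what remains is
  \<open>C' * exp (- (m / 2))\<close>. Integer values of the radius and of \<open>m\<close> keep the
  exceptional sets countable.\<close>

lemma zero_step:
  assumes t01: "0 \<le> t0" "t0 \<le> t1" "t1 \<le> T" and W: "(LINT s|lborel. indicator {t0..t1} s * w s) \<le> 1/2"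
    and z: "AE s in lborel. s \<in> {0..t0} \<longrightarrow> (AE x in lborel. u s x = 0)"
  shows "AE t in lborel. t \<in> {t0..t1} \<longrightarrow> (AE x in lborel. u t x = 0)"
proof -
  let ?B = "\<lambda>K. LINT t|lborel. bX (cutoff' (real (Suc K)) :: 'a \<Rightarrow> 'a) t"
  have K1: "1 \<le> real (Suc K)" for K by simp
  note cut = cutoff_props[OF K1, where 'a='a]
  have "AE t in lborel. \<forall>K m::nat. t \<in> {t0..t1} \<longrightarrow> (LINT y|lborel. cutoff (real (Suc K)) y * renorm (u t y)) \<le> (?B K + C' * exp (- real m)) * exp (real m / 2)"
    unfolding AE_all_countable by (intro allI limit_Gronwall[OF t01 W z] K1) simp
  then show ?thesis
  proof eventually_elim
    case (elim t)
    show ?case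
    proof
      assume t: "t \<in> {t0..t1}"
      interpret spatial "u t" "b t" "\<lambda>i. g i t" p q by (rule S)
      have cc: "continuous_on UNIV (cutoff (real (Suc K)) :: 'a \<Rightarrow> real)" for K using cut(1)[of K] C1_continuous unfolding C1c_def by blast
      have ci: "integrable lborel (cutoff (real (Suc K)) :: 'a \<Rightarrow> real)" for K
        by (rule integrable_continuous_support[OF cc, of "real (Suc K)"]) (use cut(3)[of K] in blast)
      have i: "integrable lborel (\<lambda>y. cutoff (real (Suc K)) y * renorm (u t y))" for K
        using integrable_mult_bounded[OF ci, of "\<lambda>y. renorm (u t y)" 1] renorm_range by (simp add: mult.commute)
      have nn: "0 \<le> cutoff (real (Suc K)) y * renorm (u t y)" for K y using cut(2)[of K y] renorm_range by simp
      let ?I = "\<lambda>K. LINT y|lborel. cutoff (real (Suc K)) y * renorm (u t y)"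
      have I0: "?I k = 0" for k
      proof -
        \<comment> \<open>The energy with the fixed cutoff is at most that with any wider one, so
          the limit in the radius concerns the right-hand side alone.\<close>
        have le: "?I k \<le> C' * exp (- (real m / 2))" for m :: nat
        proof -
          have "(\<lambda>K. (?B K + C' * exp (- real m)) * exp (real m / 2)) \<longlonglongrightarrow> (0 + C' * exp (- real m)) * exp (real m / 2)"
            by (intro tendsto_intros bX_tendsto)
          moreover have "\<forall>\<^sub>F K in sequentially. ?I k \<le> (?B K + C' * exp (- real m)) * exp (real m / 2)"
            using eventually_ge_at_top[of k]
          proof eventually_elim
            case (elim K)
            have "?I k \<le> ?I K"
            proof (rule Bochner_Integration.integral_mono[OF i i])
              show "cutoff (real (Suc k)) y * renorm (u t y) \<le> cutoff (real (Suc K)) y * renorm (u t y)" for y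
                using cut(6)[of k "real (Suc K)" y] elim renorm_range by (intro mult_right_mono) auto
            qed
            also have "\<dots> \<le> (?B K + C' * exp (- real m)) * exp (real m / 2)" using \<open>\<forall>K m. _\<close> t by blast
            finally show ?case .
          qed
          ultimately have "?I k \<le> (0 + C' * exp (- real m)) * exp (real m / 2)" by (rule tendsto_lowerbound) simp
          also have "\<dots> = C' * (exp (- real m) * exp (real m / 2))" by simp
          also have "exp (- real m) * exp (real m / 2) = exp (- (real m / 2))" by (simp flip: exp_add)
          finally show ?thesis .
        qed
        have "(\<lambda>m::nat. C' * exp (- (real m / 2))) \<longlonglongrightarrow> C' * 0"
        proof (intro tendsto_mult_left)
          have "filterlim (\<lambda>m::nat. real m / 2) at_top sequentially"
            by (intro filterlim_tendsto_pos_mult_at_top[of "\<lambda>_. 1/2" "1/2" _ real, simplified] filterlim_real_sequentially)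
          then have "filterlim (\<lambda>m::nat. - (real m / 2)) at_bot sequentially" by (simp add: filterlim_uminus_at_bot)
          then show "(\<lambda>m::nat. exp (- (real m / 2))) \<longlonglongrightarrow> 0" by (rule filterlim_compose[OF exp_at_bot])
        qed
        then have "?I k \<le> C' * 0" using le by (intro LIMSEQ_le_const) auto
        moreover have "?I k \<ge> 0" by (intro Bochner_Integration.integral_nonneg nn)
        ultimately show ?thesis by simp
      qed
      have "AE y in lborel. cutoff (real (Suc k)) y * renorm (u t y) = 0" for k
        using I0[of k] integral_nonneg_eq_0_iff_AE[OF i[of k]] nn by simp
      then have "AE y in lborel. \<forall>k. cutoff (real (Suc k)) y * renorm (u t y) = 0" unfolding AE_all_countable by blast
      then show "AE x in lborel. u t x = 0"
      proof eventually_elim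
        case (elim y)
        obtain k where "norm y < real (Suc k)" using reals_Archimedean2 by (metis less_trans lessI of_nat_less_iff)
        then have "cutoff (real (Suc k)) y > 0" by (rule cut(7))
        then show ?case using elim[rule_format, of k] renorm_eq_0 by simp
      qed
    qed
  qed
qed

text \<open>Uniform continuity of the indefinite integral of \<open>w\<close> provides one step
  length \<open>h\<close> for which each interval carries weight at most 1/2.\<close>

theorem zero_solution: "AE t in lborel. t \<in> {0..T} \<longrightarrow> (AE x in lborel. u t x = 0)"
proof -
  have iw: "integrable lborel (\<lambda>s. indicator {a..b} s * w s)" for a b
    using integrable_mult_indicator[OF _ wi, of "{a..b}"] by simp
  have wI: "w integrable_on {a..b}" for a b using Icc_integral_conv(1)[OF iw] by (simp add: absolutely_integrable_on_def)
  have "uniformly_continuous_on {0..T} (\<lambda>t. integral {0..t} w)"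
    by (intro compact_uniformly_continuous indefinite_integral_continuous_1 wI) auto
  then obtain \<delta> where \<delta>: "\<delta> > 0" "\<And>x y. x \<in> {0..T} \<Longrightarrow> y \<in> {0..T} \<Longrightarrow> dist y x < \<delta> \<Longrightarrow> dist (integral {0..y} w) (integral {0..x} w) < 1/2"
    unfolding uniformly_continuous_on_def by (meson half_gt_zero zero_less_one)
  define h where "h = \<delta> / 2"
  have h: "h > 0" using \<delta> by (simp add: h_def)
  have "AE s in lborel. s \<in> {0..min T (real j * h)} \<longrightarrow> (AE x in lborel. u s x = 0)" for j
  proof (induction j)
    case 0
    \<comment> \<open>The start costs nothing: the interval is the single point 0.\<close>
    have "AE s in lborel. s \<noteq> (0::real)" by (rule AE_lborel_singleton)
    then show ?case by eventually_elim (use T in auto)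
  next
    case (Suc j)
    let ?a = "min T (real j * h)" and ?b = "min T (real (Suc j) * h)"
    have ab: "0 \<le> ?a" "?a \<le> ?b" "?b \<le> T" using T h by (auto simp: min_def algebra_simps)
    have "?b - ?a \<le> h" using h by (auto simp: min_def algebra_simps)
    then have dist: "dist ?b ?a < \<delta>" using ab h by (simp add: dist_real_def h_def)
    have "integral {0..?a} w + integral {?a..?b} w = integral {0..?b} w"
      by (rule Henstock_Kurzweil_Integration.integral_combine[OF _ _ wI]) (use ab in auto)
    then have calculation: "integral {0..?a} w + (LINT s|lborel. indicator {?a..?b} s * w s) = integral {0..?b} w"
      by (simp only: Icc_integral_conv(2)[OF iw, of ?a ?b])
    have W: "(LINT s|lborel. indicator {?a..?b} s * w s) \<le> 1/2"
    proof -
      have "?a \<in> {0..T}" "?b \<in> {0..T}" using ab by auto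
      from \<delta>(2)[OF this dist] have "\<bar>integral {0..?b} w - integral {0..?a} w\<bar> < 1/2" by (simp only: dist_real_def)
      then show ?thesis using calculation by linarith
    qed
    from zero_step[OF ab W Suc.IH] Suc.IH show ?case
      by eventually_elim (metis atLeastAtMost_iff linear)
  qed
  note Z = this
  obtain j where "real j * h > T" using h reals_Archimedean3[of h] by blast
  then have eq: "min T (real j * h) = T" by simp
  show ?thesis using Z[of j] by (simp only: eq)
qed

end

section \<open>Borel representatives\<close>

text \<open>The function is extended by 0 outside \<open>S\<close> and treated componentwise, since
  completed measurability yields Borel versions of real functions.\<close>

lemma Borel_representative:
  fixes f :: "'e::euclidean_space \<Rightarrow> 'b::euclidean_space"
  assumes f: "f \<in> borel_measurable (lebesgue_on S)" and S: "S \<in> sets lebesgue"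
  obtains F where "F \<in> borel_measurable borel" "AE z in lborel. z \<in> S \<longrightarrow> F z = f z"
proof -
  define h where "h z = (if z \<in> S then f z else 0)" for z
  have [measurable]: "h \<in> borel_measurable lebesgue" unfolding h_def[abs_def] by (rule borel_measurable_if_I[OF f S])
  have "(\<lambda>z. h z \<bullet> j) \<in> borel_measurable lebesgue" for j by measurable
  then have "\<forall>j. \<exists>F. F \<in> borel_measurable lborel \<and> (AE z in lborel. h z \<bullet> j = F z)"
    using completion_ex_borel_measurable_real by blast
  then obtain F where F: "\<And>j. F j \<in> borel_measurable lborel" "\<And>j. AE z in lborel. h z \<bullet> j = F j z" by metis
  have [measurable]: "F j \<in> borel_measurable borel" for j using F(1)[of j] by simp
  show thesis
  proof
    show "(\<lambda>z. \<Sum>j\<in>Basis. F j z *\<^sub>R j) \<in> borel_measurable borel" by measurable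
    have "AE z in lborel. \<forall>j\<in>Basis. h z \<bullet> j = F j z" using F(2) by (intro AE_finite_allI) auto
    then show "AE z in lborel. z \<in> S \<longrightarrow> (\<Sum>j\<in>Basis. F j z *\<^sub>R j) = f z"
    proof eventually_elim
      case (elim z)
      then have "(\<Sum>j\<in>Basis. F j z *\<^sub>R j) = (\<Sum>j\<in>Basis. (h z \<bullet> j) *\<^sub>R j)" by (intro sum.cong) auto
      then show ?case by (simp add: euclidean_representation h_def)
    qed
  qed
qed

text \<open>Agreement is recorded twice: on slices, for the analysis at a fixed time, and on
  space-time, for the return to the given functions at the end.\<close>

lemma jointly_measurable_representative:
  fixes f :: "real \<Rightarrow> 'a::euclidean_space \<Rightarrow> 'b::euclidean_space"
  assumes "jointly_measurable T f"
  obtains F where "(\<lambda>(t, x). F t x) \<in> borel_measurable (borel \<Otimes>\<^sub>M borel)"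
    "AE z in lborel \<Otimes>\<^sub>M lborel. z \<in> {0<..<T} \<times> UNIV \<longrightarrow> (case z of (t, x) \<Rightarrow> F t x = f t x)"
    "AE t in lborel. t \<in> {0<..<T} \<longrightarrow> (AE x in lborel. F t x = f t x)"
proof -
  have "{0<..<T} \<times> (UNIV :: 'a set) \<in> sets borel" by (intro borel_open open_Times) auto
  then have "{0<..<T} \<times> (UNIV :: 'a set) \<in> sets lebesgue" by simp
  then obtain F where F: "F \<in> borel_measurable borel" "AE z in lborel. z \<in> {0<..<T} \<times> UNIV \<longrightarrow> F z = (case z of (t, x) \<Rightarrow> f t x)"
    using Borel_representative assms unfolding jointly_measurable_def by blast
  show thesis
  proof
    show "(\<lambda>(t, x). F (t, x)) \<in> borel_measurable (borel \<Otimes>\<^sub>M borel)" using F(1) by (simp add: borel_prod)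
    have J: "AE z in lborel \<Otimes>\<^sub>M lborel. z \<in> {0<..<T} \<times> UNIV \<longrightarrow> F z = (case z of (t, x) \<Rightarrow> f t x)"
      unfolding lborel_prod by (rule F(2))
    then show "AE z in lborel \<Otimes>\<^sub>M lborel. z \<in> {0<..<T} \<times> UNIV \<longrightarrow> (case z of (t, x) \<Rightarrow> F (t, x) = f t x)"
      by eventually_elim auto
    from lborel_pair.AE_pair[OF J] show "AE t in lborel. t \<in> {0<..<T} \<longrightarrow> (AE x in lborel. F (t, x) = f t x)"
      by simp
  qed
qed

lemma lebesgue_integral_representative:
  fixes f F :: "'a::euclidean_space \<Rightarrow> 'b::euclidean_space"
  assumes F: "F \<in> borel_measurable borel" and ae: "AE x in lborel. F x = f x"
  shows "(LINT x|lebesgue. f x) = (LINT x|lborel. F x)" "integrable lebesgue f \<longleftrightarrow> integrable lborel F"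
proof -
  have Fb: "F \<in> borel_measurable lborel" using F by simp
  have Fl: "F \<in> borel_measurable lebesgue" by (rule measurable_completion[OF Fb])
  have ae': "AE x in lebesgue. F x = f x" using ae by (rule AE_completion)
  have fl: "f \<in> borel_measurable lebesgue" by (rule borel_measurable_AE[OF Fl ae'])
  show "(LINT x|lebesgue. f x) = (LINT x|lborel. F x)"
    using integral_cong_AE[OF Fl fl ae'] integral_completion[OF Fb] by simp
  show "integrable lebesgue f \<longleftrightarrow> integrable lborel F"
    using integrable_cong_AE[OF Fl fl ae'] integrable_completion[OF Fb] by simp
qed

lemma AE_lebesgue_on_iff: "S \<in> sets lborel \<Longrightarrow> (AE t in lebesgue_on S. P t) \<longleftrightarrow> (AE t in lborel. t \<in> S \<longrightarrow> P t)"
  by (subst AE_restrict_space_iff) (auto simp: AE_completion_iff)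

text \<open>The set of all good times need not be Borel. A Borel subset of full measure allows
  multiplication by its indicator without leaving the Borel functions.\<close>

lemma AE_Borel_subset:
  assumes S: "S \<in> sets lborel" and ae: "AE t in lborel. t \<in> S \<longrightarrow> P t"
  obtains G where "G \<in> sets lborel" "G \<subseteq> S" "\<And>t. t \<in> G \<Longrightarrow> P t" "AE t in lborel. t \<in> S \<longrightarrow> t \<in> G"
proof -
  obtain N where N: "{t \<in> space lborel. \<not> (t \<in> S \<longrightarrow> P t)} \<subseteq> N" "N \<in> null_sets lborel"
    using ae unfolding eventually_ae_filter by blast
  show thesis
  proof (rule that[of "S - N"])
    show "S - N \<in> sets lborel" using S N(2) by auto
    show "AE t in lborel. t \<in> S \<longrightarrow> t \<in> S - N" using AE_not_in[OF N(2)] by eventually_elim simp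
  qed (use N(1) in auto)
qed

lemma loc_int_representative:
  fixes f F :: "'a::euclidean_space \<Rightarrow> 'b::euclidean_space"
  assumes f: "locally_integrable f" and F: "F \<in> borel_measurable borel" and ae: "AE x in lborel. F x = f x"
  shows "loc_int F"
  unfolding loc_int_def
proof (intro conjI allI F)
  fix r
  have "integrable lebesgue (\<lambda>x. indicator (cball 0 r) x *\<^sub>R f x)" using f by (auto simp: locally_integrable_def set_integrable_def)
  then show "integrable lborel (\<lambda>x. indicator (cball 0 r) x *\<^sub>R F x)"
    by (subst (asm) lebesgue_integral_representative(2)) (use F ae in auto)
qed

lemma loc_int_inner:
  assumes "loc_int f" shows "loc_int (\<lambda>x. f x \<bullet> j)"
proof -
  have "integrable lborel (\<lambda>x. (indicator (cball 0 r) x *\<^sub>R f x) \<bullet> j)" for r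
    using assms by (intro integrable_inner_left) (simp add: loc_int_def)
  moreover have "(\<lambda>x. f x \<bullet> j) \<in> borel_measurable borel" using assms by (auto simp: loc_int_def)
  ultimately show ?thesis by (simp add: loc_int_def)
qed

text \<open>Testing with the reflected kernels: the gradient of
  \<open>kern \<epsilon> (y - x)\<close> in \<open>x\<close> is minus \<open>gkern\<close>, which
  cancels the sign in the definition of a weak derivative.\<close>

lemma kweak_of_weak_partial:
  fixes f g F G :: "'a::euclidean_space \<Rightarrow> 'b::euclidean_space"
  assumes w: "has_weak_partial i f g"
    and F: "F \<in> borel_measurable borel" "AE x in lborel. F x = f x" and G: "G \<in> borel_measurable borel" "AE x in lborel. G x = g x"
  shows "kweak i (\<lambda>x. F x \<bullet> j) (\<lambda>x. G x \<bullet> j)"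
proof -
  have lF: "loc_int F" and lG: "loc_int G" using w F G by (auto simp: has_weak_partial_def intro: loc_int_representative)
  have "gmoll \<epsilon> (\<lambda>x. F x \<bullet> j) y \<bullet> i = moll \<epsilon> (\<lambda>x. G x \<bullet> j) y" if e: "\<epsilon> > 0" for \<epsilon> y
  proof -
    note kc = reflected_support[OF continuous_kern kern_support[OF e], where y=y]
      and gc = reflected_support[OF continuous_gkern gkern_support[OF e], where y=y]
    have gr: "grad (\<lambda>x. kern \<epsilon> (y - x)) x = - gkern \<epsilon> (y - x)" for x
      using kern_reflected_gderiv[OF e, of 1 y x] by (intro grad_eq) simp
    have [measurable]: "F \<in> borel_measurable borel" "G \<in> borel_measurable borel" by fact+
    have iF: "integrable lborel (\<lambda>x. (gkern \<epsilon> (y - x) \<bullet> i) *\<^sub>R F x)"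
      by (rule loc_int_mult_continuous[OF lF, of _ "norm y + \<epsilon> * real DIM('a)"]) (auto intro!: continuous_intros gc(1) simp: gc(2))
    have iG: "integrable lborel (\<lambda>x. kern \<epsilon> (y - x) *\<^sub>R G x)" by (rule loc_int_mult_continuous[OF lG kc])
    have iF': "integrable lborel (\<lambda>x. (F x \<bullet> j) *\<^sub>R gkern \<epsilon> (y - x))"
      by (rule integrable_compact_mult_vector[OF loc_int_inner[OF lF] gc])
    have "(LINT x|lebesgue. (grad (\<lambda>x. kern \<epsilon> (y - x)) x \<bullet> i) *\<^sub>R f x) = - (LINT x|lebesgue. kern \<epsilon> (y - x) *\<^sub>R g x)"
      using w test_function_kern[OF e] unfolding has_weak_partial_def by blast
    also have "(LINT x|lebesgue. (grad (\<lambda>x. kern \<epsilon> (y - x)) x \<bullet> i) *\<^sub>R f x) = (LINT x|lborel. - ((gkern \<epsilon> (y - x) \<bullet> i) *\<^sub>R F x))"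
      unfolding gr by (rule lebesgue_integral_representative) (use F(2) in auto)
    also have "(LINT x|lebesgue. kern \<epsilon> (y - x) *\<^sub>R g x) = (LINT x|lborel. kern \<epsilon> (y - x) *\<^sub>R G x)"
      by (rule lebesgue_integral_representative) (use G(2) in auto)
    finally have eq: "(LINT x|lborel. (gkern \<epsilon> (y - x) \<bullet> i) *\<^sub>R F x) = (LINT x|lborel. kern \<epsilon> (y - x) *\<^sub>R G x)" by simp
    have "gmoll \<epsilon> (\<lambda>x. F x \<bullet> j) y \<bullet> i = (LINT x|lborel. ((F x \<bullet> j) *\<^sub>R gkern \<epsilon> (y - x)) \<bullet> i)"
      unfolding gmoll_def by (rule integral_inner_left[symmetric]) (rule iF')
    also have "\<dots> = (LINT x|lborel. ((gkern \<epsilon> (y - x) \<bullet> i) *\<^sub>R F x) \<bullet> j)" by (simp add: mult.commute)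
    also have "\<dots> = (LINT x|lborel. (gkern \<epsilon> (y - x) \<bullet> i) *\<^sub>R F x) \<bullet> j" by (rule integral_inner_left) (rule iF)
    also have "\<dots> = (LINT x|lborel. (kern \<epsilon> (y - x) *\<^sub>R G x) \<bullet> j)" unfolding eq by (rule integral_inner_left[symmetric]) (rule iG)
    finally show ?thesis by (simp add: moll_def)
  qed
  then show ?thesis unfolding kweak_def using loc_int_inner[OF lF] loc_int_inner[OF lG] by blast
qed

text \<open>The coordinates are changed one at a time, with the mean value inequality for each; the
  induction runs over subsets of \<open>Basis\<close>. Smoothness is defined by iterated partial
  derivatives, whereas a gradient demands total differentiability.\<close>

lemma continuous_partials_gderiv:
  fixes f :: "'a::euclidean_space \<Rightarrow> real"
  assumes D: "\<And>i z. i \<in> Basis \<Longrightarrow> ((\<lambda>s. f (z + s *\<^sub>R i)) has_real_derivative D i z) (at 0)"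
    and c: "\<And>i. i \<in> Basis \<Longrightarrow> continuous_on UNIV (D i)"
  shows "GDERIV f x :> (\<Sum>i\<in>Basis. D i x *\<^sub>R i)"
proof -
  have norm_sum: "(\<Sum>i\<in>A. \<bar>h \<bullet> i\<bar>) \<le> real DIM('a) * norm h" if "A \<subseteq> Basis" for A and h :: 'a
  proof -
    have "(\<Sum>i\<in>A. \<bar>h \<bullet> i\<bar>) \<le> (\<Sum>i\<in>(Basis :: 'a set). \<bar>h \<bullet> i\<bar>)" using that by (intro sum_mono2) auto
    also have "\<dots> \<le> (\<Sum>i\<in>(Basis :: 'a set). norm h)" by (intro sum_mono Basis_le_norm)
    finally show ?thesis by simp
  qed
  have main: "\<exists>\<delta>>0. \<forall>h. norm h < \<delta> \<longrightarrow> \<bar>f (x + (\<Sum>i\<in>A. (h \<bullet> i) *\<^sub>R i)) - f x - (\<Sum>i\<in>A. (h \<bullet> i) * D i x)\<bar> \<le> e * (\<Sum>i\<in>A. \<bar>h \<bullet> i\<bar>)"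
    if "A \<subseteq> Basis" and e: "e > 0" for A e
    using finite_subset[OF that(1) finite_Basis] that(1)
  proof (induction A rule: finite_induct)
    case empty
    show ?case by (intro exI[of _ 1]) simp
  next
    case (insert i A)
    then have i: "i \<in> Basis" and A: "A \<subseteq> Basis" by auto
    obtain \<delta>1 where \<delta>1: "\<delta>1 > 0" "\<And>h. norm h < \<delta>1 \<Longrightarrow> \<bar>f (x + (\<Sum>i\<in>A. (h \<bullet> i) *\<^sub>R i)) - f x - (\<Sum>i\<in>A. (h \<bullet> i) * D i x)\<bar> \<le> e * (\<Sum>i\<in>A. \<bar>h \<bullet> i\<bar>)"
      using insert.IH[OF A] by blast
    have "isCont (D i) x" using c[OF i] by (simp add: continuous_on_eq_continuous_at)
    then obtain \<delta>2 where \<delta>2: "\<delta>2 > 0" "\<And>z. dist z x < \<delta>2 \<Longrightarrow> \<bar>D i z - D i x\<bar> < e"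
      using e unfolding continuous_at_eps_delta dist_real_def by blast
    show ?case
    proof (intro exI[of _ "min \<delta>1 (\<delta>2 / real DIM('a))"] conjI allI impI)
      show "0 < min \<delta>1 (\<delta>2 / real DIM('a))" using \<delta>1 \<delta>2 by simp
      fix h :: 'a assume h: "norm h < min \<delta>1 (\<delta>2 / real DIM('a))"
      define y where "y = x + (\<Sum>i\<in>A. (h \<bullet> i) *\<^sub>R i)"
      define \<psi> where "\<psi> s = f (y + s *\<^sub>R i) - s * D i x" for s
      have near: "\<bar>D i (y + s *\<^sub>R i) - D i x\<bar> \<le> e" if s: "\<bar>s\<bar> \<le> \<bar>h \<bullet> i\<bar>" for s
      proof -
        have "norm (y + s *\<^sub>R i - x) \<le> norm (\<Sum>i\<in>A. (h \<bullet> i) *\<^sub>R i) + norm (s *\<^sub>R i)"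
          unfolding y_def using norm_triangle_ineq[of "\<Sum>i\<in>A. (h \<bullet> i) *\<^sub>R i" "s *\<^sub>R i"] by (simp add: algebra_simps)
        also have "norm (\<Sum>i\<in>A. (h \<bullet> i) *\<^sub>R i) \<le> (\<Sum>i\<in>A. \<bar>h \<bullet> i\<bar>)"
          using A by (intro sum_norm_le) auto
        also have "(\<Sum>i\<in>A. \<bar>h \<bullet> i\<bar>) + norm (s *\<^sub>R i) \<le> (\<Sum>i\<in>insert i A. \<bar>h \<bullet> i\<bar>)" using insert s i by simp
        also have "\<dots> \<le> real DIM('a) * norm h" by (rule norm_sum[OF insert.prems])
        also have "\<dots> < \<delta>2" using h by (simp add: field_simps)
        finally show ?thesis using \<delta>2(2) by (intro less_imp_le) (simp add: dist_norm)
      qed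
      have "((\<lambda>s. f (y + s *\<^sub>R i)) has_real_derivative D i (y + s *\<^sub>R i)) (at s)" for s
        using D[OF i, of "y + s *\<^sub>R i"] DERIV_shift[of "\<lambda>s. f (y + s *\<^sub>R i)" "D i (y + s *\<^sub>R i)" 0 s]
        by (simp add: algebra_simps)
      then have "(\<psi> has_real_derivative D i (y + s *\<^sub>R i) - D i x) (at s)" for s
        unfolding \<psi>_def by (auto intro!: derivative_eq_intros)
      then have "norm (\<psi> (h \<bullet> i) - \<psi> 0) \<le> e * norm (h \<bullet> i - 0)"
        using near by (intro field_differentiable_bound[of "{- \<bar>h \<bullet> i\<bar>..\<bar>h \<bullet> i\<bar>}" \<psi> "\<lambda>s. D i (y + s *\<^sub>R i) - D i x"])
          (auto intro: has_field_derivative_at_within)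
      then have "\<bar>f (y + (h \<bullet> i) *\<^sub>R i) - f y - (h \<bullet> i) * D i x\<bar> \<le> e * \<bar>h \<bullet> i\<bar>" unfolding \<psi>_def by simp
      moreover have "\<bar>f y - f x - (\<Sum>i\<in>A. (h \<bullet> i) * D i x)\<bar> \<le> e * (\<Sum>i\<in>A. \<bar>h \<bullet> i\<bar>)" unfolding y_def using \<delta>1(2) h by simp
      moreover have "f (x + (\<Sum>i\<in>insert i A. (h \<bullet> i) *\<^sub>R i)) = f (y + (h \<bullet> i) *\<^sub>R i)" unfolding y_def using insert by (simp add: ac_simps)
      moreover have "(\<Sum>i\<in>insert i A. (h \<bullet> i) * D i x) = (h \<bullet> i) * D i x + (\<Sum>i\<in>A. (h \<bullet> i) * D i x)"
        "e * (\<Sum>i\<in>insert i A. \<bar>h \<bullet> i\<bar>) = e * \<bar>h \<bullet> i\<bar> + e * (\<Sum>i\<in>A. \<bar>h \<bullet> i\<bar>)"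
        using insert by (simp_all add: distrib_left)
      ultimately show "\<bar>f (x + (\<Sum>i\<in>insert i A. (h \<bullet> i) *\<^sub>R i)) - f x - (\<Sum>i\<in>insert i A. (h \<bullet> i) * D i x)\<bar> \<le> e * (\<Sum>i\<in>insert i A. \<bar>h \<bullet> i\<bar>)"
        by linarith
    qed
  qed
  show ?thesis
    unfolding gderiv_def has_derivative_at_alt
  proof (intro conjI allI impI)
    show "bounded_linear (\<lambda>h. h \<bullet> (\<Sum>i\<in>Basis. D i x *\<^sub>R i))" by (rule bounded_linear_inner_left)
    fix e :: real assume e: "e > 0"
    obtain \<delta> where \<delta>: "\<delta> > 0" "\<And>h. norm h < \<delta> \<Longrightarrow> \<bar>f (x + (\<Sum>i\<in>Basis. (h \<bullet> i) *\<^sub>R i)) - f x - (\<Sum>i\<in>Basis. (h \<bullet> i) * D i x)\<bar> \<le> e / real DIM('a) * (\<Sum>i\<in>Basis. \<bar>h \<bullet> i\<bar>)"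
      using main[of Basis "e / real DIM('a)"] e by auto
    show "\<exists>d>0. \<forall>y. norm (y - x) < d \<longrightarrow> norm (f y - f x - (y - x) \<bullet> (\<Sum>i\<in>Basis. D i x *\<^sub>R i)) \<le> e * norm (y - x)"
    proof (intro exI[of _ \<delta>] conjI allI impI \<delta>(1))
      fix y assume y: "norm (y - x) < \<delta>"
      have "norm (f y - f x - (y - x) \<bullet> (\<Sum>i\<in>Basis. D i x *\<^sub>R i)) \<le> e / real DIM('a) * (\<Sum>i\<in>Basis. \<bar>(y - x) \<bullet> i\<bar>)"
        using \<delta>(2)[OF y] by (simp add: euclidean_representation inner_sum_right mult.commute)
      also have "\<dots> \<le> e / real DIM('a) * (real DIM('a) * norm (y - x))" by (intro mult_left_mono norm_sum) (use e in auto)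
      finally show "norm (f y - f x - (y - x) \<bullet> (\<Sum>i\<in>Basis. D i x *\<^sub>R i)) \<le> e * norm (y - x)" by simp
    qed
  qed
qed

text \<open>It serves to verify, against arbitrary test functions, that the divergence assembled
  from the weak partials is a weak divergence.\<close>

lemma test_function_C1c:
  fixes \<phi> :: "'a::euclidean_space \<Rightarrow> real"
  assumes "test_function \<phi>" shows "C1c \<phi> (grad \<phi>)"
proof -
  obtain D where "(\<forall>z\<in>UNIV. D [] z = \<phi> z) \<and> (\<forall>l\<in>lists Basis. continuous_on UNIV (D l) \<and>
    (\<forall>i\<in>Basis. \<forall>z\<in>UNIV. ((\<lambda>s. D l (z + s *\<^sub>R i)) has_real_derivative D (i # l) z) (at 0 within {s. z + s *\<^sub>R i \<in> (UNIV :: 'a set)})))"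
    using assms unfolding test_function_def smooth_on_def by blast
  then have D: "\<And>z. D [] z = \<phi> z" "\<And>l. l \<in> lists Basis \<Longrightarrow> continuous_on UNIV (D l)"
    "\<And>l i z. l \<in> lists Basis \<Longrightarrow> i \<in> Basis \<Longrightarrow> ((\<lambda>s. D l (z + s *\<^sub>R i)) has_real_derivative D (i # l) z) (at 0 within {s. z + s *\<^sub>R i \<in> (UNIV :: 'a set)})"
    by blast+
  have D1: "((\<lambda>s. \<phi> (z + s *\<^sub>R i)) has_real_derivative D [i] z) (at 0)" if "i \<in> Basis" for i z
    using D(3)[of "[]" i z] that by (simp add: D(1))
  have D2: "continuous_on UNIV (D [i])" if "i \<in> Basis" for i using D(2) that by simp
  have gd: "GDERIV \<phi> x :> (\<Sum>i\<in>Basis. D [i] x *\<^sub>R i)" for x by (rule continuous_partials_gderiv[OF D1 D2])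
  then have gr: "grad \<phi> = (\<lambda>x. \<Sum>i\<in>Basis. D [i] x *\<^sub>R i)" using grad_eq by blast
  obtain r where r: "\<And>x. x \<in> closure {x. \<phi> x \<noteq> 0} \<Longrightarrow> norm x \<le> r"
    using assms[unfolded test_function_def, THEN conjunct2, THEN compact_imp_bounded] unfolding bounded_iff by metis
  have z: "\<phi> x = 0" if "norm x > r" for x using r[of x] that subsetD[OF closure_subset, of x "{x. \<phi> x \<noteq> 0}"] by fastforce
  have "grad \<phi> x = 0" if x: "norm x > r" for x
  proof (rule grad_eq)
    have "open {x::'a. r < norm x}" by (intro open_Collect_less continuous_intros)
    then show "GDERIV \<phi> x :> 0"
      using has_derivative_transform_within_open[of "\<lambda>_. 0" "\<lambda>_. 0" x UNIV "{x. r < norm x}" \<phi>] x z by (simp add: gderiv_def)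
  qed
  then show ?thesis unfolding C1c_def C1_def using gd z by (auto simp: gr intro!: continuous_intros D2)
qed

text \<open>The complement of the support is a union of possibly uncountably many open sets; by
  Lindelof's theorem countably many suffice, and then the exceptional sets add up to a null
  set.\<close>

lemma AE_0_outside_ess_support:
  fixes f :: "'a::euclidean_space \<Rightarrow> real"
  assumes "ess_support f \<subseteq> B"
  shows "AE x in lebesgue. x \<notin> B \<longrightarrow> f x = 0"
proof -
  let ?F = "{U. open U \<and> (AE x in lebesgue. x \<in> U \<longrightarrow> f x = 0)}"
  obtain F' where F': "F' \<subseteq> ?F" "countable F'" "\<Union>F' = \<Union>?F" using Lindelof[of ?F] by auto
  have "AE x in lebesgue. \<forall>U\<in>F'. x \<in> U \<longrightarrow> f x = 0" using F' by (subst AE_ball_countable) auto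
  then show ?thesis
  proof eventually_elim
    case (elim x)
    have "- B \<subseteq> \<Union>?F" using assms unfolding ess_support_def by blast
    then show ?case using elim F'(3) by blast
  qed
qed

section \<open>Representatives in Lebesgue and Sobolev spaces\<close>

lemma exists_nat_radius: "\<exists>n. r < real (Suc n)"
proof -
  obtain n where "r < real n" using reals_Archimedean2 by blast
  then show ?thesis by (intro exI[of _ n]) simp
qed

text \<open>The Borel estimates use closed balls, the function spaces open ones; the condition
  \<open>r < s\<close> places the former inside the latter.\<close>

lemma Lp_ball_representative:
  fixes f F :: "'a::euclidean_space \<Rightarrow> 'b::euclidean_space"
  assumes f: "f \<in> Lp q (ball 0 s)" and rs: "r < s" and F [measurable]: "F \<in> borel_measurable borel" and ae: "AE x in lborel. F x = f x"
    and q: "q > 0"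
  shows "integrable lborel (\<lambda>x. indicator (cball 0 r) x * norm (F x) powr q)"
    and "Lnorm q (\<lambda>x. indicator (cball 0 r) x * norm (F x)) \<le> Lp_norm q (ball 0 s) f"
proof -
  have "integrable lebesgue (\<lambda>x. indicator (ball 0 s) x *\<^sub>R (norm (f x) powr q))"
    using f by (simp add: Lp_def set_integrable_def)
  moreover have rep: "AE x in lborel. indicator (ball 0 s) x *\<^sub>R (norm (F x) powr q) = indicator (ball 0 s) x *\<^sub>R (norm (f x) powr q)"
    using ae by eventually_elim simp
  have [measurable]: "ball (0::'a) s \<in> sets borel" by simp
  have m: "(\<lambda>x. indicator (ball 0 s) x *\<^sub>R (norm (F x) powr q)) \<in> borel_measurable borel" by measurable
  ultimately have i: "integrable lborel (\<lambda>x. indicator (ball 0 s) x *\<^sub>R (norm (F x) powr q))"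
    using lebesgue_integral_representative(2)[OF m rep] by simp
  show j: "integrable lborel (\<lambda>x. indicator (cball 0 r) x * norm (F x) powr q)"
    by (rule Bochner_Integration.integrable_bound[OF i]) (use rs in \<open>auto simp: indicator_def\<close>)
  have "Lnorm q (\<lambda>x. indicator (cball 0 r) x * norm (F x)) = (LINT x|lborel. indicator (cball 0 r) x * norm (F x) powr q) powr (1 / q)"
    unfolding Lnorm_def using q by (intro arg_cong2[where f="(powr)"] Bochner_Integration.integral_cong refl) (auto simp: indicator_def)
  also have "\<dots> \<le> (LINT x|lborel. indicator (ball 0 s) x *\<^sub>R (norm (F x) powr q)) powr (1 / q)"
    using q rs by (intro powr_mono2 Bochner_Integration.integral_mono[OF j i] Bochner_Integration.integral_nonneg) (auto simp: indicator_def)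
  also have "\<dots> = Lp_norm q (ball 0 s) f"
    unfolding Lp_norm_def set_lebesgue_integral_def lebesgue_integral_representative(1)[OF m rep] ..
  finally show "Lnorm q (\<lambda>x. indicator (cball 0 r) x * norm (F x)) \<le> Lp_norm q (ball 0 s) f" .
qed

lemma Lp_UNIV_representative:
  fixes f F :: "'a::euclidean_space \<Rightarrow> real"
  assumes f: "f \<in> Lp p UNIV" "Lp_norm p UNIV f \<le> C" and F [measurable]: "F \<in> borel_measurable borel" and ae: "AE x in lborel. F x = f x"
    and p: "p > 0"
  shows "integrable lborel (\<lambda>x. \<bar>F x\<bar> powr p)" "(LINT x|lborel. \<bar>F x\<bar> powr p) \<le> C powr p"
proof -
  have m: "(\<lambda>x. \<bar>F x\<bar> powr p) \<in> borel_measurable borel" by measurable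
  have rep: "AE x in lborel. \<bar>F x\<bar> powr p = \<bar>f x\<bar> powr p" using ae by eventually_elim simp
  show "integrable lborel (\<lambda>x. \<bar>F x\<bar> powr p)"
    using f(1) lebesgue_integral_representative(2)[OF m rep] by (simp add: Lp_def set_integrable_def)
  let ?J = "LINT x|lborel. \<bar>F x\<bar> powr p"
  have J: "?J \<ge> 0" by simp
  have "?J powr (1 / p) \<le> C"
    using f(2) by (simp add: Lp_norm_def set_lebesgue_integral_def lebesgue_integral_representative(1)[OF m rep])
  then have "(?J powr (1 / p)) powr p \<le> C powr p" using p by (intro powr_mono2) auto
  then show "?J \<le> C powr p" using J p by (simp add: powr_powr)
qed

text \<open>Integer radii, so that one null set of times serves all balls.\<close>

lemma L1_Lp_locD:
  assumes "f \<in> L1_Lp_loc T q"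
  shows "jointly_measurable T f" "AE t in lborel. t \<in> {0<..<T} \<longrightarrow> (\<forall>n. f t \<in> Lp q (ball 0 (real (Suc n))))"
    "(\<lambda>t. Lp_norm q (ball 0 (real (Suc n))) (f t)) absolutely_integrable_on {0<..<T}"
proof -
  have f: "f \<in> L1_time T (Lp q (ball 0 (real (Suc n)))) (Lp_norm q (ball 0 (real (Suc n))))" for n
    using assms by (simp add: L1_Lp_loc_def)
  have "AE t in lborel. \<forall>n. t \<in> {0<..<T} \<longrightarrow> f t \<in> Lp q (ball 0 (real (Suc n)))"
    unfolding AE_all_countable using f by (auto simp: L1_time_def AE_lebesgue_on_iff)
  then show "AE t in lborel. t \<in> {0<..<T} \<longrightarrow> (\<forall>n. f t \<in> Lp q (ball 0 (real (Suc n))))" by eventually_elim blast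
  show "jointly_measurable T f" "(\<lambda>t. Lp_norm q (ball 0 (real (Suc n))) (f t)) absolutely_integrable_on {0<..<T}"
    using f[of n] by (auto simp: L1_time_def)
qed

text \<open>At times in \<open>G\<close> the given norm over a larger ball of integer radius is a
  majorant; the indicator makes all other times contribute 0.\<close>

lemma time_Lnorm_integrable:
  fixes f F :: "real \<Rightarrow> 'a::euclidean_space \<Rightarrow> 'b::euclidean_space"
  assumes f: "f \<in> L1_Lp_loc T q" and q: "q > 0" and F [measurable]: "(\<lambda>(t, x). F t x) \<in> borel_measurable (borel \<Otimes>\<^sub>M borel)"
    and G: "G \<in> sets lborel" "G \<subseteq> {0<..<T}"
    and rep: "\<And>t. t \<in> G \<Longrightarrow> AE x in lborel. F t x = f t x" and Lp: "\<And>t n. t \<in> G \<Longrightarrow> f t \<in> Lp q (ball 0 (real (Suc n)))"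
  shows "integrable lborel (\<lambda>t. Lnorm q (\<lambda>x. indicator (cball 0 r) x * norm (indicat_real G t *\<^sub>R F t x)))"
proof -
  obtain n where n: "r < real (Suc n)" using exists_nat_radius by blast
  let ?L = "\<lambda>t. Lnorm q (\<lambda>x. indicator (cball 0 r) x * norm (indicat_real G t *\<^sub>R F t x))"
  have [measurable]: "G \<in> sets borel" using G by simp
  have m: "?L \<in> borel_measurable lborel" by measurable
  have "integrable lebesgue ?L"
  proof (rule Bochner_Integration.integrable_bound)
    show "integrable lebesgue (\<lambda>t. indicator {0<..<T} t *\<^sub>R Lp_norm q (ball 0 (real (Suc n))) (f t))"
      using L1_Lp_locD(3)[OF f] by (simp add: set_integrable_def)
    show "?L \<in> borel_measurable lebesgue" by (rule measurable_completion[OF m])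
    show "AE t in lebesgue. norm (?L t) \<le> norm (indicator {0<..<T} t *\<^sub>R Lp_norm q (ball 0 (real (Suc n))) (f t))"
    proof (rule AE_I2)
      fix t
      show "norm (?L t) \<le> norm (indicator {0<..<T} t *\<^sub>R Lp_norm q (ball 0 (real (Suc n))) (f t))"
      proof (cases "t \<in> G")
        case True
        have "(\<lambda>x. F t x) \<in> borel_measurable borel" by measurable
        from Lp_ball_representative(2)[OF Lp[OF True] n this rep[OF True] q] show ?thesis
          using True subsetD[OF G(2) True] by (auto simp: abs_of_nonneg[OF Lnorm_nonneg] intro: order_trans[OF _ abs_ge_self])
      qed (simp add: Lnorm_def)
    qed
  qed
  then show ?thesis using integrable_completion[OF m] by simp
qed

text \<open>Everything required of the field at a single time: \<open>B\<close> and
  \<open>G i\<close> stand for Borel versions of \<open>b\<close> and of its weak partials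
  \<open>g i\<close>. One predicate keeps the exceptional times in a single null set.\<close>

definition represents_W1 :: "real \<Rightarrow> ('a::euclidean_space \<Rightarrow> 'a) \<Rightarrow> ('a \<Rightarrow> 'a) \<Rightarrow> ('a \<Rightarrow> 'a \<Rightarrow> 'a) \<Rightarrow> ('a \<Rightarrow> 'a \<Rightarrow> 'a) \<Rightarrow> bool" where
  "represents_W1 q B b G g \<longleftrightarrow> (AE x in lborel. B x = b x) \<and> (\<forall>n::nat. b \<in> Lp q (ball 0 (real (Suc n)))) \<and>
     (\<forall>i\<in>Basis. (AE x in lborel. G i x = g i x) \<and> (\<forall>n::nat. g i \<in> Lp q (ball 0 (real (Suc n)))) \<and> has_weak_partial i b (g i))"

lemma spatial_of_representation:
  fixes B b :: "'a::euclidean_space \<Rightarrow> 'a"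
  assumes pq: "p > 1" "1 / p + 1 / q = 1" and u: "u \<in> borel_measurable borel" "integrable lborel (\<lambda>x. \<bar>u x\<bar> powr p)"
    and B: "B \<in> borel_measurable borel" and G: "\<And>i. i \<in> Basis \<Longrightarrow> G i \<in> borel_measurable borel" and r: "represents_W1 q B b G g"
  shows "spatial u B G p q"
proof -
  have q: "q > 0" using conjugate_exponent_gt_1[OF pq] by simp
  have i: "integrable lborel (\<lambda>x. indicator (cball 0 r) x * norm (F x) powr q)"
    if "F \<in> borel_measurable borel" "AE x in lborel. F x = f x" "\<forall>n::nat. f \<in> Lp q (ball 0 (real (Suc n)))" for f F :: "'a \<Rightarrow> 'a" and r
  proof -
    obtain n where n: "r < real (Suc n)" using exists_nat_radius by blast
    show ?thesis by (rule Lp_ball_representative(1)[OF that(3)[rule_format] n that(1,2) q])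
  qed
  show ?thesis
  proof
    show "integrable lborel (\<lambda>x. indicator (cball 0 r) x * norm (B x) powr q)" for r
      using r B by (intro i) (auto simp: represents_W1_def)
    show "integrable lborel (\<lambda>x. indicator (cball 0 r) x * norm (G j x) powr q)" if "j \<in> Basis" for j r
      using r G that by (intro i[of "G j" "g j"]) (auto simp: represents_W1_def)
    show "kweak j (\<lambda>x. B x \<bullet> k) (\<lambda>x. G j x \<bullet> k)" if "j \<in> Basis" for j k
      using r B G that by (intro kweak_of_weak_partial[of j b "g j"]) (auto simp: represents_W1_def)
  qed (use pq u B G in auto)
qed

lemma locally_integrable_divergence:
  assumes "\<And>i. i \<in> Basis \<Longrightarrow> locally_integrable (g i :: 'a::euclidean_space \<Rightarrow> 'a)"
  shows "locally_integrable (\<lambda>x. \<Sum>i\<in>Basis. g i x \<bullet> i)"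
  using assms unfolding locally_integrable_def
  by (intro allI impI absolutely_integrable_sum absolutely_integrable_component) auto

text \<open>The sum of the diagonal weak partials, written with the given functions, so that it can
  be a witness for the choice behind \<open>space_div\<close>.\<close>

lemma weak_div_of_representation:
  fixes B b :: "'a::euclidean_space \<Rightarrow> 'a"
  assumes s: "spatial u B G p q" and r: "represents_W1 q B b G g"
  shows "has_weak_div b (\<lambda>x. \<Sum>i\<in>Basis. g i x \<bullet> i)"
  unfolding has_weak_div_def
proof (intro conjI allI impI)
  interpret spatial u B G p q by (rule s)
  obtain i :: 'a where "i \<in> Basis" using nonempty_Basis by blast
  then show "locally_integrable b" using r by (auto simp: represents_W1_def has_weak_partial_def)
  show "locally_integrable (\<lambda>x. \<Sum>i\<in>Basis. g i x \<bullet> i)"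
    using r by (intro locally_integrable_divergence) (auto simp: represents_W1_def has_weak_partial_def)
  fix \<phi> :: "'a \<Rightarrow> real" assume "test_function \<phi>"
  then have C: "C1c \<phi> (grad \<phi>)" by (rule test_function_C1c)
  then have "continuous_on UNIV \<phi>" "continuous_on UNIV (grad \<phi>)" using C1_continuous unfolding C1c_def C1_def by blast+
  then have [measurable]: "\<phi> \<in> borel_measurable borel" "grad \<phi> \<in> borel_measurable borel" by (auto intro: borel_measurable_continuous_onI)
  have "AE x in lborel. \<forall>i\<in>Basis. G i x = g i x" using r by (intro AE_finite_allI) (auto simp: represents_W1_def)
  then have d: "AE x in lborel. d x * \<phi> x = (\<Sum>i\<in>Basis. g i x \<bullet> i) * \<phi> x"
    by eventually_elim (auto simp: d_def)
  have "AE x in lborel. B x = b x" using r by (simp add: represents_W1_def)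
  then have b: "AE x in lborel. B x \<bullet> grad \<phi> x = b x \<bullet> grad \<phi> x" by eventually_elim simp
  have "(LINT x|lebesgue. b x \<bullet> grad \<phi> x) = (LINT x|lborel. B x \<bullet> grad \<phi> x)"
    by (rule lebesgue_integral_representative(1)[OF _ b]) measurable
  also have "\<dots> = - (LINT x|lborel. d x * \<phi> x)" by (rule weak_div_C1c(3)[OF C])
  also have "(LINT x|lborel. d x * \<phi> x) = (LINT x|lebesgue. (\<Sum>i\<in>Basis. g i x \<bullet> i) * \<phi> x)"
    by (rule lebesgue_integral_representative(1)[OF _ d, symmetric]) measurable
  finally show "(LINT x|lebesgue. b x \<bullet> grad \<phi> x) = - (LINT x|lebesgue. (\<Sum>i\<in>Basis. g i x \<bullet> i) * \<phi> x)" .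
qed

text \<open>Two weak divergences of one field have the same mollifications. Hence the divergence
  picked by choice agrees almost everywhere with the one computed from the partials.\<close>

lemma weak_div_unique:
  fixes B b :: "'a::euclidean_space \<Rightarrow> 'a"
  assumes s: "spatial u B G p q" and ae: "AE x in lborel. B x = b x" and w: "has_weak_div b d'"
  shows "AE x in lborel. spatial.d G x = d' x"
proof -
  interpret spatial u B G p q by (rule s)
  have l: "locally_integrable d'" using w by (simp add: has_weak_div_def)
  obtain D where D [measurable]: "D \<in> borel_measurable borel" and Dd: "AE x in lborel. D x = d' x"
    using Borel_representative[of d' UNIV] locally_integrable_measurable[OF l] by (auto simp: lebesgue_on_UNIV_eq)
  have lD: "loc_int D" by (rule loc_int_representative[OF l D Dd])
  have "AE x in lborel. D x - d x = 0"
  proof (rule moll_eq_0_imp_AE_0)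
    show "loc_int (\<lambda>x. D x - d x)" using lD loc_int_d unfolding loc_int_def by (auto simp: right_diff_distrib)
    fix \<epsilon> :: real and y :: 'a assume e: "\<epsilon> > 0"
    have gr: "grad (\<lambda>x. kern \<epsilon> (y - x)) x = - gkern \<epsilon> (y - x)" for x
      using kern_reflected_gderiv[OF e, of 1 y x] by (intro grad_eq) simp
    have "(LINT x|lebesgue. b x \<bullet> grad (\<lambda>x. kern \<epsilon> (y - x)) x) = - (LINT x|lebesgue. d' x * kern \<epsilon> (y - x))"
      using w test_function_kern[OF e] unfolding has_weak_div_def by blast
    also have "(LINT x|lebesgue. d' x * kern \<epsilon> (y - x)) = (LINT x|lborel. D x * kern \<epsilon> (y - x))"
      by (rule lebesgue_integral_representative(1)) (use Dd in auto)
    also have "(LINT x|lebesgue. b x \<bullet> grad (\<lambda>x. kern \<epsilon> (y - x)) x) = (LINT x|lborel. B x \<bullet> - gkern \<epsilon> (y - x))"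
      unfolding gr by (rule lebesgue_integral_representative(1)) (use ae in auto)
    also have "\<dots> = - (LINT x|lborel. d x * kern \<epsilon> (y - x))" by (rule weak_div_C1c(3)[OF kern_reflected_C1c[OF e]])
    finally have "(LINT x|lborel. kern \<epsilon> (y - x) * D x) = (LINT x|lborel. kern \<epsilon> (y - x) * d x)" by (simp add: mult.commute)
    then show "moll \<epsilon> (\<lambda>x. D x - d x) y = 0"
      unfolding moll_def right_diff_distrib
      using Bochner_Integration.integral_diff[OF kern_mult_integrable[OF lD e] kern_mult_integrable[OF loc_int_d e]] by simp
  qed
  with Dd show ?thesis by eventually_elim simp
qed

lemma L1_W1_loc_representative:
  fixes b :: "real \<Rightarrow> 'a::euclidean_space \<Rightarrow> 'a"
  assumes b: "b \<in> L1_W1_loc T q"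
  obtains B G g where "(\<lambda>(t, x). B t x) \<in> borel_measurable (borel \<Otimes>\<^sub>M borel)"
    "\<And>i. i \<in> Basis \<Longrightarrow> (\<lambda>(t, x). G i t x) \<in> borel_measurable (borel \<Otimes>\<^sub>M borel)"
    "b \<in> L1_Lp_loc T q" "\<And>i. i \<in> Basis \<Longrightarrow> g i \<in> L1_Lp_loc T q"
    "AE t in lborel. t \<in> {0<..<T} \<longrightarrow> represents_W1 q (B t) (b t) (\<lambda>i. G i t) (\<lambda>i. g i t)"
proof -
  have bL: "b \<in> L1_Lp_loc T q" and "\<forall>i\<in>Basis. \<exists>g. g \<in> L1_Lp_loc T q \<and> (AE t in lebesgue_on {0<..<T}. has_weak_partial i (b t) (g t))"
    using b by (auto simp: L1_W1_loc_def)
  from bchoice[OF this(2)] obtain g where g: "\<And>i. i \<in> Basis \<Longrightarrow> g i \<in> L1_Lp_loc T q"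
    "\<And>i. i \<in> Basis \<Longrightarrow> AE t in lebesgue_on {0<..<T}. has_weak_partial i (b t) (g i t)" by blast
  obtain B where B: "(\<lambda>(t, x). B t x) \<in> borel_measurable (borel \<Otimes>\<^sub>M borel)" "AE t in lborel. t \<in> {0<..<T} \<longrightarrow> (AE x in lborel. B t x = b t x)"
    by (rule jointly_measurable_representative[OF L1_Lp_locD(1)[OF bL]]) blast
  have "\<forall>i\<in>Basis. \<exists>G. (\<lambda>(t, x). G t x) \<in> borel_measurable (borel \<Otimes>\<^sub>M borel) \<and> (AE t in lborel. t \<in> {0<..<T} \<longrightarrow> (AE x in lborel. G t x = g i t x))"
  proof
    fix i :: 'a assume "i \<in> Basis"
    obtain G where "(\<lambda>(t, x). G t x) \<in> borel_measurable (borel \<Otimes>\<^sub>M borel)" "AE t in lborel. t \<in> {0<..<T} \<longrightarrow> (AE x in lborel. G t x = g i t x)"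
      by (rule jointly_measurable_representative[OF L1_Lp_locD(1)[OF g(1)[OF \<open>i \<in> Basis\<close>]]]) blast
    then show "\<exists>G. (\<lambda>(t, x). G t x) \<in> borel_measurable (borel \<Otimes>\<^sub>M borel) \<and> (AE t in lborel. t \<in> {0<..<T} \<longrightarrow> (AE x in lborel. G t x = g i t x))"
      by (intro exI[of _ G] conjI)
  qed
  from bchoice[OF this] obtain G where G: "\<And>i. i \<in> Basis \<Longrightarrow> (\<lambda>(t, x). G i t x) \<in> borel_measurable (borel \<Otimes>\<^sub>M borel)"
    "\<And>i. i \<in> Basis \<Longrightarrow> AE t in lborel. t \<in> {0<..<T} \<longrightarrow> (AE x in lborel. G i t x = g i t x)" by blast
  have "AE t in lborel. t \<in> {0<..<T} \<longrightarrow> has_weak_partial i (b t) (g i t)" if "i \<in> Basis" for i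
    using g(2)[OF that] by (simp add: AE_lebesgue_on_iff)
  then have "AE t in lborel. \<forall>i\<in>Basis. t \<in> {0<..<T} \<longrightarrow> has_weak_partial i (b t) (g i t)" by (intro AE_finite_allI) auto
  moreover have "AE t in lborel. \<forall>i\<in>Basis. t \<in> {0<..<T} \<longrightarrow> (AE x in lborel. G i t x = g i t x)" using G(2) by (intro AE_finite_allI) auto
  moreover have "AE t in lborel. \<forall>i\<in>Basis. t \<in> {0<..<T} \<longrightarrow> (\<forall>n. g i t \<in> Lp q (ball 0 (real (Suc n))))"
    using L1_Lp_locD(2)[OF g(1)] by (intro AE_finite_allI) auto
  moreover note B(2) L1_Lp_locD(2)[OF bL]
  ultimately have "AE t in lborel. t \<in> {0<..<T} \<longrightarrow> represents_W1 q (B t) (b t) (\<lambda>i. G i t) (\<lambda>i. g i t)"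
    by eventually_elim (auto simp: represents_W1_def)
  then show thesis using that B(1) G(1) bL g(1) by blast
qed

lemma section_measurable:
  assumes "(\<lambda>(t, x). F t x) \<in> borel_measurable (borel \<Otimes>\<^sub>M borel)" shows "F t \<in> borel_measurable borel"
  using measurable_compose[OF measurable_Pair1'[of t borel borel] assms] by simp

lemma space_div_exists:
  fixes b :: "real \<Rightarrow> 'a::euclidean_space \<Rightarrow> 'a"
  assumes b: "b \<in> L1_W1_loc T q" and pq: "p > 1" "1 / p + 1 / q = 1"
  shows "AE t in lborel. t \<in> {0<..<T} \<longrightarrow> has_weak_div (b t) (space_div T b t)"
proof -
  obtain B G g where B: "(\<lambda>(t, x). B t x) \<in> borel_measurable (borel \<Otimes>\<^sub>M borel)"
    and G: "\<And>i. i \<in> Basis \<Longrightarrow> (\<lambda>(t, x). G i t x) \<in> borel_measurable (borel \<Otimes>\<^sub>M borel)"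
    and g: "\<And>i. i \<in> Basis \<Longrightarrow> g i \<in> L1_Lp_loc T q"
    and r: "AE t in lborel. t \<in> {0<..<T} \<longrightarrow> represents_W1 q (B t) (b t) (\<lambda>i. G i t) (\<lambda>i. g i t)"
    by (rule L1_W1_loc_representative[OF b]) blast
  have "has_weak_div (b t) (\<lambda>x. \<Sum>i\<in>Basis. g i t x \<bullet> i)" if "represents_W1 q (B t) (b t) (\<lambda>i. G i t) (\<lambda>i. g i t)" for t
  proof (rule weak_div_of_representation[OF _ that])
    \<comment> \<open>The divergence concerns the field alone, so the slice of the solution is taken
      to be 0.\<close>
    show "spatial (\<lambda>_. 0) (B t) (\<lambda>i. G i t) p q"
      by (rule spatial_of_representation[OF pq _ _ _ _ that]) (auto intro: section_measurable B G)
  qed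
  then have "AE t in lborel. t \<in> {0<..<T} \<longrightarrow> has_weak_div (b t) (\<lambda>x. \<Sum>i\<in>Basis. g i t x \<bullet> i)"
    using r by (auto elim: eventually_mono)
  moreover have "jointly_measurable T (\<lambda>t x. \<Sum>i\<in>Basis. g i t x \<bullet> i)"
  proof -
    have "(\<lambda>z. (case z of (t, x) \<Rightarrow> g i t x) \<bullet> i) \<in> borel_measurable (lebesgue_on ({0<..<T} \<times> (UNIV :: 'a set)))" if "i \<in> Basis" for i
      using L1_Lp_locD(1)[OF g[OF that]] unfolding jointly_measurable_def by (intro borel_measurable_inner) auto
    then have "(\<lambda>z. \<Sum>i\<in>Basis. (case z of (t, x) \<Rightarrow> g i t x) \<bullet> i) \<in> borel_measurable (lebesgue_on ({0<..<T} \<times> (UNIV :: 'a set)))"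
      by (rule borel_measurable_sum)
    then show ?thesis unfolding jointly_measurable_def by (simp add: case_prod_beta)
  qed
  ultimately have "\<exists>d. jointly_measurable T d \<and> (AE t in lebesgue_on {0<..<T}. has_weak_div (b t) (d t))"
    by (auto simp: AE_lebesgue_on_iff)
  from someI_ex[OF this] show ?thesis unfolding space_div_def by (simp add: AE_lebesgue_on_iff)
qed

section \<open>The weak formulation tested with mollifier kernels\<close>

lemma lebesgue_time_integral:
  fixes H K :: "real \<Rightarrow> real"
  assumes K [measurable]: "K \<in> borel_measurable borel" and ae: "AE t in lborel. t \<in> {0<..<T} \<longrightarrow> K t = H t"
  shows "(LINT t:{0<..<T}|lebesgue. H t) = (LINT t|lborel. indicator {0..T} t * K t)"
  unfolding set_lebesgue_integral_def
proof (rule lebesgue_integral_representative(1))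
  show "(\<lambda>t. indicator {0..T} t * K t) \<in> borel_measurable borel" by measurable
  have "AE t in lborel. t \<noteq> (0::real)" "AE t in lborel. t \<noteq> T" by (rule AE_lborel_singleton)+
  with ae show "AE t in lborel. indicator {0..T} t * K t = indicator {0<..<T} t *\<^sub>R H t"
    by eventually_elim (auto simp: indicator_def)
qed

text \<open>The divergence term and the transport term are kept apart and the datum stays on the
  right, in a form that can be compared for two solutions.\<close>

lemma (in transport_data) weak_solution_tested:
  assumes e: "\<epsilon> > 0" and \<eta>: "smooth1 \<eta>" "\<eta> 0 T = 0" and ws: "weak_solution T b' u\<^sub>0 u'"
    and rep: "AE t in lborel. t \<in> {0<..<T} \<longrightarrow> (AE x in lborel. u t x = u' t x) \<and> (AE x in lborel. b t x = b' t x) \<and>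
      (AE x in lborel. dv t x = space_div T b' t x)"
  shows "(LINT t|lborel. indicator {0..T} t * (\<eta> (Suc 0) t * moll \<epsilon> (u t) y)) +
    (LINT t|lborel. indicator {0..T} t * (\<eta> 0 t * (LINT x|lborel. u t x * (dv t x * kern \<epsilon> (y - x))))) -
    (LINT t|lborel. indicator {0..T} t * (\<eta> 0 t * (LINT x|lborel. u t x * (b t x \<bullet> gkern \<epsilon> (y - x)))))
    = - (LINT x|lebesgue. u\<^sub>0 x * (\<eta> 0 0 * kern \<epsilon> (y - x)))"
proof -
  let ?\<phi> = "\<lambda>t x. \<eta> 0 t * kern \<epsilon> (y - x)"
  have [measurable]: "\<eta> n \<in> borel_measurable borel" for n by (intro borel_measurable_continuous_onI smooth1_continuous[OF \<eta>(1)])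
  have [measurable]: "u t \<in> borel_measurable borel" "b t \<in> borel_measurable borel" "dv t \<in> borel_measurable borel" for t
    using section_measurable[OF um] section_measurable[OF bm] section_measurable[OF dvm] .
  have dt: "deriv (\<lambda>s. ?\<phi> s x) t = \<eta> (Suc 0) t * kern \<epsilon> (y - x)" for t x
    by (intro DERIV_imp_deriv DERIV_cmult_right) (rule smooth1D[OF \<eta>(1)])
  have gr: "grad (?\<phi> t) x = - (\<eta> 0 t *\<^sub>R gkern \<epsilon> (y - x))" for t x by (rule grad_eq[OF kern_reflected_gderiv[OF e]])
  have "(LINT t:{0<..<T}|lebesgue. LINT x|lebesgue. u' t x * deriv (\<lambda>s. ?\<phi> s x) t) +
        (LINT t:{0<..<T}|lebesgue. LINT x|lebesgue. space_div T b' t x * u' t x * ?\<phi> t x) +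
        (LINT t:{0<..<T}|lebesgue. LINT x|lebesgue. (b' t x \<bullet> grad (?\<phi> t) x) * u' t x)
        = - (LINT x|lebesgue. u\<^sub>0 x * ?\<phi> 0 x)"
    using ws spacetime_test_function_kern[OF e \<eta>(1), of T y] \<eta>(2) unfolding weak_solution_def by simp
  moreover have "(LINT t:{0<..<T}|lebesgue. LINT x|lebesgue. u' t x * deriv (\<lambda>s. ?\<phi> s x) t)
    = (LINT t|lborel. indicator {0..T} t * (\<eta> (Suc 0) t * moll \<epsilon> (u t) y))"
  proof (rule lebesgue_time_integral)
    show "(\<lambda>t. \<eta> (Suc 0) t * moll \<epsilon> (u t) y) \<in> borel_measurable borel" by measurable
    show "AE t in lborel. t \<in> {0<..<T} \<longrightarrow> \<eta> (Suc 0) t * moll \<epsilon> (u t) y = (LINT x|lebesgue. u' t x * deriv (\<lambda>s. ?\<phi> s x) t)"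
      using rep
    proof eventually_elim
      case (elim t)
      show ?case
      proof
        assume "t \<in> {0<..<T}"
        then have "AE x in lborel. u t x = u' t x" using elim by blast
        then have "AE x in lborel. u t x * (\<eta> (Suc 0) t * kern \<epsilon> (y - x)) = u' t x * (\<eta> (Suc 0) t * kern \<epsilon> (y - x))" by eventually_elim simp
        then have "(LINT x|lebesgue. u' t x * (\<eta> (Suc 0) t * kern \<epsilon> (y - x))) = (LINT x|lborel. u t x * (\<eta> (Suc 0) t * kern \<epsilon> (y - x)))"
          by (intro lebesgue_integral_representative(1)) measurable
        also have "\<dots> = (LINT x|lborel. \<eta> (Suc 0) t * (kern \<epsilon> (y - x) * u t x))" by (simp add: ac_simps)
        finally show "\<eta> (Suc 0) t * moll \<epsilon> (u t) y = (LINT x|lebesgue. u' t x * deriv (\<lambda>s. ?\<phi> s x) t)" by (simp add: dt moll_def)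
      qed
    qed
  qed
  moreover have "(LINT t:{0<..<T}|lebesgue. LINT x|lebesgue. space_div T b' t x * u' t x * ?\<phi> t x)
    = (LINT t|lborel. indicator {0..T} t * (\<eta> 0 t * (LINT x|lborel. u t x * (dv t x * kern \<epsilon> (y - x)))))"
  proof (rule lebesgue_time_integral)
    show "(\<lambda>t. \<eta> 0 t * (LINT x|lborel. u t x * (dv t x * kern \<epsilon> (y - x)))) \<in> borel_measurable borel" by measurable
    show "AE t in lborel. t \<in> {0<..<T} \<longrightarrow> \<eta> 0 t * (LINT x|lborel. u t x * (dv t x * kern \<epsilon> (y - x))) = (LINT x|lebesgue. space_div T b' t x * u' t x * ?\<phi> t x)"
      using rep
    proof eventually_elim
      case (elim t)
      show ?case
      proof
        assume "t \<in> {0<..<T}"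
        then have "AE x in lborel. u t x = u' t x" "AE x in lborel. dv t x = space_div T b' t x" using elim by blast+
        then have "AE x in lborel. \<eta> 0 t * (u t x * (dv t x * kern \<epsilon> (y - x))) = space_div T b' t x * u' t x * ?\<phi> t x" by eventually_elim simp
        then have "(LINT x|lebesgue. space_div T b' t x * u' t x * ?\<phi> t x) = (LINT x|lborel. \<eta> 0 t * (u t x * (dv t x * kern \<epsilon> (y - x))))"
          by (intro lebesgue_integral_representative(1)) measurable
        then show "\<eta> 0 t * (LINT x|lborel. u t x * (dv t x * kern \<epsilon> (y - x))) = (LINT x|lebesgue. space_div T b' t x * u' t x * ?\<phi> t x)" by simp
      qed
    qed
  qed
  moreover have "(LINT t:{0<..<T}|lebesgue. LINT x|lebesgue. (b' t x \<bullet> grad (?\<phi> t) x) * u' t x)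
    = (LINT t|lborel. indicator {0..T} t * - (\<eta> 0 t * (LINT x|lborel. u t x * (b t x \<bullet> gkern \<epsilon> (y - x)))))"
  proof (rule lebesgue_time_integral)
    show "(\<lambda>t. - (\<eta> 0 t * (LINT x|lborel. u t x * (b t x \<bullet> gkern \<epsilon> (y - x))))) \<in> borel_measurable borel" by measurable
    show "AE t in lborel. t \<in> {0<..<T} \<longrightarrow> - (\<eta> 0 t * (LINT x|lborel. u t x * (b t x \<bullet> gkern \<epsilon> (y - x)))) = (LINT x|lebesgue. (b' t x \<bullet> grad (?\<phi> t) x) * u' t x)"
      using rep
    proof eventually_elim
      case (elim t)
      show ?case
      proof
        assume "t \<in> {0<..<T}"
        then have "AE x in lborel. u t x = u' t x" "AE x in lborel. b t x = b' t x" using elim by blast+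
        then have "AE x in lborel. (- \<eta> 0 t) * (u t x * (b t x \<bullet> gkern \<epsilon> (y - x))) = (b' t x \<bullet> grad (?\<phi> t) x) * u' t x" by eventually_elim (simp add: gr)
        then have "(LINT x|lebesgue. (b' t x \<bullet> grad (?\<phi> t) x) * u' t x) = (LINT x|lborel. (- \<eta> 0 t) * (u t x * (b t x \<bullet> gkern \<epsilon> (y - x))))"
          by (intro lebesgue_integral_representative(1)) measurable
        then show "- (\<eta> 0 t * (LINT x|lborel. u t x * (b t x \<bullet> gkern \<epsilon> (y - x)))) = (LINT x|lebesgue. (b' t x \<bullet> grad (?\<phi> t) x) * u' t x)" by simp
      qed
    qed
  qed
  ultimately show ?thesis by simp
qed

text \<open>The right-hand sides agree for both solutions and cancel; linearity then recombines the
  two spatial terms into \<open>Fl\<close> of the difference.\<close>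

lemma weak_solution_difference:
  assumes e: "0 < \<epsilon>" "\<epsilon> \<le> 1" and \<eta>: "smooth1 \<eta>" "\<eta> 0 T = 0"
    and D1: "transport_data v1 b g p q M1" and D2: "transport_data v2 b g p q M2" and D: "transport_data (\<lambda>t x. v1 t x - v2 t x) b g p q C"
    and ws: "weak_solution T b' u\<^sub>0 u1" "weak_solution T b' u\<^sub>0 u2"
    and rep: "AE t in lborel. t \<in> {0<..<T} \<longrightarrow> (AE x in lborel. v1 t x = u1 t x) \<and> (AE x in lborel. v2 t x = u2 t x) \<and> (AE x in lborel. b t x = b' t x) \<and>
      (AE x in lborel. spatial.d (\<lambda>i. g i t) x = space_div T b' t x)"
  shows "(LINT t|lborel. indicator {0..T} t * (\<eta> (Suc 0) t * moll \<epsilon> (\<lambda>x. v1 t x - v2 t x) y)) +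
      (LINT t|lborel. indicator {0..T} t * (\<eta> 0 t * spatial.Fl (\<lambda>x. v1 t x - v2 t x) (b t) (\<lambda>i. g i t) \<epsilon> y)) = 0"
proof -
  interpret D1: transport_data v1 b g p q M1 by (rule D1)
  interpret D2: transport_data v2 b g p q M2 by (rule D2)
  interpret D: transport_data "\<lambda>t x. v1 t x - v2 t x" b g p q C by (rule D)
  have c: "continuous_on UNIV (\<eta> n)" for n by (rule smooth1_continuous[OF \<eta>(1)])
  have rep1: "AE t in lborel. t \<in> {0<..<T} \<longrightarrow> (AE x in lborel. v1 t x = u1 t x) \<and> (AE x in lborel. b t x = b' t x) \<and>
      (AE x in lborel. spatial.d (\<lambda>i. g i t) x = space_div T b' t x)"
    and rep2: "AE t in lborel. t \<in> {0<..<T} \<longrightarrow> (AE x in lborel. v2 t x = u2 t x) \<and> (AE x in lborel. b t x = b' t x) \<and>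
      (AE x in lborel. spatial.d (\<lambda>i. g i t) x = space_div T b' t x)"
    using rep by (auto elim: eventually_mono)
  let ?m = "\<lambda>v t. indicator {0..T} t * (\<eta> (Suc 0) t * moll \<epsilon> (v t) y)"
  let ?d = "\<lambda>v t. indicator {0..T} t * (\<eta> 0 t * (LINT x|lborel. v t x * (spatial.d (\<lambda>i. g i t) x * kern \<epsilon> (y - x))))"
  let ?b = "\<lambda>v t. indicator {0..T} t * (\<eta> 0 t * (LINT x|lborel. v t x * (b t x \<bullet> gkern \<epsilon> (y - x))))"
  note i1 = D1.weak_terms_integrable(1)[OF e c[of "Suc 0"], of T y] D1.weak_terms_integrable(2,3)[OF e c[of 0], of T y]
  note i2 = D2.weak_terms_integrable(1)[OF e c[of "Suc 0"], of T y] D2.weak_terms_integrable(2,3)[OF e c[of 0], of T y]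
  have m: "moll \<epsilon> (\<lambda>x. v1 t x - v2 t x) y = moll \<epsilon> (v1 t) y - moll \<epsilon> (v2 t) y" for t
    unfolding moll_def right_diff_distrib
    by (rule Bochner_Integration.integral_diff) (intro kern_mult_integrable e spatial.loc_int_u[OF D1.S] spatial.loc_int_u[OF D2.S])+
  have F: "spatial.Fl (\<lambda>x. v1 t x - v2 t x) (b t) (\<lambda>i. g i t) \<epsilon> y =
    ((LINT x|lborel. v1 t x * (spatial.d (\<lambda>i. g i t) x * kern \<epsilon> (y - x))) - (LINT x|lborel. v1 t x * (b t x \<bullet> gkern \<epsilon> (y - x)))) -
    ((LINT x|lborel. v2 t x * (spatial.d (\<lambda>i. g i t) x * kern \<epsilon> (y - x))) - (LINT x|lborel. v2 t x * (b t x \<bullet> gkern \<epsilon> (y - x))))" for t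
  proof -
    note j1 = spatial.integrable_ud[OF D1.S e(1), of t y] spatial.integrable_ub[OF D1.S e(1), of t y]
    note j2 = spatial.integrable_ud[OF D2.S e(1), of t y] spatial.integrable_ub[OF D2.S e(1), of t y]
    have "spatial.Fl (\<lambda>x. v1 t x - v2 t x) (b t) (\<lambda>i. g i t) \<epsilon> y =
      (LINT x|lborel. (v1 t x * (spatial.d (\<lambda>i. g i t) x * kern \<epsilon> (y - x)) - v1 t x * (b t x \<bullet> gkern \<epsilon> (y - x))) -
        (v2 t x * (spatial.d (\<lambda>i. g i t) x * kern \<epsilon> (y - x)) - v2 t x * (b t x \<bullet> gkern \<epsilon> (y - x))))"
      unfolding spatial.Fl_def[OF D.S] by (simp add: algebra_simps)
    then show ?thesis
      by (simp only: Bochner_Integration.integral_diff[OF j1] Bochner_Integration.integral_diff[OF j2]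
          Bochner_Integration.integral_diff[OF Bochner_Integration.integrable_diff[OF j1] Bochner_Integration.integrable_diff[OF j2]])
  qed
  have "(LINT t|lborel. indicator {0..T} t * (\<eta> (Suc 0) t * moll \<epsilon> (\<lambda>x. v1 t x - v2 t x) y)) = (LINT t|lborel. ?m v1 t - ?m v2 t)"
    by (simp add: m algebra_simps)
  also have "\<dots> = (LINT t|lborel. ?m v1 t) - (LINT t|lborel. ?m v2 t)" by (rule Bochner_Integration.integral_diff[OF i1(1) i2(1)])
  finally have M: "(LINT t|lborel. indicator {0..T} t * (\<eta> (Suc 0) t * moll \<epsilon> (\<lambda>x. v1 t x - v2 t x) y)) = (LINT t|lborel. ?m v1 t) - (LINT t|lborel. ?m v2 t)" .
  have "(LINT t|lborel. indicator {0..T} t * (\<eta> 0 t * spatial.Fl (\<lambda>x. v1 t x - v2 t x) (b t) (\<lambda>i. g i t) \<epsilon> y))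
    = (LINT t|lborel. (?d v1 t - ?b v1 t) - (?d v2 t - ?b v2 t))"
    unfolding F by (simp add: algebra_simps)
  also have "\<dots> = ((LINT t|lborel. ?d v1 t) - (LINT t|lborel. ?b v1 t)) - ((LINT t|lborel. ?d v2 t) - (LINT t|lborel. ?b v2 t))"
    by (simp only: Bochner_Integration.integral_diff[OF i1(2,3)] Bochner_Integration.integral_diff[OF i2(2,3)]
          Bochner_Integration.integral_diff[OF Bochner_Integration.integrable_diff[OF i1(2,3)] Bochner_Integration.integrable_diff[OF i2(2,3)]])
  finally show ?thesis
    using M D1.weak_solution_tested[OF e(1) \<eta> ws(1) rep1, of y] D2.weak_solution_tested[OF e(1) \<eta> ws(2) rep2, of y] by linarith
qed

section \<open>Assembly of the uniqueness theorem\<close>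

lemma spatial_zero:
  fixes b :: "'a::euclidean_space \<Rightarrow> 'a"
  assumes "p > 1" "1 / p + 1 / q = 1" shows "spatial (\<lambda>_::'a. 0) (\<lambda>_. 0) (\<lambda>_ _. 0) p q"
  by unfold_locales (use assms in \<open>auto simp: kweak_def loc_int_def gmoll_def moll_def\<close>)

text \<open>The modulus and the summand 1 make the oscillation bound positive without a case
  distinction; it stays integrable in time on a bounded interval.\<close>

lemma BMO_weighted_bound:
  fixes f F G :: "'a::euclidean_space \<Rightarrow> real"
  assumes f: "f \<in> BMO" and R: "R > 0" and supp: "ess_support f \<subseteq> ball 0 R"
    and F [measurable]: "F \<in> borel_measurable borel" and ae: "AE x in lborel. F x = f x"
    and G: "continuous_on UNIV G" "\<And>x. 0 \<le> G x" "\<And>x. G x \<le> 1" "integrable lborel G" and m: "m \<ge> 0"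
  shows "(LINT x|lborel. \<bar>F x\<bar> * G x) \<le> 20 * (osc_const TYPE('a) * (\<bar>BMO_seminorm f\<bar> + 1)) * (m * (LINT x|lborel. G x) + 6 * (2 * R) ^ DIM('a) * exp (- m))"
proof -
  have [measurable]: "G \<in> borel_measurable borel" using G(1) by (rule borel_measurable_continuous_onI)
  have osc: "mean_oscillation f x r \<le> \<bar>BMO_seminorm f\<bar> + 1" if "r > 0" for x r
  proof -
    have "(case (x, r) of (x, r) \<Rightarrow> mean_oscillation f x r) \<le> BMO_seminorm f"
      unfolding BMO_seminorm_def by (rule cSUP_upper) (use f that in \<open>auto simp: BMO_def\<close>)
    then show ?thesis by simp
  qed
  have Gl: "(LINT x|lebesgue. G x) = (LINT x|lborel. G x)" "integrable lebesgue G"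
    using lebesgue_integral_representative[of G G] G(4) by auto
  have "(LINT x|lborel. \<bar>F x\<bar> * G x) = (LINT x|lebesgue. \<bar>f x\<bar> * G x)"
  proof (rule lebesgue_integral_representative(1)[symmetric])
    show "AE x in lborel. \<bar>F x\<bar> * G x = \<bar>f x\<bar> * G x" using ae by eventually_elim simp
  qed measurable
  also have "\<dots> \<le> 20 * (osc_const TYPE('a) * (\<bar>BMO_seminorm f\<bar> + 1)) * (m * (LINT x|lebesgue. G x) + 6 * (2 * R) ^ DIM('a) * exp (- m))"
    using f by (intro bounded_oscillation_weighted[OF _ _ osc R AE_0_outside_ess_support[OF supp] G(1-3) Gl(2) m]) (auto simp: BMO_def)
  finally show ?thesis unfolding Gl(1) .
qed

theorem theoremC:
  fixes p p' T R :: real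
    and b :: "real \<Rightarrow> 'a::euclidean_space \<Rightarrow> 'a"
    and u\<^sub>0 :: "'a \<Rightarrow> real"
    and u1 u2 :: "real \<Rightarrow> 'a \<Rightarrow> real"
  assumes "1 < p" and "1 / p + 1 / p' = 1" and "T > 0" and "R > 0"
    and "b \<in> L1_W1_loc T p'"
    and "space_div T b \<in> L1_time T BMO BMO_seminorm"
    and "(\<lambda>t x. b t x /\<^sub>R (1 + norm x)) \<in> L1_time T (Lp 1 UNIV) (Lp_norm 1 UNIV)"
    and "AE t in lebesgue_on {0<..<T}. ess_support (space_div T b t) \<subseteq> ball 0 R"
    and "locally_integrable u\<^sub>0"
    and "u1 \<in> Linf_time T (Lp p UNIV) (Lp_norm p UNIV)"
    and "u2 \<in> Linf_time T (Lp p UNIV) (Lp_norm p UNIV)"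
    and "weak_solution T b u\<^sub>0 u1"
    and "weak_solution T b u\<^sub>0 u2"
  shows "AE (t, x) in lebesgue_on ({0<..<T} \<times> UNIV). u1 t x = u2 t x"
proof -
  let ?I = "{0<..<T}" and ?D = "space_div T b"
  note pq = assms(1,2)
  have p: "p > 0" using assms(1) by simp
  have q: "p' > 0" using conjugate_exponent_gt_1[OF pq] by simp
  have I: "?I \<in> sets lborel" by simp
  obtain B G g where Bm: "(\<lambda>(t, x). B t x) \<in> borel_measurable (borel \<Otimes>\<^sub>M borel)"
    and Gm: "\<And>i. i \<in> Basis \<Longrightarrow> (\<lambda>(t, x). G i t x) \<in> borel_measurable (borel \<Otimes>\<^sub>M borel)"
    and bL: "b \<in> L1_Lp_loc T p'" and gL: "\<And>i. i \<in> Basis \<Longrightarrow> g i \<in> L1_Lp_loc T p'"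
    and W1: "AE t in lborel. t \<in> ?I \<longrightarrow> represents_W1 p' (B t) (b t) (\<lambda>i. G i t) (\<lambda>i. g i t)"
    by (rule L1_W1_loc_representative[OF assms(5)]) blast
  obtain c1 where u1: "jointly_measurable T u1" "AE t in lebesgue_on ?I. u1 t \<in> Lp p UNIV \<and> Lp_norm p UNIV (u1 t) \<le> c1"
    using assms(10) by (auto simp: Linf_time_def)
  obtain c2 where u2: "jointly_measurable T u2" "AE t in lebesgue_on ?I. u2 t \<in> Lp p UNIV \<and> Lp_norm p UNIV (u2 t) \<le> c2"
    using assms(11) by (auto simp: Linf_time_def)
  obtain V1 where V1: "(\<lambda>(t, x). V1 t x) \<in> borel_measurable (borel \<Otimes>\<^sub>M borel)"
    "AE z in lborel \<Otimes>\<^sub>M lborel. z \<in> ?I \<times> UNIV \<longrightarrow> (case z of (t, x) \<Rightarrow> V1 t x = u1 t x)"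
    "AE t in lborel. t \<in> ?I \<longrightarrow> (AE x in lborel. V1 t x = u1 t x)"
    by (rule jointly_measurable_representative[OF u1(1)]) blast
  obtain V2 where V2: "(\<lambda>(t, x). V2 t x) \<in> borel_measurable (borel \<Otimes>\<^sub>M borel)"
    "AE z in lborel \<Otimes>\<^sub>M lborel. z \<in> ?I \<times> UNIV \<longrightarrow> (case z of (t, x) \<Rightarrow> V2 t x = u2 t x)"
    "AE t in lborel. t \<in> ?I \<longrightarrow> (AE x in lborel. V2 t x = u2 t x)"
    by (rule jointly_measurable_representative[OF u2(1)]) blast
  have DB: "AE t in lebesgue_on ?I. ?D t \<in> BMO" "(\<lambda>t. BMO_seminorm (?D t)) absolutely_integrable_on ?I"
    using assms(6) by (auto simp: L1_time_def)
  have Ni: "integrable lebesgue (\<lambda>t. indicator ?I t *\<^sub>R BMO_seminorm (?D t))" using DB(2) by (simp add: set_integrable_def)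
  have Nm: "(\<lambda>t. indicator ?I t *\<^sub>R BMO_seminorm (?D t)) \<in> borel_measurable (lebesgue_on UNIV)"
    using borel_measurable_integrable[OF Ni] by (simp only: lebesgue_on_UNIV_eq)
  \<comment> \<open>The seminorm is only Lebesgue measurable in time; a Borel version is taken
    because \<open>w\<close> is built from it.\<close>
  obtain N where N: "N \<in> borel_measurable borel" "AE t in lborel. t \<in> UNIV \<longrightarrow> N t = indicator ?I t *\<^sub>R BMO_seminorm (?D t)"
    by (rule Borel_representative[OF Nm]) auto
  have Nint: "integrable lborel N" using lebesgue_integral_representative(2)[OF N(1)] N(2) Ni by simp
  \<comment> \<open>All conditions on a single time are collected, so that one Borel set
    \<open>J\<close> of good times serves them all.\<close>
  let ?P = "\<lambda>t. represents_W1 p' (B t) (b t) (\<lambda>i. G i t) (\<lambda>i. g i t) \<and>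
    (AE x in lborel. V1 t x = u1 t x) \<and> u1 t \<in> Lp p UNIV \<and> Lp_norm p UNIV (u1 t) \<le> c1 \<and>
    (AE x in lborel. V2 t x = u2 t x) \<and> u2 t \<in> Lp p UNIV \<and> Lp_norm p UNIV (u2 t) \<le> c2 \<and>
    has_weak_div (b t) (?D t) \<and> ?D t \<in> BMO \<and> ess_support (?D t) \<subseteq> ball 0 R \<and> N t = BMO_seminorm (?D t) \<and>
    (\<lambda>x. b t x /\<^sub>R (1 + norm x)) \<in> Lp 1 UNIV"
  have "AE t in lebesgue_on ?I. (\<lambda>x. b t x /\<^sub>R (1 + norm x)) \<in> Lp 1 UNIV" using assms(7) by (simp add: L1_time_def)
  then have "AE t in lborel. t \<in> ?I \<longrightarrow> ?P t"
    unfolding AE_lebesgue_on_iff[OF I] using W1 V1(3) V2(3) u1(2)[unfolded AE_lebesgue_on_iff[OF I]] u2(2)[unfolded AE_lebesgue_on_iff[OF I]]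
      space_div_exists[OF assms(5) pq] DB(1)[unfolded AE_lebesgue_on_iff[OF I]] assms(8)[unfolded AE_lebesgue_on_iff[OF I]] N(2)
    by eventually_elim simp
  then obtain J where J: "J \<in> sets lborel" "J \<subseteq> ?I" "\<And>t. t \<in> J \<Longrightarrow> ?P t" and aeJ: "AE t in lborel. t \<in> ?I \<longrightarrow> t \<in> J"
    by (rule AE_Borel_subset[OF I]) blast
  \<comment> \<open>Setting all functions to 0 outside \<open>J\<close> makes the locale conditions
    true at every time; the equation is unaffected, since the times of the interval outside
    \<open>J\<close> form a null set.\<close>
  define v1 where "v1 t x = indicat_real J t * V1 t x" for t x
  define v2 where "v2 t x = indicat_real J t * V2 t x" for t x
  define b' where "b' t x = indicat_real J t *\<^sub>R B t x" for t x
  define g' where "g' i t x = indicat_real J t *\<^sub>R G i t x" for i t x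
  note [measurable] = Bm V1(1) V2(1) N(1)
  have [measurable]: "J \<in> sets borel" using J(1) by simp
  have [measurable]: "(\<lambda>(t, x). v1 t x) \<in> borel_measurable (borel \<Otimes>\<^sub>M borel)" "(\<lambda>(t, x). v2 t x) \<in> borel_measurable (borel \<Otimes>\<^sub>M borel)"
    "(\<lambda>(t, x). b' t x) \<in> borel_measurable (borel \<Otimes>\<^sub>M borel)" unfolding v1_def v2_def b'_def by measurable
  have g'm: "(\<lambda>(t, x). g' i t x) \<in> borel_measurable (borel \<Otimes>\<^sub>M borel)" if "i \<in> Basis" for i
  proof -
    note [measurable] = Gm[OF that]
    show ?thesis unfolding g'_def by measurable
  qed
  have good: "b' t = B t" "v1 t = V1 t" "v2 t = V2 t" "(\<lambda>i. g' i t) = (\<lambda>i. G i t)" if "t \<in> J" for t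
    using that by (auto simp: fun_eq_iff b'_def v1_def v2_def g'_def)
  have bad: "b' t = (\<lambda>_. 0)" "v1 t = (\<lambda>_. 0)" "v2 t = (\<lambda>_. 0)" "(\<lambda>i. g' i t) = (\<lambda>_ _. 0)" if "t \<notin> J" for t
    using that by (auto simp: fun_eq_iff b'_def v1_def v2_def g'_def)
  have data: "transport_data v b' g' p p' M"
    if vm: "(\<lambda>(t, x). v t x) \<in> borel_measurable (borel \<Otimes>\<^sub>M borel)" and v0: "\<And>t. t \<notin> J \<Longrightarrow> v t = (\<lambda>_. 0)"
      and vi: "\<And>t. integrable lborel (\<lambda>x. \<bar>v t x\<bar> powr p)" and vM: "\<And>t. (LINT x|lborel. \<bar>v t x\<bar> powr p) \<le> M" for v M
  proof -
    have S: "spatial (v t) (b' t) (\<lambda>i. g' i t) p p'" for t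
    proof (cases "t \<in> J")
      case True
      show ?thesis unfolding good(1)[OF True] good(4)[OF True]
      proof (rule spatial_of_representation[OF pq _ vi])
        show "v t \<in> borel_measurable borel" by (rule section_measurable[OF vm])
        show "B t \<in> borel_measurable borel" by (rule section_measurable[OF Bm])
        show "G i t \<in> borel_measurable borel" if "i \<in> Basis" for i by (rule section_measurable[OF Gm[OF that]])
        show "represents_W1 p' (B t) (b t) (\<lambda>i. G i t) (\<lambda>i. g i t)" using J(3)[OF True] by blast
      qed
    next
      case False
      show ?thesis unfolding bad(1)[OF False] bad(4)[OF False] v0[OF False] by (rule spatial_zero[OF pq])
    qed
    show ?thesis
    proof (rule transport_data.intro)
      show "spatial (v t) (b' t) (\<lambda>i. g' i t) p p'" for t by (rule S)
      have "integrable lborel (\<lambda>t. Lnorm p' (\<lambda>x. indicator (cball 0 r) x * norm (indicat_real J t *\<^sub>R G i t x)))" if "i \<in> Basis" for i r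
        by (rule time_Lnorm_integrable[OF gL[OF that] q Gm[OF that] J(1,2)]) (use J(3) that in \<open>auto simp: represents_W1_def\<close>)
      then show "integrable lborel (\<lambda>t. spatial.NG (\<lambda>i. g' i t) p' r)" for r
        unfolding spatial.NG_def[OF S] g'_def by (intro Bochner_Integration.integrable_sum)
      show "integrable lborel (\<lambda>t. Lnorm p' (\<lambda>x. indicator (cball 0 r) x * norm (b' t x)))" for r
        unfolding b'_def by (rule time_Lnorm_integrable[OF bL q Bm J(1,2)]) (use J(3) in \<open>auto simp: represents_W1_def\<close>)
    qed (use vm g'm vM in auto)
  qed
  have int1: "integrable lborel (\<lambda>x. \<bar>v1 t x\<bar> powr p)" "(LINT x|lborel. \<bar>v1 t x\<bar> powr p) \<le> c1 powr p" for t
    using Lp_UNIV_representative[of "u1 t" p c1 "V1 t", OF _ _ section_measurable[OF V1(1)] _ p] J(3)[of t] p good(2)[of t] bad(2)[of t]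
    by (cases "t \<in> J"; simp)+
  have int2: "integrable lborel (\<lambda>x. \<bar>v2 t x\<bar> powr p)" "(LINT x|lborel. \<bar>v2 t x\<bar> powr p) \<le> c2 powr p" for t
    using Lp_UNIV_representative[of "u2 t" p c2 "V2 t", OF _ _ section_measurable[OF V2(1)] _ p] J(3)[of t] p good(3)[of t] bad(3)[of t]
    by (cases "t \<in> J"; simp)+
  let ?v = "\<lambda>t x. v1 t x - v2 t x" and ?M = "3 powr p * (c1 powr p + c2 powr p)"
  have le: "\<bar>?v t x\<bar> powr p \<le> 3 powr p * (\<bar>v1 t x\<bar> powr p + \<bar>v2 t x\<bar> powr p)" for t x
  proof -
    have "\<bar>?v t x\<bar> powr p \<le> (\<bar>v1 t x\<bar> + \<bar>v2 t x\<bar> + 0) powr p" using p by (intro powr_mono2) auto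
    also have "\<dots> \<le> 3 powr p * (\<bar>v1 t x\<bar> powr p + \<bar>v2 t x\<bar> powr p + 0 powr p)" by (rule powr_sum3_le) (use p in auto)
    finally show ?thesis by simp
  qed
  have isum: "integrable lborel (\<lambda>x. 3 powr p * (\<bar>v1 t x\<bar> powr p + \<bar>v2 t x\<bar> powr p))" for t using int1(1) int2(1) by simp
  have vm: "(\<lambda>(t, x). ?v t x) \<in> borel_measurable (borel \<Otimes>\<^sub>M borel)" by measurable
  have vi: "integrable lborel (\<lambda>x. \<bar>?v t x\<bar> powr p)" for t
  proof (rule Bochner_Integration.integrable_bound[OF isum])
    have [measurable]: "v1 t \<in> borel_measurable borel" "v2 t \<in> borel_measurable borel" by (rule section_measurable, measurable)+
    show "(\<lambda>x. \<bar>?v t x\<bar> powr p) \<in> borel_measurable lborel" by measurable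
  qed (use le in \<open>auto intro!: AE_I2 order_trans[OF _ abs_ge_self]\<close>)
  have vM: "(LINT x|lborel. \<bar>?v t x\<bar> powr p) \<le> ?M" for t
  proof -
    have "(LINT x|lborel. \<bar>?v t x\<bar> powr p) \<le> (LINT x|lborel. 3 powr p * (\<bar>v1 t x\<bar> powr p + \<bar>v2 t x\<bar> powr p))"
      by (rule Bochner_Integration.integral_mono[OF vi isum le])
    also have "\<dots> = 3 powr p * ((LINT x|lborel. \<bar>v1 t x\<bar> powr p) + (LINT x|lborel. \<bar>v2 t x\<bar> powr p))"
      using int1(1) int2(1) by simp
    also have "\<dots> \<le> ?M" by (intro mult_left_mono add_mono int1(2) int2(2)) auto
    finally show ?thesis .
  qed
  have D1: "transport_data v1 b' g' p p' (c1 powr p)" by (rule data) (use bad(2) int1 in auto)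
  have D2: "transport_data v2 b' g' p p' (c2 powr p)" by (rule data) (use bad(3) int2 in auto)
  have D: "transport_data ?v b' g' p p' ?M" by (rule data[OF vm _ vi vM]) (simp add: bad(2,3))
  \<comment> \<open>The weak formulation contains the chosen divergence; uniqueness identifies it
    with that of the representatives.\<close>
  have dD: "AE x in lborel. spatial.d (\<lambda>i. g' i t) x = ?D t x" if "t \<in> J" for t
    by (rule weak_div_unique[OF transport_data.S[OF D1]]) (use J(3)[OF that] good(1)[OF that] in \<open>auto simp: represents_W1_def\<close>)
  have rep: "AE t in lborel. t \<in> ?I \<longrightarrow> (AE x in lborel. v1 t x = u1 t x) \<and> (AE x in lborel. v2 t x = u2 t x) \<and> (AE x in lborel. b' t x = b t x) \<and>
      (AE x in lborel. spatial.d (\<lambda>i. g' i t) x = ?D t x)"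
    using aeJ by eventually_elim (use J(3) good dD in \<open>auto simp: represents_W1_def\<close>)
  let ?K = "20 * osc_const TYPE('a)"
  have K: "?K \<ge> 0" by (simp add: osc_const_def)
  \<comment> \<open>The factor \<open>?K\<close> is the constant of the weighted oscillation
    inequality, and the remaining factor is its bound on the mean oscillation.\<close>
  define w where "w t = indicat_real J t * (?K * (\<bar>N t\<bar> + 1))" for t
  interpret transport ?v b' g' p p' ?M T "6 * (2 * R) ^ DIM('a)" w
  proof (intro transport.intro transport_axioms.intro D)
    show "T > 0" by fact
    show "w \<in> borel_measurable borel" unfolding w_def[abs_def] by measurable
    show "0 \<le> w t" for t using K by (simp add: w_def)
    have "integrable lborel (indicat_real ?I)" using assms(3) by (intro integrable_real_indicator) auto
    then have Ji: "integrable lborel (indicat_real J)" by (rule Bochner_Integration.integrable_bound) (use subsetD[OF J(2)] in \<open>auto simp: indicator_def intro!: AE_I2\<close>)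
    have "integrable lborel (\<lambda>t. indicat_real J t * \<bar>N t\<bar>)"
      using integrable_mult_indicator[OF J(1), of "\<lambda>t. \<bar>N t\<bar>"] Nint by simp
    with Ji have "integrable lborel (\<lambda>t. ?K * (indicat_real J t * \<bar>N t\<bar> + indicat_real J t))" by simp
    then show "integrable lborel w" by (simp add: w_def[abs_def] algebra_simps)
    show "6 * (2 * R) ^ DIM('a) > 0" using assms(4) by simp
    show "integrable (lborel \<Otimes>\<^sub>M lborel) (\<lambda>(t, x). norm (b' t x) / (1 + norm x))"
    proof (rule lborel_pair.Fubini_integrable)
      let ?f = "\<lambda>t x. b t x /\<^sub>R (1 + norm x)" and ?h = "\<lambda>t x. norm (b' t x) / (1 + norm x)"
      have hm: "?h t \<in> borel_measurable borel" for t
      proof -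
        have [measurable]: "b' t \<in> borel_measurable borel" by (rule section_measurable) measurable
        show ?thesis by measurable
      qed
      have hJ: "integrable lborel (?h t)" "(LINT x|lborel. ?h t x) = Lp_norm 1 UNIV (?f t)" if t: "t \<in> J" for t
      proof -
        have "AE x in lborel. B t x = b t x" using J(3)[OF t] by (simp add: represents_W1_def)
        then have r: "AE x in lborel. ?h t x = norm (?f t x) powr 1"
          by eventually_elim (simp add: good(1)[OF t] divide_inverse mult.commute)
        have L: "?f t \<in> Lp 1 UNIV" using J(3)[OF t] by blast
        show "integrable lborel (?h t)"
          using L lebesgue_integral_representative(2)[OF hm r] by (simp add: Lp_def set_integrable_def)
        \<comment> \<open>For exponent 1 the norm is the integral itself, so integrability in time
          of the norms is the outer condition in Fubini's criterion.\<close>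
        have "(LINT x|lborel. ?h t x) = (LINT x:UNIV|lebesgue. norm (?f t x) powr 1)"
          by (simp only: set_lebesgue_integral_def lebesgue_integral_representative(1)[OF hm r, symmetric] indicator_UNIV scaleR_one)
        moreover have "(LINT x|lborel. ?h t x) \<ge> 0" by (intro Bochner_Integration.integral_nonneg) simp
        ultimately show "(LINT x|lborel. ?h t x) = Lp_norm 1 UNIV (?f t)" unfolding Lp_norm_def by simp
      qed
      have h0: "?h t = (\<lambda>_. 0)" if "t \<notin> J" for t using bad(1)[OF that] by simp
      show "(\<lambda>(t, x). ?h t x) \<in> borel_measurable (lborel \<Otimes>\<^sub>M lborel)" by measurable
      have "integrable lborel (?h t)" for t using hJ(1)[of t] h0[of t] by (cases "t \<in> J") auto
      then show "AE t in lborel. integrable lborel (\<lambda>x. case (t, x) of (t, x) \<Rightarrow> ?h t x)" by simp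
      have Hm: "(\<lambda>t. LINT x|lborel. ?h t x) \<in> borel_measurable lborel" by measurable
      have "integrable lebesgue (\<lambda>t. LINT x|lborel. ?h t x)"
      proof (rule Bochner_Integration.integrable_bound)
        show "integrable lebesgue (\<lambda>t. indicator ?I t *\<^sub>R Lp_norm 1 UNIV (?f t))"
          using assms(7) by (simp add: L1_time_def set_integrable_def)
        show "AE t in lebesgue. norm (LINT x|lborel. ?h t x) \<le> norm (indicator ?I t *\<^sub>R Lp_norm 1 UNIV (?f t))"
        proof (rule AE_I2)
          fix t
          show "norm (LINT x|lborel. ?h t x) \<le> norm (indicator ?I t *\<^sub>R Lp_norm 1 UNIV (?f t))"
            using hJ(2)[of t] h0[of t] subsetD[OF J(2), of t] by (cases "t \<in> J") auto
        qed
      qed (rule measurable_completion[OF Hm])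
      then show "integrable lborel (\<lambda>t. LINT x|lborel. norm (case (t, x) of (t, x) \<Rightarrow> ?h t x))"
        using integrable_completion[OF Hm] by simp
    qed
  next
    fix t :: real and G :: "'a \<Rightarrow> real" and m :: real
    assume G: "continuous_on UNIV G" "\<And>x. 0 \<le> G x" "\<And>x. G x \<le> 1" "integrable lborel G" and m: "m \<ge> 0"
    show "(LINT x|lborel. \<bar>spatial.d (\<lambda>i. g' i t) x\<bar> * G x) \<le> w t * (m * (LINT x|lborel. G x) + 6 * (2 * R) ^ DIM('a) * exp (- m))"
    proof (cases "t \<in> J")
      case True
      show ?thesis
        using BMO_weighted_bound[OF _ assms(4) _ spatial.dm[OF transport_data.S[OF D]] dD[OF True] G m] J(3)[OF True] True
        by (simp add: w_def mult.assoc)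
    next
      case False
      then show ?thesis
        unfolding bad(4)[OF False] spatial.d_def[OF spatial_zero[OF pq]] by (simp add: w_def)
    qed
  next
    fix \<epsilon> :: real and y :: 'a and \<eta> :: "nat \<Rightarrow> real \<Rightarrow> real"
    assume "0 < \<epsilon>" "\<epsilon> \<le> 1" "smooth1 \<eta>" "\<eta> 0 T = 0"
    then show "(LINT t|lborel. indicator {0..T} t * (\<eta> (Suc 0) t * moll \<epsilon> (?v t) y)) +
      (LINT t|lborel. indicator {0..T} t * (\<eta> 0 t * spatial.Fl (?v t) (b' t) (\<lambda>i. g' i t) \<epsilon> y)) = 0"
      by (rule weak_solution_difference[OF _ _ _ _ D1 D2 D assms(12,13) rep])
  qed
  have "AE t in lborel. AE x in lborel. t \<in> ?I \<longrightarrow> V1 t x = V2 t x"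
    using zero_solution aeJ
  proof eventually_elim
    case (elim t)
    show ?case
    proof (cases "t \<in> ?I")
      case True
      then have "AE x in lborel. ?v t x = 0" and t: "t \<in> J" using elim by auto
      then show ?thesis by eventually_elim (simp add: good(2,3)[OF t])
    next
      case False
      then show ?thesis by (intro AE_I2) blast
    qed
  qed
  \<comment> \<open>The passage from slices to space-time is made for the Borel representatives,
    whose set of agreement is measurable; afterwards they are exchanged for the given
    solutions.\<close>
  then have "AE z in lborel \<Otimes>\<^sub>M lborel. (case z of (t, x) \<Rightarrow> t \<in> ?I \<longrightarrow> V1 t x = V2 t x)"
  proof (intro lborel_pair.AE_pair_measure)
    show "{z \<in> space (lborel \<Otimes>\<^sub>M lborel). case z of (t, x) \<Rightarrow> t \<in> ?I \<longrightarrow> V1 t x = V2 t x} \<in> sets (lborel \<Otimes>\<^sub>M (lborel :: 'a measure))"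
      by measurable
  qed (simp only: case_prod_conv)
  with V1(2) V2(2) have "AE z in lborel \<Otimes>\<^sub>M lborel. z \<in> ?I \<times> UNIV \<longrightarrow> (case z of (t, x) \<Rightarrow> u1 t x = u2 t x)"
  proof eventually_elim
    case (elim z)
    then show ?case by (cases z) auto
  qed
  then have "AE z in lborel. z \<in> ?I \<times> (UNIV :: 'a set) \<longrightarrow> (case z of (t, x) \<Rightarrow> u1 t x = u2 t x)" unfolding lborel_prod .
  moreover have "?I \<times> (UNIV :: 'a set) \<in> sets lborel" by (simp add: borel_open open_Times)
  ultimately show ?thesis by (simp only: AE_lebesgue_on_iff)
qed

end
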